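(* Let $E$ be a digraph, $K$ a field, $c$ a simple closed path in $E$, and $f\in K[t]$ an irreducible polynomial not associate to $t$. Let $K'=K[t,t^{-1}]/(f(t))$, let $\bar t\in K'$ be the class of $t$, let $\underline a\in(K'^* )^{E^1}$ be such that $a_c=\bar t$, and let $V^f_{[c^\infty],K}:=V^{\underline a}_{[c^\infty],K'}|_K$ be the restriction of $V^{\underline a}_{[c^\infty],K'}$ from $L_{K'}(E)$ to $L_K(E)$. Then $$V^{f}_{[c^\infty],K}\simeq \mathrm{Ind}_{c^\infty}\bigl(K[t,t^{-1}]/(f(t))\bigr)$$ as simple left $A_K(G_E)$-modules; that is, both modules are simple and they are isomorphic.
   Context: Paths. $E=(E^0,E^1,s,r)$ is a directed graph. A vertex is regular if it emits at least one and only finitely many edges. A finite path is $p=e_1\cdots e_n$ with $r(e_i)=s(e_{i+1})$, $|p|=n$, $s(p)=s(e_1)$, $r(p)=r(e_n)$; vertices are trivial paths of length $0$. $F(E)$ is the set of finite paths and $E^\infty$ the set of infinite paths. A closed path is a nontrivial finite path $c$ with $s(c)=r(c)$; it is simple if $c\neq d^m$ for every closed path $d\neq c$ and every $m$. $c^\infty=ccc\cdots$. $X=E^\infty\cup\{p\in F(E): r(p)\text{ is not regular}\}$. Elements $x,y\in X$ are tail-equivalent if $x=\mu x'$, $y=\nu x'$ for some $\mu,\nu\in F(E)$, $x'\in X$; $[x]$ is the class of $x$. Groupoid. $G_E=\{(\mu x',|\mu|-|\nu|,\nu x'):\mu,\nu\in F(E),\ x'\in X,\ \mu x',\nu x'\in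 X\}$ is a groupoid with $(x,k,y)(y,l,z)=(x,k+l,z)$ and $(x,k,y)^{-1}=(y,-k,x)$. Its unit space is identified with $X$, and $s(x,k,y)=x$, $r(x,k,y)=y$. For $r(\mu)=r(\nu)$, $Z_{(\mu,\nu)}=\{(\mu x,|\mu|-|\nu|,\nu x)\in G_E\}$. $A_K(G_E)$ is the $K$-span of the indicator functions $1_{Z_{(\mu,\nu)}}$ with convolution product. The Leavitt path algebra $L_K(E)$ is isomorphic to $A_K(G_E)$ via $\mu\nu^*\mapsto 1_{Z_{(\mu,\nu)}}$, and left $L_K(E)$-modules are regarded as $A_K(G_E)$-modules through this isomorphism. Induction. For $x\in X$, $G_x=\{\alpha\in G_E:s(\alpha)=r(\alpha)=x\}$ and $L_x=\{\alpha\in G_E:r(\alpha)=x\}$. $KL_x$ is the vector space with basis $L_x$; it is an $A_K(G_E)$-$KG_x$-bimodule with $G_x$ acting by right multiplication and $f\cdot t=\sum_{y\in L_x}f(yt^{-1})y$ for $f\in A_K(G_E)$, $t\in L_x$. For a $KG_x$-module $V$, $\mathrm{Ind}_x(V)=KL_x\otimes_{KG_x}V$. For $c$ simple closed of length $n$, $G_{c^\infty}=\{(c^\infty,ln,c^\infty):l\in\mathbb Z\}$, and $KG_{c^\infty}$ is identified with $K[t,t^{-1}]$ by $(c^\infty,ln,c^\infty)\leftrightarrow t^l$. Twisted Chen modules. For a field $F$, $V_{[x],F}$ is the $F$-vector space with basis $[x]$ and left $L_F(E)$-action $v.p=\delta_{v,s(p)}p$, $e.p=\delta_{r(e),s(p)}ep$,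 $e^*.p=p'$ if $p=ep'$ and $0$ otherwise ($v\in E^0$, $e\in E^1$, $p\in[x]$). For $\underline a=(a_e)_{e\in E^1}\in(F^* )^{E^1}$, $\sigma_{\underline a}$ is the automorphism of $L_F(E)$ with $v\mapsto v$, $e\mapsto a_ee$, $e^*\mapsto a_e^{-1}e^*$. $V^{\underline a}_{[x],F}$ is the same vector space with the action in which $z\in L_F(E)$ sends $p$ to $\sigma_{\underline a}(z).p$. For $q=e_1\cdots e_n$, $a_q=a_{e_1}\cdots a_{e_n}$. A module $M$ over an algebra $A$ (possibly non-unital) is simple if $AM\ne0$ and its only submodules are $0$ and $M$. *)

theory Defs
  imports
    "HOL-Algebra.Polynomials"
    "HOL-Algebra.QuotRing"
    "HOL-Algebra.Free_Abelian_Groups"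
    "HOL-Library.Stream"
    "Graph_Theory.Arc_Walk"
begin

section \<open>Free vector spaces, algebras and modules\<close>

text \<open>
  An associative, possibly non-unital \<open>K\<close>-algebra is represented by a record of the library type
  \<^typ>\<open>('k, 'x) module\<close>, whose ring multiplication is the algebra product. Its \<open>one\<close> field is
  meaningless when the algebra has no unit; in a plain vector space neither \<open>mult\<close> nor \<open>one\<close> is used.
\<close>

definition free_vs :: "('k, 'r) ring_scheme \<Rightarrow> 's set \<Rightarrow> ('k, 's \<Rightarrow> 'k) module" where
  "free_vs K S =
     \<lparr>carrier = {f. (\<forall>s\<in>S. f s \<in> carrier K) \<and> (\<forall>s. s \<notin> S \<longrightarrow> f s = \<zero>\<^bsub>K\<^esub>) \<and> finite {s. f s \<noteq> \<zero>\<^bsub>K\<^esub>}},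
      monoid.mult = undefined, monoid.one = undefined,
      ring.zero = (\<lambda>_. \<zero>\<^bsub>K\<^esub>), ring.add = (\<lambda>f g s. f s \<oplus>\<^bsub>K\<^esub> g s),
      smult = (\<lambda>k f s. k \<otimes>\<^bsub>K\<^esub> f s)\<rparr>"

definition basis_vec :: "('k, 'r) ring_scheme \<Rightarrow> 's \<Rightarrow> 's \<Rightarrow> 'k" where
  "basis_vec K s = (\<lambda>s'. if s' = s then \<one>\<^bsub>K\<^esub> else \<zero>\<^bsub>K\<^esub>)"

inductive_set lin_span :: "('k, 'r) ring_scheme \<Rightarrow> ('s \<Rightarrow> 'k) set \<Rightarrow> ('s \<Rightarrow> 'k) set"
  for K :: "('k, 'r) ring_scheme" and B :: "('s \<Rightarrow> 'k) set" where
  zero: "(\<lambda>_. \<zero>\<^bsub>K\<^esub>) \<in> lin_span K B"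
| step: "\<lbrakk>k \<in> carrier K; b \<in> B; f \<in> lin_span K B\<rbrakk>
           \<Longrightarrow> (\<lambda>s. (k \<otimes>\<^bsub>K\<^esub> b s) \<oplus>\<^bsub>K\<^esub> f s) \<in> lin_span K B"

text \<open>
  Convolution along a partial product \<open>p\<close> defined on the composable pairs \<open>P\<close>. The index set
  contains only pairs with nonzero coefficients, because \<open>finsum\<close> over an infinite set is zero
  by convention.
\<close>
definition convolution ::
  "('k, 'r) ring_scheme \<Rightarrow> ('s \<times> 't) set \<Rightarrow> ('s \<Rightarrow> 't \<Rightarrow> 'u) \<Rightarrow> ('s \<Rightarrow> 'k) \<Rightarrow> ('t \<Rightarrow> 'k) \<Rightarrow> 'u \<Rightarrow> 'k" where
  "convolution K P p f g = (\<lambda>u. \<Oplus>\<^bsub>K\<^esub>z \<in>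
       {(s, t) \<in> P. f s \<noteq> \<zero>\<^bsub>K\<^esub> \<and> g t \<noteq> \<zero>\<^bsub>K\<^esub> \<and> p s t = u}. f (fst z) \<otimes>\<^bsub>K\<^esub> g (snd z))"

definition semigroup_algebra ::
  "('k, 'r) ring_scheme \<Rightarrow> ('s, 'm) monoid_scheme \<Rightarrow> ('k, 's \<Rightarrow> 'k) module" where
  "semigroup_algebra K S = (free_vs K (carrier S))
     \<lparr>monoid.mult := convolution K (carrier S \<times> carrier S) (monoid.mult S), one := basis_vec K \<one>\<^bsub>S\<^esub>\<rparr>"

definition algebra_ideal :: "('k, 'r) ring_scheme \<Rightarrow> ('k, 'a) module \<Rightarrow> 'a set \<Rightarrow> bool" where
  "algebra_ideal K A I \<longleftrightarrow> submodule I K A \<and>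
     (\<forall>a\<in>carrier A. \<forall>x\<in>I. a \<otimes>\<^bsub>A\<^esub> x \<in> I \<and> x \<otimes>\<^bsub>A\<^esub> a \<in> I)"

definition algebra_genideal :: "('k, 'r) ring_scheme \<Rightarrow> ('k, 'a) module \<Rightarrow> 'a set \<Rightarrow> 'a set" where
  "algebra_genideal K A S = \<Inter>{I. algebra_ideal K A I \<and> S \<subseteq> I}"

definition quotient_algebra :: "('k, 'a) module \<Rightarrow> 'a set \<Rightarrow> ('k, 'a set) module" where
  "quotient_algebra A I =
     ring.extend (A Quot I) (module.fields (\<lambda>k Y. \<Union>x\<in>Y. I +>\<^bsub>A\<^esub> (k \<odot>\<^bsub>A\<^esub> x)))"

text \<open>The map of cosets induced by \<open>g\<close>, with values in the quotient of \<open>B\<close> by \<open>J\<close>.\<close>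
definition quotient_map :: "('k, 'b) module \<Rightarrow> 'b set \<Rightarrow> ('a \<Rightarrow> 'b) \<Rightarrow> 'a set \<Rightarrow> 'b set" where
  "quotient_map B J g Y = (\<Union>x\<in>Y. J +>\<^bsub>B\<^esub> g x)"

text \<open>The map on cosets induced by a map \<open>g\<close> that is constant on each coset.\<close>
definition quotient_lift :: "('a \<Rightarrow> 'b) \<Rightarrow> 'a set \<Rightarrow> 'b" where
  "quotient_lift g Y = the_elem (g ` Y)"

record ('k, 'a, 'x) alg_module = "('k, 'x) module" +
  act :: "'a \<Rightarrow> 'x \<Rightarrow> 'x"

definition left_module ::
  "('k, 'r) ring_scheme \<Rightarrow> ('k, 'a) module \<Rightarrow> ('k, 'a, 'x) alg_module \<Rightarrow> bool" where
  "left_module K A M \<longleftrightarrow> module K M \<and>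
     (\<forall>a\<in>carrier A. \<forall>x\<in>carrier M. act M a x \<in> carrier M) \<and>
     (\<forall>a\<in>carrier A. \<forall>x\<in>carrier M. \<forall>y\<in>carrier M.
        act M a (x \<oplus>\<^bsub>M\<^esub> y) = act M a x \<oplus>\<^bsub>M\<^esub> act M a y) \<and>
     (\<forall>a\<in>carrier A. \<forall>b\<in>carrier A. \<forall>x\<in>carrier M.
        act M (a \<oplus>\<^bsub>A\<^esub> b) x = act M a x \<oplus>\<^bsub>M\<^esub> act M b x) \<and>
     (\<forall>k\<in>carrier K. \<forall>a\<in>carrier A. \<forall>x\<in>carrier M.
        act M (k \<odot>\<^bsub>A\<^esub> a) x = k \<odot>\<^bsub>M\<^esub> act M a x \<and> act M a (k \<odot>\<^bsub>M\<^esub> x) = k \<odot>\<^bsub>M\<^esub> act M a x) \<and>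
     (\<forall>a\<in>carrier A. \<forall>b\<in>carrier A. \<forall>x\<in>carrier M.
        act M (a \<otimes>\<^bsub>A\<^esub> b) x = act M a (act M b x))"

definition alg_submodule ::
  "('k, 'r) ring_scheme \<Rightarrow> ('k, 'a) module \<Rightarrow> ('k, 'a, 'x) alg_module \<Rightarrow> 'x set \<Rightarrow> bool" where
  "alg_submodule K A M N \<longleftrightarrow> submodule N K M \<and> (\<forall>a\<in>carrier A. \<forall>x\<in>N. act M a x \<in> N)"

definition simple_left_module ::
  "('k, 'r) ring_scheme \<Rightarrow> ('k, 'a) module \<Rightarrow> ('k, 'a, 'x) alg_module \<Rightarrow> bool" where
  "simple_left_module K A M \<longleftrightarrow> left_module K A M \<and>
     (\<exists>a\<in>carrier A. \<exists>x\<in>carrier M. act M a x \<noteq> \<zero>\<^bsub>M\<^esub>) \<and>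
     (\<forall>N. alg_submodule K A M N \<longrightarrow> N = {\<zero>\<^bsub>M\<^esub>} \<or> N = carrier M)"

definition left_module_iso ::
  "('k, 'r) ring_scheme \<Rightarrow> ('k, 'a) module \<Rightarrow> ('k, 'a, 'x) alg_module \<Rightarrow> ('k, 'a, 'y) alg_module
     \<Rightarrow> ('x \<Rightarrow> 'y) \<Rightarrow> bool" where
  "left_module_iso K A M N h \<longleftrightarrow> bij_betw h (carrier M) (carrier N) \<and>
     (\<forall>x\<in>carrier M. \<forall>y\<in>carrier M. h (x \<oplus>\<^bsub>M\<^esub> y) = h x \<oplus>\<^bsub>N\<^esub> h y) \<and>
     (\<forall>k\<in>carrier K. \<forall>x\<in>carrier M. h (k \<odot>\<^bsub>M\<^esub> x) = k \<odot>\<^bsub>N\<^esub> h x) \<and>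
     (\<forall>a\<in>carrier A. \<forall>x\<in>carrier M. h (act M a x) = act N a (h x))"

definition left_modules_isomorphic ::
  "('k, 'r) ring_scheme \<Rightarrow> ('k, 'a) module \<Rightarrow> ('k, 'a, 'x) alg_module \<Rightarrow> ('k, 'a, 'y) alg_module
     \<Rightarrow> bool" where
  "left_modules_isomorphic K A M N \<longleftrightarrow> (\<exists>h. left_module_iso K A M N h)"

definition restrict_module ::
  "('k \<Rightarrow> 'f) \<Rightarrow> ('a \<Rightarrow> 'b) \<Rightarrow> ('f, 'b, 'x) alg_module \<Rightarrow> ('k, 'a, 'x) alg_module" where
  "restrict_module i g M =
     \<lparr>carrier = carrier M, monoid.mult = monoid.mult M, one = one M, ring.zero = ring.zero M, ring.add = ring.add M,
      smult = (\<lambda>k. smult M (i k)), act = (\<lambda>a. act M (g a))\<rparr>"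

section \<open>Paths\<close>

text \<open>
  Digraphs are those of the AFP entry on graph theory: arbitrary, possibly infinite, with loops and
  multiple arcs; the source map is \<open>tail\<close> and the range map is \<open>head\<close>. A finite path is its source
  vertex together with its list of arcs, so that \<open>(v, [])\<close> is the trivial path at \<open>v\<close>.
\<close>

type_synonym ('v, 'e) fpath = "'v \<times> 'e list"

datatype ('v, 'e) epath = FinPath 'v "'e list" | InfPath "'e stream"

definition regular_vertex :: "('v, 'e) pre_digraph \<Rightarrow> 'v \<Rightarrow> bool" where
  "regular_vertex E v \<longleftrightarrow> v \<in> verts E \<and> out_arcs E v \<noteq> {} \<and> finite (out_arcs E v)"

definition finite_paths :: "('v, 'e) pre_digraph \<Rightarrow> ('v, 'e) fpath set" where
  "finite_paths E = {(u, p). \<exists>v. pre_digraph.awalk E u p v}"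

definition path_range :: "('v, 'e) pre_digraph \<Rightarrow> ('v, 'e) fpath \<Rightarrow> 'v" where
  "path_range E p = pre_digraph.awlast E (fst p) (snd p)"

definition infinite_paths :: "('v, 'e) pre_digraph \<Rightarrow> 'e stream set" where
  "infinite_paths E = {s. sset s \<subseteq> arcs E \<and> (\<forall>n. head E (s !! n) = tail E (s !! Suc n))}"

definition boundary_paths :: "('v, 'e) pre_digraph \<Rightarrow> ('v, 'e) epath set" where
  "boundary_paths E = InfPath ` infinite_paths E \<union>
     {FinPath u p | u p. (u, p) \<in> finite_paths E \<and> \<not> regular_vertex E (path_range E (u, p))}"

fun path_source :: "('v, 'e) pre_digraph \<Rightarrow> ('v, 'e) epath \<Rightarrow> 'v" where
  "path_source E (FinPath u p) = u"
| "path_source E (InfPath s) = tail E (shd s)"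

text \<open>Concatenation, meaningful only if the range of the first path is the source of the second.\<close>
fun path_append :: "('v, 'e) fpath \<Rightarrow> ('v, 'e) epath \<Rightarrow> ('v, 'e) epath" where
  "path_append (u, m) (FinPath v p) = FinPath u (m @ p)"
| "path_append (u, m) (InfPath s) = InfPath (m @- s)"

definition path_length :: "('v, 'e) fpath \<Rightarrow> int" where
  "path_length p = int (length (snd p))"

definition tail_class :: "('v, 'e) pre_digraph \<Rightarrow> ('v, 'e) epath \<Rightarrow> ('v, 'e) epath set" where
  "tail_class E x = {y \<in> boundary_paths E. \<exists>m n z. m \<in> finite_paths E \<and> n \<in> finite_paths E \<and>
     z \<in> boundary_paths E \<and> path_range E m = path_source E z \<and> path_range E n = path_source E z \<and>
     x = path_append m z \<and> y = path_append n z}"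

definition closed_path :: "('v, 'e) pre_digraph \<Rightarrow> 'e list \<Rightarrow> bool" where
  "closed_path E c \<longleftrightarrow> c \<noteq> [] \<and> (\<exists>v. pre_digraph.awalk E v c v)"

definition simple_closed_path :: "('v, 'e) pre_digraph \<Rightarrow> 'e list \<Rightarrow> bool" where
  "simple_closed_path E c \<longleftrightarrow> closed_path E c \<and>
     (\<forall>d m. closed_path E d \<and> d \<noteq> c \<longrightarrow> c \<noteq> concat (replicate m d))"

definition cycle_path :: "'e list \<Rightarrow> ('v, 'e) epath" where
  "cycle_path c = InfPath (cycle c)"

section \<open>The boundary path groupoid and its Steinberg algebra\<close>

type_synonym ('v, 'e) arrow = "('v, 'e) epath \<times> int \<times> ('v, 'e) epath"

definition groupoid_arrows :: "('v, 'e) pre_digraph \<Rightarrow> ('v, 'e) arrow set" where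
  "groupoid_arrows E = {(path_append m z, path_length m - path_length n, path_append n z) | m n z.
     m \<in> finite_paths E \<and> n \<in> finite_paths E \<and> z \<in> boundary_paths E \<and>
     path_range E m = path_source E z \<and> path_range E n = path_source E z}"

fun arrow_source :: "('v, 'e) arrow \<Rightarrow> ('v, 'e) epath" where
  "arrow_source (x, k, y) = x"

fun arrow_range :: "('v, 'e) arrow \<Rightarrow> ('v, 'e) epath" where
  "arrow_range (x, k, y) = y"

fun arrow_mult :: "('v, 'e) arrow \<Rightarrow> ('v, 'e) arrow \<Rightarrow> ('v, 'e) arrow" where
  "arrow_mult (x, k, y) (y', l, z) = (x, k + l, z)"

fun arrow_inv :: "('v, 'e) arrow \<Rightarrow> ('v, 'e) arrow" where
  "arrow_inv (x, k, y) = (y, - k, x)"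

definition cylinder :: "('v, 'e) pre_digraph \<Rightarrow> ('v, 'e) fpath \<Rightarrow> ('v, 'e) fpath \<Rightarrow> ('v, 'e) arrow set" where
  "cylinder E m n = {(path_append m z, path_length m - path_length n, path_append n z) | z.
     z \<in> boundary_paths E \<and> path_range E m = path_source E z \<and> path_range E n = path_source E z}"

definition cylinder_indicator ::
  "('v, 'e) pre_digraph \<Rightarrow> ('k, 'r) ring_scheme \<Rightarrow> ('v, 'e) fpath \<Rightarrow> ('v, 'e) fpath
     \<Rightarrow> ('v, 'e) arrow \<Rightarrow> 'k" where
  "cylinder_indicator E K m n = (\<lambda>g. if g \<in> cylinder E m n then \<one>\<^bsub>K\<^esub> else \<zero>\<^bsub>K\<^esub>)"

definition steinberg_algebra ::
  "('v, 'e) pre_digraph \<Rightarrow> ('k, 'r) ring_scheme \<Rightarrow> ('k, ('v, 'e) arrow \<Rightarrow> 'k) module" where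
  "steinberg_algebra E K =
     \<lparr>carrier = lin_span K {cylinder_indicator E K m n | m n.
        m \<in> finite_paths E \<and> n \<in> finite_paths E \<and> path_range E m = path_range E n},
      monoid.mult = convolution K {(g, h). g \<in> groupoid_arrows E \<and> h \<in> groupoid_arrows E \<and>
        arrow_range g = arrow_source h} arrow_mult,
      monoid.one = undefined,
      ring.zero = (\<lambda>_. \<zero>\<^bsub>K\<^esub>), ring.add = (\<lambda>f g s. f s \<oplus>\<^bsub>K\<^esub> g s),
      smult = (\<lambda>k f s. k \<otimes>\<^bsub>K\<^esub> f s)\<rparr>"

section \<open>The Leavitt path algebra\<close>

datatype ('v, 'e) leavitt_gen = Vtx 'v | Edge 'e | Ghost 'e

type_synonym ('v, 'e) word = "('v, 'e) leavitt_gen list"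

definition leavitt_words :: "('v, 'e) pre_digraph \<Rightarrow> ('v, 'e) word set" where
  "leavitt_words E = {w. w \<noteq> [] \<and> set w \<subseteq> Vtx ` verts E \<union> Edge ` arcs E \<union> Ghost ` arcs E}"

text \<open>
  The free non-unital associative algebra on the generators: its basis is the free semigroup of
  nonempty words, so no unit is adjoined when the digraph has infinitely many vertices.
\<close>
definition leavitt_free ::
  "('v, 'e) pre_digraph \<Rightarrow> ('k, 'r) ring_scheme \<Rightarrow> ('k, ('v, 'e) word \<Rightarrow> 'k) module" where
  "leavitt_free E K =
     semigroup_algebra K \<lparr>carrier = leavitt_words E, monoid.mult = (@), monoid.one = undefined\<rparr>"

definition leavitt_relations ::
  "('v, 'e) pre_digraph \<Rightarrow> ('k, 'r) ring_scheme \<Rightarrow> (('v, 'e) word \<Rightarrow> 'k) set" where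
  "leavitt_relations E K = (let A = leavitt_free E K; b = basis_vec K in
     {b [Vtx v, Vtx w] \<ominus>\<^bsub>A\<^esub> (if v = w then b [Vtx v] else \<zero>\<^bsub>A\<^esub>) | v w. v \<in> verts E \<and> w \<in> verts E} \<union>
     {b [Vtx (tail E e), Edge e] \<ominus>\<^bsub>A\<^esub> b [Edge e] | e. e \<in> arcs E} \<union>
     {b [Edge e, Vtx (head E e)] \<ominus>\<^bsub>A\<^esub> b [Edge e] | e. e \<in> arcs E} \<union>
     {b [Vtx (head E e), Ghost e] \<ominus>\<^bsub>A\<^esub> b [Ghost e] | e. e \<in> arcs E} \<union>
     {b [Ghost e, Vtx (tail E e)] \<ominus>\<^bsub>A\<^esub> b [Ghost e] | e. e \<in> arcs E} \<union>
     {b [Ghost e, Edge e'] \<ominus>\<^bsub>A\<^esub> (if e = e' then b [Vtx (head E e)] else \<zero>\<^bsub>A\<^esub>) | e e'.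
        e \<in> arcs E \<and> e' \<in> arcs E} \<union>
     {b [Vtx v] \<ominus>\<^bsub>A\<^esub> (\<Oplus>\<^bsub>A\<^esub>e\<in>out_arcs E v. b [Edge e, Ghost e]) | v. regular_vertex E v})"

definition leavitt_ideal ::
  "('v, 'e) pre_digraph \<Rightarrow> ('k, 'r) ring_scheme \<Rightarrow> (('v, 'e) word \<Rightarrow> 'k) set" where
  "leavitt_ideal E K = algebra_genideal K (leavitt_free E K) (leavitt_relations E K)"

definition leavitt_algebra ::
  "('v, 'e) pre_digraph \<Rightarrow> ('k, 'r) ring_scheme \<Rightarrow> ('k, (('v, 'e) word \<Rightarrow> 'k) set) module" where
  "leavitt_algebra E K = quotient_algebra (leavitt_free E K) (leavitt_ideal E K)"

text \<open>The homomorphism from the Leavitt path algebra over \<open>K\<close> to the one over \<open>F\<close> induced by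
  \<open>i : K \<rightarrow> F\<close>.\<close>
definition leavitt_base_change ::
  "('v, 'e) pre_digraph \<Rightarrow> ('f, 'r) ring_scheme \<Rightarrow> ('k \<Rightarrow> 'f)
     \<Rightarrow> (('v, 'e) word \<Rightarrow> 'k) set \<Rightarrow> (('v, 'e) word \<Rightarrow> 'f) set" where
  "leavitt_base_change E F i =
     quotient_map (leavitt_free E F) (leavitt_ideal E F) (\<lambda>p w. i (p w))"

definition path_weight :: "('f, 'r) ring_scheme \<Rightarrow> ('e \<Rightarrow> 'f) \<Rightarrow> 'e list \<Rightarrow> 'f" where
  "path_weight F a q = foldr (\<lambda>e x. a e \<otimes>\<^bsub>F\<^esub> x) q \<one>\<^bsub>F\<^esub>"

fun gen_weight :: "('f, 'r) ring_scheme \<Rightarrow> ('e \<Rightarrow> 'f) \<Rightarrow> ('v, 'e) leavitt_gen \<Rightarrow> 'f" where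
  "gen_weight F a (Vtx v) = \<one>\<^bsub>F\<^esub>"
| "gen_weight F a (Edge e) = a e"
| "gen_weight F a (Ghost e) = inv\<^bsub>F\<^esub> (a e)"

text \<open>The automorphism of the Leavitt path algebra scaling \<open>e\<close> by \<open>a\<^sub>e\<close> and \<open>e\<^sup>*\<close> by \<open>a\<^sub>e\<^sup>-\<^sup>1\<close>; on the
  free algebra it multiplies each word by the product of the weights of its letters.\<close>
definition leavitt_twist ::
  "('v, 'e) pre_digraph \<Rightarrow> ('f, 'r) ring_scheme \<Rightarrow> ('e \<Rightarrow> 'f)
     \<Rightarrow> (('v, 'e) word \<Rightarrow> 'f) set \<Rightarrow> (('v, 'e) word \<Rightarrow> 'f) set" where
  "leavitt_twist E F a = quotient_map (leavitt_free E F) (leavitt_ideal E F)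
     (\<lambda>p w. if w \<in> leavitt_words E
        then foldr (\<lambda>g x. gen_weight F a g \<otimes>\<^bsub>F\<^esub> x) w \<one>\<^bsub>F\<^esub> \<otimes>\<^bsub>F\<^esub> p w else \<zero>\<^bsub>F\<^esub>)"

text \<open>The images \<open>1\<^bsub>Z(v,v)\<^esub>\<close>, \<open>1\<^bsub>Z(e,r(e))\<^esub>\<close> and \<open>1\<^bsub>Z(r(e),e)\<^esub>\<close> of the generators \<open>v\<close>, \<open>e\<close> and \<open>e\<^sup>*\<close>.\<close>
fun gen_image ::
  "('v, 'e) pre_digraph \<Rightarrow> ('k, 'r) ring_scheme \<Rightarrow> ('v, 'e) leavitt_gen \<Rightarrow> ('v, 'e) arrow \<Rightarrow> 'k" where
  "gen_image E K (Vtx v) = cylinder_indicator E K (v, []) (v, [])"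
| "gen_image E K (Edge e) = cylinder_indicator E K (tail E e, [e]) (head E e, [])"
| "gen_image E K (Ghost e) = cylinder_indicator E K (head E e, []) (tail E e, [e])"

fun word_image ::
  "('v, 'e) pre_digraph \<Rightarrow> ('k, 'r) ring_scheme \<Rightarrow> ('v, 'e) word \<Rightarrow> ('v, 'e) arrow \<Rightarrow> 'k" where
  "word_image E K [] = undefined"
| "word_image E K [g] = gen_image E K g"
| "word_image E K (g # h # w) = gen_image E K g \<otimes>\<^bsub>steinberg_algebra E K\<^esub> word_image E K (h # w)"

text \<open>
  The algebra isomorphism from the Leavitt path algebra to the Steinberg algebra with
  \<open>\<mu>\<nu>\<^sup>* \<mapsto> 1\<^bsub>Z(\<mu>,\<nu>)\<^esub>\<close>, given by its values on the generators.
\<close>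
definition leavitt_to_steinberg ::
  "('v, 'e) pre_digraph \<Rightarrow> ('k, 'r) ring_scheme
     \<Rightarrow> (('v, 'e) word \<Rightarrow> 'k) set \<Rightarrow> ('v, 'e) arrow \<Rightarrow> 'k" where
  "leavitt_to_steinberg E K = quotient_lift
     (\<lambda>p. \<Oplus>\<^bsub>steinberg_algebra E K\<^esub>w \<in> {w. p w \<noteq> \<zero>\<^bsub>K\<^esub>}.
        p w \<odot>\<^bsub>steinberg_algebra E K\<^esub> word_image E K w)"

definition as_steinberg_module ::
  "('v, 'e) pre_digraph \<Rightarrow> ('k, 'r) ring_scheme \<Rightarrow> ('k, (('v, 'e) word \<Rightarrow> 'k) set, 'x) alg_module
     \<Rightarrow> ('k, ('v, 'e) arrow \<Rightarrow> 'k, 'x) alg_module" where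
  "as_steinberg_module E K M = restrict_module (\<lambda>k. k)
     (inv_into (carrier (leavitt_algebra E K)) (leavitt_to_steinberg E K)) M"

section \<open>Twisted Chen modules\<close>

text \<open>The action of a generator on a basis path, with \<open>None\<close> for zero.\<close>
fun gen_path_act ::
  "('v, 'e) pre_digraph \<Rightarrow> ('v, 'e) leavitt_gen \<Rightarrow> ('v, 'e) epath \<Rightarrow> ('v, 'e) epath option" where
  "gen_path_act E (Vtx v) p = (if v = path_source E p then Some p else None)"
| "gen_path_act E (Edge e) p =
     (if head E e = path_source E p then Some (path_append (tail E e, [e]) p) else None)"
| "gen_path_act E (Ghost e) (FinPath u []) = None"
| "gen_path_act E (Ghost e) (FinPath u (e' # p)) =
     (if e' = e then Some (FinPath (head E e) p) else None)"
| "gen_path_act E (Ghost e) (InfPath s) = (if shd s = e then Some (InfPath (stl s)) else None)"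

definition gen_act ::
  "('v, 'e) pre_digraph \<Rightarrow> ('f, 'r) ring_scheme \<Rightarrow> ('v, 'e) leavitt_gen
     \<Rightarrow> (('v, 'e) epath \<Rightarrow> 'f) \<Rightarrow> ('v, 'e) epath \<Rightarrow> 'f" where
  "gen_act E F g m = (\<lambda>q. \<Oplus>\<^bsub>F\<^esub>p \<in> {p. m p \<noteq> \<zero>\<^bsub>F\<^esub> \<and> gen_path_act E g p = Some q}. m p)"

definition chen_module ::
  "('v, 'e) pre_digraph \<Rightarrow> ('f, 'r) ring_scheme \<Rightarrow> ('v, 'e) epath
     \<Rightarrow> ('f, (('v, 'e) word \<Rightarrow> 'f) set, ('v, 'e) epath \<Rightarrow> 'f) alg_module" where
  "chen_module E F x = (let V = free_vs F (tail_class E x) in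
     module.extend V (alg_module.fields (\<lambda>Z m. quotient_lift
       (\<lambda>p. \<Oplus>\<^bsub>V\<^esub>w \<in> {w. p w \<noteq> \<zero>\<^bsub>F\<^esub>}. p w \<odot>\<^bsub>V\<^esub> foldr (gen_act E F) w m) Z)))"

definition twisted_chen_module ::
  "('v, 'e) pre_digraph \<Rightarrow> ('f, 'r) ring_scheme \<Rightarrow> ('e \<Rightarrow> 'f) \<Rightarrow> ('v, 'e) epath
     \<Rightarrow> ('f, (('v, 'e) word \<Rightarrow> 'f) set, ('v, 'e) epath \<Rightarrow> 'f) alg_module" where
  "twisted_chen_module E F a x = restrict_module (\<lambda>k. k) (leavitt_twist E F a) (chen_module E F x)"

section \<open>Induced modules\<close>

definition isotropy_group :: "('v, 'e) pre_digraph \<Rightarrow> ('v, 'e) epath \<Rightarrow> ('v, 'e) arrow monoid" where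
  "isotropy_group E x =
     \<lparr>carrier = {g \<in> groupoid_arrows E. arrow_source g = x \<and> arrow_range g = x},
      monoid.mult = arrow_mult, one = (x, 0, x)\<rparr>"

definition L_arrows :: "('v, 'e) pre_digraph \<Rightarrow> ('v, 'e) epath \<Rightarrow> ('v, 'e) arrow set" where
  "L_arrows E x = {g \<in> groupoid_arrows E. arrow_range g = x}"

text \<open>The linear extension of \<open>f \<cdot> t = \<Sum>\<^bsub>y \<in> L\<^esub> f(y t\<^sup>-\<^sup>1) y\<close>.\<close>
definition L_left_act ::
  "('v, 'e) pre_digraph \<Rightarrow> ('k, 'r) ring_scheme \<Rightarrow> ('v, 'e) epath
     \<Rightarrow> (('v, 'e) arrow \<Rightarrow> 'k) \<Rightarrow> (('v, 'e) arrow \<Rightarrow> 'k) \<Rightarrow> ('v, 'e) arrow \<Rightarrow> 'k" where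
  "L_left_act E K x f m = (\<lambda>y. if y \<in> L_arrows E x
     then \<Oplus>\<^bsub>K\<^esub>t \<in> {t. m t \<noteq> \<zero>\<^bsub>K\<^esub>}. m t \<otimes>\<^bsub>K\<^esub> f (arrow_mult y (arrow_inv t)) else \<zero>\<^bsub>K\<^esub>)"

definition L_right_act ::
  "('v, 'e) pre_digraph \<Rightarrow> ('k, 'r) ring_scheme \<Rightarrow> ('v, 'e) epath
     \<Rightarrow> (('v, 'e) arrow \<Rightarrow> 'k) \<Rightarrow> (('v, 'e) arrow \<Rightarrow> 'k) \<Rightarrow> ('v, 'e) arrow \<Rightarrow> 'k" where
  "L_right_act E K x = convolution K (L_arrows E x \<times> carrier (isotropy_group E x)) arrow_mult"

text \<open>
  The tensor product over \<open>R\<close> of a right module \<open>M\<close>, with action \<open>ra\<close>, and a left module \<open>V\<close>: the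
  free abelian group on pairs modulo the relations of biadditivity and \<open>R\<close>-balancedness.
\<close>
definition tensor_relations ::
  "('r, 's) ring_scheme \<Rightarrow> ('k, 'm) module \<Rightarrow> ('m \<Rightarrow> 'r \<Rightarrow> 'm) \<Rightarrow> ('k, 'r, 'x) alg_module
     \<Rightarrow> ('m \<times> 'x \<Rightarrow>\<^sub>0 int) set" where
  "tensor_relations R M ra V =
     {frag_of (m \<oplus>\<^bsub>M\<^esub> m', v) - frag_of (m, v) - frag_of (m', v) | m m' v.
        m \<in> carrier M \<and> m' \<in> carrier M \<and> v \<in> carrier V} \<union>
     {frag_of (m, v \<oplus>\<^bsub>V\<^esub> v') - frag_of (m, v) - frag_of (m, v') | m v v'.
        m \<in> carrier M \<and> v \<in> carrier V \<and> v' \<in> carrier V} \<union>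
     {frag_of (ra m r, v) - frag_of (m, act V r v) | m r v.
        m \<in> carrier M \<and> r \<in> carrier R \<and> v \<in> carrier V}"

definition tensor_kernel ::
  "('r, 's) ring_scheme \<Rightarrow> ('k, 'm) module \<Rightarrow> ('m \<Rightarrow> 'r \<Rightarrow> 'm) \<Rightarrow> ('k, 'r, 'x) alg_module
     \<Rightarrow> ('m \<times> 'x \<Rightarrow>\<^sub>0 int) set" where
  "tensor_kernel R M ra V =
     generate (free_Abelian_group (carrier M \<times> carrier V)) (tensor_relations R M ra V)"

definition tensor_product ::
  "('r, 's) ring_scheme \<Rightarrow> ('k, 'm) module \<Rightarrow> ('m \<Rightarrow> 'r \<Rightarrow> 'm) \<Rightarrow> ('k, 'r, 'x) alg_module
     \<Rightarrow> ('m \<times> 'x \<Rightarrow>\<^sub>0 int) set monoid" where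
  "tensor_product R M ra V =
     free_Abelian_group (carrier M \<times> carrier V) Mod tensor_kernel R M ra V"

text \<open>The endomorphism \<open>m \<otimes> v \<mapsto> h(m) \<otimes> v\<close>.\<close>
definition tensor_map ::
  "('r, 's) ring_scheme \<Rightarrow> ('k, 'm) module \<Rightarrow> ('m \<Rightarrow> 'r \<Rightarrow> 'm) \<Rightarrow> ('k, 'r, 'x) alg_module
     \<Rightarrow> ('m \<Rightarrow> 'm) \<Rightarrow> ('m \<times> 'x \<Rightarrow>\<^sub>0 int) set \<Rightarrow> ('m \<times> 'x \<Rightarrow>\<^sub>0 int) set" where
  "tensor_map R M ra V h Y = (\<Union>z\<in>Y. tensor_kernel R M ra V
     #>\<^bsub>free_Abelian_group (carrier M \<times> carrier V)\<^esub> frag_extend (\<lambda>(m, v). frag_of (h m, v)) z)"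

definition induced_module ::
  "('v, 'e) pre_digraph \<Rightarrow> ('k, 'r) ring_scheme \<Rightarrow> ('v, 'e) epath
     \<Rightarrow> ('k, ('v, 'e) arrow \<Rightarrow> 'k, 'x) alg_module
     \<Rightarrow> ('k, ('v, 'e) arrow \<Rightarrow> 'k, ((('v, 'e) arrow \<Rightarrow> 'k) \<times> 'x \<Rightarrow>\<^sub>0 int) set) alg_module" where
  "induced_module E K x V =
     (let R = semigroup_algebra K (isotropy_group E x);
          M = free_vs K (L_arrows E x);
          ra = L_right_act E K x;
          T = tensor_product R M ra V
      in \<lparr>carrier = carrier T, monoid.mult = undefined, monoid.one = undefined,
          ring.zero = \<one>\<^bsub>T\<^esub>, ring.add = monoid.mult T,
          smult = (\<lambda>k. tensor_map R M ra V (\<lambda>m. k \<odot>\<^bsub>M\<^esub> m)),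
          act = (\<lambda>f. tensor_map R M ra V (L_left_act E K x f))\<rparr>)"

section \<open>Quotients of the Laurent polynomial ring\<close>

text \<open>The Laurent polynomial ring is the group algebra of \<open>\<int>\<close>.\<close>
definition laurent_ring :: "('k, 'r) ring_scheme \<Rightarrow> ('k, int \<Rightarrow> 'k) module" where
  "laurent_ring K = semigroup_algebra K integer_group"

definition laurent_of_poly :: "('k, 'r) ring_scheme \<Rightarrow> 'k list \<Rightarrow> int \<Rightarrow> 'k" where
  "laurent_of_poly K f = (\<lambda>l. if 0 \<le> l then ring.coeff K f (nat l) else \<zero>\<^bsub>K\<^esub>)"

definition laurent_ideal :: "('k, 'r) ring_scheme \<Rightarrow> 'k list \<Rightarrow> (int \<Rightarrow> 'k) set" where
  "laurent_ideal K f = PIdl\<^bsub>laurent_ring K\<^esub> (laurent_of_poly K f)"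

definition laurent_quotient :: "('k, 'r) ring_scheme \<Rightarrow> 'k list \<Rightarrow> (int \<Rightarrow> 'k) set ring" where
  "laurent_quotient K f = laurent_ring K Quot laurent_ideal K f"

definition laurent_class :: "('k, 'r) ring_scheme \<Rightarrow> 'k list \<Rightarrow> (int \<Rightarrow> 'k) \<Rightarrow> (int \<Rightarrow> 'k) set" where
  "laurent_class K f g = laurent_ideal K f +>\<^bsub>laurent_ring K\<^esub> g"

definition laurent_const :: "('k, 'r) ring_scheme \<Rightarrow> 'k list \<Rightarrow> 'k \<Rightarrow> (int \<Rightarrow> 'k) set" where
  "laurent_const K f k = laurent_class K f (k \<odot>\<^bsub>laurent_ring K\<^esub> \<one>\<^bsub>laurent_ring K\<^esub>)"

definition laurent_tbar :: "('k, 'r) ring_scheme \<Rightarrow> 'k list \<Rightarrow> (int \<Rightarrow> 'k) set" where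
  "laurent_tbar K f = laurent_class K f (basis_vec K 1)"

text \<open>
  The quotient as a module over the group algebra of the isotropy group at \<open>c\<^sup>\<infinity>\<close>, which is
  identified with the Laurent polynomial ring by \<open>(c\<^sup>\<infinity>, ln, c\<^sup>\<infinity>) \<leftrightarrow> t\<^sup>l\<close>, where \<open>n = |c|\<close>.
\<close>
definition laurent_quotient_module ::
  "('k, 'r) ring_scheme \<Rightarrow> 'k list \<Rightarrow> 'e list
     \<Rightarrow> ('k, ('v, 'e) arrow \<Rightarrow> 'k, (int \<Rightarrow> 'k) set) alg_module" where
  "laurent_quotient_module K f c = (let Q = laurent_quotient K f in
     \<lparr>carrier = carrier Q, monoid.mult = monoid.mult Q, one = one Q, ring.zero = ring.zero Q, ring.add = ring.add Q,
      smult = (\<lambda>k z. laurent_const K f k \<otimes>\<^bsub>Q\<^esub> z),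
      act = (\<lambda>r z. laurent_class K f
        (\<lambda>l. r (cycle_path c, l * int (length c), cycle_path c)) \<otimes>\<^bsub>Q\<^esub> z)\<rparr>)"

definition restricted_chen_module ::
  "('v, 'e) pre_digraph \<Rightarrow> ('k, 'r) ring_scheme \<Rightarrow> 'k list \<Rightarrow> ('e \<Rightarrow> (int \<Rightarrow> 'k) set) \<Rightarrow> 'e list
     \<Rightarrow> ('k, (('v, 'e) word \<Rightarrow> 'k) set, ('v, 'e) epath \<Rightarrow> (int \<Rightarrow> 'k) set) alg_module" where
  "restricted_chen_module E K f a c = (let F = laurent_quotient K f in
     restrict_module (laurent_const K f) (leavitt_base_change E F (laurent_const K f))
       (twisted_chen_module E F a (cycle_path c)))"

end

theory Submission
  imports Defs "HOL-Algebra.Polynomial_Divisibility"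
begin

text \<open>
  Write \<open>K'\<close> for the field \<open>K[t, t\<^sup>-\<^sup>1]/(f)\<close>. Both modules are compared with functions on the set of
  arrows \<open>(y, k, c\<^sup>\<infinity>)\<close>. Such an arrow exists when deleting the first \<open>i\<close> edges of \<open>y\<close> and the first \<open>j\<close>
  edges of \<open>c\<^sup>\<infinity>\<close> leaves the same path, for some \<open>i\<close> and \<open>j\<close> with \<open>k = i - j\<close>. Its value under the cocycle
  (\<open>cocycle\<close>) is the weight of the edges deleted from \<open>y\<close> divided by the weight of those deleted from
  \<open>c\<^sup>\<infinity>\<close>, an element of \<open>K'\<close>. Prepending an edge \<open>e\<close> to \<open>y\<close> multiplies the value by \<open>a\<^sub>e\<close>. Because \<open>c\<close> is simple,
  \<open>k\<close> is determined by \<open>y\<close> up to multiples of the length of \<open>c\<close>, and adding this length to \<open>k\<close> multiplies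
  the value by \<open>a\<^sub>c\<close>, which is the class of \<open>t\<close> (\<open>tail_lag_diff\<close>, \<open>cocycle_multiple\<close>).

  Dividing a function on the tail class of \<open>c\<^sup>\<infinity>\<close> by the cocycle (\<open>lift\<close>) cancels the weights: a word in
  the generators now acts by moving the sources of arrows, and an element of the Leavitt path
  algebra acts by convolution with its image in the Steinberg algebra (\<open>lift_chen_twist\<close>,
  \<open>chen_act_lift\<close>). As convolution is associative and the division is injective, the twisted Chen
  module is a module over the Steinberg algebra. The indicator of \<open>Z\<^bsub>(\<mu>,\<nu>)\<^esub>\<close> replaces the initial
  segment \<open>\<nu>\<close> of a path by \<open>\<mu>\<close> and scales by a quotient of values of the cocycle (\<open>cylinder_delta\<close>).

  For simplicity, an element of minimal support in a nonzero submodule is a multiple \<open>z p\<close> of a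
  single path, since the idempotents of \<open>Z\<^bsub>(\<mu>,\<mu>)\<^esub>\<close> separate two different paths. Going from \<open>p\<close> to \<open>p\<close>
  along an arrow that turns \<open>l\<close> times around \<open>c\<close> multiplies \<open>z\<close> by the \<open>l\<close>-th power of the class of \<open>t\<close>.
  These powers span \<open>K'\<close> over \<open>K\<close>, and \<open>z\<close> is invertible because \<open>f\<close> is irreducible and not associate to
  \<open>t\<close>; so the submodule contains all multiples of \<open>p\<close>. Paths of one tail class differ only in an
  initial segment, and the submodule is everything.

  For the isomorphism, send \<open>(q, k, c\<^sup>\<infinity>) \<otimes> v\<close> to the path \<open>q\<close> with the coefficient \<open>\<lambda>(q, k) v\<close>, where \<open>\<lambda>\<close>
  is the cocycle. This is balanced, since a loop at \<open>c\<^sup>\<infinity>\<close> shifts \<open>k\<close> and multiplies \<open>v\<close> by a power of the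
  class of \<open>t\<close>. The arrows with source \<open>q\<close> form one free orbit under the loops, so every element of
  the tensor product is a sum with one term for each path, and the coefficient of that term is
  determined by the image (\<open>normalizable_all\<close>, \<open>theta_eta\<close>). Hence the Chen module is a model of the
  induced module. The two actions agree on the indicators of \<open>Z\<^bsub>(\<mu>,\<nu>)\<^esub>\<close> and single arrows, hence
  everywhere (\<open>intertwined_all\<close>).
\<close>

section \<open>Finite linear combinations\<close>

definition fin_supp :: "('k, 'r) ring_scheme \<Rightarrow> ('s \<Rightarrow> 'k) set" where
  "fin_supp R = {p. (\<forall>s. p s \<in> carrier R) \<and> finite {s. p s \<noteq> \<zero>\<^bsub>R\<^esub>}}"

text \<open>The sum runs over the support of \<open>p\<close>, so that no finite index set has to be named and functions
  with different supports can be added.\<close>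
definition lincomb :: "('k, 'r) ring_scheme \<Rightarrow> ('s \<Rightarrow> 'k) \<Rightarrow> ('s \<Rightarrow> 'k) \<Rightarrow> 'k" where
  "lincomb R p h = (\<Oplus>\<^bsub>R\<^esub>s \<in> {s. p s \<noteq> \<zero>\<^bsub>R\<^esub>}. p s \<otimes>\<^bsub>R\<^esub> h s)"

lemma fin_suppD: "p \<in> fin_supp R \<Longrightarrow> p s \<in> carrier R"
  by (simp add: fin_supp_def)

lemma fin_supp_finite: "p \<in> fin_supp R \<Longrightarrow> finite {s. p s \<noteq> \<zero>\<^bsub>R\<^esub>}"
  by (simp add: fin_supp_def)

lemma fin_suppI: "\<lbrakk>\<And>s. p s \<in> carrier R; finite A; \<And>s. s \<notin> A \<Longrightarrow> p s = \<zero>\<^bsub>R\<^esub>\<rbrakk> \<Longrightarrow> p \<in> fin_supp R"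
  unfolding fin_supp_def by (auto intro: finite_subset[of _ A])

lemma basis_vec_apply: "basis_vec R s t = (if t = s then \<one>\<^bsub>R\<^esub> else \<zero>\<^bsub>R\<^esub>)"
  by (simp add: basis_vec_def)

lemma carrier_free_vs:
  "p \<in> carrier (free_vs R S) \<longleftrightarrow>
     (\<forall>s\<in>S. p s \<in> carrier R) \<and> (\<forall>s. s \<notin> S \<longrightarrow> p s = \<zero>\<^bsub>R\<^esub>) \<and> finite {s. p s \<noteq> \<zero>\<^bsub>R\<^esub>}"
  by (simp add: free_vs_def)

context abelian_monoid
begin

lemma finsum_cartesian:
  assumes "finite A" "finite B" "\<And>s t. F s t \<in> carrier G"
  shows "(\<Oplus>z\<in>A \<times> B. F (fst z) (snd z)) = (\<Oplus>s\<in>A. \<Oplus>t\<in>B. F s t)"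
  using assms(1)
proof (induction A rule: finite_induct)
  case (insert a A)
  have "(\<Oplus>z\<in>insert a A \<times> B. F (fst z) (snd z)) = (\<Oplus>z\<in>Pair a ` B \<union> A \<times> B. F (fst z) (snd z))"
    by (rule arg_cong[where f = "finsum G _"]) auto
  also have "\<dots> = (\<Oplus>z\<in>Pair a ` B. F (fst z) (snd z)) \<oplus> (\<Oplus>z\<in>A \<times> B. F (fst z) (snd z))"
    using insert assms by (intro finsum_Un_disjoint) auto
  also have "(\<Oplus>z\<in>Pair a ` B. F (fst z) (snd z)) = (\<Oplus>t\<in>B. F a t)"
    using assms by (subst finsum_reindex) (auto simp: inj_on_def)
  finally show ?case
    using insert assms by (simp add: finsum_insert Pi_def finsum_closed)
qed simp

lemma finsum_single:
  assumes "finite A" "\<And>s. f s \<in> carrier G" "\<And>s. s \<in> A \<Longrightarrow> s \<noteq> a \<Longrightarrow> f s = \<zero>" "a \<in> A"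
  shows "(\<Oplus>s\<in>A. f s) = f a"
proof -
  have "(\<Oplus>s\<in>A. f s) = (\<Oplus>s\<in>{a}. f s)"
    using assms by (intro add.finprod_mono_neutral_cong_right) auto
  then show ?thesis using assms(2) by simp
qed

end

text \<open>The operations of \<open>M\<close> enter through hypotheses because the sums occur in several records that
  share nothing but pointwise operations.\<close>
lemma finsum_pointwise:
  fixes M (structure)
  assumes "abelian_monoid M" "abelian_monoid R"
    and "\<zero> = (\<lambda>_. \<zero>\<^bsub>R\<^esub>)" and "\<And>x y. x \<oplus> y = (\<lambda>s. x s \<oplus>\<^bsub>R\<^esub> y s)"
    and "\<And>x s. x \<in> carrier M \<Longrightarrow> x s \<in> carrier R"
    and "\<And>i. i \<in> I \<Longrightarrow> g i \<in> carrier M"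
  shows "(\<Oplus>i\<in>I. g i) s = (\<Oplus>\<^bsub>R\<^esub>i\<in>I. g i s)"
  using assms(6)
proof (induction I rule: infinite_finite_induct)
  interpret M: abelian_monoid M by fact
  interpret R: abelian_monoid R by fact
  {
    case (infinite I)
    then show ?case by (simp add: assms(3))
  next
    case empty
    then show ?case by (simp add: assms(3))
  next
    case (insert i I)
    have "(\<Oplus>i\<in>insert i I. g i) = g i \<oplus> (\<Oplus>i\<in>I. g i)"
      using insert by (intro M.finsum_insert) auto
    moreover have "(\<Oplus>\<^bsub>R\<^esub>i\<in>insert i I. g i s) = g i s \<oplus>\<^bsub>R\<^esub> (\<Oplus>\<^bsub>R\<^esub>i\<in>I. g i s)"
      using insert assms(5) by (intro R.finsum_insert) auto
    ultimately show ?case using insert by (simp add: assms(4))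
  }
qed

context cring
begin

lemma lincomb_superset:
  assumes "p \<in> fin_supp R" "finite A" "\<And>s. s \<notin> A \<Longrightarrow> p s = \<zero>" "\<And>s. h s \<in> carrier R"
  shows "lincomb R p h = (\<Oplus>s\<in>A. p s \<otimes> h s)"
  unfolding lincomb_def using assms
  by (intro add.finprod_mono_neutral_cong_left) (auto simp: fin_suppD)

lemma lincomb_closed [simp, intro]:
  assumes "p \<in> fin_supp R" "\<And>s. h s \<in> carrier R"
  shows "lincomb R p h \<in> carrier R"
  unfolding lincomb_def using assms by (intro finsum_closed) (auto simp: fin_suppD)

lemma lincomb_cong:
  assumes "p \<in> fin_supp R" "\<And>s. p s \<noteq> \<zero> \<Longrightarrow> h s \<in> carrier R" "\<And>s. p s \<noteq> \<zero> \<Longrightarrow> h s = h' s"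
  shows "lincomb R p h = lincomb R p h'"
  unfolding lincomb_def by (rule finsum_cong') (use assms in \<open>auto simp: Pi_iff fin_suppD\<close>)

lemma fin_supp_zero [simp]: "(\<lambda>_. \<zero>) \<in> fin_supp R"
  by (simp add: fin_supp_def)

lemma fin_supp_basis [simp]: "basis_vec R s \<in> fin_supp R"
  by (rule fin_suppI[of _ _ "{s}"]) (auto simp: basis_vec_def)

lemma fin_supp_add [simp]: "p \<in> fin_supp R \<Longrightarrow> q \<in> fin_supp R \<Longrightarrow> (\<lambda>s. p s \<oplus> q s) \<in> fin_supp R"
  by (rule fin_suppI[of _ _ "{s. p s \<noteq> \<zero>} \<union> {s. q s \<noteq> \<zero>}"]) (auto simp: fin_supp_finite fin_suppD)

lemma fin_supp_smult [simp]: "k \<in> carrier R \<Longrightarrow> p \<in> fin_supp R \<Longrightarrow> (\<lambda>s. k \<otimes> p s) \<in> fin_supp R"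
  by (rule fin_suppI[of _ _ "{s. p s \<noteq> \<zero>}"]) (auto simp: fin_supp_finite fin_suppD)

lemma lincomb_add_left:
  assumes "p \<in> fin_supp R" "q \<in> fin_supp R" "\<And>s. h s \<in> carrier R"
  shows "lincomb R (\<lambda>s. p s \<oplus> q s) h = lincomb R p h \<oplus> lincomb R q h"
proof -
  let ?A = "{s. p s \<noteq> \<zero>} \<union> {s. q s \<noteq> \<zero>}"
  have fin: "finite ?A" using assms by (simp add: fin_supp_finite)
  have c: "\<And>s. p s \<in> carrier R" "\<And>s. q s \<in> carrier R" using assms by (auto simp: fin_suppD)
  have "lincomb R (\<lambda>s. p s \<oplus> q s) h = (\<Oplus>s\<in>?A. (p s \<oplus> q s) \<otimes> h s)"
    using assms fin by (intro lincomb_superset) auto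
  also have "\<dots> = (\<Oplus>s\<in>?A. p s \<otimes> h s \<oplus> q s \<otimes> h s)"
    using c assms by (intro finsum_cong') (auto simp: l_distr)
  also have "\<dots> = (\<Oplus>s\<in>?A. p s \<otimes> h s) \<oplus> (\<Oplus>s\<in>?A. q s \<otimes> h s)"
    using c assms by (intro finsum_addf) auto
  also have "\<dots> = lincomb R p h \<oplus> lincomb R q h"
    using assms fin by (subst (1 2) lincomb_superset[of _ ?A]) auto
  finally show ?thesis .
qed

lemma lincomb_smult_left:
  assumes "p \<in> fin_supp R" "k \<in> carrier R" "\<And>s. h s \<in> carrier R"
  shows "lincomb R (\<lambda>s. k \<otimes> p s) h = k \<otimes> lincomb R p h"
proof -
  let ?A = "{s. p s \<noteq> \<zero>}"
  have fin: "finite ?A" using assms by (simp add: fin_supp_finite)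
  have c: "\<And>s. p s \<in> carrier R" using assms by (auto simp: fin_suppD)
  have "lincomb R (\<lambda>s. k \<otimes> p s) h = (\<Oplus>s\<in>?A. (k \<otimes> p s) \<otimes> h s)"
    using assms fin by (intro lincomb_superset) auto
  also have "\<dots> = (\<Oplus>s\<in>?A. k \<otimes> (p s \<otimes> h s))"
    using c assms by (intro finsum_cong') (auto simp: m_assoc)
  also have "\<dots> = k \<otimes> (\<Oplus>s\<in>?A. p s \<otimes> h s)"
    using c assms fin by (intro finsum_rdistr[symmetric]) auto
  finally show ?thesis by (simp add: lincomb_def)
qed

lemma lincomb_add_right:
  assumes "p \<in> fin_supp R" "\<And>s. h s \<in> carrier R" "\<And>s. h' s \<in> carrier R"
  shows "lincomb R p (\<lambda>s. h s \<oplus> h' s) = lincomb R p h \<oplus> lincomb R p h'"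
proof -
  have c: "\<And>s. p s \<in> carrier R" using assms by (auto simp: fin_suppD)
  show ?thesis unfolding lincomb_def using c assms
    by (subst finsum_addf[symmetric]) (auto simp: r_distr intro!: finsum_cong')
qed

lemma lincomb_smult_right:
  assumes "p \<in> fin_supp R" "k \<in> carrier R" "\<And>s. h s \<in> carrier R"
  shows "lincomb R p (\<lambda>s. k \<otimes> h s) = k \<otimes> lincomb R p h"
proof -
  have c: "\<And>s. p s \<in> carrier R" using assms by (auto simp: fin_suppD)
  show ?thesis unfolding lincomb_def using c assms fin_supp_finite[OF assms(1)]
    by (subst finsum_rdistr) (auto simp: m_lcomm intro!: finsum_cong')
qed

lemma lincomb_zero_left [simp]: "lincomb R (\<lambda>_. \<zero>) h = \<zero>"
  by (simp add: lincomb_def)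

lemma lincomb_zero_right [simp]: "p \<in> fin_supp R \<Longrightarrow> lincomb R p (\<lambda>_. \<zero>) = \<zero>"
  unfolding lincomb_def by (rule add.finprod_one_eqI) (auto simp: fin_suppD)

lemma lincomb_single:
  assumes "p \<in> fin_supp R" "\<And>s. h s \<in> carrier R" "\<And>s. s \<noteq> a \<Longrightarrow> p s \<noteq> \<zero> \<Longrightarrow> h s = \<zero>"
  shows "lincomb R p h = p a \<otimes> h a"
proof -
  have c: "\<And>s. p s \<in> carrier R" using assms by (auto simp: fin_suppD)
  have "lincomb R p h = (\<Oplus>s\<in>insert a {s. p s \<noteq> \<zero>}. p s \<otimes> h s)"
    using assms by (intro lincomb_superset) (auto simp: fin_supp_finite fin_suppD)
  also have "\<dots> = p a \<otimes> h a"
    using assms c by (intro finsum_single) (auto simp: fin_supp_finite fin_suppD)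
  finally show ?thesis .
qed

lemma lincomb_basis:
  assumes "\<And>s. h s \<in> carrier R"
  shows "lincomb R (basis_vec R a) h = h a"
  using lincomb_single[OF fin_supp_basis, of h a a] assms by (auto simp: basis_vec_apply)

lemma lincomb_indicator_right:
  assumes "p \<in> fin_supp R"
  shows "lincomb R p (\<lambda>s. if s = a then \<one> else \<zero>) = p a"
  using lincomb_single[of p "\<lambda>s. if s = a then \<one> else \<zero>" a] fin_suppD[OF assms] assms by simp

lemma fin_supp_induct [consumes 1, case_names zero step]:
  assumes "p \<in> fin_supp R" "P (\<lambda>_. \<zero>)"
    and step: "\<And>k a p. \<lbrakk>k \<in> carrier R; p \<in> fin_supp R; P p; p a = \<zero>\<rbrakk>
                  \<Longrightarrow> P (\<lambda>s. k \<otimes> basis_vec R a s \<oplus> p s)"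
  shows "P p"
proof -
  have "\<forall>p. p \<in> fin_supp R \<longrightarrow> {s. p s \<noteq> \<zero>} = A \<longrightarrow> P p" if "finite A" for A
    using that
  proof (induction A rule: finite_induct)
    case empty
    show ?case
    proof (intro allI impI)
      fix p :: "'c \<Rightarrow> 'a" assume "{s. p s \<noteq> \<zero>} = {}"
      then have "p = (\<lambda>_. \<zero>)" by auto
      then show "P p" using assms(2) by simp
    qed
  next
    case (insert a A)
    show ?case
    proof (intro allI impI)
      fix p assume p: "p \<in> fin_supp R" "{s. p s \<noteq> \<zero>} = insert a A"
      define q where "q = p(a := \<zero>)"
      have q: "q \<in> fin_supp R"
        using p insert.hyps by (intro fin_suppI[of _ _ A]) (auto simp: q_def fin_suppD)
      have "{s. q s \<noteq> \<zero>} = A" using p insert by (auto simp: q_def)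
      then have "P q" using insert.IH q by blast
      then have "P (\<lambda>s. p a \<otimes> basis_vec R a s \<oplus> q s)"
        by (rule step[rotated 2]) (use q p in \<open>simp_all add: q_def fin_suppD\<close>)
      moreover have "(\<lambda>s. p a \<otimes> basis_vec R a s \<oplus> q s) = p"
        using p q by (auto simp: q_def basis_vec_def fun_eq_iff fin_suppD)
      ultimately show "P p" by simp
    qed
  qed
  from this[OF fin_supp_finite[OF assms(1)]] assms(1) show ?thesis by blast
qed

lemma lincomb_family_fin_supp:
  assumes "p \<in> fin_supp R" "\<And>s. q s \<in> fin_supp R"
  shows "(\<lambda>t. lincomb R p (\<lambda>s. q s t)) \<in> fin_supp R"
proof (rule fin_suppI)
  have c: "q s t \<in> carrier R" for s t using assms(2) by (rule fin_suppD)
  show "lincomb R p (\<lambda>s. q s t) \<in> carrier R" for t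
    using assms(1) c by blast
  show "finite (\<Union>s\<in>{s. p s \<noteq> \<zero>}. {t. q s t \<noteq> \<zero>})"
    using assms by (auto simp: fin_supp_finite fin_suppD)
  show "lincomb R p (\<lambda>s. q s t) = \<zero>" if "t \<notin> (\<Union>s\<in>{s. p s \<noteq> \<zero>}. {t. q s t \<noteq> \<zero>})" for t
    unfolding lincomb_def by (rule add.finprod_one_eqI) (use that assms in \<open>auto simp: fin_suppD\<close>)
qed

lemma lincomb_bind:
  assumes "p \<in> fin_supp R" "\<And>s. q s \<in> fin_supp R" "\<And>t. h t \<in> carrier R"
  shows "lincomb R (\<lambda>t. lincomb R p (\<lambda>s. q s t)) h = lincomb R p (\<lambda>s. lincomb R (q s) h)"
  using assms(1)
proof (induction p rule: fin_supp_induct)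
  case (step k a p)
  have c: "q s t \<in> carrier R" for s t using assms(2) by (rule fin_suppD)
  have "lincomb R (\<lambda>s. k \<otimes> basis_vec R a s \<oplus> p s) H = k \<otimes> H a \<oplus> lincomb R p H"
    if "\<And>s. H s \<in> carrier R" for H
    using that step by (simp add: lincomb_add_left lincomb_smult_left lincomb_basis)
  then show ?case
    using step assms c
    by (simp add: lincomb_add_left lincomb_smult_left lincomb_family_fin_supp)
qed simp

lemma lincomb_swap:
  assumes "p \<in> fin_supp R" "q \<in> fin_supp R" "\<And>s t. h s t \<in> carrier R"
  shows "lincomb R p (\<lambda>s. lincomb R q (h s)) = lincomb R q (\<lambda>t. lincomb R p (\<lambda>s. h s t))"
  using assms(1)
proof (induction p rule: fin_supp_induct)
  case (step k a p)
  have e: "lincomb R (\<lambda>s. k \<otimes> basis_vec R a s \<oplus> p s) H = k \<otimes> H a \<oplus> lincomb R p H"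
    if "\<And>s. H s \<in> carrier R" for H
    using that step by (simp add: lincomb_add_left lincomb_smult_left lincomb_basis)
  show ?case
    using step assms
    by (simp add: e lincomb_add_right lincomb_smult_right)
qed (simp add: assms)

lemma fin_supp_reindex:
  assumes "p \<in> fin_supp R" "inj g"
  shows "(\<lambda>s. p (g s)) \<in> fin_supp R"
proof (rule fin_suppI[of _ _ "g -` {s. p s \<noteq> \<zero>}"])
  show "finite (g -` {s. p s \<noteq> \<zero>})"
    using assms by (intro finite_vimageI) (auto simp: fin_supp_finite)
qed (use assms in \<open>auto simp: fin_suppD\<close>)

lemma lincomb_reindex:
  assumes "p \<in> fin_supp R" "\<And>s. h s \<in> carrier R" "inj g" "\<And>s. p s \<noteq> \<zero> \<Longrightarrow> s \<in> range g"
  shows "lincomb R p h = lincomb R (\<lambda>s. p (g s)) (\<lambda>s. h (g s))"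
proof -
  have c: "\<And>s. p s \<in> carrier R" using assms by (auto simp: fin_suppD)
  have "{s. p s \<noteq> \<zero>} = g ` {s. p (g s) \<noteq> \<zero>}"
    using assms(4) by blast
  moreover have "inj_on g A" for A using assms(3) by (rule inj_on_subset) simp
  ultimately show ?thesis
    unfolding lincomb_def using c assms by (simp add: finsum_reindex Pi_iff)
qed

lemma fin_supp_shift:
  assumes "p \<in> fin_supp R" "\<And>s. g' (g s) = s"
  shows "(\<lambda>s. p (g s)) \<in> fin_supp R"
  by (rule fin_supp_reindex[OF assms(1)]) (metis assms(2) injI)

lemma lincomb_shift:
  assumes "p \<in> fin_supp R" "\<And>s. h s \<in> carrier R" "\<And>s. g' (g s) = s" "\<And>s. g (g' s) = s"
  shows "lincomb R (\<lambda>s. p (g s)) h = lincomb R p (\<lambda>s. h (g' s))"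
proof -
  have "inj g" by (metis assms(3) injI)
  moreover have "s \<in> range g" for s by (metis assms(4) rangeI)
  ultimately show ?thesis
    using lincomb_reindex[of p "\<lambda>s. h (g' s)" g] assms by simp
qed

lemma convolution_lincomb:
  assumes p: "p \<in> fin_supp R" and q: "q \<in> fin_supp R"
    and P: "\<And>s t. p s \<noteq> \<zero> \<Longrightarrow> q t \<noteq> \<zero> \<Longrightarrow> (s, t) \<in> P"
  shows "convolution R P m p q u = lincomb R p (\<lambda>s. lincomb R q (\<lambda>t. if m s t = u then \<one> else \<zero>))"
proof -
  let ?A = "{s. p s \<noteq> \<zero>}" and ?B = "{t. q t \<noteq> \<zero>}"
  have c: "\<And>s. p s \<in> carrier R" "\<And>s. q s \<in> carrier R" using assms by (auto simp: fin_suppD)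
  have fin: "finite ?A" "finite ?B" using assms by (auto simp: fin_supp_finite fin_suppD)
  define F where "F = (\<lambda>s t. p s \<otimes> (q t \<otimes> (if m s t = u then \<one> else \<zero>)))"
  have "lincomb R p (\<lambda>s. lincomb R q (\<lambda>t. if m s t = u then \<one> else \<zero>)) = (\<Oplus>s\<in>?A. \<Oplus>t\<in>?B. F s t)"
    unfolding lincomb_def F_def using c fin
    by (intro finsum_cong') (auto simp: finsum_rdistr Pi_iff intro!: finsum_closed)
  also have "\<dots> = (\<Oplus>z\<in>?A \<times> ?B. F (fst z) (snd z))"
    using c fin by (subst finsum_cartesian) (auto simp: F_def)
  also have "\<dots> = (\<Oplus>z\<in>{(s, t) \<in> P. p s \<noteq> \<zero> \<and> q t \<noteq> \<zero> \<and> m s t = u}. p (fst z) \<otimes> q (snd z))"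
    using c fin P
    by (intro add.finprod_mono_neutral_cong_right) (auto simp: F_def)
  finally show ?thesis by (simp add: convolution_def)
qed

lemma convolution_lincomb_basis:
  assumes "p \<in> fin_supp R" "q \<in> fin_supp R" "\<And>s t. p s \<noteq> \<zero> \<Longrightarrow> q t \<noteq> \<zero> \<Longrightarrow> (s, t) \<in> P"
  shows "convolution R P m p q = (\<lambda>u. lincomb R p (\<lambda>s. lincomb R q (\<lambda>t. basis_vec R (m s t) u)))"
  using convolution_lincomb[OF assms, where m = m] by (simp add: basis_vec_apply eq_commute fun_eq_iff)

text \<open>A finitely supported function is determined by its sums against arbitrary \<open>h\<close>. On such sums
  convolution is an iterated sum, so that its algebraic laws reduce to exchanging and reindexing
  sums.\<close>
lemma lincomb_convolution:
  assumes "p \<in> fin_supp R" "q \<in> fin_supp R" "\<And>s t. p s \<noteq> \<zero> \<Longrightarrow> q t \<noteq> \<zero> \<Longrightarrow> (s, t) \<in> P"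
  shows "convolution R P m p q \<in> fin_supp R"
    and "(\<And>u. h u \<in> carrier R) \<Longrightarrow>
      lincomb R (convolution R P m p q) h = lincomb R p (\<lambda>s. lincomb R q (\<lambda>t. h (m s t)))"
proof -
  have fam: "(\<lambda>u. lincomb R q (\<lambda>t. basis_vec R (m s t) u)) \<in> fin_supp R" for s
    by (intro lincomb_family_fin_supp assms(2) fin_supp_basis)
  show "convolution R P m p q \<in> fin_supp R"
    using convolution_lincomb_basis[OF assms, where m = m] lincomb_family_fin_supp[OF assms(1) fam] by simp
  show "lincomb R (convolution R P m p q) h = lincomb R p (\<lambda>s. lincomb R q (\<lambda>t. h (m s t)))"
    if "\<And>u. h u \<in> carrier R"
    using convolution_lincomb_basis[OF assms, where m = m] that
    by (simp add: lincomb_bind assms(1,2) fam lincomb_basis)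
qed

lemma lincomb_diff_left:
  assumes "p \<in> fin_supp R" "q \<in> fin_supp R" "\<And>s. h s \<in> carrier R"
  shows "lincomb R (\<lambda>s. p s \<ominus> q s) h = lincomb R p h \<ominus> lincomb R q h"
proof -
  have e: "(\<lambda>s. p s \<ominus> q s) = (\<lambda>s. p s \<oplus> (\<ominus> \<one>) \<otimes> q s)"
    using assms by (auto simp: fin_suppD minus_eq l_minus)
  have c: "lincomb R q h \<in> carrier R" using assms by blast
  show ?thesis
    unfolding e using assms c by (simp add: lincomb_add_left lincomb_smult_left minus_eq l_minus)
qed

end

lemma (in ring_hom_cring) hom_lincomb:
  assumes "p \<in> fin_supp R" "\<And>s. g s \<in> carrier R"
  shows "h (lincomb R p g) = lincomb S (\<lambda>s. h (p s)) (\<lambda>s. h (g s))"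
    and "(\<lambda>s. h (p s)) \<in> fin_supp S"
proof -
  have c: "p s \<in> carrier R" for s using assms by (auto simp: fin_suppD)
  show f: "(\<lambda>s. h (p s)) \<in> fin_supp S"
    by (rule fin_suppI[of _ _ "{s. p s \<noteq> \<zero>}"]) (use assms c in \<open>auto simp: fin_supp_finite\<close>)
  have "lincomb S (\<lambda>s. h (p s)) (\<lambda>s. h (g s)) = (\<Oplus>\<^bsub>S\<^esub>s\<in>{s. p s \<noteq> \<zero>}. h (p s) \<otimes>\<^bsub>S\<^esub> h (g s))"
    using assms by (intro S.lincomb_superset f) (auto simp: fin_supp_finite fin_suppD)
  then show "h (lincomb R p g) = lincomb S (\<lambda>s. h (p s)) (\<lambda>s. h (g s))"
    using c assms by (simp add: lincomb_def Pi_iff comp_def)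
qed

section \<open>Free vector spaces\<close>

lemma abelian_group_free_vs:
  fixes R (structure) and M :: "('s \<Rightarrow> 'k, 'z) ring_scheme"
  assumes "ring R" "carrier M = carrier (free_vs R S)"
    "ring.zero M = ring.zero (free_vs R S)" "ring.add M = ring.add (free_vs R S)"
  shows "abelian_group M"
proof -
  interpret ring R by fact
  have fin: "finite {s. f s \<oplus> g s \<noteq> \<zero>}" if "finite {s. f s \<noteq> \<zero>}" "finite {s. g s \<noteq> \<zero>}" for f g :: "'s \<Rightarrow> 'k"
    by (rule finite_subset[of _ "{s. f s \<noteq> \<zero>} \<union> {s. g s \<noteq> \<zero>}"]) (use that in auto)
  have c: "f s \<in> carrier R" if "f \<in> carrier (free_vs R S)" for f s
    using that by (cases "s \<in> S") (auto simp: carrier_free_vs)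
  have inv: "\<exists>g. g \<in> carrier (free_vs R S) \<and> (\<lambda>s. g s \<oplus> f s) = (\<lambda>_. \<zero>)" if "f \<in> carrier (free_vs R S)" for f
  proof (intro exI conjI)
    show "(\<lambda>s. \<ominus> f s) \<in> carrier (free_vs R S)"
      using that c[OF that] finite_subset[of "{s. \<ominus> f s \<noteq> \<zero>}" "{s. f s \<noteq> \<zero>}"]
      by (auto simp: carrier_free_vs)
    show "(\<lambda>s. \<ominus> f s \<oplus> f s) = (\<lambda>_. \<zero>)" using c[OF that] by (simp add: l_neg)
  qed
  show ?thesis
  proof (rule abelian_groupI, unfold assms)
    fix f assume f: "f \<in> carrier (free_vs R S)"
    show "\<exists>g\<in>carrier (free_vs R S). g \<oplus>\<^bsub>free_vs R S\<^esub> f = \<zero>\<^bsub>free_vs R S\<^esub>"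
      using inv[OF f] by (auto simp: free_vs_def)
    show "\<zero>\<^bsub>free_vs R S\<^esub> \<oplus>\<^bsub>free_vs R S\<^esub> f = f"
      using c[OF f] by (simp add: free_vs_def)
    fix g assume g: "g \<in> carrier (free_vs R S)"
    show "f \<oplus>\<^bsub>free_vs R S\<^esub> g \<in> carrier (free_vs R S)"
      using f g by (simp add: free_vs_def fin)
    show "f \<oplus>\<^bsub>free_vs R S\<^esub> g = g \<oplus>\<^bsub>free_vs R S\<^esub> f"
      using c[OF f] c[OF g] by (simp add: free_vs_def a_comm)
    fix h assume h: "h \<in> carrier (free_vs R S)"
    show "f \<oplus>\<^bsub>free_vs R S\<^esub> g \<oplus>\<^bsub>free_vs R S\<^esub> h = f \<oplus>\<^bsub>free_vs R S\<^esub> (g \<oplus>\<^bsub>free_vs R S\<^esub> h)"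
      using c[OF f] c[OF g] c[OF h] by (simp add: free_vs_def a_assoc)
  qed (simp add: free_vs_def)
qed

lemma (in cring) carrier_free_vs_fin_supp: "p \<in> carrier (free_vs R S) \<Longrightarrow> p \<in> fin_supp R"
  unfolding carrier_free_vs fin_supp_def mem_Collect_eq by (metis zero_closed)

lemma (in cring) free_vs_minus:
  fixes M :: "('a, 's \<Rightarrow> 'a, 'z) module_scheme"
  assumes "carrier M = carrier (free_vs R S)"
    "ring.zero M = ring.zero (free_vs R S)" "ring.add M = ring.add (free_vs R S)"
    and "p \<in> carrier M" "q \<in> carrier M"
  shows "p \<ominus>\<^bsub>M\<^esub> q = (\<lambda>s. p s \<ominus> q s)"
proof -
  interpret M: abelian_group M by (rule abelian_group_free_vs[OF ring_axioms assms(1-3)])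
  have c: "p s \<in> carrier R" "q s \<in> carrier R" for s
    using assms carrier_free_vs_fin_supp[THEN fin_suppD] by auto
  have add: "x \<oplus>\<^bsub>M\<^esub> y = (\<lambda>s. x s \<oplus> y s)" for x y by (simp add: assms(3) free_vs_def)
  have neg: "(\<lambda>s. \<ominus> q s) \<in> carrier M"
    using assms(1,5) c finite_subset[of "{s. \<ominus> q s \<noteq> \<zero>}" "{s. q s \<noteq> \<zero>}"]
    by (auto simp: carrier_free_vs)
  have "(\<lambda>s. \<ominus> q s) \<oplus>\<^bsub>M\<^esub> q = \<zero>\<^bsub>M\<^esub>"
    using c by (simp add: add assms(2) free_vs_def l_neg)
  then have "\<ominus>\<^bsub>M\<^esub> q = (\<lambda>s. \<ominus> q s)" using neg assms(5) M.minus_equality by blast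
  then show ?thesis by (simp add: M.minus_eq add minus_eq)
qed

section \<open>Quotients of the Laurent polynomial ring\<close>

lemma (in cring) carrier_free_vs_UNIV: "carrier (free_vs R UNIV) = fin_supp R"
  by (auto simp: free_vs_def fin_supp_def)

lemma laurent_ring_simps:
  "ring.zero (laurent_ring R) = (\<lambda>_. \<zero>\<^bsub>R\<^esub>)"
  "ring.add (laurent_ring R) = (\<lambda>p q s. p s \<oplus>\<^bsub>R\<^esub> q s)"
  "monoid.one (laurent_ring R) = basis_vec R 0"
  "monoid.mult (laurent_ring R) = convolution R UNIV (+)"
  "module.smult (laurent_ring R) = (\<lambda>k p s. k \<otimes>\<^bsub>R\<^esub> p s)"
  by (simp_all add: laurent_ring_def semigroup_algebra_def free_vs_def integer_group_def)

context cring
begin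

lemma carrier_laurent_ring: "carrier (laurent_ring R) = fin_supp R"
  by (simp add: laurent_ring_def semigroup_algebra_def carrier_free_vs_UNIV)

lemma laurent_mult:
  assumes "p \<in> fin_supp R" "q \<in> fin_supp R"
  shows "(p \<otimes>\<^bsub>laurent_ring R\<^esub> q) = (\<lambda>u. lincomb R p (\<lambda>s. lincomb R q (\<lambda>t. basis_vec R (s + t) u)))"
  using assms by (simp add: laurent_ring_simps convolution_lincomb_basis)

lemma laurent_mult_closed:
  "p \<in> fin_supp R \<Longrightarrow> q \<in> fin_supp R \<Longrightarrow> p \<otimes>\<^bsub>laurent_ring R\<^esub> q \<in> fin_supp R"
  by (simp add: laurent_ring_simps lincomb_convolution(1))

lemma lincomb_laurent_mult:
  assumes "p \<in> fin_supp R" "q \<in> fin_supp R" "\<And>s. h s \<in> carrier R"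
  shows "lincomb R (p \<otimes>\<^bsub>laurent_ring R\<^esub> q) h = lincomb R p (\<lambda>s. lincomb R q (\<lambda>t. h (s + t)))"
  using assms by (simp add: laurent_ring_simps lincomb_convolution(2))

text \<open>Testing against indicators of points recovers the values.\<close>
lemma fin_supp_eqI:
  assumes "p \<in> fin_supp R" "q \<in> fin_supp R"
    "\<And>h. (\<And>s. h s \<in> carrier R) \<Longrightarrow> lincomb R p h = lincomb R q h"
  shows "p = q"
proof
  fix a
  show "p a = q a"
    using assms(3)[of "\<lambda>s. if s = a then \<one> else \<zero>"] assms(1,2) by (simp add: lincomb_indicator_right)
qed

lemma laurent_ring_cring: "cring (laurent_ring R)"
proof (rule cringI)
  show "abelian_group (laurent_ring R)"
    by (rule abelian_group_free_vs[of R _ UNIV])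
       (auto simp: laurent_ring_def semigroup_algebra_def ring_axioms free_vs_def)
  show "comm_monoid (laurent_ring R)"
  proof (rule comm_monoidI, unfold carrier_laurent_ring)
    show one: "\<one>\<^bsub>laurent_ring R\<^esub> \<in> fin_supp R" by (simp add: laurent_ring_simps)
    fix p :: "int \<Rightarrow> 'a" assume p: "p \<in> fin_supp R"
    show "\<one>\<^bsub>laurent_ring R\<^esub> \<otimes>\<^bsub>laurent_ring R\<^esub> p = p"
      by (rule fin_supp_eqI)
         (use one p in \<open>simp_all add: laurent_mult_closed lincomb_laurent_mult laurent_ring_simps(3) lincomb_basis\<close>)
    fix q :: "int \<Rightarrow> 'a" assume q: "q \<in> fin_supp R"
    show "p \<otimes>\<^bsub>laurent_ring R\<^esub> q \<in> fin_supp R" by (rule laurent_mult_closed[OF p q])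
    show "p \<otimes>\<^bsub>laurent_ring R\<^esub> q = q \<otimes>\<^bsub>laurent_ring R\<^esub> p"
    proof (rule fin_supp_eqI)
      fix h :: "int \<Rightarrow> 'a" assume "\<And>s. h s \<in> carrier R"
      then show "lincomb R (p \<otimes>\<^bsub>laurent_ring R\<^esub> q) h = lincomb R (q \<otimes>\<^bsub>laurent_ring R\<^esub> p) h"
        using p q by (simp add: lincomb_laurent_mult lincomb_swap[of p q] add.commute)
    qed (use p q in \<open>simp_all add: laurent_mult_closed\<close>)
    fix r :: "int \<Rightarrow> 'a" assume r: "r \<in> fin_supp R"
    show "p \<otimes>\<^bsub>laurent_ring R\<^esub> q \<otimes>\<^bsub>laurent_ring R\<^esub> r = p \<otimes>\<^bsub>laurent_ring R\<^esub> (q \<otimes>\<^bsub>laurent_ring R\<^esub> r)"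
      by (rule fin_supp_eqI)
         (use p q r in \<open>simp_all add: laurent_mult_closed lincomb_laurent_mult add.assoc\<close>)
  qed
  fix p q r assume "p \<in> carrier (laurent_ring R)" "q \<in> carrier (laurent_ring R)" "r \<in> carrier (laurent_ring R)"
  then show "(p \<oplus>\<^bsub>laurent_ring R\<^esub> q) \<otimes>\<^bsub>laurent_ring R\<^esub> r =
      p \<otimes>\<^bsub>laurent_ring R\<^esub> r \<oplus>\<^bsub>laurent_ring R\<^esub> q \<otimes>\<^bsub>laurent_ring R\<^esub> r"
    unfolding carrier_laurent_ring laurent_ring_simps(2)
    by (simp add: laurent_mult lincomb_add_left fin_suppD)
qed

lemma laurent_basis_mult:
  "basis_vec R s \<otimes>\<^bsub>laurent_ring R\<^esub> basis_vec R t = basis_vec R (s + t)"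
  by (rule fin_supp_eqI)
     (simp_all add: laurent_mult_closed lincomb_laurent_mult lincomb_basis)

lemma laurent_scalar_mult:
  assumes "k \<in> carrier R" "p \<in> fin_supp R"
  shows "(\<lambda>s. k \<otimes> basis_vec R 0 s) \<otimes>\<^bsub>laurent_ring R\<^esub> p = (\<lambda>s. k \<otimes> p s)"
  by (rule fin_supp_eqI)
     (use assms in \<open>simp_all add: laurent_mult_closed lincomb_laurent_mult lincomb_smult_left lincomb_basis\<close>)

lemma laurent_scalar_hom:
  "(\<lambda>k. k \<odot>\<^bsub>laurent_ring R\<^esub> \<one>\<^bsub>laurent_ring R\<^esub>) \<in> ring_hom R (laurent_ring R)"
proof (rule ring_hom_memI)
  show "\<one> \<odot>\<^bsub>laurent_ring R\<^esub> \<one>\<^bsub>laurent_ring R\<^esub> = \<one>\<^bsub>laurent_ring R\<^esub>"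
    by (simp add: laurent_ring_simps basis_vec_def fun_eq_iff)
  fix k l assume kl: "k \<in> carrier R" "l \<in> carrier R"
  show "(k \<otimes> l) \<odot>\<^bsub>laurent_ring R\<^esub> \<one>\<^bsub>laurent_ring R\<^esub> = k \<odot>\<^bsub>laurent_ring R\<^esub> \<one>\<^bsub>laurent_ring R\<^esub>
      \<otimes>\<^bsub>laurent_ring R\<^esub> (l \<odot>\<^bsub>laurent_ring R\<^esub> \<one>\<^bsub>laurent_ring R\<^esub>)"
    using kl by (simp add: laurent_ring_simps(3,5) laurent_scalar_mult m_assoc fin_suppD)
  show "(k \<oplus> l) \<odot>\<^bsub>laurent_ring R\<^esub> \<one>\<^bsub>laurent_ring R\<^esub> = k \<odot>\<^bsub>laurent_ring R\<^esub> \<one>\<^bsub>laurent_ring R\<^esub>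
      \<oplus>\<^bsub>laurent_ring R\<^esub> l \<odot>\<^bsub>laurent_ring R\<^esub> \<one>\<^bsub>laurent_ring R\<^esub>"
    using kl by (simp add: laurent_ring_simps l_distr basis_vec_apply)
  show "k \<odot>\<^bsub>laurent_ring R\<^esub> \<one>\<^bsub>laurent_ring R\<^esub> \<in> carrier (laurent_ring R)"
    using kl by (simp add: laurent_ring_simps carrier_laurent_ring)
qed

end

text \<open>The coefficient of a product in the Laurent ring is a sum over all pairs of integers with the
  given sum. Pairs with a negative member contribute nothing, which leaves the sum that defines
  the product of polynomials.\<close>
lemma (in field) laurent_of_poly_hom:
  shows "laurent_of_poly R \<in> ring_hom (univ_poly R (carrier R)) (laurent_ring R)"
proof (rule ring_hom_memI)
  note sub = carrier_is_subring
  have set: "set p \<subseteq> carrier R" if "p \<in> carrier (univ_poly R (carrier R))" for p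
    using that polynomial_in_carrier[OF sub] by (simp add: univ_poly_carrier)
  have closed: "laurent_of_poly R p \<in> fin_supp R" if "p \<in> carrier (univ_poly R (carrier R))" for p
  proof (rule fin_suppI)
    show "laurent_of_poly R p s \<in> carrier R" for s
      using set[OF that] by (simp add: laurent_of_poly_def)
    show "finite {0..int (length p)}" by simp
    show "laurent_of_poly R p s = \<zero>" if "s \<notin> {0..int (length p)}" for s
      using that coeff_length[of p "nat s"] by (auto simp: laurent_of_poly_def)
  qed
  show "laurent_of_poly R p \<in> carrier (laurent_ring R)" if "p \<in> carrier (univ_poly R (carrier R))" for p
    using closed[OF that] by (simp add: carrier_laurent_ring)
  show "laurent_of_poly R \<one>\<^bsub>univ_poly R (carrier R)\<^esub> = \<one>\<^bsub>laurent_ring R\<^esub>"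
    by (auto simp: laurent_of_poly_def univ_poly_one laurent_ring_simps basis_vec_def)
  fix p q assume pq: "p \<in> carrier (univ_poly R (carrier R))" "q \<in> carrier (univ_poly R (carrier R))"
  show "laurent_of_poly R (p \<oplus>\<^bsub>univ_poly R (carrier R)\<^esub> q) =
      laurent_of_poly R p \<oplus>\<^bsub>laurent_ring R\<^esub> laurent_of_poly R q"
    using poly_add_coeff[OF set set, OF pq]
    by (auto simp: laurent_of_poly_def univ_poly_add laurent_ring_simps simp del: poly_add.simps)
  show "laurent_of_poly R (p \<otimes>\<^bsub>univ_poly R (carrier R)\<^esub> q) =
      laurent_of_poly R p \<otimes>\<^bsub>laurent_ring R\<^esub> laurent_of_poly R q"
  proof
    fix u :: int
    let ?P = "laurent_of_poly R p" and ?Q = "laurent_of_poly R q"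
    have c: "\<And>i. coeff p i \<in> carrier R" "\<And>i. coeff q i \<in> carrier R"
      using set pq by auto
    have c': "\<And>s. ?P s \<in> carrier R" "\<And>s. ?Q s \<in> carrier R"
      using closed pq by (auto simp: fin_suppD)
    have "(?P \<otimes>\<^bsub>laurent_ring R\<^esub> ?Q) u = lincomb R ?P (\<lambda>s. lincomb R ?Q (\<lambda>t. if t = u - s then \<one> else \<zero>))"
      unfolding laurent_mult[OF closed closed, OF pq] basis_vec_apply by (intro arg_cong[where f = "lincomb R ?P"] ext) (auto intro!: arg_cong[where f = "lincomb R ?Q"])
    also have "\<dots> = lincomb R ?P (\<lambda>s. ?Q (u - s))"
      using closed pq by (simp add: lincomb_indicator_right)
    also have "\<dots> = (\<Oplus>s\<in>int ` {..nat u}. ?P s \<otimes> ?Q (u - s))"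
      unfolding lincomb_def
    proof (rule add.finprod_mono_neutral_cong)
      show "finite {s. ?P s \<noteq> \<zero>}" using closed[OF pq(1)] by (simp add: fin_supp_finite)
      show "?P s \<otimes> ?Q (u - s) = \<zero>" if "s \<in> {s. ?P s \<noteq> \<zero>} - int ` {..nat u}" for s
      proof -
        have "0 \<le> s" using that by (auto simp: laurent_of_poly_def split: if_splits)
        moreover have "\<not> nat s \<le> nat u" using that \<open>0 \<le> s\<close> by (auto intro!: image_eqI[of s int "nat s"])
        ultimately have "u - s < 0" by linarith
        then show ?thesis using c' by (simp add: laurent_of_poly_def)
      qed
    qed (use c' in auto)
    also have "\<dots> = (\<Oplus>i\<in>{..nat u}. ?P (int i) \<otimes> ?Q (u - int i))"
      using c' by (subst finsum_reindex) auto
    also have "\<dots> = laurent_of_poly R (p \<otimes>\<^bsub>univ_poly R (carrier R)\<^esub> q) u"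
    proof (cases "0 \<le> u")
      case True
      then have "(\<Oplus>i\<in>{..nat u}. ?P (int i) \<otimes> ?Q (u - int i)) = (\<Oplus>i\<in>{..nat u}. coeff p i \<otimes> coeff q (nat u - i))"
        using c by (intro finsum_cong') (auto simp: laurent_of_poly_def nat_diff_distrib)
      then show ?thesis
        using True poly_mult_coeff[OF set set, OF pq] by (simp add: laurent_of_poly_def univ_poly_mult)
    next
      case False
      then show ?thesis using c by (simp add: laurent_of_poly_def)
    qed
    finally show "laurent_of_poly R (p \<otimes>\<^bsub>univ_poly R (carrier R)\<^esub> q) u = (?P \<otimes>\<^bsub>laurent_ring R\<^esub> ?Q) u" ..
  qed
qed

lemma (in field) laurent_of_poly_inj:
  assumes "p \<in> carrier (univ_poly R (carrier R))" "q \<in> carrier (univ_poly R (carrier R))"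
    "laurent_of_poly R p = laurent_of_poly R q"
  shows "p = q"
proof -
  have "coeff p i = coeff q i" for i
    using fun_cong[OF assms(3), of "int i"] by (simp add: laurent_of_poly_def)
  then have "coeff p = coeff q" by blast
  then show ?thesis
    using coeff_iff_polynomial_cond[of "carrier R" p q] assms(1,2) by (simp add: univ_poly_carrier)
qed

lemma (in field) laurent_of_poly_var_pow:
  "laurent_of_poly R (X [^]\<^bsub>univ_poly R (carrier R)\<^esub> (n::nat)) = basis_vec R (int n)"
proof (induction n)
  case 0
  have "laurent_of_poly R \<one>\<^bsub>univ_poly R (carrier R)\<^esub> = \<one>\<^bsub>laurent_ring R\<^esub>"
    using laurent_of_poly_hom by (rule ring_hom_one)
  then show ?case by (simp add: laurent_ring_simps)
next
  case (Suc n)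
  interpret UP: domain "univ_poly R (carrier R)" by (rule univ_poly_is_domain[OF carrier_is_subring])
  have X: "X \<in> carrier (univ_poly R (carrier R))" by (rule var_closed(1)[OF carrier_is_subring])
  have "laurent_of_poly R X = basis_vec R 1"
    by (auto simp: laurent_of_poly_def var_def basis_vec_def fun_eq_iff nat_eq_iff)
  then show ?case
    using Suc ring_hom_mult[OF laurent_of_poly_hom UP.nat_pow_closed[OF X] X, of n]
    by (simp add: laurent_basis_mult add.commute)
qed

text \<open>By induction on the support: one more term \<open>k t\<^sup>a\<close> is absorbed by a further power of \<open>t\<close>.\<close>
lemma (in field) laurent_shift_to_poly:
  assumes "g \<in> fin_supp R"
  shows "\<exists>n::nat. \<exists>p\<in>carrier (univ_poly R (carrier R)).
    basis_vec R (int n) \<otimes>\<^bsub>laurent_ring R\<^esub> g = laurent_of_poly R p"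
  using assms
proof (induction g rule: fin_supp_induct)
  interpret L: cring "laurent_ring R" by (rule laurent_ring_cring)
  interpret UP: domain "univ_poly R (carrier R)" by (rule univ_poly_is_domain[OF carrier_is_subring])
  have X: "X \<in> carrier (univ_poly R (carrier R))" by (rule var_closed(1)[OF carrier_is_subring])
  note hom = laurent_of_poly_hom
  {
    case zero
    have "laurent_of_poly R \<zero>\<^bsub>univ_poly R (carrier R)\<^esub> = \<zero>\<^bsub>laurent_ring R\<^esub>"
      using ring_hom_zero[OF hom UP.ring_axioms L.ring_axioms] .
    moreover have "basis_vec R (int 0) \<otimes>\<^bsub>laurent_ring R\<^esub> (\<lambda>_. \<zero>) = \<zero>\<^bsub>laurent_ring R\<^esub>"
      using L.r_null[of "basis_vec R 0"] by (simp add: carrier_laurent_ring laurent_ring_simps(1))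
    ultimately show ?case using UP.zero_closed by (intro exI[of _ 0] bexI[of _ "\<zero>\<^bsub>univ_poly R (carrier R)\<^esub>"]) simp_all
  next
    case (step k a g)
    then obtain n p where p: "p \<in> carrier (univ_poly R (carrier R))"
      "basis_vec R (int n) \<otimes>\<^bsub>laurent_ring R\<^esub> g = laurent_of_poly R p" by blast
    \<comment> \<open>The exponent is raised until the new term \<open>k t\<^sup>a\<close> has a non-negative degree.\<close>
    define N where "N = n + nat (- a)"
    define m where "m = nat (int N + a)"
    have m: "int m = int N + a" by (simp add: m_def N_def)
    define kk where "kk = (if k = \<zero> then [] else [k])"
    have kk: "kk \<in> carrier (univ_poly R (carrier R))" "laurent_of_poly R kk = (\<lambda>s. k \<otimes> basis_vec R 0 s)"
      using step(1) by (auto simp: kk_def univ_poly_carrier[symmetric] polynomial_def laurent_of_poly_def basis_vec_def fun_eq_iff)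
    let ?q = "kk \<otimes>\<^bsub>univ_poly R (carrier R)\<^esub> X [^]\<^bsub>univ_poly R (carrier R)\<^esub> m
      \<oplus>\<^bsub>univ_poly R (carrier R)\<^esub> X [^]\<^bsub>univ_poly R (carrier R)\<^esub> (nat (- a)) \<otimes>\<^bsub>univ_poly R (carrier R)\<^esub> p"
    have c: "basis_vec R s \<in> carrier (laurent_ring R)" "g \<in> carrier (laurent_ring R)"
      "(\<lambda>s. k \<otimes> basis_vec R a s) \<in> carrier (laurent_ring R)"
      "(\<lambda>s. k \<otimes> basis_vec R 0 s) \<in> carrier (laurent_ring R)" for s
      using step by (auto simp: carrier_laurent_ring)
    have "laurent_of_poly R ?q = (\<lambda>s. k \<otimes> basis_vec R 0 s) \<otimes>\<^bsub>laurent_ring R\<^esub> basis_vec R (int m)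
      \<oplus>\<^bsub>laurent_ring R\<^esub> basis_vec R (int (nat (- a))) \<otimes>\<^bsub>laurent_ring R\<^esub> (basis_vec R (int n) \<otimes>\<^bsub>laurent_ring R\<^esub> g)"
      using kk p X UP.nat_pow_closed[OF X] by (simp add: ring_hom_add[OF hom] ring_hom_mult[OF hom] laurent_of_poly_var_pow)
    also have "basis_vec R (int (nat (- a))) \<otimes>\<^bsub>laurent_ring R\<^esub> (basis_vec R (int n) \<otimes>\<^bsub>laurent_ring R\<^esub> g)
        = basis_vec R (int N) \<otimes>\<^bsub>laurent_ring R\<^esub> g"
      using c by (simp add: L.m_assoc[symmetric] laurent_basis_mult N_def add.commute)
    also have "(\<lambda>s. k \<otimes> basis_vec R 0 s) \<otimes>\<^bsub>laurent_ring R\<^esub> basis_vec R (int m)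
        = basis_vec R (int N) \<otimes>\<^bsub>laurent_ring R\<^esub> (\<lambda>s. k \<otimes> basis_vec R a s)"
    proof -
      have "(\<lambda>s. k \<otimes> basis_vec R a s) = (\<lambda>s. k \<otimes> basis_vec R 0 s) \<otimes>\<^bsub>laurent_ring R\<^esub> basis_vec R a"
        using step by (simp add: laurent_scalar_mult)
      then show ?thesis
        using L.m_lcomm[OF c(4) c(1)[of "int N"] c(1)[of a]] by (simp add: laurent_basis_mult m)
    qed
    finally have "laurent_of_poly R ?q = basis_vec R (int N) \<otimes>\<^bsub>laurent_ring R\<^esub>
       ((\<lambda>s. k \<otimes> basis_vec R a s) \<oplus>\<^bsub>laurent_ring R\<^esub> g)"
      using c by (simp add: L.r_distr)
    then have "basis_vec R (int N) \<otimes>\<^bsub>laurent_ring R\<^esub> (\<lambda>s. k \<otimes> basis_vec R a s \<oplus> g s) = laurent_of_poly R ?q"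
      by (simp add: laurent_ring_simps(2))
    moreover have "?q \<in> carrier (univ_poly R (carrier R))"
      using kk p X by simp
    ultimately show ?case by blast
  }
qed

text \<open>The quotient by \<open>f\<close> is a field, and the class of \<open>p\<close> in it is not zero.\<close>
lemma (in field) irreducible_poly_inverse:
  assumes f: "f \<in> carrier (univ_poly R (carrier R))" "ring_irreducible\<^bsub>univ_poly R (carrier R)\<^esub> f"
    and p: "p \<in> carrier (univ_poly R (carrier R))" "p \<notin> PIdl\<^bsub>univ_poly R (carrier R)\<^esub> f"
  shows "\<exists>u\<in>carrier (univ_poly R (carrier R)).
    p \<otimes>\<^bsub>univ_poly R (carrier R)\<^esub> u \<ominus>\<^bsub>univ_poly R (carrier R)\<^esub> \<one>\<^bsub>univ_poly R (carrier R)\<^esub>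
      \<in> PIdl\<^bsub>univ_poly R (carrier R)\<^esub> f"
proof -
  let ?P = "univ_poly R (carrier R)" and ?J = "PIdl\<^bsub>univ_poly R (carrier R)\<^esub> f"
  interpret UP: domain ?P by (rule univ_poly_is_domain[OF carrier_is_subring])
  have J: "ideal ?J ?P" by (rule UP.cgenideal_ideal[OF f(1)])
  then have self: "p \<in> ?J +>\<^bsub>?P\<^esub> p"
    using p(1) by (intro abelian_subgroup.a_rcos_self[OF abelian_subgroupI3])
       (auto simp: ideal_def UP.abelian_group_axioms)
  have Q: "field (?P Quot ?J)"
    using rupture_is_field_iff_pirreducible[OF carrier_is_subfield f(1)] f(2)
    by (simp add: rupture_def)
  have "?J +>\<^bsub>?P\<^esub> p \<noteq> \<zero>\<^bsub>?P Quot ?J\<^esub>"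
    using p(2) self by (force simp: FactRing_def)
  moreover have "?J +>\<^bsub>?P\<^esub> p \<in> carrier (?P Quot ?J)"
    using p by (auto simp: FactRing_def A_RCOSETS_def')
  ultimately have "?J +>\<^bsub>?P\<^esub> p \<in> Units (?P Quot ?J)"
    using field.field_Units[OF Q] by simp
  then obtain U where "U \<in> carrier (?P Quot ?J)"
    "(?J +>\<^bsub>?P\<^esub> p) \<otimes>\<^bsub>?P Quot ?J\<^esub> U = \<one>\<^bsub>?P Quot ?J\<^esub>"
    by (auto simp: Units_def)
  then obtain u where u: "u \<in> carrier ?P"
    "(?J +>\<^bsub>?P\<^esub> p) \<otimes>\<^bsub>?P Quot ?J\<^esub> (?J +>\<^bsub>?P\<^esub> u) = ?J +>\<^bsub>?P\<^esub> \<one>\<^bsub>?P\<^esub>"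
    by (auto simp: FactRing_def A_RCOSETS_def')
  then have "?J +>\<^bsub>?P\<^esub> (p \<otimes>\<^bsub>?P\<^esub> u) = ?J +>\<^bsub>?P\<^esub> \<one>\<^bsub>?P\<^esub>"
    using ideal.rcoset_mult_add[OF J p(1) u(1)] by (simp add: FactRing_def)
  then show ?thesis
    using UP.quotient_eq_iff_same_a_r_cos[OF J, of "p \<otimes>\<^bsub>?P\<^esub> u" "\<one>\<^bsub>?P\<^esub>"] p(1) u(1)
    by (intro bexI[of _ u]) simp_all
qed

locale laurent_quot = field K for K :: "('k, 'r) ring_scheme" (structure) +
  fixes f :: "'k list"
  assumes f_poly: "f \<in> carrier (univ_poly K (carrier K))"
    and f_irreducible: "ring_irreducible\<^bsub>univ_poly K (carrier K)\<^esub> f"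
    and f_not_var: "\<not> f \<sim>\<^bsub>univ_poly K (carrier K)\<^esub> X\<^bsub>K\<^esub>"
begin

abbreviation "L \<equiv> laurent_ring K"
abbreviation "I \<equiv> laurent_ideal K f"
abbreviation "F \<equiv> laurent_quotient K f"
abbreviation "cls \<equiv> laurent_class K f"
abbreviation "tau l \<equiv> cls (basis_vec K l)"
abbreviation "emb \<equiv> laurent_const K f"

sublocale L: cring L by (rule laurent_ring_cring)
sublocale UP: domain "univ_poly K (carrier K)"
  by (rule univ_poly_is_domain[OF carrier_is_subring])

lemma laurent_f: "laurent_of_poly K f \<in> carrier L"
  using laurent_of_poly_hom f_poly by (rule ring_hom_closed)

sublocale I: ideal I L
  unfolding laurent_ideal_def by (rule L.cgenideal_ideal[OF laurent_f])

sublocale F: cring F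
  unfolding laurent_quotient_def by (rule I.quotient_is_cring[OF L.is_cring])

lemma cls_hom: "cls \<in> ring_hom L F"
  using I.rcos_ring_hom unfolding laurent_class_def laurent_quotient_def .

sublocale cls: ring_hom_cring L F cls
  using cls_hom by unfold_locales

lemma carrier_F: "z \<in> carrier F \<longleftrightarrow> (\<exists>g\<in>fin_supp K. z = cls g)"
  unfolding laurent_quotient_def laurent_class_def FactRing_def
  by (auto simp: A_RCOSETS_def' carrier_laurent_ring)

lemma emb_hom: "emb \<in> ring_hom K F"
proof -
  have "emb = cls \<circ> (\<lambda>k. k \<odot>\<^bsub>L\<^esub> \<one>\<^bsub>L\<^esub>)" by (auto simp: laurent_const_def)
  then show ?thesis using ring_hom_trans[OF laurent_scalar_hom cls_hom] by simp
qed

sublocale emb: ring_hom_cring K F emb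
  using emb_hom by unfold_locales

lemma emb_mult_cls:
  assumes "k \<in> carrier K" "g \<in> fin_supp K"
  shows "emb k \<otimes>\<^bsub>F\<^esub> cls g = cls (\<lambda>s. k \<otimes> g s)"
proof -
  have "emb k \<otimes>\<^bsub>F\<^esub> cls g = cls ((\<lambda>s. k \<otimes> basis_vec K 0 s) \<otimes>\<^bsub>L\<^esub> g)"
    using assms by (simp add: laurent_const_def laurent_ring_simps(3,5) carrier_laurent_ring)
  then show ?thesis using assms by (simp add: laurent_scalar_mult)
qed

lemma tau_closed [simp]: "tau l \<in> carrier F"
  by (auto simp: carrier_F)

lemma tau_add: "tau (l + m) = tau l \<otimes>\<^bsub>F\<^esub> tau m"
  by (simp add: laurent_basis_mult[symmetric] carrier_laurent_ring)

lemma tau_zero: "tau 0 = \<one>\<^bsub>F\<^esub>"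
  using ring_hom_one[OF cls_hom] by (simp add: laurent_ring_simps)

text \<open>The powers of \<open>t\<close>, positive and negative, span the Laurent ring over the constants.\<close>
lemma quotient_induct [consumes 1, case_names zero step]:
  assumes "z \<in> carrier F" "P \<zero>\<^bsub>F\<^esub>"
    and step: "\<And>k l z. \<lbrakk>k \<in> carrier K; z \<in> carrier F; P z\<rbrakk> \<Longrightarrow> P (emb k \<otimes>\<^bsub>F\<^esub> tau l \<oplus>\<^bsub>F\<^esub> z)"
  shows "P z"
proof -
  obtain g where "g \<in> fin_supp K" "z = cls g" using assms(1) by (auto simp: carrier_F)
  moreover have "P (cls g)" if "g \<in> fin_supp K" for g
    using that
  proof (induction g rule: fin_supp_induct)
    case zero
    have "cls (\<lambda>_. \<zero>) = \<zero>\<^bsub>F\<^esub>" using cls.hom_zero by (simp add: laurent_ring_simps(1))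
    then show ?case using assms(2) by simp
  next
    case (step k a p)
    have "cls ((\<lambda>s. k \<otimes> basis_vec K a s) \<oplus>\<^bsub>L\<^esub> p) = cls (\<lambda>s. k \<otimes> basis_vec K a s) \<oplus>\<^bsub>F\<^esub> cls p"
      using step by (intro cls.hom_add) (simp_all add: carrier_laurent_ring)
    then have "cls (\<lambda>s. k \<otimes> basis_vec K a s \<oplus> p s) = emb k \<otimes>\<^bsub>F\<^esub> tau a \<oplus>\<^bsub>F\<^esub> cls p"
      using step by (simp add: laurent_ring_simps(2) emb_mult_cls)
    moreover have "cls p \<in> carrier F" using step by (auto simp: carrier_F)
    ultimately show ?case using assms(3) step by simp
  qed
  ultimately show ?thesis by blast
qed

lemma cls_lincomb:
  assumes "g \<in> fin_supp K"
  shows "cls g = lincomb F (\<lambda>l. emb (g l)) tau"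
  using assms
proof (induction g rule: fin_supp_induct)
  case zero
  have "cls (\<lambda>_. \<zero>) = \<zero>\<^bsub>F\<^esub>" using cls.hom_zero by (simp add: laurent_ring_simps(1))
  then show ?case by simp
next
  case (step k a p)
  have "cls ((\<lambda>s. k \<otimes> basis_vec K a s) \<oplus>\<^bsub>L\<^esub> p) = cls (\<lambda>s. k \<otimes> basis_vec K a s) \<oplus>\<^bsub>F\<^esub> cls p"
    using step by (intro cls.hom_add) (simp_all add: carrier_laurent_ring)
  then have e: "cls (\<lambda>s. k \<otimes> basis_vec K a s \<oplus> p s) = emb k \<otimes>\<^bsub>F\<^esub> tau a \<oplus>\<^bsub>F\<^esub> cls p"
    using step by (simp add: laurent_ring_simps(2) emb_mult_cls)
  have b: "(\<lambda>l. emb (basis_vec K a l)) = basis_vec F a"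
    by (auto simp: basis_vec_apply fun_eq_iff emb.hom_one emb.hom_zero)
  have "(\<lambda>l. emb (k \<otimes> basis_vec K a l \<oplus> p l)) = (\<lambda>l. emb k \<otimes>\<^bsub>F\<^esub> basis_vec F a l \<oplus>\<^bsub>F\<^esub> emb (p l))"
    using step by (auto simp: b[symmetric] fin_suppD)
  moreover have "(\<lambda>l. emb (p l)) \<in> fin_supp F"
    using emb.hom_lincomb(2)[of p "\<lambda>_. \<zero>"] step by simp
  ultimately show ?case
    using step e by (simp add: F.lincomb_add_left F.lincomb_smult_left F.lincomb_basis)
qed

text \<open>The variable is irreducible, so that a non-unit dividing it is associate to it.\<close>
lemma var_not_multiple: "\<not> f divides\<^bsub>univ_poly K (carrier K)\<^esub> X\<^bsub>K\<^esub>"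
proof
  have X: "X \<in> carrier (univ_poly K (carrier K))" by (rule var_closed(1)[OF carrier_is_subring])
  have irr: "ring_irreducible\<^bsub>univ_poly K (carrier K)\<^esub> X"
    by (rule degree_one_imp_pirreducible[OF carrier_is_subfield X]) (simp add: var_def)
  assume "f divides\<^bsub>univ_poly K (carrier K)\<^esub> X"
  then have "f \<in> Units (univ_poly K (carrier K)) \<or> f \<sim>\<^bsub>univ_poly K (carrier K)\<^esub> X"
    by (rule divides_pirreducible_condition[OF irr f_poly])
  moreover have "f \<notin> Units (univ_poly K (carrier K))"
    using f_irreducible by (simp add: ring_irreducible_def irreducible_def)
  ultimately show False using f_not_var by blast
qed

text \<open>If \<open>1\<close> were a multiple of \<open>f\<close> in the Laurent ring, then \<open>f\<close> would divide a power of the variable in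
  the polynomial ring; as \<open>f\<close> is prime there, it would divide the variable.\<close>
lemma one_notin_I: "\<one>\<^bsub>L\<^esub> \<notin> I"
proof
  let ?P = "univ_poly K (carrier K)"
  have X: "X \<in> carrier ?P" by (rule var_closed(1)[OF carrier_is_subring])
  assume "\<one>\<^bsub>L\<^esub> \<in> I"
  then obtain x where x: "x \<in> carrier L" "\<one>\<^bsub>L\<^esub> = x \<otimes>\<^bsub>L\<^esub> laurent_of_poly K f"
    unfolding laurent_ideal_def cgenideal_def by blast
  obtain n :: nat and p where p: "p \<in> carrier ?P" "basis_vec K (int n) \<otimes>\<^bsub>L\<^esub> x = laurent_of_poly K p"
    using laurent_shift_to_poly[of x] x by (auto simp: carrier_laurent_ring)
  have b: "basis_vec K (int n) \<in> carrier L" by (simp add: carrier_laurent_ring)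
  have "laurent_of_poly K (p \<otimes>\<^bsub>?P\<^esub> f) = basis_vec K (int n) \<otimes>\<^bsub>L\<^esub> x \<otimes>\<^bsub>L\<^esub> laurent_of_poly K f"
    using ring_hom_mult[OF laurent_of_poly_hom p(1) f_poly] p by simp
  also have "\<dots> = basis_vec K (int n) \<otimes>\<^bsub>L\<^esub> \<one>\<^bsub>L\<^esub>"
    unfolding x(2) using b x(1) laurent_f by (rule L.m_assoc)
  also have "\<dots> = laurent_of_poly K (X [^]\<^bsub>?P\<^esub> n)"
    using b by (simp add: laurent_of_poly_var_pow)
  finally have "X [^]\<^bsub>?P\<^esub> n = p \<otimes>\<^bsub>?P\<^esub> f"
    using laurent_of_poly_inj p(1) f_poly X by (metis UP.m_closed UP.nat_pow_closed)
  then have "X [^]\<^bsub>?P\<^esub> n = f \<otimes>\<^bsub>?P\<^esub> p" using p(1) f_poly UP.m_comm by simp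
  then have "f divides\<^bsub>?P\<^esub> X [^]\<^bsub>?P\<^esub> n" using p(1) by (auto simp: factor_def)
  moreover have "\<not> f divides\<^bsub>?P\<^esub> X [^]\<^bsub>?P\<^esub> n" for n :: nat
  proof (induction n)
    case 0
    have "f \<notin> Units ?P" using f_irreducible by (simp add: ring_irreducible_def irreducible_def)
    then show ?case using f_poly by (simp add: UP.Unit_eq_dividesone)
  next
    case (Suc n)
    have "prime ?P f"
      using pprime_iff_pirreducible[OF carrier_is_subfield f_poly] f_irreducible
      by (simp add: ring_prime_def)
    then show ?case using Suc var_not_multiple X f_poly by (auto simp: prime_def)
  qed
  ultimately show False by blast
qed

text \<open>Up to a power of \<open>t\<close>, which is a unit, a nonzero class is represented by a polynomial outside
  \<open>(f)\<close>, and an inverse of this polynomial modulo \<open>f\<close> provides the inverse of the class.\<close>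
lemma F_field: "field F"
proof (rule F.cring_fieldI2)
  let ?P = "univ_poly K (carrier K)"
  have eq: "cls x = cls y \<longleftrightarrow> x \<ominus>\<^bsub>L\<^esub> y \<in> I" if "x \<in> carrier L" "y \<in> carrier L" for x y
    using L.quotient_eq_iff_same_a_r_cos[OF I.is_ideal that] by (simp add: laurent_class_def)
  have eq0: "cls x = \<zero>\<^bsub>F\<^esub> \<longleftrightarrow> x \<in> I" if "x \<in> carrier L" for x
    using eq[OF that L.zero_closed] that cls.hom_zero by (simp add: L.minus_eq)
  show "\<zero>\<^bsub>F\<^esub> \<noteq> \<one>\<^bsub>F\<^esub>"
    using eq0[OF L.one_closed] one_notin_I by auto
  fix z assume z: "z \<in> carrier F" "z \<noteq> \<zero>\<^bsub>F\<^esub>"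
  then obtain g where g: "g \<in> carrier L" "z = cls g" by (auto simp: carrier_F carrier_laurent_ring)
  have gI: "g \<notin> I" using eq0[OF g(1)] g z by simp
  obtain n :: nat and p where p: "p \<in> carrier ?P" "basis_vec K (int n) \<otimes>\<^bsub>L\<^esub> g = laurent_of_poly K p"
    using laurent_shift_to_poly[of g] g by (auto simp: carrier_laurent_ring)
  have b: "basis_vec K s \<in> carrier L" for s by (simp add: carrier_laurent_ring)
  interpret hom: ring_hom_cring ?P L "laurent_of_poly K"
    using laurent_of_poly_hom by unfold_locales
  let ?J = "PIdl\<^bsub>?P\<^esub> f"
  have JI: "laurent_of_poly K q \<in> I" if q: "q \<in> ?J" for q
  proof -
    obtain r where r: "r \<in> carrier ?P" "q = r \<otimes>\<^bsub>?P\<^esub> f" using q by (auto simp: cgenideal_def)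
    then have "laurent_of_poly K q = laurent_of_poly K r \<otimes>\<^bsub>L\<^esub> laurent_of_poly K f"
      using ring_hom_mult[OF laurent_of_poly_hom] f_poly by blast
    moreover have "laurent_of_poly K r \<otimes>\<^bsub>L\<^esub> laurent_of_poly K f \<in> I"
      unfolding laurent_ideal_def cgenideal_def using ring_hom_closed[OF laurent_of_poly_hom r(1)] by blast
    ultimately show ?thesis by simp
  qed
  have "p \<notin> ?J"
  proof
    assume "p \<in> ?J"
    then have "basis_vec K (- int n) \<otimes>\<^bsub>L\<^esub> (basis_vec K (int n) \<otimes>\<^bsub>L\<^esub> g) \<in> I"
      using JI[of p] p b by (simp add: I.I_l_closed)
    moreover have "basis_vec K (- int n) \<otimes>\<^bsub>L\<^esub> (basis_vec K (int n) \<otimes>\<^bsub>L\<^esub> g) = g"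
      using g b L.l_one[OF g(1)]
      by (simp add: L.m_assoc[symmetric] laurent_basis_mult laurent_ring_simps(3))
    ultimately show False using gI by simp
  qed
  then obtain u where u: "u \<in> carrier ?P" "p \<otimes>\<^bsub>?P\<^esub> u \<ominus>\<^bsub>?P\<^esub> \<one>\<^bsub>?P\<^esub> \<in> ?J"
    using irreducible_poly_inverse[OF f_poly f_irreducible p(1)] by blast
  from u(2) have "laurent_of_poly K (p \<otimes>\<^bsub>?P\<^esub> u \<ominus>\<^bsub>?P\<^esub> \<one>\<^bsub>?P\<^esub>) \<in> I" by (rule JI)
  moreover have "laurent_of_poly K (p \<otimes>\<^bsub>?P\<^esub> u \<ominus>\<^bsub>?P\<^esub> \<one>\<^bsub>?P\<^esub>) = 
     basis_vec K (int n) \<otimes>\<^bsub>L\<^esub> g \<otimes>\<^bsub>L\<^esub> laurent_of_poly K u \<ominus>\<^bsub>L\<^esub> \<one>\<^bsub>L\<^esub>"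
    unfolding UP.minus_eq L.minus_eq using p(1) u(1) by (simp only: hom.hom_add hom.hom_mult hom.hom_a_inv hom.hom_one UP.m_closed UP.one_closed UP.a_inv_closed p(2)[symmetric])
  ultimately have one: "cls (basis_vec K (int n) \<otimes>\<^bsub>L\<^esub> g \<otimes>\<^bsub>L\<^esub> laurent_of_poly K u) = cls \<one>\<^bsub>L\<^esub>"
    using eq[of "basis_vec K (int n) \<otimes>\<^bsub>L\<^esub> g \<otimes>\<^bsub>L\<^esub> laurent_of_poly K u" "\<one>\<^bsub>L\<^esub>"]
      L.m_closed[OF L.m_closed[OF b g(1)] hom.hom_closed[OF u(1)]] L.one_closed
    by (simp only:)
  define w where "w = basis_vec K (int n) \<otimes>\<^bsub>L\<^esub> laurent_of_poly K u"
  have w: "w \<in> carrier L" unfolding w_def by (intro L.m_closed b hom.hom_closed u(1))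
  have "g \<otimes>\<^bsub>L\<^esub> w = basis_vec K (int n) \<otimes>\<^bsub>L\<^esub> g \<otimes>\<^bsub>L\<^esub> laurent_of_poly K u"
    unfolding w_def using b[of "int n"] g(1) hom.hom_closed[OF u(1)] by (simp add: L.m_ac)
  then have "cls (g \<otimes>\<^bsub>L\<^esub> w) = cls \<one>\<^bsub>L\<^esub>" using one by (simp only:)
  then have "z \<otimes>\<^bsub>F\<^esub> cls w = \<one>\<^bsub>F\<^esub>"
    using g w by simp
  then show "\<exists>w\<in>carrier F. z \<otimes>\<^bsub>F\<^esub> w = \<one>\<^bsub>F\<^esub>"
    using cls.hom_closed[OF w] by blast
qed

lemma F_unit:
  assumes "z \<in> carrier F" "z \<noteq> \<zero>\<^bsub>F\<^esub>"
  shows "z \<in> Units F"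
  using field.field_Units[OF F_field] assms by blast

end

section \<open>Boundary paths and the action of the generators\<close>

text \<open>The generator that undoes \<open>g\<close> on boundary paths, as \<open>gen_path_act_inverse\<close> shows.\<close>
fun gen_star :: "('v, 'e) leavitt_gen \<Rightarrow> ('v, 'e) leavitt_gen" where
  "gen_star (Vtx v) = Vtx v"
| "gen_star (Edge e) = Ghost e"
| "gen_star (Ghost e) = Edge e"

fun gen_degree :: "('v, 'e) leavitt_gen \<Rightarrow> int" where
  "gen_degree (Vtx v) = 0"
| "gen_degree (Edge e) = 1"
| "gen_degree (Ghost e) = - 1"

definition leavitt_gens :: "('v, 'e) pre_digraph \<Rightarrow> ('v, 'e) leavitt_gen set" where
  "leavitt_gens E = Vtx ` verts E \<union> Edge ` arcs E \<union> Ghost ` arcs E"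

lemma leavitt_words_gens: "w \<in> leavitt_words E \<longleftrightarrow> w \<noteq> [] \<and> set w \<subseteq> leavitt_gens E"
  by (simp add: leavitt_words_def leavitt_gens_def)

lemma gen_star_star [simp]: "gen_star (gen_star g) = g"
  by (cases g) auto

lemma gen_degree_star [simp]: "gen_degree (gen_star g) = - gen_degree g"
  by (cases g) auto

lemma gen_star_gens [simp]: "gen_star g \<in> leavitt_gens E \<longleftrightarrow> g \<in> leavitt_gens E"
  by (cases g) (auto simp: leavitt_gens_def)

lemma path_append_append: "path_append (u, m) (path_append (v, n) z) = path_append (u, m @ n) z"
  by (cases z) auto

lemma path_append_Nil: "path_source E z = u \<Longrightarrow> path_append (u, []) z = z"
  by (cases z) auto

lemma path_append_inj:
  assumes "path_append m z = path_append m z'" "path_source E z = path_source E z'"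
  shows "z = z'"
  using assms by (cases m; cases z; cases z') auto

lemma ghost_path_append_Cons:
  "gen_path_act E (Ghost e) (path_append (u, e' # m) z) =
     (if e' = e then Some (path_append (head E e, m) z) else None)"
  by (cases z) auto

context wf_digraph
begin

lemma boundary_FinPath_Nil: "FinPath u [] \<in> boundary_paths G \<longleftrightarrow> u \<in> verts G \<and> \<not> regular_vertex G u"
  by (auto simp: boundary_paths_def finite_paths_def path_range_def awalk_Nil_iff)

lemma boundary_FinPath_Cons:
  "FinPath u (e # p) \<in> boundary_paths G \<longleftrightarrow>
     e \<in> arcs G \<and> u = tail G e \<and> FinPath (head G e) p \<in> boundary_paths G"
  by (auto simp: boundary_paths_def finite_paths_def path_range_def awalk_Cons_iff)

lemma boundary_InfPath: "InfPath s \<in> boundary_paths G \<longleftrightarrow> s \<in> infinite_paths G"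
  by (auto simp: boundary_paths_def)

lemma infinite_SCons:
  "e ## s \<in> infinite_paths G \<longleftrightarrow> e \<in> arcs G \<and> head G e = tail G (shd s) \<and> s \<in> infinite_paths G"
proof -
  have nat_split: "(\<forall>n. P n) \<longleftrightarrow> P 0 \<and> (\<forall>n. P (Suc n))" for P :: "nat \<Rightarrow> bool"
    by (metis nat.exhaust)
  have "(\<forall>n. head G ((e ## s) !! n) = tail G ((e ## s) !! Suc n)) \<longleftrightarrow>
      head G e = tail G (shd s) \<and> (\<forall>n. head G (s !! n) = tail G (s !! Suc n))"
    by (subst nat_split) simp
  then show ?thesis by (auto simp: infinite_paths_def)
qed

lemma gen_path_act_inverse:
  assumes "g \<in> leavitt_gens G" "p \<in> boundary_paths G" "gen_path_act G g p = Some q"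
  shows "q \<in> boundary_paths G" "gen_path_act G (gen_star g) q = Some p"
proof -
  have "q \<in> boundary_paths G \<and> gen_path_act G (gen_star g) q = Some p"
  proof (cases g)
    case (Vtx v)
    then show ?thesis using assms by (auto split: if_splits)
  next
    case (Edge e)
    then have e: "e \<in> arcs G" using assms(1) by (auto simp: leavitt_gens_def)
    show ?thesis
    proof (cases p)
      case (FinPath u l)
      then show ?thesis using assms e Edge by (auto simp: boundary_FinPath_Cons split: if_splits)
    next
      case (InfPath s)
      then show ?thesis using assms e Edge by (auto simp: boundary_InfPath infinite_SCons split: if_splits)
    qed
  next
    case (Ghost e)
    show ?thesis
    proof (cases p)
      case (FinPath u l)
      then show ?thesis using assms Ghost by (cases l) (auto simp: boundary_FinPath_Cons split: if_splits)
    next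
      case (InfPath s)
      obtain x t where s: "s = x ## t" by (cases s)
      then have "x = e" "q = InfPath t"
        using assms(3) InfPath Ghost by (simp_all split: if_splits)
      moreover have "x \<in> arcs G" "head G x = tail G (shd t)" "t \<in> infinite_paths G"
        using assms(2) InfPath s by (simp_all add: boundary_InfPath infinite_SCons)
      ultimately show ?thesis using InfPath s Ghost by (simp add: boundary_InfPath)
    qed
  qed
  then show "q \<in> boundary_paths G" "gen_path_act G (gen_star g) q = Some p" by auto
qed

lemma gen_path_act_iff:
  assumes "g \<in> leavitt_gens G" "p \<in> boundary_paths G" "q \<in> boundary_paths G"
  shows "gen_path_act G g p = Some q \<longleftrightarrow> gen_path_act G (gen_star g) q = Some p"
  using gen_path_act_inverse[of g p q] gen_path_act_inverse[of "gen_star g" q p] assms by auto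

text \<open>A ghost edge acts only on paths that begin with its edge; the conclusions describe this edge
  and the remaining path.\<close>
lemma ghost_act_SomeD:
  assumes "gen_path_act G (Ghost e) y = Some z" "y \<in> boundary_paths G"
  shows "e \<in> arcs G" "z \<in> boundary_paths G" "y = path_append (tail G e, [e]) z"
    "path_source G y = tail G e" "path_source G z = head G e"
proof -
  have "e \<in> arcs G \<and> z \<in> boundary_paths G \<and> y = path_append (tail G e, [e]) z
     \<and> path_source G y = tail G e \<and> path_source G z = head G e"
  proof (cases y)
    case (FinPath u l)
    then show ?thesis using assms by (cases l) (auto simp: boundary_FinPath_Cons split: if_splits)
  next
    case (InfPath s)
    obtain x t where s: "s = x ## t" by (cases s)
    then have "x = e" "z = InfPath t"
      using assms(1) InfPath by (simp_all split: if_splits)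
    moreover have "x \<in> arcs G" "head G x = tail G (shd t)" "t \<in> infinite_paths G"
      using assms(2) InfPath s by (simp_all add: boundary_InfPath infinite_SCons)
    ultimately show ?thesis using InfPath s by (simp add: boundary_InfPath)
  qed
  then show "e \<in> arcs G" "z \<in> boundary_paths G" "y = path_append (tail G e, [e]) z"
    "path_source G y = tail G e" "path_source G z = head G e" by auto
qed

lemma path_source_append:
  assumes "awalk u m v" "path_source G z = v"
  shows "path_source G (path_append (u, m) z) = u"
  using assms by (cases m; cases z) (auto simp: awalk_Nil_iff awalk_Cons_iff)

lemma boundary_append:
  assumes "awalk u m v" "path_source G z = v" "z \<in> boundary_paths G"
  shows "path_append (u, m) z \<in> boundary_paths G"
  using assms
proof (induction m arbitrary: u)
  case Nil
  then show ?case by (simp add: path_append_Nil[of G] awalk_Nil_iff)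
next
  case (Cons e m)
  then have IH: "path_append (head G e, m) z \<in> boundary_paths G" and e: "e \<in> arcs G" "u = tail G e"
    and m: "awalk (head G e) m v"
    by (auto simp: awalk_Cons_iff)
  have "path_append (u, e # m) z = path_append (tail G e, [e]) (path_append (head G e, m) z)"
    using e by (simp add: path_append_append)
  moreover have "gen_path_act G (Edge e) (path_append (head G e, m) z) =
      Some (path_append (tail G e, [e]) (path_append (head G e, m) z))"
    using path_source_append[OF m] Cons by simp
  ultimately show ?case
    using gen_path_act_inverse(1)[of "Edge e", OF _ IH] e by (auto simp: leavitt_gens_def)
qed

lemma path_range_awalk: "awalk u m v \<Longrightarrow> path_range G (u, m) = v"
  by (auto simp: path_range_def)

lemma finite_paths_awalk: "(u, m) \<in> finite_paths G \<longleftrightarrow> awalk u m (path_range G (u, m))"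
  by (auto simp: finite_paths_def path_range_awalk)

lemma mem_groupoid_arrows:
  "a \<in> groupoid_arrows G \<longleftrightarrow> (\<exists>u m w n v z. awalk u m v \<and> awalk w n v \<and> z \<in> boundary_paths G \<and>
     path_source G z = v \<and> a = (path_append (u, m) z, int (length m) - int (length n), path_append (w, n) z))"
  (is "_ \<longleftrightarrow> ?R")
proof
  assume "a \<in> groupoid_arrows G"
  then show ?R unfolding groupoid_arrows_def path_length_def
    by (force simp: finite_paths_awalk)
next
  assume ?R
  then obtain u m w n v z where h: "awalk u m v" "awalk w n v" "z \<in> boundary_paths G" "path_source G z = v"
    "a = (path_append (u, m) z, int (length m) - int (length n), path_append (w, n) z)" by blast
  then show "a \<in> groupoid_arrows G"
    unfolding groupoid_arrows_def path_length_def mem_Collect_eq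
    by (intro exI[of _ "(u, m)"] exI[of _ "(w, n)"] exI[of _ z]) (simp add: finite_paths_awalk path_range_awalk)
qed

lemma groupoid_arrows_boundary:
  assumes "(y, k, x) \<in> groupoid_arrows G"
  shows "y \<in> boundary_paths G" "x \<in> boundary_paths G"
  using assms by (auto simp: mem_groupoid_arrows intro: boundary_append)

text \<open>Moving the source of an arrow changes its lag by the degree of the generator. The delicate
  case deletes an edge from a path whose first part is trivial: the edge then comes off the common
  tail and has to be appended to the second part.\<close>
lemma arrow_shift:
  assumes g: "g \<in> leavitt_gens G" and a: "(y, k, x) \<in> groupoid_arrows G"
    and act: "gen_path_act G g y = Some y'"
  shows "(y', k + gen_degree g, x) \<in> groupoid_arrows G"
proof -
  obtain u m w n v z where h: "awalk u m v" "awalk w n v" "z \<in> boundary_paths G" "path_source G z = v"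
    and y: "y = path_append (u, m) z" and k: "k = int (length m) - int (length n)"
    and x: "x = path_append (w, n) z"
    using a by (auto simp: mem_groupoid_arrows)
  have src: "path_source G y = u" using h y path_source_append by blast
  show ?thesis
  proof (cases g)
    case (Vtx a)
    then show ?thesis using a act by (auto split: if_splits)
  next
    case (Edge e)
    then have "e \<in> arcs G" using g by (auto simp: leavitt_gens_def)
    then have "awalk (tail G e) (e # m) v" "y' = path_append (tail G e, e # m) z"
      using Edge act src h y by (auto simp: awalk_Cons_iff path_append_append split: if_splits)
    then show ?thesis
      unfolding mem_groupoid_arrows
      using h k x Edge by (intro exI[of _ "tail G e"] exI[of _ "e # m"] exI[of _ w] exI[of _ n] exI[of _ v] exI[of _ z]) auto
  next
    case (Ghost e)
    show ?thesis
    proof (cases m)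
      case Nil
      then have yz: "y = z" "u = v" using h y by (auto simp: awalk_Nil_iff path_append_Nil[of G])
      note D = ghost_act_SomeD[OF act[unfolded Ghost]]
      have "y \<in> boundary_paths G" using yz h by simp
      note D = D[OF this]
      have "awalk w (n @ [e]) (head G e)"
        using h(2) D(1,4) yz src by (auto simp: awalk_appendI awalk_Cons_iff awalk_Nil_iff)
      moreover have "awalk (head G e) [] (head G e)" using D(1) by (simp add: awalk_Nil_iff)
      moreover have "x = path_append (w, n @ [e]) y'"
        using x yz(1) D(3) by (metis path_append_append)
      moreover have "y' = path_append (head G e, []) y'" using D(5) by (simp add: path_append_Nil)
      ultimately show ?thesis
        unfolding mem_groupoid_arrows
        using D k Nil Ghost by (intro exI[of _ "head G e"] exI[of _ "[]"] exI[of _ w] exI[of _ "n @ [e]"] exI[of _ "head G e"] exI[of _ y']) auto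
    next
      case (Cons e' m')
      then have e: "e' = e" "y' = path_append (head G e, m') z"
        using act y Ghost ghost_path_append_Cons[of G e u e' m' z] by (auto split: if_splits)
      then have "awalk (head G e) m' v" using h Cons by (simp add: awalk_Cons_iff)
      then show ?thesis
        unfolding mem_groupoid_arrows
        using h e k x Cons Ghost by (intro exI[of _ "head G e"] exI[of _ m'] exI[of _ w] exI[of _ n] exI[of _ v] exI[of _ z]) auto
    qed
  qed
qed

end

section \<open>Row-finite functions and convolution\<close>

definition row :: "('a \<times> int \<times> 'b \<Rightarrow> 'k) \<Rightarrow> 'a \<Rightarrow> int \<times> 'b \<Rightarrow> 'k" where
  "row f y = (\<lambda>(j, x). f (y, j, x))"

text \<open>Convolution at \<open>(y, k, x)\<close> as a sum over the arrows of \<open>f\<close> that start at \<open>y\<close>. The right factor is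
  an arbitrary function on triples, so that the same operation is the product of the Steinberg
  algebra and its action on functions on the arrows into a fixed path.\<close>
definition row_conv :: "('k, 'r) ring_scheme \<Rightarrow> ('a \<times> int \<times> 'b \<Rightarrow> 'k) \<Rightarrow> ('b \<times> int \<times> 'c \<Rightarrow> 'k)
    \<Rightarrow> 'a \<times> int \<times> 'c \<Rightarrow> 'k" where
  "row_conv R f n = (\<lambda>(y, k, x). lincomb R (row f y) (\<lambda>(j, x'). n (x', k - j, x)))"

text \<open>Left multiplication by the bisection of the generator \<open>g\<close>, see \<open>gen_image_shift\<close>: the value at \<open>y\<close>
  is the value at the path from which \<open>g\<close> produces \<open>y\<close>.\<close>
definition gen_shift :: "('v, 'e) pre_digraph \<Rightarrow> ('k, 'r) ring_scheme \<Rightarrow> ('v, 'e) leavitt_gen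
    \<Rightarrow> (('v, 'e) epath \<times> int \<times> 'b \<Rightarrow> 'k) \<Rightarrow> ('v, 'e) epath \<times> int \<times> 'b \<Rightarrow> 'k" where
  "gen_shift E R g n = (\<lambda>(y, k, x). if y \<in> boundary_paths E
     then (case gen_path_act E (gen_star g) y of None \<Rightarrow> \<zero>\<^bsub>R\<^esub> | Some y' \<Rightarrow> n (y', k - gen_degree g, x))
     else \<zero>\<^bsub>R\<^esub>)"

definition unit_indicator :: "('v, 'e) pre_digraph \<Rightarrow> ('k, 'r) ring_scheme \<Rightarrow> ('v, 'e) arrow \<Rightarrow> 'k" where
  "unit_indicator E R = (\<lambda>(y, k, x). if y \<in> boundary_paths E \<and> k = 0 \<and> x = y then \<one>\<^bsub>R\<^esub> else \<zero>\<^bsub>R\<^esub>)"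

abbreviation word_shift :: "('v, 'e) pre_digraph \<Rightarrow> ('k, 'r) ring_scheme \<Rightarrow> ('v, 'e) word
    \<Rightarrow> (('v, 'e) epath \<times> int \<times> 'b \<Rightarrow> 'k) \<Rightarrow> ('v, 'e) epath \<times> int \<times> 'b \<Rightarrow> 'k" where
  "word_shift E R w \<equiv> foldr (gen_shift E R) w"

text \<open>Elements of the Steinberg algebra have infinite support in general, but only finitely many
  arrows of the support start at a given path. This is what makes the sums in \<open>row_conv\<close> finite.\<close>
definition row_finite :: "('k, 'r) ring_scheme \<Rightarrow> ('a \<times> int \<times> 'b \<Rightarrow> 'k) \<Rightarrow> bool" where
  "row_finite R f \<longleftrightarrow> (\<forall>y. row f y \<in> fin_supp R)"

lemma row_apply: "row f y (j, x) = f (y, j, x)"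
  by (simp add: row_def)

lemma row_finite_closed: "row_finite R f \<Longrightarrow> f u \<in> carrier R"
  unfolding row_finite_def by (cases u) (metis fin_suppD row_apply)

lemma gen_shift_outside: "y \<notin> boundary_paths E \<Longrightarrow> gen_shift E R g n (y, k, x) = \<zero>\<^bsub>R\<^esub>"
  by (simp add: gen_shift_def)

locale steinberg = wf_digraph E + cring K
  for E :: "('v, 'e) pre_digraph" and K :: "('k, 'r) ring_scheme" (structure)
begin

abbreviation "S \<equiv> steinberg_algebra E K"

lemma gen_shift_closed: "(\<And>u. n u \<in> carrier K) \<Longrightarrow> gen_shift E K g n u \<in> carrier K"
  by (cases u) (auto simp: gen_shift_def split: option.splits)

lemma word_shift_closed: "(\<And>u. n u \<in> carrier K) \<Longrightarrow> word_shift E K w n u \<in> carrier K"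
  by (induction w arbitrary: u) (auto simp: gen_shift_closed)

lemma row_finite_gen_shift:
  assumes "row_finite K f"
  shows "row_finite K (gen_shift E K g f)"
  unfolding row_finite_def
proof
  fix y
  show "row (gen_shift E K g f) y \<in> fin_supp K"
  proof (cases "y \<in> boundary_paths E \<and> gen_path_act E (gen_star g) y \<noteq> None")
    case True
    then obtain y' where y': "y \<in> boundary_paths E" "gen_path_act E (gen_star g) y = Some y'" by auto
    have "(\<lambda>a. row f y' (apfst (\<lambda>j. j - gen_degree g) a)) \<in> fin_supp K"
      by (rule fin_supp_shift[where g' = "apfst (\<lambda>j. j + gen_degree g)"])
         (use assms in \<open>auto simp: row_finite_def\<close>)
    also have "(\<lambda>a. row f y' (apfst (\<lambda>j. j - gen_degree g) a)) = row (gen_shift E K g f) y"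
      using y' by (auto simp: row_def gen_shift_def fun_eq_iff)
    finally show ?thesis .
  next
    case False
    then have "row (gen_shift E K g f) y = (\<lambda>_. \<zero>)"
      by (auto simp: row_def gen_shift_def fun_eq_iff split: option.splits)
    then show ?thesis by simp
  qed
qed

lemma row_finite_unit: "row_finite K (unit_indicator E K)"
  unfolding row_finite_def
proof
  fix y
  show "row (unit_indicator E K) y \<in> fin_supp K"
    by (rule fin_suppI[of _ _ "{(0, y)}"]) (auto simp: row_def unit_indicator_def split: if_splits)
qed

lemma row_finite_word_shift: "row_finite K f \<Longrightarrow> row_finite K (word_shift E K w f)"
  by (induction w) (auto intro: row_finite_gen_shift)

text \<open>Prepending an edge to the sources moves the row of \<open>f\<close> at one path to another path and shifts
  its lags by a constant.\<close>
lemma row_conv_gen_shift: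
  fixes n :: "('v, 'e) epath \<times> int \<times> 'c \<Rightarrow> 'k"
  assumes f: "row_finite K f" and n: "\<And>u. n u \<in> carrier K"
  shows "row_conv K (gen_shift E K g f) n = gen_shift E K g (row_conv K f n)"
proof
  fix u :: "('v, 'e) epath \<times> int \<times> 'c"
  obtain y k x where u: "u = (y, k, x)" by (cases u) auto
  show "row_conv K (gen_shift E K g f) n u = gen_shift E K g (row_conv K f n) u"
  proof (cases "y \<in> boundary_paths E \<and> gen_path_act E (gen_star g) y \<noteq> None")
    case True
    then obtain y' where y': "y \<in> boundary_paths E" "gen_path_act E (gen_star g) y = Some y'" by auto
    let ?d = "gen_degree g"
    have r: "row (gen_shift E K g f) y = (\<lambda>a. row f y' (apfst (\<lambda>j. j - ?d) a))"
      using y' by (auto simp: row_def gen_shift_def fun_eq_iff)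
    have "row_conv K (gen_shift E K g f) n u =
        lincomb K (row f y') (\<lambda>a. (\<lambda>(j, x'). n (x', k - j, x)) (apfst (\<lambda>j. j + ?d) a))"
      unfolding u row_conv_def prod.case r
      by (rule lincomb_shift) (use f n in \<open>auto simp: row_finite_def\<close>)
    also have "\<dots> = gen_shift E K g (row_conv K f n) u"
      using y' by (simp add: u gen_shift_def row_conv_def case_prod_beta' apfst_def map_prod_def algebra_simps)
    finally show ?thesis .
  next
    case False
    then have "row (gen_shift E K g f) y = (\<lambda>_. \<zero>)"
      by (auto simp: row_def gen_shift_def fun_eq_iff split: option.splits)
    then show ?thesis using False by (auto simp: u row_conv_def gen_shift_def split: option.splits)
  qed
qed

lemma row_conv_unit:
  fixes n :: "('v, 'e) epath \<times> int \<times> 'c \<Rightarrow> 'k"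
  assumes "\<And>u. n u \<in> carrier K" "\<And>y k x. y \<notin> boundary_paths E \<Longrightarrow> n (y, k, x) = \<zero>"
  shows "row_conv K (unit_indicator E K) n = n"
proof
  fix u :: "('v, 'e) epath \<times> int \<times> 'c"
  obtain y k x where u: "u = (y, k, x)" by (cases u) auto
  have "row (unit_indicator E K) y = (if y \<in> boundary_paths E then basis_vec K (0, y) else (\<lambda>_. \<zero>))"
    by (auto simp: row_def unit_indicator_def basis_vec_def fun_eq_iff)
  then show "row_conv K (unit_indicator E K) n u = n u"
    using assms lincomb_basis[of "\<lambda>(j, x'). n (x', k - j, x)" "(0, y)"]
    by (auto simp: u row_conv_def)
qed

lemma row_conv_word_shift:
  assumes "\<And>u. n u \<in> carrier K" "\<And>y k x. y \<notin> boundary_paths E \<Longrightarrow> n (y, k, x) = \<zero>"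
  shows "row_conv K (word_shift E K w (unit_indicator E K)) n = word_shift E K w n"
  by (induction w)
     (simp_all add: row_conv_unit assms row_conv_gen_shift row_finite_word_shift row_finite_unit)

text \<open>Both sides sum over pairs of composable arrows that start at \<open>y\<close>. On the left the second arrow
  is described by the lag of the composite, on the right by its own lag; subtracting the lag of
  the first arrow converts one into the other.\<close>
lemma row_conv_assoc:
  fixes f g :: "('v, 'e) arrow \<Rightarrow> 'k" and n :: "('v, 'e) epath \<times> int \<times> 'c \<Rightarrow> 'k"
  assumes f: "row_finite K f" and g: "row_finite K g" and n: "\<And>u. n u \<in> carrier K"
  shows "row_conv K (row_conv K f g) n = row_conv K f (row_conv K g n)"
proof
  fix u :: "('v, 'e) epath \<times> int \<times> 'c"
  obtain y k x where u: "u = (y, k, x)" by (cases u) auto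
  \<comment> \<open>\<open>q a\<close> is the part of the product contributed by a first arrow with entry \<open>a\<close>.\<close>
  define q where "q = (\<lambda>(l :: int, z) (j, x'). g (z, j - l, x'))"
  have q: "q a = (\<lambda>b. row g (snd a) (apfst (\<lambda>j. j - fst a) b))" for a
    by (auto simp: q_def row_def case_prod_beta')
  have qf: "q a \<in> fin_supp K" for a
    unfolding q by (rule fin_supp_shift[where g' = "apfst (\<lambda>j. j + fst a)"])
       (use g in \<open>auto simp: row_finite_def\<close>)
  have fy: "row f y \<in> fin_supp K" using f by (simp add: row_finite_def)
  define h where "h = (\<lambda>(j, x'). n (x', k - j, x))"
  have h: "h b \<in> carrier K" for b using n by (auto simp: h_def split: prod.splits)
  have "row (row_conv K f g) y = (\<lambda>b. lincomb K (row f y) (\<lambda>a. q a b))"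
    by (auto simp: row_apply row_conv_def q_def case_prod_beta' fun_eq_iff)
  then have "row_conv K (row_conv K f g) n u = lincomb K (\<lambda>b. lincomb K (row f y) (\<lambda>a. q a b)) h"
    unfolding u row_conv_def[of K "row_conv K f g"] h_def by simp
  also have "\<dots> = lincomb K (row f y) (\<lambda>a. lincomb K (q a) h)"
    by (rule lincomb_bind[OF fy qf h])
  also have "(\<lambda>a. lincomb K (q a) h) = (\<lambda>(j, x'). row_conv K g n (x', k - j, x))"
  proof
    fix a :: "int \<times> ('v, 'e) epath"
    have "lincomb K (q a) h = lincomb K (row g (snd a)) (\<lambda>b. h (apfst (\<lambda>j. j + fst a) b))"
      unfolding q by (rule lincomb_shift) (use g h in \<open>auto simp: row_finite_def\<close>)
    then show "lincomb K (q a) h = (case a of (j, x') \<Rightarrow> row_conv K g n (x', k - j, x))"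
      by (simp add: row_conv_def h_def case_prod_beta' algebra_simps)
  qed
  also have "lincomb K (row f y) (\<lambda>(j, x'). row_conv K g n (x', k - j, x)) = row_conv K f (row_conv K g n) u"
    by (simp add: u row_conv_def[of K f])
  finally show "row_conv K (row_conv K f g) n u = row_conv K f (row_conv K g n) u" .
qed

text \<open>A factorization of \<open>(y, k, x)\<close> into two arrows is determined by its midpoint and the lag of the
  first arrow, that is by an entry of the row of \<open>f\<close> at \<open>y\<close>.\<close>
lemma convolution_eq_row_conv:
  fixes f g :: "('v, 'e) arrow \<Rightarrow> 'k"
  assumes f: "row_finite K f" "\<And>u. u \<notin> groupoid_arrows E \<Longrightarrow> f u = \<zero>"
    and g: "\<And>u. g u \<in> carrier K" "\<And>u. u \<notin> groupoid_arrows E \<Longrightarrow> g u = \<zero>"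
  shows "convolution K {(g, h). g \<in> groupoid_arrows E \<and> h \<in> groupoid_arrows E \<and> arrow_range g = arrow_source h}
    arrow_mult f g = row_conv K f g"
proof
  fix u :: "('v, 'e) arrow"
  obtain y k x where u: "u = (y, k, x)" by (cases u) auto
  define D where "D = {(j, x'). f (y, j, x') \<noteq> \<zero> \<and> g (x', k - j, x) \<noteq> \<zero>}"
  define \<phi> :: "int \<times> ('v, 'e) epath \<Rightarrow> ('v, 'e) arrow \<times> ('v, 'e) arrow"
    where "\<phi> = (\<lambda>(j, x'). ((y, j, x'), (x', k - j, x)))"
  have c: "f u \<in> carrier K" "g u \<in> carrier K" for u using row_finite_closed[OF f(1)] g by auto
  have supp: "f a \<noteq> \<zero> \<Longrightarrow> a \<in> groupoid_arrows E" "g a \<noteq> \<zero> \<Longrightarrow> a \<in> groupoid_arrows E" for a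
    using f(2) g(2) by blast+
  have set: "{(s, t). s \<in> groupoid_arrows E \<and> t \<in> groupoid_arrows E \<and> arrow_range s = arrow_source t
      \<and> f s \<noteq> \<zero> \<and> g t \<noteq> \<zero> \<and> arrow_mult s t = u} = \<phi> ` D" (is "?L = _")
  proof
    show "?L \<subseteq> \<phi> ` D"
    proof
      fix z assume z: "z \<in> ?L"
      obtain y1 j x' x'' l x1 where zz: "z = ((y1, j, x'), (x'', l, x1))"
        by (metis prod.exhaust)
      then have "z = \<phi> (j, x') \<and> (j, x') \<in> D" using z by (auto simp: u \<phi>_def D_def)
      then show "z \<in> \<phi> ` D" by blast
    qed
    show "\<phi> ` D \<subseteq> ?L"
      using supp by (auto simp: u \<phi>_def D_def)
  qed
  have "convolution K {(g, h). g \<in> groupoid_arrows E \<and> h \<in> groupoid_arrows E \<and> arrow_range g = arrow_source h}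
    arrow_mult f g u = (\<Oplus>z\<in>\<phi> ` D. f (fst z) \<otimes> g (snd z))"
    unfolding convolution_def set[symmetric] by (rule arg_cong[where f = "finsum K _"]) auto
  also have "\<dots> = (\<Oplus>a\<in>D. f (fst (\<phi> a)) \<otimes> g (snd (\<phi> a)))"
    using c by (subst finsum_reindex) (auto simp: inj_on_def \<phi>_def)
  also have "\<dots> = (\<Oplus>a\<in>{a. row f y a \<noteq> \<zero>}. row f y a \<otimes> (case a of (j, x') \<Rightarrow> g (x', k - j, x)))"
  proof (rule add.finprod_mono_neutral_cong_left)
    show "finite {a. row f y a \<noteq> \<zero>}" using f(1) by (simp add: row_finite_def fin_supp_finite)
    show "D \<subseteq> {a. row f y a \<noteq> \<zero>}" by (auto simp: D_def row_def)
    show "(\<lambda>a. row f y a \<otimes> (case a of (j, x') \<Rightarrow> g (x', k - j, x))) \<in> {a. row f y a \<noteq> \<zero>} \<rightarrow> carrier K"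
      using c by (auto simp: row_def)
  qed (use c in \<open>auto simp: D_def \<phi>_def row_def\<close>)
  also have "\<dots> = row_conv K f g u" by (simp add: u row_conv_def lincomb_def)
  finally show "convolution K {(g, h). g \<in> groupoid_arrows E \<and> h \<in> groupoid_arrows E
    \<and> arrow_range g = arrow_source h} arrow_mult f g u = row_conv K f g u" .
qed

end

section \<open>The Steinberg algebra is spanned by words in the generators\<close>

lemma steinberg_simps:
  "ring.zero (steinberg_algebra E R) = (\<lambda>_. \<zero>\<^bsub>R\<^esub>)"
  "ring.add (steinberg_algebra E R) = (\<lambda>f g s. f s \<oplus>\<^bsub>R\<^esub> g s)"
  "module.smult (steinberg_algebra E R) = (\<lambda>k f s. k \<otimes>\<^bsub>R\<^esub> f s)"
  "carrier (steinberg_algebra E R) = lin_span R {cylinder_indicator E R m n | m n.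
        m \<in> finite_paths E \<and> n \<in> finite_paths E \<and> path_range E m = path_range E n}"
  "monoid.mult (steinberg_algebra E R) = convolution R {(g, h). g \<in> groupoid_arrows E \<and> h \<in> groupoid_arrows E \<and>
        arrow_range g = arrow_source h} arrow_mult"
  by (simp_all add: steinberg_algebra_def)

context cring
begin

lemma lin_span_closed:
  assumes "B \<subseteq> {b. \<forall>s. b s \<in> carrier R}" "f \<in> lin_span R B"
  shows "f s \<in> carrier R"
  using assms(2)
proof induction
  case (step k b f)
  then have "b s \<in> carrier R" using assms(1) by blast
  then show ?case using step by simp
qed simp

lemma lin_span_add:
  assumes B: "B \<subseteq> {b. \<forall>s. b s \<in> carrier R}" and "f \<in> lin_span R B" "g \<in> lin_span R B"
  shows "(\<lambda>s. f s \<oplus> g s) \<in> lin_span R B"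
  using assms(2)
proof induction
  case zero
  have "(\<lambda>s. \<zero> \<oplus> g s) = g" using lin_span_closed[OF B assms(3)] by simp
  then show ?case using assms(3) by simp
next
  case (step k b f)
  have "(\<lambda>s. (k \<otimes> b s) \<oplus> (f s \<oplus> g s)) \<in> lin_span R B"
    using step by (intro lin_span.step)
  moreover have "(\<lambda>s. (k \<otimes> b s) \<oplus> (f s \<oplus> g s)) = (\<lambda>s. (k \<otimes> b s) \<oplus> f s \<oplus> g s)"
    using step lin_span_closed[OF B] lin_span_closed[OF B assms(3)] subsetD[OF B step(2)] by (simp add: a_assoc)
  ultimately show ?case by simp
qed

lemma lin_span_smult:
  assumes B: "B \<subseteq> {b. \<forall>s. b s \<in> carrier R}" and "f \<in> lin_span R B" "k \<in> carrier R"
  shows "(\<lambda>s. k \<otimes> f s) \<in> lin_span R B"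
  using assms(2)
proof induction
  case zero
  then show ?case using assms(3) lin_span.zero by simp
next
  case (step l b f)
  have "(\<lambda>s. (k \<otimes> l) \<otimes> b s \<oplus> k \<otimes> f s) \<in> lin_span R B"
    using step assms(3) by (intro lin_span.step) auto
  moreover have "(\<lambda>s. (k \<otimes> l) \<otimes> b s \<oplus> k \<otimes> f s) = (\<lambda>s. k \<otimes> (l \<otimes> b s \<oplus> f s))"
    using step lin_span_closed[OF B] subsetD[OF B step(2)] assms(3) by (simp add: r_distr m_assoc)
  ultimately show ?case by simp
qed

lemma lin_span_base:
  assumes "B \<subseteq> {b. \<forall>s. b s \<in> carrier R}" "b \<in> B"
  shows "b \<in> lin_span R B"
  using lin_span.step[OF one_closed assms(2) lin_span.zero] subsetD[OF assms] by simp

end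

text \<open>The two forms in which a bisection \<open>Z\<^bsub>(\<mu>,\<nu>)\<^esub>\<close> with one of the paths trivial can be listed by its
  arrows.\<close>
lemma image_graph_eq:
  "(\<And>y y'. Q y y' \<longleftrightarrow> P y' \<and> y = h y') \<Longrightarrow> (\<lambda>z. (h z, d, z)) ` {z. P z} = {(y, d, y') | y y'. Q y y'}"
  "(\<And>y y'. Q y y' \<longleftrightarrow> P y \<and> y' = h y) \<Longrightarrow> (\<lambda>z. (z, d, h z)) ` {z. P z} = {(y, d, y') | y y'. Q y y'}"
  by auto

definition gen_translate :: "('v, 'e) pre_digraph \<Rightarrow> ('v, 'e) leavitt_gen \<Rightarrow> ('v, 'e) arrow set \<Rightarrow> ('v, 'e) arrow set"
  where "gen_translate E g Z =
    {(y, k + gen_degree g, x) | y k x y'. (y', k, x) \<in> Z \<and> gen_path_act E g y' = Some y}"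

context steinberg
begin

abbreviation "ind Z u \<equiv> (if u \<in> Z then \<one> else \<zero>)"

lemma gen_shift_indicator:
  assumes g: "g \<in> leavitt_gens E" and Z: "\<And>y k x. (y, k, x) \<in> Z \<Longrightarrow> y \<in> boundary_paths E"
  shows "gen_shift E K g (ind Z) = ind (gen_translate E g Z)"
proof
  fix u :: "('v, 'e) arrow"
  obtain y k x where u: "u = (y, k, x)" by (cases u) auto
  have "u \<in> gen_translate E g Z \<longleftrightarrow> (\<exists>y'. (y', k - gen_degree g, x) \<in> Z \<and> gen_path_act E g y' = Some y)"
    unfolding gen_translate_def u by force
  also have "\<dots> \<longleftrightarrow> (\<exists>y'. (y', k - gen_degree g, x) \<in> Z \<and> y \<in> boundary_paths E \<and> gen_path_act E (gen_star g) y = Some y')"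
    using gen_path_act_iff[OF g] gen_path_act_inverse(1)[OF g] Z by (metis (no_types, lifting))
  finally show "gen_shift E K g (ind Z) u = ind (gen_translate E g Z) u"
    by (auto simp: u gen_shift_def split: option.splits)
qed

lemma cylinder_boundary:
  assumes "m \<in> finite_paths E" "(y, k, x) \<in> cylinder E m n"
  shows "y \<in> boundary_paths E"
  using assms by (cases m) (auto simp: cylinder_def finite_paths_awalk intro!: boundary_append)

lemma cylinder_awalk:
  assumes "awalk u m v" "awalk w n v"
  shows "cylinder E (u, m) (w, n) = {(path_append (u, m) z, int (length m) - int (length n), path_append (w, n) z) | z.
    z \<in> boundary_paths E \<and> path_source E z = v}"
  using assms by (auto simp: cylinder_def path_length_def path_range_awalk)

lemma cylinder_image:
  assumes "awalk u m v" "awalk w n v"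
  shows "cylinder E (u, m) (w, n) =
    (\<lambda>z. (path_append (u, m) z, int (length m) - int (length n), path_append (w, n) z)) `
      {z \<in> boundary_paths E. path_source E z = v}"
  unfolding cylinder_awalk[OF assms] by blast

lemma translate_cylinder:
  assumes "awalk u m v" "awalk w n v"
  shows "gen_translate E g (cylinder E (u, m) (w, n)) =
    {(y, int (length m) - int (length n) + gen_degree g, path_append (w, n) z) | y z.
      z \<in> boundary_paths E \<and> path_source E z = v \<and> gen_path_act E g (path_append (u, m) z) = Some y}"
  unfolding gen_translate_def cylinder_awalk[OF assms] by blast

lemma translate_cylinder_Some:
  assumes "awalk u m v" "awalk w n v" "awalk u' m' v" "int (length m') = int (length m) + gen_degree g"
    and act: "\<And>z. path_source E z = v \<Longrightarrow> gen_path_act E g (path_append (u, m) z) = Some (path_append (u', m') z)"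
  shows "gen_translate E g (cylinder E (u, m) (w, n)) = cylinder E (u', m') (w, n)"
proof -
  have "(z \<in> boundary_paths E \<and> path_source E z = v \<and> gen_path_act E g (path_append (u, m) z) = Some y) \<longleftrightarrow>
      (z \<in> boundary_paths E \<and> path_source E z = v \<and> y = path_append (u', m') z)" for y z
    using act by auto
  then show ?thesis
    unfolding translate_cylinder[OF assms(1,2)] cylinder_awalk[OF assms(3,2)] assms(4)
    by (simp add: algebra_simps)
qed

lemma translate_cylinder_None:
  assumes "awalk u m v" "awalk w n v"
    and act: "\<And>z. path_source E z = v \<Longrightarrow> gen_path_act E g (path_append (u, m) z) = None"
  shows "gen_translate E g (cylinder E (u, m) (w, n)) = {}"
  unfolding translate_cylinder[OF assms(1,2)] using act by auto

lemma translate_vertex: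
  assumes "awalk u m v" "awalk w n v"
  shows "gen_translate E (Vtx a) (cylinder E (u, m) (w, n)) = (if a = u then cylinder E (u, m) (w, n) else {})"
proof (cases "a = u")
  case True
  then show ?thesis
    using translate_cylinder_Some[OF assms assms(1), of "Vtx a"] path_source_append[OF assms(1)] by simp
next
  case False
  then show ?thesis
    using translate_cylinder_None[OF assms, of "Vtx a"] path_source_append[OF assms(1)] by simp
qed

lemma translate_edge:
  assumes "awalk u m v" "awalk w n v" "e \<in> arcs E"
  shows "gen_translate E (Edge e) (cylinder E (u, m) (w, n)) =
    (if head E e = u then cylinder E (tail E e, e # m) (w, n) else {})"
proof (cases "head E e = u")
  case True
  then have "awalk (tail E e) (e # m) v" using assms by (simp add: awalk_Cons_iff)
  from translate_cylinder_Some[OF assms(1,2) this, of "Edge e"] show ?thesis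
    using True path_source_append[OF assms(1)] by (simp add: path_append_append)
next
  case False
  then show ?thesis
    using translate_cylinder_None[OF assms(1,2), of "Edge e"] path_source_append[OF assms(1)] by simp
qed

lemma translate_ghost_Cons:
  assumes "awalk u (e' # m) v" "awalk w n v"
  shows "gen_translate E (Ghost e) (cylinder E (u, e' # m) (w, n)) =
    (if e' = e then cylinder E (head E e, m) (w, n) else {})"
proof (cases "e' = e")
  case True
  then have "awalk (head E e) m v" using assms by (simp add: awalk_Cons_iff)
  from translate_cylinder_Some[OF assms this, of "Ghost e"] show ?thesis
    using True by (simp add: ghost_path_append_Cons)
next
  case False
  then show ?thesis
    using translate_cylinder_None[OF assms, of "Ghost e"] by (simp add: ghost_path_append_Cons)
qed

text \<open>No edge can be taken from a trivial \<open>\<mu>\<close>. The arrows that remain are those whose common tail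
  begins with \<open>e\<close>, and \<open>e\<close> moves to the end of \<open>\<nu>\<close>.\<close>
lemma translate_ghost_Nil:
  assumes "awalk w n u" "e \<in> arcs E"
  shows "gen_translate E (Ghost e) (cylinder E (u, []) (w, n)) =
    (if tail E e = u then cylinder E (head E e, []) (w, n @ [e]) else {})"
proof -
  have u: "awalk u [] u" using assms(1) by (simp add: awalk_Nil_iff awalk_last_in_verts)
  have h: "awalk (head E e) [] (head E e)" using assms by (simp add: awalk_Nil_iff)
  have "gen_translate E (Ghost e) (cylinder E (u, []) (w, n)) =
      {(y, - int (length n) - 1, path_append (w, n) z) | y z.
        z \<in> boundary_paths E \<and> path_source E z = u \<and> gen_path_act E (Ghost e) z = Some y}"
  proof -
    have "(z \<in> boundary_paths E \<and> path_source E z = u \<and> gen_path_act E (Ghost e) (path_append (u, []) z) = Some y) \<longleftrightarrow>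
        (z \<in> boundary_paths E \<and> path_source E z = u \<and> gen_path_act E (Ghost e) z = Some y)" for y z
      using path_append_Nil[of E z u] by auto
    then show ?thesis by (simp add: translate_cylinder[OF u assms(1)])
  qed
  also have "\<dots> = {(y, - int (length n) - 1, path_append (w, n) (path_append (tail E e, [e]) y)) | y.
        y \<in> boundary_paths E \<and> path_source E y = head E e \<and> tail E e = u}" (is "?L = ?R")
  proof
    show "?L \<subseteq> ?R"
    proof
      fix a assume "a \<in> ?L"
      then obtain y z where yz: "a = (y, - int (length n) - 1, path_append (w, n) z)"
        "z \<in> boundary_paths E" "path_source E z = u" "gen_path_act E (Ghost e) z = Some y" by blast
      show "a \<in> ?R" using ghost_act_SomeD[OF yz(4,2)] yz by auto
    qed
    show "?R \<subseteq> ?L"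
    proof
      fix a assume "a \<in> ?R"
      then obtain y where y: "a = (y, - int (length n) - 1, path_append (w, n) (path_append (tail E e, [e]) y))"
        "y \<in> boundary_paths E" "path_source E y = head E e" "tail E e = u" by blast
      have "awalk (tail E e) [e] (head E e)" using assms(2) by (rule arc_implies_awalk)
      then have "path_append (tail E e, [e]) y \<in> boundary_paths E"
        "path_source E (path_append (tail E e, [e]) y) = tail E e"
        using y boundary_append path_source_append by blast+
      moreover have "gen_path_act E (Ghost e) (path_append (tail E e, [e]) y) = Some y"
        using y(3) by (simp add: ghost_path_append_Cons path_append_Nil[of E])
      ultimately show "a \<in> ?L" using y by blast
    qed
  qed
  also have "\<dots> = (if tail E e = u then cylinder E (head E e, []) (w, n @ [e]) else {})"
  proof (cases "tail E e = u")
    case True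
    then have "awalk w (n @ [e]) (head E e)"
      using assms by (auto simp: awalk_Cons_iff awalk_Nil_iff intro: awalk_appendI)
    have "cylinder E (head E e, []) (w, n @ [e]) =
        (\<lambda>y. (y, - int (length n) - 1, path_append (w, n) (path_append (tail E e, [e]) y))) `
          {y \<in> boundary_paths E. path_source E y = head E e}"
      unfolding cylinder_image[OF h \<open>awalk w (n @ [e]) (head E e)\<close>]
      by (rule image_cong) (simp_all add: path_append_Nil[of E] path_append_append)
    then show ?thesis using True by auto
  qed simp
  finally show ?thesis .
qed

lemma steinberg_base_closed:
  "{cylinder_indicator E K m n | m n. m \<in> finite_paths E \<and> n \<in> finite_paths E \<and> path_range E m = path_range E n}
    \<subseteq> {b. \<forall>s. b s \<in> carrier K}"
  by (auto simp: cylinder_indicator_def)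

lemma cylinder_indicator_ind: "cylinder_indicator E K m n = ind (cylinder E m n)"
  by (simp add: cylinder_indicator_def)

lemma cylinder_mem:
  assumes "awalk u m v" "awalk w n v"
  shows "ind (cylinder E (u, m) (w, n)) \<in> carrier S"
proof -
  have "ind (cylinder E (u, m) (w, n)) \<in> {cylinder_indicator E K m n | m n.
      m \<in> finite_paths E \<and> n \<in> finite_paths E \<and> path_range E m = path_range E n}"
    unfolding mem_Collect_eq
    by (intro exI[of _ "(u, m)"] exI[of _ "(w, n)"])
       (use assms in \<open>simp add: cylinder_indicator_ind finite_paths_awalk path_range_awalk\<close>)
  from lin_span_base[OF steinberg_base_closed this] show ?thesis by (simp add: steinberg_simps)
qed

lemma S_closed: "f \<in> carrier S \<Longrightarrow> f u \<in> carrier K"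
  using lin_span_closed[OF steinberg_base_closed] by (simp add: steinberg_simps)

lemma S_add: "f \<in> carrier S \<Longrightarrow> g \<in> carrier S \<Longrightarrow> (\<lambda>u. f u \<oplus> g u) \<in> carrier S"
  using lin_span_add[OF steinberg_base_closed] by (simp add: steinberg_simps)

lemma S_smult: "f \<in> carrier S \<Longrightarrow> k \<in> carrier K \<Longrightarrow> (\<lambda>u. k \<otimes> f u) \<in> carrier S"
  using lin_span_smult[OF steinberg_base_closed] by (simp add: steinberg_simps)

lemma S_zero: "(\<lambda>_. \<zero>) \<in> carrier S"
  unfolding steinberg_simps by (rule lin_span.zero)

lemma S_induct [consumes 1, case_names zero step]:
  assumes "f \<in> carrier S" "P (\<lambda>_. \<zero>)"
    and "\<And>k u m w n v f. \<lbrakk>k \<in> carrier K; awalk u m v; awalk w n v; f \<in> carrier S; P f\<rbrakk>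
      \<Longrightarrow> P (\<lambda>s. k \<otimes> ind (cylinder E (u, m) (w, n)) s \<oplus> f s)"
  shows "P f"
  using assms(1) unfolding steinberg_simps(4)
proof induction
  case zero
  then show ?case by (rule assms(2))
next
  case (step k b f)
  then obtain m n where "b = ind (cylinder E m n)" "m \<in> finite_paths E" "n \<in> finite_paths E"
    "path_range E m = path_range E n"
    by (auto simp: cylinder_indicator_ind)
  then show ?case
    using step assms(3)[of k "fst m" "snd m" "path_range E m" "fst n" "snd n" f]
      finite_paths_awalk[of "fst m" "snd m"] finite_paths_awalk[of "fst n" "snd n"]
    by (simp add: steinberg_simps(4))
qed

lemma row_finite_S: "f \<in> carrier S \<Longrightarrow> row_finite K f"
proof (induction f rule: S_induct)
  case zero
  show ?case by (simp add: row_finite_def row_def case_prod_beta')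
next
  case (step k u m w n v f)
  let ?Z = "cylinder E (u, m) (w, n)"
  have "row (ind ?Z) y \<in> fin_supp K" for y
  proof (rule fin_suppI[of _ _ "{(j, x). (y, j, x) \<in> ?Z}"])
    have "a = b" if "a \<in> {(j, x). (y, j, x) \<in> ?Z}" "b \<in> {(j, x). (y, j, x) \<in> ?Z}" for a b
    proof -
      obtain z where z: "path_source E z = v" "y = path_append (u, m) z"
          "a = (int (length m) - int (length n), path_append (w, n) z)"
        using \<open>a \<in> _\<close> unfolding cylinder_awalk[OF step(2,3)] by blast
      obtain z' where z': "path_source E z' = v" "y = path_append (u, m) z'"
          "b = (int (length m) - int (length n), path_append (w, n) z')"
        using \<open>b \<in> _\<close> unfolding cylinder_awalk[OF step(2,3)] by blast
      have "z = z'" by (rule path_append_inj[of "(u, m)" _ _ E]) (use z z' in simp_all)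
      then show ?thesis using z z' by simp
    qed
    then have "is_singleton {(j, x). (y, j, x) \<in> ?Z} \<or> {(j, x). (y, j, x) \<in> ?Z} = {}"
      by (meson is_singletonI')
    then show "finite {(j, x). (y, j, x) \<in> ?Z}" by (auto elim!: is_singletonE)
  qed (auto simp: row_def)
  moreover have "row (\<lambda>s. k \<otimes> ind ?Z s \<oplus> f s) y = (\<lambda>a. k \<otimes> row (ind ?Z) y a \<oplus> row f y a)" for y
    by (auto simp: row_def fun_eq_iff)
  ultimately show ?case using step by (simp add: row_finite_def)
qed

lemma S_support: "f \<in> carrier S \<Longrightarrow> a \<notin> groupoid_arrows E \<Longrightarrow> f a = \<zero>"
proof (induction f rule: S_induct)
  case (step k u m w n v f)
  have "a \<notin> cylinder E (u, m) (w, n)"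
    using step(6) by (auto simp: cylinder_awalk[OF step(2,3)] mem_groupoid_arrows) (use step in blast)
  then show ?case using step by simp
qed simp

lemma S_outside: "f \<in> carrier S \<Longrightarrow> y \<notin> boundary_paths E \<Longrightarrow> f (y, k, x) = \<zero>"
  using S_support groupoid_arrows_boundary(1) by blast

lemma S_mult:
  assumes "f \<in> carrier S" "g \<in> carrier S"
  shows "f \<otimes>\<^bsub>S\<^esub> g = row_conv K f g"
  unfolding steinberg_simps(5)
  by (rule convolution_eq_row_conv)
     (use assms in \<open>auto simp: row_finite_S S_closed S_support\<close>)

text \<open>A generator translates a bisection \<open>Z\<^bsub>(\<mu>,\<nu>)\<^esub>\<close> to another one or to the empty set.\<close>
lemma gen_shift_S:
  assumes g: "g \<in> leavitt_gens E" and f: "f \<in> carrier S"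
  shows "gen_shift E K g f \<in> carrier S"
  using f
proof (induction f rule: S_induct)
  case zero
  have "gen_shift E K g (\<lambda>_ :: ('v, 'e) arrow. \<zero>) = (\<lambda>_. \<zero>)"
    by (auto simp: gen_shift_def fun_eq_iff split: option.splits)
  then show ?case by (simp add: S_zero)
next
  case (step k u m w n v f)
  let ?Z = "cylinder E (u, m) (w, n)"
  have "gen_shift E K g (\<lambda>s. k \<otimes> ind ?Z s \<oplus> f s) = (\<lambda>s. k \<otimes> gen_shift E K g (ind ?Z) s \<oplus> gen_shift E K g f s)"
    using step(1) by (auto simp: gen_shift_def fun_eq_iff split: option.splits)
  moreover have "gen_shift E K g (ind ?Z) \<in> carrier S"
  proof -
    have "(u, m) \<in> finite_paths E" using step(2) by (auto simp: finite_paths_def)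
    then have e: "gen_shift E K g (ind ?Z) = ind (gen_translate E g ?Z)"
      using cylinder_boundary by (intro gen_shift_indicator g) blast
    have z: "ind {} \<in> carrier S" using S_zero by simp
    show ?thesis
    proof (cases g)
      case (Vtx a)
      then show ?thesis using e z cylinder_mem[OF step(2,3)] by (simp add: translate_vertex[OF step(2,3)])
    next
      case (Edge a)
      then have a: "a \<in> arcs E" using g by (auto simp: leavitt_gens_def)
      have "head E a = u \<Longrightarrow> awalk (tail E a) (a # m) v" using a step(2) by (simp add: awalk_Cons_iff)
      then show ?thesis using e z Edge cylinder_mem[OF _ step(3)] by (simp add: translate_edge[OF step(2,3) a])
    next
      case (Ghost a)
      then have a: "a \<in> arcs E" using g by (auto simp: leavitt_gens_def)
      show ?thesis
      proof (cases m)
        case Nil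
        then have uv: "u = v" using step(2) by (simp add: awalk_Nil_iff)
        have "tail E a = u \<Longrightarrow> awalk w (n @ [a]) (head E a)"
          using a step(3) uv by (auto simp: awalk_Cons_iff awalk_Nil_iff intro: awalk_appendI)
        moreover have "awalk (head E a) [] (head E a)" using a by (simp add: awalk_Nil_iff)
        ultimately show ?thesis
          using e z Ghost Nil uv cylinder_mem translate_ghost_Nil[of w n u a] step(3) a by simp
      next
        case (Cons b l)
        then have "awalk (head E b) l v" using step(2) by (simp add: awalk_Cons_iff)
        then show ?thesis
          using e z Ghost Cons cylinder_mem[OF _ step(3)] translate_ghost_Cons[of u b l v w n a] step(2,3)
          by (cases "b = a") simp_all
      qed
    qed
  qed
  ultimately show ?case using step by (simp add: S_add S_smult)
qed

text \<open>The unit space is the bisection of all identities, and the bisection of a generator is its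
  translate.\<close>
lemma gen_image_shift:
  assumes g: "g \<in> leavitt_gens E"
  shows "gen_image E K g = gen_shift E K g (unit_indicator E K)"
proof -
  define U where "U = {(y, 0 :: int, y) | y. y \<in> boundary_paths E}"
  have U: "unit_indicator E K = ind U"
    by (auto simp: unit_indicator_def U_def fun_eq_iff)
  have "gen_shift E K g (ind U) = ind (gen_translate E g U)"
    by (rule gen_shift_indicator[OF g]) (auto simp: U_def)
  moreover have "gen_image E K g = ind (gen_translate E g U)"
  proof -
    have tr: "gen_translate E g U = {(y, gen_degree g, y') | y y'. y' \<in> boundary_paths E \<and> gen_path_act E g y' = Some y}"
      by (auto simp: gen_translate_def U_def)
    show ?thesis
    proof (cases g)
      case (Vtx v)
      then have v: "awalk v [] v" using g by (auto simp: leavitt_gens_def awalk_Nil_iff)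
      have "cylinder E (v, []) (v, []) = (\<lambda>z. (z, 0, z)) ` {z \<in> boundary_paths E. path_source E z = v}"
        unfolding cylinder_image[OF v v] by (rule image_cong) (simp_all add: path_append_Nil[of E])
      also have "\<dots> = gen_translate E g U"
        unfolding tr unfolding Vtx gen_degree.simps by (rule image_graph_eq(1)) auto
      finally show ?thesis by (simp add: Vtx cylinder_indicator_ind)
    next
      case (Edge e)
      then have e: "e \<in> arcs E" using g by (auto simp: leavitt_gens_def)
      have w: "awalk (tail E e) [e] (head E e)" "awalk (head E e) [] (head E e)"
        using e by (simp_all add: awalk_Cons_iff awalk_Nil_iff)
      have "cylinder E (tail E e, [e]) (head E e, []) =
          (\<lambda>z. (path_append (tail E e, [e]) z, 1, z)) ` {z \<in> boundary_paths E. path_source E z = head E e}"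
        unfolding cylinder_image[OF w] by (rule image_cong) (simp_all add: path_append_Nil[of E])
      also have "\<dots> = gen_translate E g U"
        unfolding tr unfolding Edge gen_degree.simps by (rule image_graph_eq(1)) auto
      finally show ?thesis by (simp add: Edge cylinder_indicator_ind)
    next
      case (Ghost e)
      then have e: "e \<in> arcs E" using g by (auto simp: leavitt_gens_def)
      have w: "awalk (head E e) [] (head E e)" "awalk (tail E e) [e] (head E e)"
        using e by (simp_all add: awalk_Cons_iff awalk_Nil_iff)
      have "cylinder E (head E e, []) (tail E e, [e]) =
          (\<lambda>z. (z, - 1, path_append (tail E e, [e]) z)) ` {z \<in> boundary_paths E. path_source E z = head E e}"
        unfolding cylinder_image[OF w] by (rule image_cong) (simp_all add: path_append_Nil[of E])
      also have "\<dots> = gen_translate E g U"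
        unfolding tr unfolding Ghost gen_degree.simps
      proof (rule image_graph_eq(2))
        fix y y'
        show "y' \<in> boundary_paths E \<and> gen_path_act E (Ghost e) y' = Some y \<longleftrightarrow>
            (y \<in> boundary_paths E \<and> path_source E y = head E e) \<and> y' = path_append (tail E e, [e]) y"
          using ghost_act_SomeD[of e y' y] boundary_append[OF w(2), of y]
            ghost_path_append_Cons[of E e "tail E e" e "[]" y] path_append_Nil[of E y "head E e"] by auto
      qed
      finally show ?thesis by (simp add: Ghost cylinder_indicator_ind)
    qed
  qed
  ultimately show ?thesis by (simp add: U)
qed

lemma gen_image_S:
  assumes g: "g \<in> leavitt_gens E"
  shows "gen_image E K g \<in> carrier S"
proof (cases g)
  case (Vtx v)
  then have "awalk v [] v" using g by (auto simp: leavitt_gens_def awalk_Nil_iff)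
  then show ?thesis by (simp add: Vtx cylinder_indicator_ind cylinder_mem)
next
  case (Edge e)
  then have "e \<in> arcs E" using g by (auto simp: leavitt_gens_def)
  then have "awalk (tail E e) [e] (head E e)" "awalk (head E e) [] (head E e)"
    by (auto simp: awalk_Cons_iff awalk_Nil_iff)
  then show ?thesis by (simp add: Edge cylinder_indicator_ind cylinder_mem)
next
  case (Ghost e)
  then have "e \<in> arcs E" using g by (auto simp: leavitt_gens_def)
  then have "awalk (tail E e) [e] (head E e)" "awalk (head E e) [] (head E e)"
    by (auto simp: awalk_Cons_iff awalk_Nil_iff)
  then show ?thesis by (simp add: Ghost cylinder_indicator_ind cylinder_mem)
qed

text \<open>This replaces products in the Steinberg algebra by the composition of operators.\<close>
lemma word_image_shift:
  assumes "w \<in> leavitt_words E"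
  shows "word_image E K w = word_shift E K w (unit_indicator E K)" "word_image E K w \<in> carrier S"
proof -
  have "word_image E K w = word_shift E K w (unit_indicator E K) \<and> word_image E K w \<in> carrier S"
    using assms
  proof (induction w rule: induct_list012)
    case 1
    then show ?case by (simp add: leavitt_words_gens)
  next
    case (2 g)
    then show ?case by (simp add: leavitt_words_gens gen_image_shift[symmetric] gen_image_S)
  next
    case (3 g h w)
    then have g: "g \<in> leavitt_gens E" and IH: "word_image E K (h # w) = word_shift E K (h # w) (unit_indicator E K)"
      "word_image E K (h # w) \<in> carrier S"
      by (auto simp: leavitt_words_gens)
    have "word_image E K (g # h # w) = row_conv K (gen_shift E K g (unit_indicator E K)) (word_image E K (h # w))"
      using S_mult[OF gen_image_S[OF g] IH(2)] by (simp add: gen_image_shift[OF g])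
    also have "\<dots> = gen_shift E K g (word_image E K (h # w))"
      using IH(2) by (simp add: row_conv_gen_shift row_finite_unit S_closed row_conv_unit S_outside)
    finally show ?case using gen_shift_S[OF g IH(2)] IH(1) by simp
  qed
  then show "word_image E K w = word_shift E K w (unit_indicator E K)" "word_image E K w \<in> carrier S" by auto
qed

lemma ghost_word_shift:
  assumes "awalk w n v"
  shows "word_shift E K (map Ghost (rev n)) (gen_image E K (Vtx w)) = ind (cylinder E (v, []) (w, n))"
  using assms
proof (induction n arbitrary: v rule: rev_induct)
  case Nil
  then show ?case by (simp add: awalk_Nil_iff cylinder_indicator_ind)
next
  case (snoc e n)
  then have n: "awalk w n (tail E e)" and e: "e \<in> arcs E" "v = head E e"
    by (auto simp: awalk_append_iff awalk_Cons_iff awalk_Nil_iff)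
  have t: "(tail E e, []) \<in> finite_paths E" using e by (auto simp: finite_paths_def awalk_Nil_iff)
  have "word_shift E K (map Ghost (rev (n @ [e]))) (gen_image E K (Vtx w)) =
     gen_shift E K (Ghost e) (ind (cylinder E (tail E e, []) (w, n)))"
    using snoc.IH[OF n] by simp
  also have "\<dots> = ind (gen_translate E (Ghost e) (cylinder E (tail E e, []) (w, n)))"
    using cylinder_boundary[OF t] e by (intro gen_shift_indicator) (auto simp: leavitt_gens_def)
  also have "\<dots> = ind (cylinder E (v, []) (w, n @ [e]))"
    using translate_ghost_Nil[OF n e(1)] e(2) by simp
  finally show ?case .
qed

text \<open>\<open>Z\<^bsub>(\<mu>,\<nu>)\<^esub>\<close> comes from the word \<open>\<mu>\<nu>\<^sup>*\<close>. The final vertex keeps the word nonempty when both paths are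
  trivial.\<close>
lemma cylinder_word:
  assumes "awalk u m v" "awalk w n v"
  shows "map Edge m @ map Ghost (rev n) @ [Vtx w] \<in> leavitt_words E"
    and "word_image E K (map Edge m @ map Ghost (rev n) @ [Vtx w]) = ind (cylinder E (u, m) (w, n))"
proof -
  have w: "w \<in> verts E" using assms(2) by auto
  then show word: "map Edge m @ map Ghost (rev n) @ [Vtx w] \<in> leavitt_words E"
    using assms by (auto simp: leavitt_words_gens leavitt_gens_def awalk_def)
  have "word_shift E K (map Edge m) (ind (cylinder E (v, []) (w, n))) = ind (cylinder E (u, m) (w, n))"
    using assms(1)
  proof (induction m arbitrary: u)
    case Nil
    then show ?case by (simp add: awalk_Nil_iff)
  next
    case (Cons e m)
    then have m: "awalk (head E e) m v" and e: "e \<in> arcs E" "u = tail E e" by (auto simp: awalk_Cons_iff)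
    have t: "(head E e, m) \<in> finite_paths E" using m by (auto simp: finite_paths_def)
    have "gen_shift E K (Edge e) (ind (cylinder E (head E e, m) (w, n))) =
        ind (gen_translate E (Edge e) (cylinder E (head E e, m) (w, n)))"
      using cylinder_boundary[OF t] e by (intro gen_shift_indicator) (auto simp: leavitt_gens_def)
    then show ?case
      using Cons.IH[OF m] translate_edge[OF m assms(2) e(1)] e(2) by simp
  qed
  then show "word_image E K (map Edge m @ map Ghost (rev n) @ [Vtx w]) = ind (cylinder E (u, m) (w, n))"
    using ghost_word_shift[OF assms(2)] w word_image_shift(1)[OF word]
      gen_image_shift[of "Vtx w"] by (simp add: leavitt_gens_def)
qed

end

section \<open>From the Leavitt path algebra to the Steinberg algebra\<close>

lemma (in cring) module_free_vs:
  fixes M :: "('a, 's \<Rightarrow> 'a, 'z) module_scheme"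
  assumes "carrier M = carrier (free_vs R S)" "ring.zero M = ring.zero (free_vs R S)"
    "ring.add M = ring.add (free_vs R S)" "module.smult M = module.smult (free_vs R S)"
  shows "module R M"
proof (rule moduleI)
  show "abelian_group M" by (rule abelian_group_free_vs[OF ring_axioms assms(1-3)])
  have c: "f s \<in> carrier R" if "f \<in> carrier M" for f s
    using that assms(1) carrier_free_vs_fin_supp[THEN fin_suppD] by auto
  have ops: "k \<odot>\<^bsub>M\<^esub> f = (\<lambda>s. k \<otimes> f s)" "f \<oplus>\<^bsub>M\<^esub> g = (\<lambda>s. f s \<oplus> g s)" for k f g
    by (simp_all add: assms free_vs_def)
  fix a f assume a: "a \<in> carrier R" and f: "f \<in> carrier M"
  have "finite {s. a \<otimes> f s \<noteq> \<zero>}"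
    by (rule finite_subset[of _ "{s. f s \<noteq> \<zero>}"]) (use a f in \<open>auto simp: assms(1) carrier_free_vs\<close>)
  then show "a \<odot>\<^bsub>M\<^esub> f \<in> carrier M"
    using a f by (auto simp: assms(1) ops carrier_free_vs)
  fix b assume b: "b \<in> carrier R"
  show "(a \<oplus> b) \<odot>\<^bsub>M\<^esub> f = a \<odot>\<^bsub>M\<^esub> f \<oplus>\<^bsub>M\<^esub> b \<odot>\<^bsub>M\<^esub> f"
    using a b c[OF f] by (simp add: ops l_distr)
  show "(a \<otimes> b) \<odot>\<^bsub>M\<^esub> f = a \<odot>\<^bsub>M\<^esub> (b \<odot>\<^bsub>M\<^esub> f)"
    using a b c[OF f] by (simp add: ops m_assoc)
next
  have c: "f s \<in> carrier R" if "f \<in> carrier M" for f s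
    using that assms(1) carrier_free_vs_fin_supp[THEN fin_suppD] by auto
  have ops: "k \<odot>\<^bsub>M\<^esub> f = (\<lambda>s. k \<otimes> f s)" "f \<oplus>\<^bsub>M\<^esub> g = (\<lambda>s. f s \<oplus> g s)" for k f g
    by (simp_all add: assms free_vs_def)
  show "\<one> \<odot>\<^bsub>M\<^esub> f = f" if f: "f \<in> carrier M" for f using c[OF f] by (simp add: ops)
  fix a f g assume a: "a \<in> carrier R" and fg: "f \<in> carrier M" "g \<in> carrier M"
  show "a \<odot>\<^bsub>M\<^esub> (f \<oplus>\<^bsub>M\<^esub> g) = a \<odot>\<^bsub>M\<^esub> f \<oplus>\<^bsub>M\<^esub> a \<odot>\<^bsub>M\<^esub> g"
    using a c[OF fg(1)] c[OF fg(2)] by (simp add: ops r_distr)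
qed (rule is_cring)

lemma leavitt_free_simps:
  "carrier (leavitt_free E R) = carrier (free_vs R (leavitt_words E))"
  "ring.zero (leavitt_free E R) = ring.zero (free_vs R (leavitt_words E))"
  "ring.add (leavitt_free E R) = ring.add (free_vs R (leavitt_words E))"
  "module.smult (leavitt_free E R) = module.smult (free_vs R (leavitt_words E))"
  "monoid.mult (leavitt_free E R) = convolution R (leavitt_words E \<times> leavitt_words E) (@)"
  by (simp_all add: leavitt_free_def semigroup_algebra_def free_vs_def)

text \<open>The linear extension of the images of words; it is multiplicative by \<open>LF_mult\<close> and induces the
  map from the Leavitt path algebra by \<open>leavitt_to_steinberg_coset\<close>.\<close>
definition word_eval :: "('v, 'e) pre_digraph \<Rightarrow> ('k, 'r) ring_scheme \<Rightarrow> (('v, 'e) word \<Rightarrow> 'k) \<Rightarrow> ('v, 'e) arrow \<Rightarrow> 'k"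
  where "word_eval E R p = (\<lambda>u. lincomb R p (\<lambda>w. word_shift E R w (unit_indicator E R) u))"

context steinberg
begin

abbreviation "LF \<equiv> leavitt_free E K"

sublocale LF: module K LF
  by (rule module_free_vs) (simp_all add: leavitt_free_simps)

lemma LF_ops:
  "p \<oplus>\<^bsub>LF\<^esub> q = (\<lambda>w. p w \<oplus> q w)" "k \<odot>\<^bsub>LF\<^esub> p = (\<lambda>w. k \<otimes> p w)" "\<zero>\<^bsub>LF\<^esub> = (\<lambda>_. \<zero>)"
  by (simp_all add: leavitt_free_simps free_vs_def)

lemma LF_fin_supp: "p \<in> carrier LF \<Longrightarrow> p \<in> fin_supp K"
  unfolding leavitt_free_simps by (rule carrier_free_vs_fin_supp)

lemma LF_supp: "p \<in> carrier LF \<Longrightarrow> p w \<noteq> \<zero> \<Longrightarrow> w \<in> leavitt_words E"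
  unfolding leavitt_free_simps by (auto simp: carrier_free_vs)

lemma basis_LF: "w \<in> leavitt_words E \<Longrightarrow> basis_vec K w \<in> carrier LF"
  using fin_supp_finite[OF fin_supp_basis[of w]]
  unfolding leavitt_free_simps by (auto simp: carrier_free_vs basis_vec_def)

lemma unit_closed: "unit_indicator E K u \<in> carrier K"
  by (rule row_finite_closed[OF row_finite_unit])

lemma word_eval_closed: "p \<in> fin_supp K \<Longrightarrow> word_eval E K p u \<in> carrier K"
  unfolding word_eval_def by (intro lincomb_closed word_shift_closed unit_closed)

lemma word_eval_add:
  "p \<in> fin_supp K \<Longrightarrow> q \<in> fin_supp K \<Longrightarrow>
    word_eval E K (\<lambda>w. p w \<oplus> q w) = (\<lambda>u. word_eval E K p u \<oplus> word_eval E K q u)"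
  unfolding word_eval_def by (intro ext lincomb_add_left word_shift_closed unit_closed)

lemma word_eval_smult:
  "p \<in> fin_supp K \<Longrightarrow> k \<in> carrier K \<Longrightarrow>
    word_eval E K (\<lambda>w. k \<otimes> p w) = (\<lambda>u. k \<otimes> word_eval E K p u)"
  unfolding word_eval_def by (intro ext lincomb_smult_left word_shift_closed unit_closed)

lemma word_eval_basis: "word_eval E K (basis_vec K w) = word_shift E K w (unit_indicator E K)"
  unfolding word_eval_def by (intro ext lincomb_basis word_shift_closed unit_closed)

lemma word_eval_zero: "word_eval E K (\<lambda>_. \<zero>) = (\<lambda>_. \<zero>)"
  by (simp add: word_eval_def)

lemma word_eval_minus:
  assumes "p \<in> carrier LF" "q \<in> carrier LF"
  shows "word_eval E K (p \<ominus>\<^bsub>LF\<^esub> q) = (\<lambda>u. word_eval E K p u \<ominus> word_eval E K q u)"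
proof -
  have "p \<ominus>\<^bsub>LF\<^esub> q = (\<lambda>s. p s \<ominus> q s)"
    by (rule free_vs_minus) (use assms in \<open>simp_all add: leavitt_free_simps\<close>)
  then show ?thesis
    unfolding word_eval_def
    by (simp add: lincomb_diff_left LF_fin_supp assms word_shift_closed unit_closed)
qed

lemma word_eval_finsum:
  assumes "\<And>i. i \<in> I \<Longrightarrow> g i \<in> carrier LF"
  shows "word_eval E K (\<Oplus>\<^bsub>LF\<^esub>i\<in>I. g i) u = (\<Oplus>i\<in>I. word_eval E K (g i) u)"
  using assms
proof (induction I rule: infinite_finite_induct)
  case (insert i I)
  have "(\<Oplus>\<^bsub>LF\<^esub>i\<in>insert i I. g i) = g i \<oplus>\<^bsub>LF\<^esub> (\<Oplus>\<^bsub>LF\<^esub>i\<in>I. g i)"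
    using insert by (intro LF.M.finsum_insert) auto
  moreover have "(\<Oplus>\<^bsub>LF\<^esub>i\<in>I. g i) \<in> carrier LF"
    using insert by (intro LF.M.finsum_closed) auto
  moreover have "(\<Oplus>i\<in>insert i I. word_eval E K (g i) u) = word_eval E K (g i) u \<oplus> (\<Oplus>i\<in>I. word_eval E K (g i) u)"
    using insert by (intro finsum_insert) (auto simp: word_eval_closed LF_fin_supp)
  ultimately show ?case
    using insert by (simp add: LF_ops word_eval_add LF_fin_supp)
qed (simp_all add: LF_ops word_eval_zero)

lemma word_shift_unit_outside:
  "y \<notin> boundary_paths E \<Longrightarrow> word_shift E K w (unit_indicator E K) (y, k, x) = \<zero>"
  by (cases w) (simp_all add: gen_shift_outside unit_indicator_def)

lemma word_eval_outside:
  "p \<in> fin_supp K \<Longrightarrow> y \<notin> boundary_paths E \<Longrightarrow> word_eval E K p (y, k, x) = \<zero>"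
  by (simp add: word_eval_def word_shift_unit_outside)

lemma word_shift_lincomb:
  assumes "p \<in> fin_supp K" "\<And>s u. N s u \<in> carrier K"
  shows "word_shift E K w (\<lambda>u. lincomb K p (\<lambda>s. N s u)) = (\<lambda>u. lincomb K p (\<lambda>s. word_shift E K w (N s) u))"
proof (induction w)
  case (Cons g w)
  then show ?case
    using assms(1) by (auto simp: gen_shift_def fun_eq_iff split: option.splits)
qed simp

lemma row_word_eval:
  "row (word_eval E K p) y = (\<lambda>b. lincomb K p (\<lambda>w. row (word_shift E K w (unit_indicator E K)) y b))"
  by (auto simp: row_def word_eval_def)

lemma row_finite_word_eval: "p \<in> fin_supp K \<Longrightarrow> row_finite K (word_eval E K p)"
  using row_finite_word_shift[OF row_finite_unit]
  by (simp add: row_finite_def row_word_eval lincomb_family_fin_supp)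

text \<open>Convolution with the image of a word is the operator of that word.\<close>
lemma row_conv_word_eval:
  fixes n :: "('v, 'e) epath \<times> int \<times> 'c \<Rightarrow> 'k"
  assumes p: "p \<in> fin_supp K" and n: "\<And>u. n u \<in> carrier K" "\<And>y k x. y \<notin> boundary_paths E \<Longrightarrow> n (y, k, x) = \<zero>"
  shows "row_conv K (word_eval E K p) n = (\<lambda>u. lincomb K p (\<lambda>w. word_shift E K w n u))"
proof
  fix u :: "('v, 'e) epath \<times> int \<times> 'c"
  obtain y k x where u: "u = (y, k, x)" by (cases u) auto
  have f: "row (word_shift E K w (unit_indicator E K)) y \<in> fin_supp K" for w
    using row_finite_word_shift[OF row_finite_unit] by (simp add: row_finite_def)
  have "row_conv K (word_eval E K p) n u = lincomb K p (\<lambda>w. row_conv K (word_shift E K w (unit_indicator E K)) n u)"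
    unfolding u row_conv_def prod.case row_word_eval
    by (rule lincomb_bind[OF p f]) (use n in \<open>auto split: prod.splits\<close>)
  then show "row_conv K (word_eval E K p) n u = lincomb K p (\<lambda>w. word_shift E K w n u)"
    by (simp add: row_conv_word_shift n)
qed

text \<open>Concatenation of words is composition of the operators that they define.\<close>
lemma LF_mult:
  assumes "p \<in> carrier LF" "q \<in> carrier LF"
  shows "p \<otimes>\<^bsub>LF\<^esub> q \<in> carrier LF"
    and "word_eval E K (p \<otimes>\<^bsub>LF\<^esub> q) = row_conv K (word_eval E K p) (word_eval E K q)"
proof -
  let ?W = "leavitt_words E"
  have f: "p \<in> fin_supp K" "q \<in> fin_supp K" using assms by (auto simp: LF_fin_supp)
  have supp: "p s \<noteq> \<zero> \<Longrightarrow> q t \<noteq> \<zero> \<Longrightarrow> (s, t) \<in> ?W \<times> ?W" for s t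
    using assms LF_supp by blast
  note conv = lincomb_convolution[OF f supp, where m = "(@)"]
  have "convolution K (?W \<times> ?W) (@) p q w = \<zero>" if "w \<notin> ?W" for w
  proof -
    have "{(s, t). (s, t) \<in> ?W \<times> ?W \<and> p s \<noteq> \<zero> \<and> q t \<noteq> \<zero> \<and> s @ t = w} = {}"
      using that by (auto simp: leavitt_words_def)
    then show ?thesis unfolding convolution_def by (metis finsum_empty)
  qed
  then show "p \<otimes>\<^bsub>LF\<^esub> q \<in> carrier LF"
    using conv(1) unfolding leavitt_free_simps by (auto simp: carrier_free_vs fin_supp_def)
  show "word_eval E K (p \<otimes>\<^bsub>LF\<^esub> q) = row_conv K (word_eval E K p) (word_eval E K q)"
  proof
    fix u :: "('v, 'e) arrow"
    have "word_eval E K (p \<otimes>\<^bsub>LF\<^esub> q) u =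
        lincomb K p (\<lambda>s. lincomb K q (\<lambda>t. word_shift E K s (word_shift E K t (unit_indicator E K)) u))"
      unfolding word_eval_def leavitt_free_simps(5)
      using conv(2) by (simp add: word_shift_closed unit_closed)
    also have "\<dots> = lincomb K p (\<lambda>s. word_shift E K s (word_eval E K q) u)"
      unfolding word_eval_def by (simp add: word_shift_lincomb f word_shift_closed unit_closed)
    also have "\<dots> = row_conv K (word_eval E K p) (word_eval E K q) u"
      using f by (simp add: row_conv_word_eval word_eval_closed word_eval_outside)
    finally show "word_eval E K (p \<otimes>\<^bsub>LF\<^esub> q) u = row_conv K (word_eval E K p) (word_eval E K q) u" .
  qed
qed

text \<open>This and the following identities between operators become the defining relations of the
  Leavitt path algebra when they are applied to the indicator of the units.\<close>
lemma gen_shift_vertices: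
  assumes "\<And>y k x. y \<notin> boundary_paths E \<Longrightarrow> n (y, k, x) = \<zero>"
  shows "gen_shift E K (Vtx v) (gen_shift E K (Vtx w) n) = (if v = w then gen_shift E K (Vtx v) n else (\<lambda>_. \<zero>))"
  by (auto simp: gen_shift_def fun_eq_iff)

lemma gen_shift_tail_edge:
  "gen_shift E K (Vtx (tail E e)) (gen_shift E K (Edge e) n) = gen_shift E K (Edge e) n"
  using ghost_act_SomeD(4)[of e]
  by (auto simp: gen_shift_def fun_eq_iff split: option.splits)

lemma gen_shift_edge_head:
  "gen_shift E K (Edge e) (gen_shift E K (Vtx (head E e)) n) = gen_shift E K (Edge e) n"
  using ghost_act_SomeD(2,5)[of e]
  by (auto simp: gen_shift_def fun_eq_iff split: option.splits)

lemma gen_shift_head_ghost: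
  "gen_shift E K (Vtx (head E e)) (gen_shift E K (Ghost e) n) = gen_shift E K (Ghost e) n"
  by (auto simp: gen_shift_def fun_eq_iff)

lemma edge_append_boundary:
  assumes "e \<in> arcs E" "y \<in> boundary_paths E" "head E e = path_source E y"
  shows "path_append (tail E e, [e]) y \<in> boundary_paths E"
    "path_source E (path_append (tail E e, [e]) y) = tail E e"
    "gen_path_act E (Ghost e') (path_append (tail E e, [e]) y) = (if e = e' then Some y else None)"
  using boundary_append[OF arc_implies_awalk, of e y] path_source_append[OF arc_implies_awalk, of e y] assms
    ghost_path_append_Cons[of E e' "tail E e" e "[]" y] path_append_Nil[of E y "head E e"]
  by auto

lemma gen_shift_ghost_tail:
  assumes "e \<in> arcs E"
  shows "gen_shift E K (Ghost e) (gen_shift E K (Vtx (tail E e)) n) = gen_shift E K (Ghost e) n"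
  using edge_append_boundary(1,2)[OF assms] by (auto simp: gen_shift_def fun_eq_iff)

lemma gen_shift_ghost_edge:
  assumes "e \<in> arcs E"
  shows "gen_shift E K (Ghost e) (gen_shift E K (Edge e') n) =
    (if e = e' then gen_shift E K (Vtx (head E e)) n else (\<lambda>_. \<zero>))"
  using edge_append_boundary[OF assms] by (auto simp: gen_shift_def fun_eq_iff)

text \<open>A finite boundary path ends at a vertex that is not regular, so that it cannot be the trivial
  path at a regular vertex.\<close>
lemma regular_first_edge:
  assumes "y \<in> boundary_paths E" "regular_vertex E (path_source E y)"
  obtains e z where "e \<in> out_arcs E (path_source E y)" "gen_path_act E (Ghost e) y = Some z"
    "\<And>e'. e' \<noteq> e \<Longrightarrow> gen_path_act E (Ghost e') y = None"
proof (cases y)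
  case (FinPath u l)
  then obtain e l' where l: "l = e # l'" using assms by (cases l) (auto simp: boundary_FinPath_Nil)
  then show ?thesis
    using that[of e "FinPath (head E e) l'"] FinPath assms by (auto simp: boundary_FinPath_Cons)
next
  case (InfPath s)
  obtain e t where s: "s = e ## t" by (cases s)
  then show ?thesis
    using that[of e "InfPath t"] InfPath assms by (auto simp: boundary_InfPath infinite_SCons)
qed

lemma edge_ghost_shift:
  "y \<in> boundary_paths E \<Longrightarrow> gen_shift E K (Edge e) (gen_shift E K (Ghost e) n) (y, k, x) =
    (if gen_path_act E (Ghost e) y = None then \<zero> else n (y, k, x))"
  using ghost_act_SomeD[of e y] by (auto simp: gen_shift_def split: option.splits)

text \<open>Exactly one edge at a regular vertex is the first edge of a given path, so that the sum has a
  single nonzero term.\<close>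
lemma gen_shift_regular:
  assumes v: "regular_vertex E v" and n: "\<And>u. n u \<in> carrier K"
  shows "gen_shift E K (Vtx v) n u = (\<Oplus>e\<in>out_arcs E v. gen_shift E K (Edge e) (gen_shift E K (Ghost e) n) u)"
proof -
  obtain y k x where u: "u = (y, k, x)" by (cases u) auto
  have fin: "finite (out_arcs E v)" using v by (simp add: regular_vertex_def)
  have c: "gen_shift E K (Edge e) (gen_shift E K (Ghost e) n) u \<in> carrier K" for e
    by (intro gen_shift_closed n)
  show ?thesis
  proof (cases "y \<in> boundary_paths E \<and> path_source E y = v")
    case True
    then obtain e z where e: "e \<in> out_arcs E v" "gen_path_act E (Ghost e) y = Some z"
      "\<And>e'. e' \<noteq> e \<Longrightarrow> gen_path_act E (Ghost e') y = None"
      using regular_first_edge[of y] v by metis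
    have "(\<Oplus>e\<in>out_arcs E v. gen_shift E K (Edge e) (gen_shift E K (Ghost e) n) u) =
        gen_shift E K (Edge e) (gen_shift E K (Ghost e) n) u"
      using True e(3) by (intro finsum_single fin c e(1)) (simp add: u edge_ghost_shift)
    then show ?thesis using True e(2) by (simp add: u edge_ghost_shift) (simp add: gen_shift_def)
  next
    case False
    have "gen_shift E K (Edge e) (gen_shift E K (Ghost e) n) u = \<zero>" if "e \<in> out_arcs E v" for e
    proof (cases "y \<in> boundary_paths E")
      case True
      then have "gen_path_act E (Ghost e) y = None"
        using False that ghost_act_SomeD(4)[of e y] by (cases "gen_path_act E (Ghost e) y") auto
      then show ?thesis using True by (simp add: u edge_ghost_shift)
    qed (simp add: u gen_shift_outside)
    then have "(\<Oplus>e\<in>out_arcs E v. gen_shift E K (Edge e) (gen_shift E K (Ghost e) n) u) = \<zero>"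
      by (intro add.finprod_one_eqI) simp
    then show ?thesis using False by (auto simp: u gen_shift_def)
  qed
qed

definition eval_kernel :: "(('v, 'e) word \<Rightarrow> 'k) set" where
  "eval_kernel = {p \<in> carrier LF. word_eval E K p = (\<lambda>_. \<zero>)}"

lemma eval_kernel_minus:
  assumes "p \<in> carrier LF" "q \<in> carrier LF" "word_eval E K p = word_eval E K q"
  shows "p \<ominus>\<^bsub>LF\<^esub> q \<in> eval_kernel"
  using assms by (simp add: eval_kernel_def word_eval_minus word_eval_closed LF_fin_supp r_neg minus_eq)

lemma eval_kernel_ideal: "algebra_ideal K LF eval_kernel"
proof -
  have sub: "submodule eval_kernel K LF"
  proof (rule LF.submoduleI)
    show "eval_kernel \<subseteq> carrier LF" "\<zero>\<^bsub>LF\<^esub> \<in> eval_kernel"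
      by (auto simp: eval_kernel_def LF_ops(3) word_eval_zero) (use LF.M.zero_closed in \<open>simp add: LF_ops\<close>)
    fix p assume p: "p \<in> eval_kernel"
    then have "\<zero>\<^bsub>LF\<^esub> \<ominus>\<^bsub>LF\<^esub> p \<in> eval_kernel"
      by (intro eval_kernel_minus) (auto simp: eval_kernel_def LF_ops(3)[symmetric] word_eval_zero[folded LF_ops(3)])
    then show "\<ominus>\<^bsub>LF\<^esub> p \<in> eval_kernel"
      using p by (simp add: LF.M.minus_eq eval_kernel_def)
    show "p \<oplus>\<^bsub>LF\<^esub> q \<in> eval_kernel" if "q \<in> eval_kernel" for q
      using p that LF.M.a_closed[of p q] by (simp add: eval_kernel_def LF_ops word_eval_add LF_fin_supp)
    show "k \<odot>\<^bsub>LF\<^esub> p \<in> eval_kernel" if "k \<in> carrier K" for k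
      using p that LF.smult_closed[of k p] by (simp add: eval_kernel_def LF_ops word_eval_smult LF_fin_supp)
  qed
  have z: "row_conv K f (\<lambda>_ :: ('v, 'e) arrow. \<zero>) = (\<lambda>_. \<zero>)" if "row_finite K f" for f :: "('v, 'e) arrow \<Rightarrow> 'k"
    using that by (auto simp: row_conv_def row_finite_def case_prod_beta' fun_eq_iff)
  have z': "row_conv K (\<lambda>_ :: ('v, 'e) arrow. \<zero>) f = (\<lambda>_. \<zero>)" for f :: "('v, 'e) arrow \<Rightarrow> 'k"
    by (auto simp: row_conv_def row_def case_prod_beta' fun_eq_iff)
  show ?thesis
    unfolding algebra_ideal_def
    using sub z z' by (auto simp: eval_kernel_def LF_mult row_finite_word_eval LF_fin_supp)
qed

lemma leavitt_relations_kernel: "leavitt_relations E K \<subseteq> eval_kernel"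
proof -
  have unit: "y \<notin> boundary_paths E \<Longrightarrow> unit_indicator E K (y, k, x) = \<zero>" for y k and x :: "('v, 'e) epath"
    by (simp add: unit_indicator_def)
  have wrd: "g \<in> leavitt_gens E \<Longrightarrow> [g] \<in> leavitt_words E"
    "g \<in> leavitt_gens E \<Longrightarrow> h \<in> leavitt_gens E \<Longrightarrow> [g, h] \<in> leavitt_words E" for g h
    by (simp_all add: leavitt_words_gens)
  have gens: "v \<in> verts E \<Longrightarrow> Vtx v \<in> leavitt_gens E" "e \<in> arcs E \<Longrightarrow> Edge e \<in> leavitt_gens E"
    "e \<in> arcs E \<Longrightarrow> Ghost e \<in> leavitt_gens E" for v e
    by (simp_all add: leavitt_gens_def)
  have bas: "g \<in> leavitt_gens E \<Longrightarrow> basis_vec K [g] \<in> carrier LF"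
    "g \<in> leavitt_gens E \<Longrightarrow> h \<in> leavitt_gens E \<Longrightarrow> basis_vec K [g, h] \<in> carrier LF" for g h
    using wrd basis_LF by blast+
  note ev = word_eval_basis word_eval_zero[folded LF_ops(3)]
  have zero: "\<zero>\<^bsub>LF\<^esub> \<in> carrier LF" by simp
  have r1: "basis_vec K [Vtx v, Vtx w] \<ominus>\<^bsub>LF\<^esub> (if v = w then basis_vec K [Vtx v] else \<zero>\<^bsub>LF\<^esub>) \<in> eval_kernel"
    if "v \<in> verts E" "w \<in> verts E" for v w
    using that by (intro eval_kernel_minus) (auto simp: bas gens ev gen_shift_vertices unit)
  have r2: "basis_vec K [Vtx (tail E e), Edge e] \<ominus>\<^bsub>LF\<^esub> basis_vec K [Edge e] \<in> eval_kernel"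
    "basis_vec K [Edge e, Vtx (head E e)] \<ominus>\<^bsub>LF\<^esub> basis_vec K [Edge e] \<in> eval_kernel"
    "basis_vec K [Vtx (head E e), Ghost e] \<ominus>\<^bsub>LF\<^esub> basis_vec K [Ghost e] \<in> eval_kernel"
    "basis_vec K [Ghost e, Vtx (tail E e)] \<ominus>\<^bsub>LF\<^esub> basis_vec K [Ghost e] \<in> eval_kernel"
    if e: "e \<in> arcs E" for e
    using e by (auto intro!: eval_kernel_minus
        simp: bas gens ev gen_shift_tail_edge gen_shift_edge_head gen_shift_head_ghost gen_shift_ghost_tail)
  have r3: "basis_vec K [Ghost e, Edge e'] \<ominus>\<^bsub>LF\<^esub> (if e = e' then basis_vec K [Vtx (head E e)] else \<zero>\<^bsub>LF\<^esub>) \<in> eval_kernel"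
    if "e \<in> arcs E" "e' \<in> arcs E" for e e'
    using that by (intro eval_kernel_minus) (auto simp: bas gens ev gen_shift_ghost_edge)
  have r4: "basis_vec K [Vtx v] \<ominus>\<^bsub>LF\<^esub> (\<Oplus>\<^bsub>LF\<^esub>e\<in>out_arcs E v. basis_vec K [Edge e, Ghost e]) \<in> eval_kernel"
    if v: "regular_vertex E v" for v
  proof (rule eval_kernel_minus)
    have b: "basis_vec K [Edge e, Ghost e] \<in> carrier LF" if "e \<in> out_arcs E v" for e
      using that bas gens by auto
    show "basis_vec K [Vtx v] \<in> carrier LF"
      using v bas gens by (auto simp: regular_vertex_def)
    show "(\<Oplus>\<^bsub>LF\<^esub>e\<in>out_arcs E v. basis_vec K [Edge e, Ghost e]) \<in> carrier LF"
      using b by (intro LF.M.finsum_closed) auto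
    show "word_eval E K (basis_vec K [Vtx v]) =
        word_eval E K (\<Oplus>\<^bsub>LF\<^esub>e\<in>out_arcs E v. basis_vec K [Edge e, Ghost e])"
    proof
      fix u
      have "word_eval E K (\<Oplus>\<^bsub>LF\<^esub>e\<in>out_arcs E v. basis_vec K [Edge e, Ghost e]) u =
          (\<Oplus>e\<in>out_arcs E v. gen_shift E K (Edge e) (gen_shift E K (Ghost e) (unit_indicator E K)) u)"
        using word_eval_finsum[of "out_arcs E v" "\<lambda>e. basis_vec K [Edge e, Ghost e]" u] b
        by (simp add: word_eval_basis)
      then show "word_eval E K (basis_vec K [Vtx v]) u =
          word_eval E K (\<Oplus>\<^bsub>LF\<^esub>e\<in>out_arcs E v. basis_vec K [Edge e, Ghost e]) u"
        using gen_shift_regular[OF v unit_closed] by (simp add: word_eval_basis)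
    qed
  qed
  show ?thesis
    unfolding leavitt_relations_def Let_def using r1 r2 r3 r4 by blast
qed

abbreviation "LI \<equiv> leavitt_ideal E K"

text \<open>The kernel of \<open>word_eval\<close> is an ideal that contains the defining relations.\<close>
lemma leavitt_ideal_kernel: "LI \<subseteq> eval_kernel"
  unfolding leavitt_ideal_def algebra_genideal_def
  using eval_kernel_ideal leavitt_relations_kernel by blast

lemma zero_leavitt_ideal: "\<zero>\<^bsub>LF\<^esub> \<in> LI"
proof -
  have "\<zero>\<^bsub>LF\<^esub> \<in> J" if "algebra_ideal K LF J" for J
  proof -
    have "submodule J K LF" using that by (simp add: algebra_ideal_def)
    then have "subgroup J (add_monoid LF)" by (rule submodule.axioms(1))
    from subgroup.one_closed[OF this] show ?thesis by simp
  qed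
  then show ?thesis unfolding leavitt_ideal_def algebra_genideal_def by blast
qed

lemma coset_eval:
  assumes "p \<in> carrier LF" "q \<in> LI +>\<^bsub>LF\<^esub> p"
  shows "q \<in> carrier LF" "word_eval E K q = word_eval E K p"
proof -
  obtain i where i: "i \<in> LI" "q = i \<oplus>\<^bsub>LF\<^esub> p" using assms(2) by (auto simp: a_r_coset_def')
  then have k: "i \<in> carrier LF" "word_eval E K i = (\<lambda>_. \<zero>)"
    using leavitt_ideal_kernel by (auto simp: eval_kernel_def)
  show "q \<in> carrier LF" using i k assms by simp
  show "word_eval E K q = word_eval E K p"
    using i k assms by (simp add: LF_ops word_eval_add word_eval_closed LF_fin_supp)
qed

lemma coset_self: "p \<in> carrier LF \<Longrightarrow> p \<in> LI +>\<^bsub>LF\<^esub> p"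
  unfolding a_r_coset_def' using zero_leavitt_ideal LF.M.l_zero[of p] by (intro UN_I) auto

lemma S_abelian_monoid: "abelian_monoid S"
  by (rule abelian_monoidI)
     (auto simp: S_closed S_add S_zero a_ac steinberg_simps(1,2))

lemma steinberg_finsum_eval:
  assumes "p \<in> carrier LF"
  shows "(\<Oplus>\<^bsub>S\<^esub>w\<in>{w. p w \<noteq> \<zero>}. p w \<odot>\<^bsub>S\<^esub> word_image E K w) = word_eval E K p"
    and "word_eval E K p \<in> carrier S"
proof -
  have c: "p w \<odot>\<^bsub>S\<^esub> word_image E K w \<in> carrier S" if "p w \<noteq> \<zero>" for w
    using word_image_shift(2)[OF LF_supp[OF assms that]] fin_suppD[OF LF_fin_supp[OF assms]]
    by (simp add: steinberg_simps(3) S_smult)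
  show e: "(\<Oplus>\<^bsub>S\<^esub>w\<in>{w. p w \<noteq> \<zero>}. p w \<odot>\<^bsub>S\<^esub> word_image E K w) = word_eval E K p"
  proof
    fix u
    have "(\<Oplus>\<^bsub>S\<^esub>w\<in>{w. p w \<noteq> \<zero>}. p w \<odot>\<^bsub>S\<^esub> word_image E K w) u =
        (\<Oplus>w\<in>{w. p w \<noteq> \<zero>}. (p w \<odot>\<^bsub>S\<^esub> word_image E K w) u)"
      by (rule finsum_pointwise[OF S_abelian_monoid abelian_monoid_axioms])
         (use c S_closed in \<open>auto simp: steinberg_simps(1,2)\<close>)
    also have "\<dots> = lincomb K p (\<lambda>w. word_image E K w u)"
      by (simp add: lincomb_def steinberg_simps(3))
    also have "\<dots> = word_eval E K p u"
      unfolding word_eval_def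
      by (rule lincomb_cong[OF LF_fin_supp[OF assms]])
         (use word_image_shift LF_supp[OF assms] S_closed in auto)
    finally show "(\<Oplus>\<^bsub>S\<^esub>w\<in>{w. p w \<noteq> \<zero>}. p w \<odot>\<^bsub>S\<^esub> word_image E K w) u = word_eval E K p u" .
  qed
  have "(\<Oplus>\<^bsub>S\<^esub>w\<in>{w. p w \<noteq> \<zero>}. p w \<odot>\<^bsub>S\<^esub> word_image E K w) \<in> carrier S"
    by (rule abelian_monoid.finsum_closed[OF S_abelian_monoid]) (use c in auto)
  then show "word_eval E K p \<in> carrier S" by (simp add: e)
qed

text \<open>\<open>word_eval\<close> is constant on cosets, as \<open>quotient_lift\<close> requires.\<close>
lemma leavitt_to_steinberg_coset:
  assumes "p \<in> carrier LF"
  shows "leavitt_to_steinberg E K (LI +>\<^bsub>LF\<^esub> p) = word_eval E K p"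
proof -
  let ?g = "\<lambda>p. \<Oplus>\<^bsub>S\<^esub>w\<in>{w. p w \<noteq> \<zero>}. p w \<odot>\<^bsub>S\<^esub> word_image E K w"
  have "?g q = word_eval E K p" if "q \<in> LI +>\<^bsub>LF\<^esub> p" for q
    using steinberg_finsum_eval(1)[OF coset_eval(1)[OF assms that]] coset_eval(2)[OF assms that] by (rule trans)
  then have "?g ` (LI +>\<^bsub>LF\<^esub> p) = (\<lambda>_. word_eval E K p) ` (LI +>\<^bsub>LF\<^esub> p)"
    by (rule image_cong[OF refl])
  also have "\<dots> = {word_eval E K p}" by (rule image_constant[OF coset_self[OF assms]])
  finally have "?g ` (LI +>\<^bsub>LF\<^esub> p) = {word_eval E K p}" .
  then show ?thesis by (simp add: leavitt_to_steinberg_def quotient_lift_def)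
qed

lemma word_eval_surj:
  assumes "s \<in> carrier S"
  shows "\<exists>p\<in>carrier LF. word_eval E K p = s"
  using assms
proof (induction s rule: S_induct)
  case zero
  have "\<zero>\<^bsub>LF\<^esub> \<in> carrier LF" by simp
  then show ?case using word_eval_zero unfolding LF_ops(3) by blast
next
  case (step k u m w n v f)
  then obtain p where p: "p \<in> carrier LF" "word_eval E K p = f" by blast
  let ?w = "map Edge m @ map Ghost (rev n) @ [Vtx w]"
  have b: "basis_vec K ?w \<in> carrier LF" by (rule basis_LF[OF cylinder_word(1)[OF step(2,3)]])
  have "word_eval E K (basis_vec K ?w) = ind (cylinder E (u, m) (w, n))"
    unfolding word_eval_basis
    using cylinder_word(2)[OF step(2,3)] word_image_shift(1)[OF cylinder_word(1)[OF step(2,3)]] by (simp only:)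
  then have "word_eval E K (k \<odot>\<^bsub>LF\<^esub> basis_vec K ?w \<oplus>\<^bsub>LF\<^esub> p) = (\<lambda>s. k \<otimes> ind (cylinder E (u, m) (w, n)) s \<oplus> f s)"
    using p step(1) LF_fin_supp[OF p(1)] fin_supp_basis[of ?w]
    by (simp add: LF_ops word_eval_add word_eval_smult)
  moreover have "k \<odot>\<^bsub>LF\<^esub> basis_vec K ?w \<oplus>\<^bsub>LF\<^esub> p \<in> carrier LF"
    using b p step(1) by simp
  ultimately show ?case by blast
qed

lemma leavitt_carrier: "carrier (leavitt_algebra E K) = {LI +>\<^bsub>LF\<^esub> p | p. p \<in> carrier LF}"
  by (auto simp: leavitt_algebra_def quotient_algebra_def ring.defs FactRing_def A_RCOSETS_def')

text \<open>The representative is known only through its image \<open>s\<close>. This is enough, because the image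
  determines the action, see \<open>chen_act_lift\<close>.\<close>
lemma steinberg_preimage:
  assumes "s \<in> carrier S"
  obtains p where "p \<in> carrier LF" "word_eval E K p = s"
    "inv_into (carrier (leavitt_algebra E K)) (leavitt_to_steinberg E K) s = LI +>\<^bsub>LF\<^esub> p"
proof -
  obtain q where q: "q \<in> carrier LF" "word_eval E K q = s" using word_eval_surj[OF assms] by blast
  then have "s \<in> leavitt_to_steinberg E K ` carrier (leavitt_algebra E K)"
    using leavitt_to_steinberg_coset[OF q(1)] by (auto simp: leavitt_carrier intro!: image_eqI)
  then have "inv_into (carrier (leavitt_algebra E K)) (leavitt_to_steinberg E K) s \<in> carrier (leavitt_algebra E K)"
    "leavitt_to_steinberg E K (inv_into (carrier (leavitt_algebra E K)) (leavitt_to_steinberg E K) s) = s"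
    by (auto intro: inv_into_into f_inv_into_f)
  then show ?thesis
    using that leavitt_to_steinberg_coset by (auto simp: leavitt_carrier)
qed

text \<open>The image of the multiplicative map \<open>word_eval\<close> is closed under products.\<close>
lemma S_mult_closed:
  assumes "f \<in> carrier S" "g \<in> carrier S"
  shows "f \<otimes>\<^bsub>S\<^esub> g \<in> carrier S"
proof -
  obtain p where p: "p \<in> carrier LF" "word_eval E K p = f" using word_eval_surj[OF assms(1)] by blast
  obtain q where q: "q \<in> carrier LF" "word_eval E K q = g" using word_eval_surj[OF assms(2)] by blast
  have "f \<otimes>\<^bsub>S\<^esub> g = word_eval E K (p \<otimes>\<^bsub>LF\<^esub> q)"
    using p q by (simp add: S_mult[OF assms] LF_mult(2))
  then show ?thesis using steinberg_finsum_eval(2)[OF LF_mult(1)[OF p(1) q(1)]] by (simp only:)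
qed

end

section \<open>Paths tail-equivalent to a periodic path\<close>

lemma cycle_snth:
  assumes "c \<noteq> []"
  shows "cycle c !! m = c ! (m mod length c)"
proof -
  have "cycle c !! m = shd (sdrop m (cycle c))" using sdrop_snth[of m "cycle c" 0] by simp
  also have "\<dots> = hd (rotate (m mod length c) c)" using assms by (simp add: sdrop_cycle)
  also have "\<dots> = c ! (m mod length c)" using assms by (simp add: hd_rotate_conv_nth)
  finally show ?thesis .
qed

lemma sdrop_eq_iff: "sdrop i s = sdrop j t \<longleftrightarrow> (\<forall>m. s !! (i + m) = t !! (j + m))"
  using smap_alt[of id "sdrop i s" "sdrop j t"] by (simp add: stream.map_id sdrop_snth)

text \<open>The period \<open>d\<close> holds from the start of the stream, since every position can be moved beyond \<open>i\<close>
  by multiples of the length of \<open>c\<close>. By Bezout's identity the greatest common divisor of the two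
  periods is a period as well.\<close>
lemma cycle_gcd_period:
  assumes c: "c \<noteq> []" and eq: "sdrop i (cycle c) = sdrop (i + d) (cycle c)"
  shows "cycle c = cycle (take (gcd d (length c)) c)" and "concat (replicate (length c div gcd d (length c)) (take (gcd d (length c)) c)) = c"
proof -
  let ?s = "cycle c" and ?n = "length c" and ?g = "gcd d (length c)"
  have n: "?n > 0" using c by simp
  have pn: "?s !! (m + q * ?n) = ?s !! m" for m q by (simp add: cycle_snth[OF c])
  have pd: "?s !! (m + d) = ?s !! m" for m
  proof -
    obtain r where r: "m + i * ?n = i + r" using n by (metis add.commute le_add2 le_iff_add mult.commute mult_le_mono1 less_eq_Suc_le mult_1 One_nat_def trans_le_add1)
    have "?s !! (m + d) = ?s !! (m + d + i * ?n)" by (simp only: pn)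
    also have "m + d + i * ?n = i + d + r" using r by simp
    also have "?s !! (i + d + r) = ?s !! (i + r)" using eq[unfolded sdrop_eq_iff] by simp
    also have "\<dots> = ?s !! m" by (simp only: r[symmetric] pn)
    finally show ?thesis .
  qed
  have pdq: "?s !! (m + q * d) = ?s !! m" for m q
  proof (induction q)
    case (Suc q)
    then show ?case using pd[of "m + q * d"] by (simp add: algebra_simps)
  qed simp
  have pg: "?s !! (m + ?g) = ?s !! m" for m
  proof (cases "d = 0")
    case True
    then show ?thesis using pn[of m 1] by simp
  next
    case False
    then obtain u v where uv: "d * u = ?n * v + ?g" using bezout_nat by blast
    have "?s !! (m + ?g) = ?s !! (m + ?g + v * ?n)" by (simp only: pn)
    also have "m + ?g + v * ?n = m + u * d" using uv by (simp add: mult.commute)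
    finally show ?thesis by (simp only: pdq)
  qed
  have pgq: "?s !! (m + q * ?g) = ?s !! m" for m q
  proof (induction q)
    case (Suc q)
    then show ?case using pg[of "m + q * ?g"] by (simp add: algebra_simps)
  qed simp
  have g: "?g > 0" "?g \<le> ?n" using n by (auto simp: gcd_le2_nat)
  have t: "take ?g c \<noteq> []" "length (take ?g c) = ?g" using g c by auto
  have "?s !! m = cycle (take ?g c) !! m" for m
  proof -
    have "?s !! m = ?s !! (m mod ?g + (m div ?g) * ?g)" by (simp only: mod_div_mult_eq)
    also have "\<dots> = ?s !! (m mod ?g)" by (simp only: pgq)
    also have "\<dots> = c ! (m mod ?g)"
      using g less_le_trans[OF mod_less_divisor[OF g(1), of m] g(2)] by (simp add: cycle_snth[OF c])
    also have "\<dots> = cycle (take ?g c) !! m" using g by (simp add: cycle_snth[OF t(1)] t(2))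
    finally show ?thesis .
  qed
  then show e: "?s = cycle (take ?g c)"
    using sdrop_eq_iff[of 0 ?s 0 "cycle (take ?g c)"] by simp
  have "c = stake ?n ?s" using c by simp
  also have "\<dots> = stake ?n (cycle (take ?g c))" by (simp only: e[symmetric])
  also have "\<dots> = concat (replicate (?n div ?g) (take ?g c))"
    using stake_cycle[OF t(1), of ?n] unfolding t(2) by simp
  finally show "concat (replicate (?n div ?g) (take ?g c)) = c" ..
qed

context wf_digraph
begin

lemma awalk_nth_step: "awalk u p v \<Longrightarrow> Suc k < length p \<Longrightarrow> head G (p ! k) = tail G (p ! Suc k)"
proof (induction p arbitrary: u k)
  case (Cons e p)
  show ?case
  proof (cases k)
    case 0
    then obtain e' p' where "p = e' # p'" using Cons.prems(2) by (cases p) auto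
    then show ?thesis using Cons.prems(1) 0 by (simp add: awalk_Cons_iff)
  next
    case (Suc k')
    have "awalk (head G e) p v" using Cons.prems(1) by (simp add: awalk_Cons_iff)
    then show ?thesis using Cons.IH[of "head G e" k'] Cons.prems(2) Suc by simp
  qed
qed simp

lemma awalk_ends: "awalk u p v \<Longrightarrow> p \<noteq> [] \<Longrightarrow> tail G (hd p) = u \<and> head G (last p) = v"
  by (induction p arbitrary: u) (auto simp: awalk_Cons_iff awalk_Nil_iff)

lemma infinite_path_stake:
  assumes "s \<in> infinite_paths G"
  shows "awalk (tail G (shd s)) (stake i s) (tail G (shd (sdrop i s)))" "sdrop i s \<in> infinite_paths G"
proof -
  have "awalk (tail G (shd s)) (stake i s) (tail G (shd (sdrop i s))) \<and> sdrop i s \<in> infinite_paths G"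
    using assms
  proof (induction i arbitrary: s)
    case 0
    then have "shd s \<in> arcs G" by (cases s) (auto simp: infinite_SCons)
    then show ?case using 0 by (simp add: awalk_Nil_iff)
  next
    case (Suc i)
    obtain e t where s: "s = e ## t" by (cases s)
    then have "e \<in> arcs G" "head G e = tail G (shd t)" "t \<in> infinite_paths G"
      using Suc.prems by (auto simp: infinite_SCons)
    then show ?case using Suc.IH[of t] by (simp add: s awalk_Cons_iff)
  qed
  then show "awalk (tail G (shd s)) (stake i s) (tail G (shd (sdrop i s)))" "sdrop i s \<in> infinite_paths G" by auto
qed

text \<open>Tail-equivalence to \<open>x\<close> is connectedness to \<open>x\<close> in the groupoid.\<close>
lemma tail_class_arrow:
  "y \<in> tail_class G x \<longleftrightarrow> (\<exists>k. (y, k, x) \<in> groupoid_arrows G)"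
proof
  assume "y \<in> tail_class G x"
  then show "\<exists>k. (y, k, x) \<in> groupoid_arrows G"
    unfolding tail_class_def groupoid_arrows_def by blast
next
  assume "\<exists>k. (y, k, x) \<in> groupoid_arrows G"
  then obtain k where k: "(y, k, x) \<in> groupoid_arrows G" ..
  then show "y \<in> tail_class G x"
    using groupoid_arrows_boundary(1)[OF k] unfolding tail_class_def groupoid_arrows_def by blast
qed

end

locale closed_walk = wf_digraph E for E :: "('v, 'e) pre_digraph" +
  fixes c :: "'e list"
  assumes simple: "simple_closed_path E c"
begin

abbreviation "cinf \<equiv> Stream.cycle c"
abbreviation "len \<equiv> length c"
abbreviation "x0 \<equiv> (cycle_path c :: ('v, 'e) epath)"

lemma c_nonempty: "c \<noteq> []"
  using simple by (simp add: simple_closed_path_def closed_path_def)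

lemma c_awalk: obtains v where "awalk v c v"
  using simple by (auto simp: simple_closed_path_def closed_path_def)

lemma c_step: "head E (c ! (m mod len)) = tail E (c ! (Suc m mod len))"
proof -
  obtain v where v: "awalk v c v" by (rule c_awalk)
  have n: "0 < len" using c_nonempty by simp
  show ?thesis
  proof (cases "Suc (m mod len) < len")
    case True
    then have "Suc m mod len = Suc (m mod len)" by (simp add: mod_Suc)
    then show ?thesis using awalk_nth_step[OF v True] by simp
  next
    case False
    then have m: "Suc (m mod len) = len" using n mod_less_divisor[OF n, of m] by linarith
    then have "Suc m mod len = 0" "m mod len = len - 1" by (simp_all add: mod_Suc)
    then show ?thesis
      using awalk_ends[OF v c_nonempty] c_nonempty by (simp add: hd_conv_nth last_conv_nth)
  qed
qed

lemma cinf_infinite: "cinf \<in> infinite_paths E"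
proof -
  obtain v where "awalk v c v" by (rule c_awalk)
  then have "set c \<subseteq> arcs E" by auto
  moreover have "head E (cinf !! m) = tail E (cinf !! Suc m)" for m
    unfolding cycle_snth[OF c_nonempty] by (rule c_step)
  ultimately show ?thesis
    unfolding infinite_paths_def mem_Collect_eq sset_cycle[OF c_nonempty] by blast
qed

text \<open>Otherwise \<open>c\<close> is a proper power of its initial segment of length \<open>gcd d len\<close>. The stream shows
  the first edge of \<open>c\<close> again after this segment, so the segment is a closed path, and this
  contradicts simplicity.\<close>
lemma cinf_period_nat:
  assumes "sdrop i cinf = sdrop (i + d) cinf"
  shows "len dvd d"
proof -
  let ?g = "gcd d len"
  let ?d = "take ?g c"
  note P = cycle_gcd_period[OF c_nonempty assms]
  have n: "0 < len" using c_nonempty by simp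
  have g: "?g > 0" "?g \<le> len" using n by (auto simp: gcd_le2_nat)
  have "closed_path E ?d"
  proof (cases "?g = len")
    case True
    then show ?thesis using simple by (simp add: simple_closed_path_def)
  next
    case False
    then have gl: "?g < len" using g by simp
    obtain v where v: "awalk v c v" by (rule c_awalk)
    then have "awalk v (?d @ drop ?g c) v" by simp
    then have w: "awalk v ?d (awlast v ?d)" "awalk (awlast v ?d) (drop ?g c) v"
      unfolding awalk_append_iff by auto
    have "c ! ?g = cinf !! ?g" using gl by (simp add: cycle_snth[OF c_nonempty])
    also have "\<dots> = Stream.cycle ?d !! ?g" by (subst P(1)) simp
    also have "\<dots> = ?d ! 0" using g c_nonempty by (subst cycle_snth) auto
    also have "\<dots> = c ! 0" using g by simp
    finally have "hd (drop ?g c) = hd c" using gl c_nonempty by (simp add: hd_drop_conv_nth hd_conv_nth)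
    then have "awlast v ?d = v"
      using awalk_ends[OF w(2)] awalk_ends[OF v c_nonempty] gl by simp
    then show ?thesis using w(1) g c_nonempty unfolding closed_path_def by auto
  qed
  \<comment> \<open>\<open>c\<close> is a power of the closed path \<open>?d\<close>.\<close>
  then have "?d = c" using simple P(2) unfolding simple_closed_path_def by metis
  then have "?g = len" using g by (metis length_take min.absorb2)
  then show ?thesis by (metis gcd_dvd1)
qed

lemma cinf_period:
  assumes "sdrop i cinf = sdrop j cinf"
  shows "int len dvd int i - int j"
proof (cases "i \<le> j")
  case True
  then have "len dvd j - i" using cinf_period_nat[of i "j - i"] assms by simp
  then have "int len dvd int (j - i)" by (simp only: int_dvd_int_iff)
  then show ?thesis using True by (simp add: of_nat_diff dvd_diff_commute)
next
  case False
  then have "len dvd i - j" using cinf_period_nat[of j "i - j"] assms by simp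
  then have "int len dvd int (i - j)" by (simp only: int_dvd_int_iff)
  then show ?thesis using False by (simp add: of_nat_diff)
qed

text \<open>The possible lags \<open>k\<close> of arrows from \<open>s\<close> to \<open>c\<^sup>\<infinity>\<close>.\<close>
definition tail_lag :: "'e stream \<Rightarrow> int \<Rightarrow> bool" where
  "tail_lag s k \<longleftrightarrow> s \<in> infinite_paths E \<and> (\<exists>i j. k = int i - int j \<and> sdrop i s = sdrop j cinf)"

lemma arrow_x0:
  "(y, k, x0) \<in> groupoid_arrows E \<longleftrightarrow> (\<exists>s. y = InfPath s \<and> tail_lag s k)"
proof
  assume "(y, k, x0) \<in> groupoid_arrows E"
  then obtain u m w n z where h: "awalk u m (path_source E z)" "awalk w n (path_source E z)" "z \<in> boundary_paths E"
    and y: "y = path_append (u, m) z" and k: "k = int (length m) - int (length n)" and x: "x0 = path_append (w, n) z"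
    by (auto simp: mem_groupoid_arrows)
  obtain t where z: "z = InfPath t" using x by (cases z) (auto simp: cycle_path_def)
  have yb: "y \<in> boundary_paths E" unfolding y by (rule boundary_append[OF h(1) refl h(3)])
  have "sdrop (length m) (m @- t) = sdrop (length n) cinf"
    using x z by (simp add: cycle_path_def sdrop_shift)
  then show "\<exists>s. y = InfPath s \<and> tail_lag s k"
    using yb y z k by (auto simp: tail_lag_def boundary_InfPath)
next
  assume "\<exists>s. y = InfPath s \<and> tail_lag s k"
  then obtain s i j where s: "y = InfPath s" "s \<in> infinite_paths E" "k = int i - int j" "sdrop i s = sdrop j cinf"
    by (auto simp: tail_lag_def)
  have "y = path_append (tail E (shd s), stake i s) (InfPath (sdrop i s))"
    by (simp only: path_append.simps s(1) stake_sdrop)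
  moreover have "x0 = path_append (tail E (shd cinf), stake j cinf) (InfPath (sdrop i s))"
    by (simp only: path_append.simps s(4) stake_sdrop cycle_path_def)
  moreover have "InfPath (sdrop i s) \<in> boundary_paths E"
    using infinite_path_stake(2)[OF s(2)] by (simp add: boundary_InfPath)
  moreover have "awalk (tail E (shd cinf)) (stake j cinf) (tail E (shd (sdrop i s)))"
    using infinite_path_stake(1)[OF cinf_infinite, of j] s(4) by simp
  ultimately show "(y, k, x0) \<in> groupoid_arrows E"
    unfolding mem_groupoid_arrows
    using infinite_path_stake(1)[OF s(2), of i] s(3)
    by (intro exI[of _ "tail E (shd s)"] exI[of _ "stake i s"] exI[of _ "tail E (shd cinf)"] exI[of _ "stake j cinf"]
        exI[of _ "tail E (shd (sdrop i s))"] exI[of _ "InfPath (sdrop i s)"]) simp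
qed

lemma sdrop_cinf_shift: "sdrop (j + len) cinf = sdrop j cinf"
proof -
  have "sdrop j (sdrop len cinf) = sdrop j cinf" using c_nonempty by simp
  then show ?thesis by (simp add: add.commute)
qed

lemma tail_lag_mult: "tail_lag s k \<Longrightarrow> tail_lag s (k + l * int len)"
proof -
  have up: "tail_lag s (k + int len)" if "tail_lag s k" for k
  proof -
    obtain i j where s: "s \<in> infinite_paths E" "k = int i - int j" "sdrop i s = sdrop j cinf"
      using \<open>tail_lag s k\<close> by (auto simp: tail_lag_def)
    have "sdrop (i + len) s = sdrop (j + len) cinf" using s(3) by (metis sdrop_add)
    then show ?thesis unfolding tail_lag_def using s sdrop_cinf_shift
      by (intro conjI exI[of _ "i + len"] exI[of _ j]) auto
  qed
  have down: "tail_lag s (k - int len)" if "tail_lag s k" for k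
  proof -
    obtain i j where s: "s \<in> infinite_paths E" "k = int i - int j" "sdrop i s = sdrop j cinf"
      using \<open>tail_lag s k\<close> by (auto simp: tail_lag_def)
    then show ?thesis unfolding tail_lag_def using sdrop_cinf_shift
      by (intro conjI exI[of _ i] exI[of _ "j + len"]) auto
  qed
  assume k: "tail_lag s k"
  show ?thesis
  proof (induction l rule: int_induct[where k = 0])
    case base
    then show ?case using k by simp
  next
    case (step1 l)
    then show ?case using up[OF step1(2)] by (simp add: algebra_simps)
  next
    case (step2 l)
    then show ?case using down[OF step2(2)] by (simp add: algebra_simps)
  qed
qed

text \<open>Two lags of the same path give a period of \<open>c\<^sup>\<infinity>\<close>, which is a multiple of the length of \<open>c\<close>.\<close>
lemma tail_lag_diff:
  assumes "tail_lag s k" "tail_lag s k'"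
  shows "\<exists>l. k' = k + l * int len"
proof -
  obtain i j where 1: "k = int i - int j" "sdrop i s = sdrop j cinf" using assms by (auto simp: tail_lag_def)
  obtain i' j' where 2: "k' = int i' - int j'" "sdrop i' s = sdrop j' cinf" using assms by (auto simp: tail_lag_def)
  have "sdrop (j + i') cinf = sdrop (i + i') s" using 1(2) by (metis sdrop_add)
  also have "\<dots> = sdrop (j' + i) cinf" using 2(2) by (metis sdrop_add add.commute)
  finally have "int len dvd int (j + i') - int (j' + i)" by (rule cinf_period)
  moreover have "int (j + i') - int (j' + i) = k' - k" using 1(1) 2(1) by simp
  ultimately have "int len dvd k' - k" by (simp only:)
  then obtain l where "k' - k = int len * l" ..
  then show ?thesis by (intro exI[of _ l]) (simp add: algebra_simps)
qed

lemma tail_lag_zero: "tail_lag cinf 0"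
  unfolding tail_lag_def using cinf_infinite by (intro conjI exI[of _ 0]) auto

lemma isotropy_carrier:
  "carrier (isotropy_group E x0) = {(x0, l * int len, x0) | l. True}"
proof -
  have "tail_lag cinf k \<longleftrightarrow> (\<exists>l. k = l * int len)" for k
    using tail_lag_mult[OF tail_lag_zero] tail_lag_diff[OF tail_lag_zero] by auto
  then have "(x0, k, x0) \<in> groupoid_arrows E \<longleftrightarrow> (\<exists>l. k = l * int len)" for k
    by (simp add: arrow_x0) (simp add: cycle_path_def)
  then show ?thesis by (auto simp: isotropy_group_def)
qed

lemma mem_L_arrows: "(y, k, x) \<in> L_arrows E x0 \<longleftrightarrow> x = x0 \<and> (y, k, x0) \<in> groupoid_arrows E"
  by (auto simp: L_arrows_def)

end

section \<open>The cocycle of a family of edge weights\<close>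

text \<open>Weights in an arbitrary commutative ring. With the weights \<open>a\<close> this describes the twisted
  action, and with all weights equal to \<open>1\<close> the untwisted one.\<close>
locale weighted = closed_walk E c + cring F
  for E :: "('v, 'e) pre_digraph" and c :: "'e list" and F :: "('f, 's) ring_scheme" (structure) +
  fixes a :: "'e \<Rightarrow> 'f"
  assumes a_units: "\<And>e. e \<in> arcs E \<Longrightarrow> a e \<in> Units F"
begin

abbreviation "wt \<equiv> path_weight F a"

lemma wt_unit: "set p \<subseteq> arcs E \<Longrightarrow> wt p \<in> Units F"
  by (induction p) (auto simp: path_weight_def a_units)

lemma wt_append: "set p \<subseteq> arcs E \<Longrightarrow> set q \<subseteq> arcs E \<Longrightarrow> wt (p @ q) = wt p \<otimes> wt q"
proof (induction p)
  case Nil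
  then show ?case using Units_closed[OF wt_unit[of q]] by (simp add: path_weight_def)
next
  case (Cons e p)
  then show ?case using wt_unit[of p] wt_unit[of q] a_units[of e] by (simp add: path_weight_def m_assoc Units_closed)
qed

lemma stake_arcs: "s \<in> infinite_paths E \<Longrightarrow> set (stake i s) \<subseteq> arcs E"
  using infinite_path_stake(1) by blast

lemma unit_cancel_mult:
  assumes "u \<in> Units F" "v \<in> Units F" "w \<in> Units F"
  shows "(u \<otimes> w) \<otimes> inv (v \<otimes> w) = u \<otimes> inv v"
proof -
  have c: "u \<in> carrier F" "inv v \<in> carrier F" "w \<in> carrier F" "inv w \<in> carrier F"
    using assms by auto
  have "(v \<otimes> w) \<otimes> (inv w \<otimes> inv v) = v \<otimes> ((w \<otimes> inv w) \<otimes> inv v)"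
    using assms c Units_closed[OF assms(2)] by (simp only: m_assoc m_closed)
  then have "(v \<otimes> w) \<otimes> (inv w \<otimes> inv v) = \<one>" using assms c by simp
  then have "inv (v \<otimes> w) = inv w \<otimes> inv v"
    using assms c by (intro comm_inv_char) (simp_all add: Units_closed)
  then have "(u \<otimes> w) \<otimes> inv (v \<otimes> w) = u \<otimes> ((w \<otimes> inv w) \<otimes> inv v)"
    using c by (simp only: m_assoc m_closed)
  then show ?thesis using assms c by simp
qed

text \<open>The numbers \<open>i\<close> and \<open>j\<close> are those for which deleting \<open>i\<close> edges from \<open>y\<close> and \<open>j\<close> edges from \<open>c\<^sup>\<infinity>\<close> leaves
  the same path; \<open>cocycle_eq\<close> shows that the choice does not matter. The value has a meaning only
  when \<open>(y, k, c\<^sup>\<infinity>)\<close> is an arrow.\<close>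
definition cocycle :: "('v, 'e) epath \<Rightarrow> int \<Rightarrow> 'f" where
  "cocycle y k = (let s = (THE s. y = InfPath s);
      (i, j) = (SOME (i, j). k = int i - int j \<and> sdrop i s = sdrop j cinf)
    in wt (stake i s) \<otimes> inv (wt (stake j cinf)))"

text \<open>Two choices with the same difference differ by common edges deleted from both paths, and
  their weights cancel.\<close>
lemma cocycle_eq:
  assumes s: "s \<in> infinite_paths E" "sdrop i s = sdrop j cinf"
  shows "cocycle (InfPath s) (int i - int j) = wt (stake i s) \<otimes> inv (wt (stake j cinf))"
proof -
  have ext: "wt (stake (i + d) s) \<otimes> inv (wt (stake (j + d) cinf)) = wt (stake i s) \<otimes> inv (wt (stake j cinf))"
    if ij: "sdrop i s = sdrop j cinf" for i j d
  proof -
    have t: "set (stake d (sdrop j cinf)) \<subseteq> arcs E"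
      using stake_arcs infinite_path_stake(2)[OF cinf_infinite] by blast
    have e: "stake (i + d) s = stake i s @ stake d (sdrop j cinf)" using ij by (metis stake_add)
    have e': "stake (j + d) cinf = stake j cinf @ stake d (sdrop j cinf)" by (metis stake_add)
    show ?thesis
      unfolding e e' wt_append[OF stake_arcs[OF s(1)] t] wt_append[OF stake_arcs[OF cinf_infinite] t]
      by (intro unit_cancel_mult wt_unit t stake_arcs s(1) cinf_infinite)
  qed
  define P where "P = (\<lambda>(i', j'). int i - int j = int i' - int j' \<and> sdrop i' s = sdrop j' cinf)"
  have "P (SOME p. P p)" by (rule someI[of P "(i, j)"]) (simp add: P_def s)
  then obtain i' j' where p: "(SOME p. P p) = (i', j')" "int i - int j = int i' - int j'" "sdrop i' s = sdrop j' cinf"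
    by (cases "SOME p. P p") (auto simp: P_def)
  have the: "(THE t. InfPath s = InfPath t) = s" by auto
  have "cocycle (InfPath s) (int i - int j) = wt (stake i' s) \<otimes> inv (wt (stake j' cinf))"
    using p(1) unfolding P_def cocycle_def the by simp
  also have "\<dots> = wt (stake i s) \<otimes> inv (wt (stake j cinf))"
  proof (cases "i \<le> i'")
    case True
    then have "i' = i + (i' - i)" "j' = j + (i' - i)" using p(2) by auto
    then show ?thesis using ext[OF s(2), of "i' - i"] by simp
  next
    case False
    then have "i = i' + (i - i')" "j = j' + (i - i')" using p(2) by auto
    then show ?thesis using ext[OF p(3), of "i - i'"] by simp
  qed
  finally show ?thesis .
qed

lemma tail_lagE:
  assumes "tail_lag s k"
  obtains i j where "s \<in> infinite_paths E" "k = int i - int j" "sdrop i s = sdrop j cinf"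
  using assms by (auto simp: tail_lag_def)

lemma cocycle_unit:
  assumes "(y, k, x0) \<in> groupoid_arrows E"
  shows "cocycle y k \<in> Units F"
proof -
  obtain s where s: "y = InfPath s" "tail_lag s k" using assms by (auto simp: arrow_x0)
  from s(2) obtain i j where "s \<in> infinite_paths E" "k = int i - int j" "sdrop i s = sdrop j cinf"
    by (rule tail_lagE)
  then show ?thesis
    using s(1) wt_unit stake_arcs cinf_infinite by (simp add: cocycle_eq)
qed

text \<open>The new edge is one more edge to be deleted from the source.\<close>
lemma cocycle_edge:
  assumes "(y, k, x0) \<in> groupoid_arrows E" "e \<in> arcs E" "gen_path_act E (Edge e) y = Some y'"
  shows "cocycle y' (k + 1) = a e \<otimes> cocycle y k"
proof -
  obtain s where s: "y = InfPath s" "tail_lag s k" using assms by (auto simp: arrow_x0)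
  from s(2) obtain i j where ij: "s \<in> infinite_paths E" "k = int i - int j" "sdrop i s = sdrop j cinf"
    by (rule tail_lagE)
  have y': "y' = InfPath (e ## s)" "head E e = tail E (shd s)"
    using assms(3) s(1) by (auto split: if_splits)
  have es: "e ## s \<in> infinite_paths E" using ij(1) y' assms(2) by (simp add: infinite_SCons)
  have "cocycle (InfPath (e ## s)) (int (Suc i) - int j) = wt (stake (Suc i) (e ## s)) \<otimes> inv (wt (stake j cinf))"
    by (rule cocycle_eq[OF es]) (simp add: ij(3))
  also have "\<dots> = a e \<otimes> (wt (stake i s) \<otimes> inv (wt (stake j cinf)))"
    using wt_unit[OF stake_arcs[OF ij(1)], of i] wt_unit[OF stake_arcs[OF cinf_infinite], of j] a_units[OF assms(2)]
    by (simp add: path_weight_def m_assoc Units_closed)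
  also have "\<dots> = a e \<otimes> cocycle y k" using cocycle_eq[OF ij(1,3)] s(1) ij(2) by simp
  finally have "cocycle (InfPath (e ## s)) (int (Suc i) - int j) = a e \<otimes> cocycle y k" .
  moreover have "int (Suc i) - int j = k + 1" using ij(2) by simp
  ultimately show ?thesis using y'(1) by (simp only:)
qed

lemma cocycle_gen:
  assumes "g \<in> leavitt_gens E" "(y, k, x0) \<in> groupoid_arrows E" "gen_path_act E g y = Some y'"
  shows "cocycle y' (k + gen_degree g) = gen_weight F a g \<otimes> cocycle y k"
proof (cases g)
  case (Vtx v)
  then show ?thesis using assms cocycle_unit[OF assms(2)] by (auto split: if_splits)
next
  case (Edge e)
  then show ?thesis using assms cocycle_edge by (auto simp: leavitt_gens_def)
next
  case (Ghost e)
  then have e: "e \<in> arcs E" using assms by (auto simp: leavitt_gens_def)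
  have y: "y \<in> boundary_paths E" using groupoid_arrows_boundary(1)[OF assms(2)] .
  have arr: "(y', k - 1, x0) \<in> groupoid_arrows E" using arrow_shift[OF assms] Ghost by simp
  have "gen_path_act E (Edge e) y' = Some y"
    using gen_path_act_inverse(2)[OF assms(1) y assms(3)] Ghost by simp
  from cocycle_edge[OF arr e this] have "cocycle y k = a e \<otimes> cocycle y' (k - 1)" by simp
  then have "inv (a e) \<otimes> cocycle y k = cocycle y' (k - 1)"
    using a_units[OF e] cocycle_unit[OF arr] by (simp add: m_assoc[symmetric] Units_closed)
  then show ?thesis by (simp add: Ghost)
qed

text \<open>Since the common tail repeats with the length of \<open>c\<close>, this many further edges can be deleted
  from \<open>y\<close> alone. They form a rotation of \<open>c\<close>, and in a commutative ring they have the weight of \<open>c\<close>.\<close>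
lemma cocycle_period:
  assumes "(y, k, x0) \<in> groupoid_arrows E"
  shows "cocycle y (k + int len) = cocycle y k \<otimes> wt c"
proof -
  obtain s where s: "y = InfPath s" "tail_lag s k" using assms by (auto simp: arrow_x0)
  from s(2) obtain i j where ij: "s \<in> infinite_paths E" "k = int i - int j" "sdrop i s = sdrop j cinf"
    by (rule tail_lagE)
  let ?r = "stake len (sdrop j cinf)"
  have r: "set ?r \<subseteq> arcs E" using stake_arcs infinite_path_stake(2)[OF cinf_infinite] by blast
  have carcs: "set c \<subseteq> arcs E" by (metis c_awalk awalkE)
  have u: "wt ?r \<in> carrier F" "wt c \<in> carrier F" "wt (stake j cinf) \<in> Units F" "wt (stake i s) \<in> carrier F"
    using wt_unit[OF r] wt_unit[OF carcs] wt_unit[OF stake_arcs[OF cinf_infinite], of j] wt_unit[OF stake_arcs[OF ij(1)], of i]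
    by (auto simp: Units_closed)
  have "stake j cinf @ ?r = stake len cinf @ stake j (sdrop len cinf)"
    by (simp only: stake_add add.commute)
  also have "\<dots> = c @ stake j cinf" using c_nonempty by simp
  finally have "wt (stake j cinf) \<otimes> wt ?r = wt c \<otimes> wt (stake j cinf)"
    using wt_append r carcs stake_arcs[OF cinf_infinite] by metis
  then have rc: "wt ?r = wt c"
    using u by (metis Units_closed Units_l_cancel m_comm)
  have "sdrop (i + len) s = sdrop (j + len) cinf" using ij(3) by (metis sdrop_add)
  then have "sdrop (i + len) s = sdrop j cinf" by (simp only: sdrop_cinf_shift)
  then have "cocycle y (int (i + len) - int j) = wt (stake (i + len) s) \<otimes> inv (wt (stake j cinf))"
    unfolding s(1) by (rule cocycle_eq[OF ij(1)])
  also have "stake (i + len) s = stake i s @ ?r" using ij(3) by (metis stake_add)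
  finally have "cocycle y (int (i + len) - int j) = wt (stake i s) \<otimes> wt c \<otimes> inv (wt (stake j cinf))"
    using wt_append[OF stake_arcs[OF ij(1)] r] rc by simp
  also have "\<dots> = wt (stake i s) \<otimes> inv (wt (stake j cinf)) \<otimes> wt c"
    using u by (simp add: m_ac)
  also have "wt (stake i s) \<otimes> inv (wt (stake j cinf)) = cocycle y k" using cocycle_eq[OF ij(1,3)] s(1) ij(2) by simp
  finally have "cocycle y (int (i + len) - int j) = cocycle y k \<otimes> wt c" .
  moreover have "int (i + len) - int j = k + int len" using ij(2) by simp
  ultimately show ?thesis by (simp only:)
qed

end

section \<open>The twisted Chen action as convolution\<close>

context steinberg
begin

lemma row_conv_add_right:
  fixes n n' f :: "('v, 'e) arrow \<Rightarrow> 'k"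
  assumes "row_finite K f" "\<And>u. n u \<in> carrier K" "\<And>u. n' u \<in> carrier K"
  shows "row_conv K f (\<lambda>u. n u \<oplus> n' u) = (\<lambda>u. row_conv K f n u \<oplus> row_conv K f n' u)"
proof
  fix u :: "('v, 'e) arrow"
  obtain y k x where u: "u = (y, k, x)" by (cases u) auto
  have "lincomb K (row f y) (\<lambda>a. n (snd a, k - fst a, x) \<oplus> n' (snd a, k - fst a, x)) =
     lincomb K (row f y) (\<lambda>a. n (snd a, k - fst a, x)) \<oplus> lincomb K (row f y) (\<lambda>a. n' (snd a, k - fst a, x))"
    using assms by (intro lincomb_add_right) (auto simp: row_finite_def)
  then show "row_conv K f (\<lambda>u. n u \<oplus> n' u) u = row_conv K f n u \<oplus> row_conv K f n' u"
    by (simp add: u row_conv_def case_prod_beta')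
qed

lemma row_conv_smult_right:
  fixes n f :: "('v, 'e) arrow \<Rightarrow> 'k"
  assumes "row_finite K f" "\<And>u. n u \<in> carrier K" "k \<in> carrier K"
  shows "row_conv K f (\<lambda>u. k \<otimes> n u) = (\<lambda>u. k \<otimes> row_conv K f n u)"
proof
  fix u :: "('v, 'e) arrow"
  obtain y j x where u: "u = (y, j, x)" by (cases u) auto
  have "lincomb K (row f y) (\<lambda>a. k \<otimes> n (snd a, j - fst a, x)) = k \<otimes> lincomb K (row f y) (\<lambda>a. n (snd a, j - fst a, x))"
    using assms by (intro lincomb_smult_right) (auto simp: row_finite_def)
  then show "row_conv K f (\<lambda>u. k \<otimes> n u) u = k \<otimes> row_conv K f n u"
    by (simp add: u row_conv_def case_prod_beta')
qed

lemma row_conv_add_left: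
  fixes n f g :: "('v, 'e) arrow \<Rightarrow> 'k"
  assumes "row_finite K f" "row_finite K g" "\<And>u. n u \<in> carrier K"
  shows "row_conv K (\<lambda>u. f u \<oplus> g u) n = (\<lambda>u. row_conv K f n u \<oplus> row_conv K g n u)"
proof
  fix u :: "('v, 'e) arrow"
  obtain y k x where u: "u = (y, k, x)" by (cases u) auto
  have "row (\<lambda>u. f u \<oplus> g u) y = (\<lambda>a. row f y a \<oplus> row g y a)" by (auto simp: row_def)
  then show "row_conv K (\<lambda>u. f u \<oplus> g u) n u = row_conv K f n u \<oplus> row_conv K g n u"
    using assms by (simp add: u row_conv_def case_prod_beta' row_finite_def lincomb_add_left)
qed

lemma row_conv_smult_left:
  fixes n f :: "('v, 'e) arrow \<Rightarrow> 'k"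
  assumes "row_finite K f" "k \<in> carrier K" "\<And>u. n u \<in> carrier K"
  shows "row_conv K (\<lambda>u. k \<otimes> f u) n = (\<lambda>u. k \<otimes> row_conv K f n u)"
proof
  fix u :: "('v, 'e) arrow"
  obtain y j x where u: "u = (y, j, x)" by (cases u) auto
  have "row (\<lambda>u. k \<otimes> f u) y = (\<lambda>a. k \<otimes> row f y a)" by (auto simp: row_def)
  then show "row_conv K (\<lambda>u. k \<otimes> f u) n u = k \<otimes> row_conv K f n u"
    using assms by (simp add: u row_conv_def case_prod_beta' row_finite_def lincomb_smult_left)
qed

lemma row_conv_zero_left: "row_conv K (\<lambda>_. \<zero>) n = (\<lambda>_. \<zero>)"
  by (auto simp: row_conv_def row_def case_prod_beta' fun_eq_iff)

end

definition chen_act :: "('v, 'e) pre_digraph \<Rightarrow> ('f, 's) ring_scheme \<Rightarrow> ('v, 'e) epath \<Rightarrow> (('v, 'e) word \<Rightarrow> 'f)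
    \<Rightarrow> (('v, 'e) epath \<Rightarrow> 'f) \<Rightarrow> ('v, 'e) epath \<Rightarrow> 'f" where
  "chen_act E F x p m = (\<Oplus>\<^bsub>free_vs F (tail_class E x)\<^esub>w \<in> {w. p w \<noteq> \<zero>\<^bsub>F\<^esub>}.
     p w \<odot>\<^bsub>free_vs F (tail_class E x)\<^esub> foldr (gen_act E F) w m)"

definition word_twist :: "('v, 'e) pre_digraph \<Rightarrow> ('f, 's) ring_scheme \<Rightarrow> ('e \<Rightarrow> 'f)
    \<Rightarrow> (('v, 'e) word \<Rightarrow> 'f) \<Rightarrow> ('v, 'e) word \<Rightarrow> 'f" where
  "word_twist E F a p = (\<lambda>w. if w \<in> leavitt_words E
     then foldr (\<lambda>g x. gen_weight F a g \<otimes>\<^bsub>F\<^esub> x) w \<one>\<^bsub>F\<^esub> \<otimes>\<^bsub>F\<^esub> p w else \<zero>\<^bsub>F\<^esub>)"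

lemma free_vs_ops:
  "ring.zero (free_vs R A) = (\<lambda>_. \<zero>\<^bsub>R\<^esub>)" "ring.add (free_vs R A) = (\<lambda>f g s. f s \<oplus>\<^bsub>R\<^esub> g s)"
  "module.smult (free_vs R A) = (\<lambda>k f s. k \<otimes>\<^bsub>R\<^esub> f s)"
  by (simp_all add: free_vs_def)

context weighted
begin

sublocale FS: steinberg E F by unfold_locales

abbreviation "X0 \<equiv> tail_class E x0"
abbreviation "V0 \<equiv> free_vs F X0"
abbreviation "word_weight w \<equiv> foldr (\<lambda>g x. gen_weight F a g \<otimes> x) w \<one>"

sublocale V0: module F V0 by (rule module_free_vs) simp_all

lemma V0_closed: "m \<in> carrier V0 \<Longrightarrow> m y \<in> carrier F"
  by (rule fin_suppD[OF carrier_free_vs_fin_supp])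

lemma V0_supp: "m \<in> carrier V0 \<Longrightarrow> m y \<noteq> \<zero> \<Longrightarrow> y \<in> X0"
  by (auto simp: carrier_free_vs)

lemma V0_finite: "m \<in> carrier V0 \<Longrightarrow> finite {y. m y \<noteq> \<zero>}"
  by (simp add: carrier_free_vs)

lemma V0_memI:
  assumes "\<And>y. m y \<in> carrier F" "\<And>y. y \<notin> X0 \<Longrightarrow> m y = \<zero>" "finite {y. m y \<noteq> \<zero>}"
  shows "m \<in> carrier V0"
  using assms by (simp add: carrier_free_vs)

text \<open>Division by the cocycle, which turns the weighted action of a generator into the unweighted
  operator \<open>gen_shift\<close>, see \<open>lift_gen_act\<close>.\<close>
definition lift :: "(('v, 'e) epath \<Rightarrow> 'f) \<Rightarrow> ('v, 'e) arrow \<Rightarrow> 'f" where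
  "lift m = (\<lambda>(y, k, x). if (y, k, x) \<in> L_arrows E x0 then inv (cocycle y k) \<otimes> m y else \<zero>)"

lemma cocycle_L: "(y, k, x) \<in> L_arrows E x0 \<Longrightarrow> cocycle y k \<in> Units F"
  using cocycle_unit by (simp add: mem_L_arrows)

lemma lift_closed: "(\<And>y. m y \<in> carrier F) \<Longrightarrow> lift m u \<in> carrier F"
  using cocycle_L by (cases u) (auto simp: lift_def)

lemma lift_outside: "y \<notin> boundary_paths E \<Longrightarrow> lift m (y, k, x) = \<zero>"
  using groupoid_arrows_boundary(1) by (auto simp: lift_def mem_L_arrows)

lemma lift_add:
  assumes "\<And>y. m y \<in> carrier F" "\<And>y. m' y \<in> carrier F"
  shows "lift (\<lambda>y. m y \<oplus> m' y) = (\<lambda>u. lift m u \<oplus> lift m' u)"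
  using cocycle_L assms by (auto simp: lift_def fun_eq_iff r_distr)

lemma lift_smult:
  assumes "\<And>y. m y \<in> carrier F" "k \<in> carrier F"
  shows "lift (\<lambda>y. k \<otimes> m y) = (\<lambda>u. k \<otimes> lift m u)"
  using cocycle_L assms by (auto simp: lift_def fun_eq_iff m_lcomm)

lemma lift_zero: "lift (\<lambda>_. \<zero>) = (\<lambda>_. \<zero>)"
  using cocycle_L by (auto simp: lift_def fun_eq_iff)

text \<open>Every path in the tail class is the source of an arrow into the base path, and the cocycle is
  a unit there.\<close>
lemma lift_inj:
  assumes "m \<in> carrier V0" "m' \<in> carrier V0" "lift m = lift m'"
  shows "m = m'"
proof
  fix y
  show "m y = m' y"
  proof (cases "y \<in> X0")
    case True
    then obtain k where k: "(y, k, x0) \<in> L_arrows E x0" by (auto simp: tail_class_arrow mem_L_arrows)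
    then have "inv (cocycle y k) \<otimes> m y = inv (cocycle y k) \<otimes> m' y"
      using fun_cong[OF assms(3), of "(y, k, x0)"] by (simp add: lift_def)
    then show ?thesis using cocycle_L[OF k] V0_closed assms(1,2) by (simp add: Units_l_cancel)
  next
    case False
    then show ?thesis using assms(1,2) V0_supp by metis
  qed
qed

lemma lift_lincomb:
  assumes "p \<in> fin_supp F" "\<And>s y. N s y \<in> carrier F"
  shows "lift (\<lambda>y. lincomb F p (\<lambda>s. N s y)) = (\<lambda>u. lincomb F p (\<lambda>s. lift (N s) u))"
  using cocycle_L assms by (auto simp: lift_def fun_eq_iff lincomb_smult_right)

lemma X0_boundary: "y \<in> X0 \<Longrightarrow> y \<in> boundary_paths E"
  using groupoid_arrows_boundary(1) by (auto simp: tail_class_arrow)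

lemma X0_gen: "y \<in> X0 \<Longrightarrow> g \<in> leavitt_gens E \<Longrightarrow> gen_path_act E g y = Some y' \<Longrightarrow> y' \<in> X0"
  unfolding tail_class_arrow using arrow_shift by blast

text \<open>A generator acts on paths as a partial bijection whose inverse is \<open>gen_star g\<close>, so that the
  defining sum has at most one term.\<close>
lemma gen_act_eq:
  assumes m: "m \<in> carrier V0" and g: "g \<in> leavitt_gens E"
  shows "gen_act E F g m q = (if q \<in> boundary_paths E then
     (case gen_path_act E (gen_star g) q of None \<Rightarrow> \<zero> | Some p \<Rightarrow> m p) else \<zero>)"
proof -
  have iff: "gen_path_act E g p = Some q \<longleftrightarrow> q \<in> boundary_paths E \<and> gen_path_act E (gen_star g) q = Some p"
    if "m p \<noteq> \<zero>" for p
  proof -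
    have p: "p \<in> boundary_paths E" using X0_boundary V0_supp[OF m that] by blast
    show ?thesis using gen_path_act_inverse(1)[OF g p] gen_path_act_iff[OF g p] by blast
  qed
  define A where "A = {p. m p \<noteq> \<zero> \<and> gen_path_act E g p = Some q}"
  show ?thesis
  proof (cases "q \<in> boundary_paths E \<and> gen_path_act E (gen_star g) q \<noteq> None")
    case True
    then obtain p where p: "q \<in> boundary_paths E" "gen_path_act E (gen_star g) q = Some p" by auto
    then have "A = (if m p = \<zero> then {} else {p})" using iff by (auto simp: A_def)
    then have "(\<Oplus>p\<in>A. m p) = m p" using V0_closed[OF m] by simp
    then show ?thesis using p by (simp add: gen_act_def A_def)
  next
    case False
    then have "A = {}" using iff by (auto simp: A_def)
    then have "(\<Oplus>p\<in>A. m p) = \<zero>" by simp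
    then show ?thesis using False by (auto simp: gen_act_def A_def split: option.splits)
  qed
qed

lemma gen_act_V0:
  assumes m: "m \<in> carrier V0" and g: "g \<in> leavitt_gens E"
  shows "gen_act E F g m \<in> carrier V0"
proof (rule V0_memI)
  have nz: "\<exists>p. m p \<noteq> \<zero> \<and> gen_path_act E g p = Some q" if "gen_act E F g m q \<noteq> \<zero>" for q
  proof (rule ccontr)
    assume "\<nexists>p. m p \<noteq> \<zero> \<and> gen_path_act E g p = Some q"
    then have e: "{p. m p \<noteq> \<zero> \<and> gen_path_act E g p = Some q} = {}" by simp
    have "gen_act E F g m q = \<zero>" unfolding gen_act_def e by simp
    then show False using that by simp
  qed
  show "gen_act E F g m q \<in> carrier F" for q
    using V0_closed[OF m] by (auto simp: gen_act_eq[OF m g] split: option.splits)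
  show "gen_act E F g m q = \<zero>" if "q \<notin> X0" for q
    using nz[of q] that V0_supp[OF m] X0_gen[OF _ g] by blast
  have "{q. gen_act E F g m q \<noteq> \<zero>} \<subseteq> (\<lambda>p. the (gen_path_act E g p)) ` {p. m p \<noteq> \<zero>}"
    using nz by force
  then show "finite {q. gen_act E F g m q \<noteq> \<zero>}"
    using V0_finite[OF m] finite_surj by blast
qed

lemma gen_weight_unit: "g \<in> leavitt_gens E \<Longrightarrow> gen_weight F a g \<in> Units F"
  by (cases g) (auto simp: leavitt_gens_def a_units)

text \<open>By \<open>cocycle_gen\<close> the weight of the generator is the factor by which the cocycle changes.\<close>
lemma lift_gen_act:
  assumes m: "m \<in> carrier V0" and g: "g \<in> leavitt_gens E"
  shows "lift (\<lambda>q. gen_weight F a g \<otimes> gen_act E F g m q) = gen_shift E F g (lift m)"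
proof
  fix u :: "('v, 'e) arrow"
  obtain y k x where u: "u = (y, k, x)" by (cases u) auto
  have wc: "gen_weight F a g \<in> carrier F" using gen_weight_unit[OF g] by blast
  show "lift (\<lambda>q. gen_weight F a g \<otimes> gen_act E F g m q) u = gen_shift E F g (lift m) u"
  proof (cases "y \<in> boundary_paths E")
    case False
    then show ?thesis by (simp add: u lift_outside gen_shift_outside)
  next
    case True
    show ?thesis
    proof (cases "gen_path_act E (gen_star g) y")
      case None
      then show ?thesis
        using True cocycle_L wc by (auto simp: u lift_def gen_shift_def gen_act_eq[OF m g])
    next
      case (Some y')
      have gs: "gen_star g \<in> leavitt_gens E" using g by simp
      have y': "y' \<in> boundary_paths E" "gen_path_act E g y' = Some y"
        using gen_path_act_inverse[OF gs True Some] by simp_all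
      have arr: "(y, k, x) \<in> L_arrows E x0 \<longleftrightarrow> (y', k - gen_degree g, x) \<in> L_arrows E x0"
      proof -
        have "(y, k, x0) \<in> groupoid_arrows E \<Longrightarrow> (y', k - gen_degree g, x0) \<in> groupoid_arrows E"
          using arrow_shift[OF gs _ Some, of k x0] by simp
        moreover have "(y', k - gen_degree g, x0) \<in> groupoid_arrows E \<Longrightarrow> (y, k, x0) \<in> groupoid_arrows E"
          using arrow_shift[OF g _ y'(2), of "k - gen_degree g" x0] by simp
        ultimately show ?thesis by (auto simp: mem_L_arrows)
      qed
      show ?thesis
      proof (cases "(y, k, x) \<in> L_arrows E x0")
        case False
        then show ?thesis using arr True Some by (simp add: u lift_def gen_shift_def)
      next
        case L: True
        then have L': "(y', k - gen_degree g, x) \<in> L_arrows E x0" using arr by simp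
        have "cocycle y (k - gen_degree g + gen_degree g) = gen_weight F a g \<otimes> cocycle y' (k - gen_degree g)"
          using L' by (intro cocycle_gen[OF g _ y'(2)]) (simp add: mem_L_arrows)
        then have cocycle: "cocycle y k = gen_weight F a g \<otimes> cocycle y' (k - gen_degree g)" by simp
        have mc: "m y' \<in> carrier F" by (rule V0_closed[OF m])
        have u1: "gen_weight F a g \<in> Units F" "cocycle y' (k - gen_degree g) \<in> Units F" "cocycle y k \<in> Units F"
          using gen_weight_unit[OF g] cocycle_L[OF L'] cocycle_L[OF L] by auto
        have "cocycle y k \<otimes> (inv (cocycle y k) \<otimes> (gen_weight F a g \<otimes> m y')) = gen_weight F a g \<otimes> m y'"
          using u1 mc by (simp add: m_assoc[symmetric] Units_closed)
        moreover have "cocycle y k \<otimes> (inv (cocycle y' (k - gen_degree g)) \<otimes> m y') = gen_weight F a g \<otimes> m y'"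
        proof -
          have "cocycle y k \<otimes> (inv (cocycle y' (k - gen_degree g)) \<otimes> m y')
              = gen_weight F a g \<otimes> ((cocycle y' (k - gen_degree g) \<otimes> inv (cocycle y' (k - gen_degree g))) \<otimes> m y')"
            unfolding cocycle using u1(1,2) mc by (simp only: m_assoc m_closed Units_closed Units_inv_closed)
          then show ?thesis using u1 mc by (simp add: Units_closed)
        qed
        ultimately have "inv (cocycle y k) \<otimes> (gen_weight F a g \<otimes> m y') = inv (cocycle y' (k - gen_degree g)) \<otimes> m y'"
          using u1 mc wc Units_l_cancel[OF u1(3), of "inv (cocycle y k) \<otimes> (gen_weight F a g \<otimes> m y')" "inv (cocycle y' (k - gen_degree g)) \<otimes> m y'"]
          by simp
        then show ?thesis
          using L L' True Some by (simp add: u lift_def gen_shift_def gen_act_eq[OF m g])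
      qed
    qed
  qed
qed

lemma word_weight_unit: "set w \<subseteq> leavitt_gens E \<Longrightarrow> word_weight w \<in> Units F"
  by (induction w) (auto simp: gen_weight_unit)

lemma gen_act_smult:
  assumes m: "m \<in> carrier V0" and g: "g \<in> leavitt_gens E" and k: "k \<in> carrier F"
  shows "gen_act E F g (\<lambda>q. k \<otimes> m q) q = k \<otimes> gen_act E F g m q"
proof -
  have "(\<lambda>q. k \<otimes> m q) \<in> carrier V0" using V0.smult_closed[OF k m] by (simp add: free_vs_ops)
  then show ?thesis using k by (simp add: gen_act_eq g m split: option.splits)
qed

lemma word_act:
  assumes m: "m \<in> carrier V0" and w: "set w \<subseteq> leavitt_gens E"
  shows "foldr (gen_act E F) w m \<in> carrier V0"
    and "lift (\<lambda>q. word_weight w \<otimes> foldr (gen_act E F) w m q) = word_shift E F w (lift m)"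
proof -
  have "foldr (gen_act E F) w m \<in> carrier V0 \<and>
      lift (\<lambda>q. word_weight w \<otimes> foldr (gen_act E F) w m q) = word_shift E F w (lift m)"
    using w
  proof (induction w)
    case Nil
    then show ?case using m V0_closed[OF m] by simp
  next
    case (Cons g w)
    then have g: "g \<in> leavitt_gens E" and w: "set w \<subseteq> leavitt_gens E"
      and IH: "foldr (gen_act E F) w m \<in> carrier V0"
        "lift (\<lambda>q. word_weight w \<otimes> foldr (gen_act E F) w m q) = word_shift E F w (lift m)" by auto
    let ?m = "foldr (gen_act E F) w m"
    have ww: "word_weight w \<in> carrier F" "gen_weight F a g \<in> carrier F"
      using word_weight_unit[OF w] gen_weight_unit[OF g] by (auto simp: Units_closed)
    have wm: "(\<lambda>q. word_weight w \<otimes> ?m q) \<in> carrier V0"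
      using V0.smult_closed[OF ww(1) IH(1)] by (simp add: free_vs_ops)
    have "lift (\<lambda>q. word_weight (g # w) \<otimes> gen_act E F g ?m q) =
        lift (\<lambda>q. gen_weight F a g \<otimes> gen_act E F g (\<lambda>q. word_weight w \<otimes> ?m q) q)"
      using ww V0_closed[OF gen_act_V0[OF IH(1) g]] by (simp add: gen_act_smult[OF IH(1) g ww(1)] m_assoc)
    also have "\<dots> = gen_shift E F g (lift (\<lambda>q. word_weight w \<otimes> ?m q))"
      by (rule lift_gen_act[OF wm g])
    finally show ?case using IH gen_act_V0[OF IH(1) g] by simp
  qed
  then show "foldr (gen_act E F) w m \<in> carrier V0"
    "lift (\<lambda>q. word_weight w \<otimes> foldr (gen_act E F) w m q) = word_shift E F w (lift m)" by auto
qed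

lemma words_gens: "w \<in> leavitt_words E \<Longrightarrow> set w \<subseteq> leavitt_gens E"
  by (simp add: leavitt_words_gens)

lemma chen_act_V0:
  assumes p: "p \<in> carrier FS.LF" and m: "m \<in> carrier V0"
  shows "chen_act E F x0 p m \<in> carrier V0"
    and "chen_act E F x0 p m = (\<lambda>q. lincomb F p (\<lambda>w. foldr (gen_act E F) w m q))"
proof -
  have c: "p w \<odot>\<^bsub>V0\<^esub> foldr (gen_act E F) w m \<in> carrier V0" if "p w \<noteq> \<zero>" for w
    using word_act(1)[OF m words_gens[OF FS.LF_supp[OF p that]]] fin_suppD[OF FS.LF_fin_supp[OF p]] by simp
  show "chen_act E F x0 p m \<in> carrier V0"
    unfolding chen_act_def by (rule V0.M.finsum_closed) (use c in auto)
  show "chen_act E F x0 p m = (\<lambda>q. lincomb F p (\<lambda>w. foldr (gen_act E F) w m q))"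
  proof
    fix q
    have "chen_act E F x0 p m q = (\<Oplus>w\<in>{w. p w \<noteq> \<zero>}. (p w \<odot>\<^bsub>V0\<^esub> foldr (gen_act E F) w m) q)"
      unfolding chen_act_def
      by (rule finsum_pointwise[OF V0.M.abelian_monoid_axioms abelian_monoid_axioms])
         (use c V0_closed in \<open>auto simp: free_vs_ops\<close>)
    then show "chen_act E F x0 p m q = lincomb F p (\<lambda>w. foldr (gen_act E F) w m q)"
      by (simp add: lincomb_def free_vs_ops)
  qed
qed

lemma word_twist_LF:
  assumes "p \<in> carrier FS.LF"
  shows "word_twist E F a p \<in> carrier FS.LF"
proof -
  have c: "word_twist E F a p w \<in> carrier F" for w
    using word_weight_unit[OF words_gens, of w] fin_suppD[OF FS.LF_fin_supp[OF assms]]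
    by (simp add: word_twist_def Units_closed)
  have "finite {w. word_twist E F a p w \<noteq> \<zero>}"
    by (rule finite_subset[OF _ fin_supp_finite[OF FS.LF_fin_supp[OF assms]]])
       (use word_weight_unit[OF words_gens] in \<open>auto simp: word_twist_def Units_closed\<close>)
  moreover have "word_twist E F a p w = \<zero>" if "w \<notin> leavitt_words E" for w
    using that by (simp add: word_twist_def)
  ultimately show ?thesis using c unfolding leavitt_free_simps carrier_free_vs by blast
qed

text \<open>The twist supplies each word with the product of the weights of its letters, which is what
  \<open>word_act\<close> consumes.\<close>
lemma lift_chen_twist:
  assumes p: "p \<in> carrier FS.LF" and m: "m \<in> carrier V0"
  shows "lift (chen_act E F x0 (word_twist E F a p) m) = row_conv F (word_eval E F p) (lift m)"
proof -
  let ?W = "leavitt_words E"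
  define N where "N = (\<lambda>w q. if w \<in> ?W then word_weight w \<otimes> foldr (gen_act E F) w m q else \<zero>)"
  have pf: "p \<in> fin_supp F" by (rule FS.LF_fin_supp[OF p])
  note tf = FS.LF_fin_supp[OF word_twist_LF[OF p]]
  have mc: "foldr (gen_act E F) w m q \<in> carrier F" if "w \<in> ?W" for w q
    using V0_closed[OF word_act(1)[OF m words_gens[OF that]]] .
  have ww: "word_weight w \<in> carrier F" if "w \<in> ?W" for w
    using word_weight_unit[OF words_gens[OF that]] by (rule Units_closed)
  have Nc: "N w q \<in> carrier F" for w q using mc ww by (simp add: N_def)
  have "chen_act E F x0 (word_twist E F a p) m = (\<lambda>q. lincomb F p (\<lambda>w. N w q))"
  proof
    fix q
    \<comment> \<open>Lists that are not words over the generators have no meaningful action and get the value zero.\<close>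
    define h where "h = (\<lambda>w. if w \<in> ?W then foldr (gen_act E F) w m q else \<zero>)"
    have hc: "h w \<in> carrier F" for w using mc by (simp add: h_def)
    have "lincomb F (word_twist E F a p) (\<lambda>w. foldr (gen_act E F) w m q) = lincomb F (word_twist E F a p) h"
      by (rule lincomb_cong[OF tf]) (auto simp: h_def word_twist_def mc split: if_splits)
    also have "\<dots> = (\<Oplus>w\<in>{w. p w \<noteq> \<zero>}. word_twist E F a p w \<otimes> h w)"
      by (rule lincomb_superset[OF tf fin_supp_finite[OF pf]]) (use ww hc in \<open>auto simp: word_twist_def\<close>)
    also have "\<dots> = (\<Oplus>w\<in>{w. p w \<noteq> \<zero>}. p w \<otimes> N w q)"
      by (rule finsum_cong')
         (use ww mc Nc fin_suppD[OF pf] in \<open>auto simp: word_twist_def h_def N_def m_ac\<close>)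
    finally show "chen_act E F x0 (word_twist E F a p) m q = lincomb F p (\<lambda>w. N w q)"
      by (simp add: chen_act_V0(2)[OF word_twist_LF[OF p] m] lincomb_def)
  qed
  then have "lift (chen_act E F x0 (word_twist E F a p) m) = (\<lambda>u. lincomb F p (\<lambda>w. lift (N w) u))"
    by (simp add: lift_lincomb[OF pf Nc])
  also have "\<dots> = (\<lambda>u. lincomb F p (\<lambda>w. word_shift E F w (lift m) u))"
  proof
    fix u
    show "lincomb F p (\<lambda>w. lift (N w) u) = lincomb F p (\<lambda>w. word_shift E F w (lift m) u)"
    proof (rule lincomb_cong[OF pf])
      fix w assume "p w \<noteq> \<zero>"
      then have w: "w \<in> ?W" by (rule FS.LF_supp[OF p])
      show "lift (N w) u \<in> carrier F" by (rule lift_closed[OF Nc])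
      show "lift (N w) u = word_shift E F w (lift m) u"
        using word_act(2)[OF m words_gens[OF w]] w by (simp add: N_def)
    qed
  qed
  also have "\<dots> = row_conv F (word_eval E F p) (lift m)"
    by (rule FS.row_conv_word_eval[symmetric, OF pf])
       (simp_all add: lift_closed V0_closed[OF m] lift_outside)
  finally show ?thesis .
qed

lemma chen_act_twist_kernel:
  assumes "p \<in> carrier FS.LF" "word_eval E F p = (\<lambda>_. \<zero>)" "m \<in> carrier V0"
  shows "chen_act E F x0 (word_twist E F a p) m = (\<lambda>_. \<zero>)"
proof (rule lift_inj)
  show "chen_act E F x0 (word_twist E F a p) m \<in> carrier V0"
    by (rule chen_act_V0(1)[OF word_twist_LF[OF assms(1)] assms(3)])
  show "(\<lambda>_. \<zero>) \<in> carrier V0" using V0.M.zero_closed by (simp add: free_vs_ops)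
  show "lift (chen_act E F x0 (word_twist E F a p) m) = lift (\<lambda>_. \<zero>)"
    using assms by (simp add: lift_chen_twist FS.row_conv_zero_left lift_zero)
qed

end

section \<open>The restricted Chen module\<close>

lemma (in weighted) gen_act_closed:
  "(\<And>y. m y \<in> carrier F) \<Longrightarrow> gen_act E F g m q \<in> carrier F"
  unfolding gen_act_def by (intro finsum_closed) auto

lemma (in weighted) word_act_closed:
  "(\<And>y. m y \<in> carrier F) \<Longrightarrow> foldr (gen_act E F) w m q \<in> carrier F"
  by (induction w arbitrary: q) (auto intro: gen_act_closed)

lemma (in weighted) chen_act_add:
  assumes "p \<in> carrier FS.LF" "q \<in> carrier FS.LF" "m \<in> carrier V0"
  shows "chen_act E F x0 (p \<oplus>\<^bsub>FS.LF\<^esub> q) m = (\<lambda>y. chen_act E F x0 p m y \<oplus> chen_act E F x0 q m y)"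
proof -
  have "p \<oplus>\<^bsub>FS.LF\<^esub> q \<in> carrier FS.LF" using assms by simp
  then show ?thesis
    using assms by (simp add: chen_act_V0(2) FS.LF_ops lincomb_add_left FS.LF_fin_supp word_act_closed V0_closed)
qed

locale chen_setting = laurent_quot K f + closed_walk E c
  for E :: "('v, 'e) pre_digraph" and K :: "('k, 'r) ring_scheme" (structure) and c :: "'e list" and f :: "'k list" +
  fixes a :: "'e \<Rightarrow> (int \<Rightarrow> 'k) set"
  assumes a_nonzero: "\<And>e. e \<in> arcs E \<Longrightarrow> a e \<in> carrier F - {\<zero>\<^bsub>F\<^esub>}"
    and a_cycle: "path_weight F a c = laurent_tbar K f"
begin

sublocale KS: steinberg E K by unfold_locales

sublocale W: weighted E c F a
  by unfold_locales (use a_nonzero F_unit in auto)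

sublocale T: weighted E c F "\<lambda>_. \<one>\<^bsub>F\<^esub>"
  by unfold_locales simp

abbreviation "chenV \<equiv> (as_steinberg_module E K (restricted_chen_module E K f a c)
  :: ('k, ('v, 'e) arrow \<Rightarrow> 'k, ('v, 'e) epath \<Rightarrow> (int \<Rightarrow> 'k) set) alg_module)"

lemma chenV_simps:
  "carrier chenV = carrier W.V0" "ring.zero chenV = ring.zero W.V0" "ring.add chenV = ring.add W.V0"
  "module.smult chenV = (\<lambda>k. module.smult W.V0 (emb k))"
  "act chenV s m = quotient_lift (\<lambda>p. chen_act E F x0 p m) (leavitt_twist E F a (leavitt_base_change E F emb
     (inv_into (carrier (leavitt_algebra E K)) (leavitt_to_steinberg E K) s)))"
  by (simp_all add: as_steinberg_module_def restrict_module_def restricted_chen_module_def twisted_chen_module_def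
      chen_module_def Let_def module.defs alg_module.defs chen_act_def)

lemma emb_gen_shift: "(\<And>u. n u \<in> carrier K) \<Longrightarrow> emb (gen_shift E K g n u) = gen_shift E F g (\<lambda>u. emb (n u)) u"
  by (cases u) (auto simp: gen_shift_def split: option.splits)

lemma emb_word_shift: "emb (word_shift E K w (unit_indicator E K) u) = word_shift E F w (unit_indicator E F) u"
proof (induction w arbitrary: u)
  case Nil
  then show ?case by (cases u) (auto simp: unit_indicator_def)
next
  case (Cons g w)
  then show ?case by (simp add: emb_gen_shift KS.word_shift_closed KS.unit_closed)
qed

lemma emb_LF:
  assumes p: "p \<in> carrier KS.LF"
  shows "(\<lambda>w. emb (p w)) \<in> carrier W.FS.LF"
    and "word_eval E F (\<lambda>w. emb (p w)) = (\<lambda>u. emb (word_eval E K p u))"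
proof -
  have pf: "p \<in> fin_supp K" by (rule KS.LF_fin_supp[OF p])
  have ef: "(\<lambda>w. emb (p w)) \<in> fin_supp F"
    by (rule emb.hom_lincomb(2)[OF pf, of "\<lambda>_. \<zero>"]) simp
  have "emb (p w) = \<zero>\<^bsub>F\<^esub>" if "w \<notin> leavitt_words E" for w
    using KS.LF_supp[OF p, of w] that by (cases "p w = \<zero>") auto
  then show "(\<lambda>w. emb (p w)) \<in> carrier W.FS.LF"
    using ef unfolding leavitt_free_simps carrier_free_vs fin_supp_def by blast
  show "word_eval E F (\<lambda>w. emb (p w)) = (\<lambda>u. emb (word_eval E K p u))"
    unfolding word_eval_def
    by (simp add: emb.hom_lincomb(1)[OF pf] KS.word_shift_closed KS.unit_closed emb_word_shift)
qed

lemma word_twist_one: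
  assumes "p \<in> carrier W.FS.LF"
  shows "word_twist E F (\<lambda>_. \<one>\<^bsub>F\<^esub>) p = p"
proof
  fix w
  have "gen_weight F (\<lambda>_. \<one>\<^bsub>F\<^esub>) g = \<one>\<^bsub>F\<^esub>" for g :: "('v, 'e) leavitt_gen"
    by (cases g) auto
  then have "foldr (\<lambda>g x. gen_weight F (\<lambda>_. \<one>\<^bsub>F\<^esub>) g \<otimes>\<^bsub>F\<^esub> x) w \<one>\<^bsub>F\<^esub> = \<one>\<^bsub>F\<^esub>" for w :: "('v, 'e) word"
    by (induction w) simp_all
  then show "word_twist E F (\<lambda>_. \<one>\<^bsub>F\<^esub>) p w = p w"
    using W.FS.LF_supp[OF assms, of w] fin_suppD[OF W.FS.LF_fin_supp[OF assms], of w]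
    by (auto simp: word_twist_def)
qed

text \<open>Taking all weights equal to \<open>1\<close> exhibits the untwisted action as a convolution, which vanishes
  on the kernel of \<open>word_eval\<close>.\<close>
lemma leavitt_ideal_chen:
  assumes "j \<in> W.FS.LI" "m \<in> carrier W.V0"
  shows "j \<in> carrier W.FS.LF" "word_eval E F j = (\<lambda>_. \<zero>\<^bsub>F\<^esub>)" "chen_act E F x0 j m = (\<lambda>_. \<zero>\<^bsub>F\<^esub>)"
proof -
  show j: "j \<in> carrier W.FS.LF" "word_eval E F j = (\<lambda>_. \<zero>\<^bsub>F\<^esub>)"
    using assms(1) W.FS.leavitt_ideal_kernel by (auto simp: W.FS.eval_kernel_def)
  show "chen_act E F x0 j m = (\<lambda>_. \<zero>\<^bsub>F\<^esub>)"
    using T.chen_act_twist_kernel[OF j assms(2)] by (simp add: word_twist_one[OF j(1)])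
qed

lemma leavitt_twist_eq: "leavitt_twist E F a Y = (\<Union>y\<in>Y. W.FS.LI +>\<^bsub>W.FS.LF\<^esub> word_twist E F a y)"
  unfolding leavitt_twist_def quotient_map_def word_twist_def ..

lemma leavitt_base_change_eq:
  "leavitt_base_change E F emb Z = (\<Union>x\<in>Z. W.FS.LI +>\<^bsub>W.FS.LF\<^esub> (\<lambda>w. emb (x w)))"
  unfolding leavitt_base_change_def quotient_map_def ..

text \<open>The action is defined through a chain of cosets. Each representative that can occur evaluates
  to the image of \<open>s\<close> over the larger field, and the convolution depends only on this evaluation.\<close>
lemma chen_act_lift:
  assumes s: "s \<in> carrier KS.S" and m: "m \<in> carrier W.V0"
  shows "act chenV s m \<in> carrier W.V0"
    and "W.lift (act chenV s m) = row_conv F (\<lambda>u. emb (s u)) (W.lift m)"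
proof -
  obtain p where p: "p \<in> carrier KS.LF" "word_eval E K p = s"
    "inv_into (carrier (leavitt_algebra E K)) (leavitt_to_steinberg E K) s = KS.LI +>\<^bsub>KS.LF\<^esub> p"
    using KS.steinberg_preimage[OF s] by blast
  define Z where "Z = KS.LI +>\<^bsub>KS.LF\<^esub> p"
  define Y where "Y = leavitt_twist E F a (leavitt_base_change E F emb Z)"
  define z0 where "z0 = (\<lambda>w. emb (p w))"
  define r where "r = chen_act E F x0 (word_twist E F a z0) m"
  have z0: "z0 \<in> carrier W.FS.LF" "word_eval E F z0 = (\<lambda>u. emb (s u))"
    using emb_LF[OF p(1)] p(2) by (simp_all add: z0_def)
  have r: "r \<in> carrier W.V0" "W.lift r = row_conv F (\<lambda>u. emb (s u)) (W.lift m)"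
    unfolding r_def using W.chen_act_V0(1)[OF W.word_twist_LF[OF z0(1)] m] W.lift_chen_twist[OF z0(1) m] z0(2) by simp_all
  have pZ: "p \<in> Z" unfolding Z_def by (rule KS.coset_self[OF p(1)])
  have Yr: "chen_act E F x0 y m = r" if y: "y \<in> Y" for y
  proof -
    obtain z where z: "z \<in> leavitt_base_change E F emb Z" "y \<in> W.FS.LI +>\<^bsub>W.FS.LF\<^esub> word_twist E F a z"
      using y unfolding Y_def leavitt_twist_eq by blast
    obtain x where x: "x \<in> Z" "z \<in> W.FS.LI +>\<^bsub>W.FS.LF\<^esub> (\<lambda>w. emb (x w))"
      using z(1) unfolding leavitt_base_change_eq by blast
    have x': "x \<in> carrier KS.LF" "word_eval E K x = s"
      using KS.coset_eval[OF p(1), of x] x(1) p(2) by (auto simp: Z_def)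
    have zz: "z \<in> carrier W.FS.LF" "word_eval E F z = (\<lambda>u. emb (s u))"
      using W.FS.coset_eval[OF emb_LF(1)[OF x'(1)] x(2)] emb_LF(2)[OF x'(1)] x'(2) by simp_all
    have tw: "word_twist E F a z \<in> carrier W.FS.LF" by (rule W.word_twist_LF[OF zz(1)])
    obtain j where j: "j \<in> W.FS.LI" "y = j \<oplus>\<^bsub>W.FS.LF\<^esub> word_twist E F a z"
      using z(2) by (auto simp: a_r_coset_def')
    note jj = leavitt_ideal_chen[OF j(1) m]
    have tc: "chen_act E F x0 (word_twist E F a z) m \<in> carrier W.V0" by (rule W.chen_act_V0(1)[OF tw m])
    have "chen_act E F x0 y m = chen_act E F x0 (word_twist E F a z) m"
      unfolding j(2) W.chen_act_add[OF jj(1) tw m] jj(3) using W.V0_closed[OF tc] by simp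
    also have "\<dots> = r"
      by (rule W.lift_inj[OF tc r(1)]) (simp add: r(2) W.lift_chen_twist[OF zz(1) m] zz(2))
    finally show ?thesis .
  qed
  have "z0 \<in> leavitt_base_change E F emb Z"
    unfolding leavitt_base_change_eq using pZ W.FS.coset_self[OF z0(1)] by (auto simp: z0_def)
  then have "word_twist E F a z0 \<in> Y"
    unfolding Y_def leavitt_twist_eq using W.FS.coset_self[OF W.word_twist_LF[OF z0(1)]] by blast
  then have "(\<lambda>_. r) ` Y = {r}" by (rule image_constant)
  moreover have "(\<lambda>y. chen_act E F x0 y m) ` Y = (\<lambda>_. r) ` Y" using Yr by (rule image_cong[OF refl])
  ultimately have "act chenV s m = r"
    unfolding chenV_simps p(3) Z_def[symmetric] Y_def[symmetric] quotient_lift_def by simp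
  then show "act chenV s m \<in> carrier W.V0" "W.lift (act chenV s m) = row_conv F (\<lambda>u. emb (s u)) (W.lift m)"
    using r by simp_all
qed

lemma row_emb:
  assumes "row_finite K s"
  shows "row_finite F (\<lambda>u. emb (s u))"
  unfolding row_finite_def
proof
  fix y
  have "row s y \<in> fin_supp K" using assms by (simp add: row_finite_def)
  then have "(\<lambda>b. emb (row s y b)) \<in> fin_supp F"
    by (rule emb.hom_lincomb(2)[of _ "\<lambda>_. \<zero>"]) simp
  moreover have "row (\<lambda>u. emb (s u)) y = (\<lambda>b. emb (row s y b))" by (auto simp: row_def)
  ultimately show "row (\<lambda>u. emb (s u)) y \<in> fin_supp F" by simp
qed

lemma emb_row_conv:
  fixes s t :: "('v, 'e) arrow \<Rightarrow> 'k"
  assumes "row_finite K s" "\<And>u. t u \<in> carrier K"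
  shows "(\<lambda>u. emb (row_conv K s t u)) = row_conv F (\<lambda>u. emb (s u)) (\<lambda>u. emb (t u))"
proof
  fix u :: "('v, 'e) arrow"
  obtain y k x where u: "u = (y, k, x)" by (cases u) auto
  have "row s y \<in> fin_supp K" using assms(1) by (simp add: row_finite_def)
  then have "emb (lincomb K (row s y) (\<lambda>b. t (snd b, k - fst b, x))) =
      lincomb F (\<lambda>b. emb (row s y b)) (\<lambda>b. emb (t (snd b, k - fst b, x)))"
    by (rule emb.hom_lincomb(1)) (rule assms(2))
  moreover have "row (\<lambda>u. emb (s u)) y = (\<lambda>b. emb (row s y b))" by (auto simp: row_def)
  ultimately show "emb (row_conv K s t u) = row_conv F (\<lambda>u. emb (s u)) (\<lambda>u. emb (t u)) u"
    by (simp add: u row_conv_def case_prod_beta')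
qed

lemma module_chenV: "module K chenV"
proof (rule moduleI)
  show "cring K" by (rule is_cring)
  show "abelian_group chenV"
    by (rule abelian_group_free_vs[OF F.ring_axioms]) (simp_all add: chenV_simps)
  fix k l x y assume k: "k \<in> carrier K" and x: "x \<in> carrier chenV"
  note xV = x[unfolded chenV_simps(1)]
  show "k \<odot>\<^bsub>chenV\<^esub> x \<in> carrier chenV" using k xV by (simp add: chenV_simps)
  {
    assume l: "l \<in> carrier K"
    show "(k \<oplus> l) \<odot>\<^bsub>chenV\<^esub> x = k \<odot>\<^bsub>chenV\<^esub> x \<oplus>\<^bsub>chenV\<^esub> l \<odot>\<^bsub>chenV\<^esub> x"
      using k l xV by (simp add: chenV_simps W.V0.smult_l_distr)
    show "(k \<otimes> l) \<odot>\<^bsub>chenV\<^esub> x = k \<odot>\<^bsub>chenV\<^esub> (l \<odot>\<^bsub>chenV\<^esub> x)"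
      using k l xV by (simp add: chenV_simps W.V0.smult_assoc1)
  }
  {
    assume y: "y \<in> carrier chenV"
    show "k \<odot>\<^bsub>chenV\<^esub> (x \<oplus>\<^bsub>chenV\<^esub> y) = k \<odot>\<^bsub>chenV\<^esub> x \<oplus>\<^bsub>chenV\<^esub> k \<odot>\<^bsub>chenV\<^esub> y"
      using k xV y by (simp add: chenV_simps W.V0.smult_r_distr)
  }
next
  fix x assume "x \<in> carrier chenV"
  then show "\<one> \<odot>\<^bsub>chenV\<^esub> x = x" by (simp add: chenV_simps W.V0.smult_one)
qed

text \<open>Under the injective map \<open>W.lift\<close> the axioms become identities of convolution.\<close>
lemma left_module_chenV: "left_module K KS.S chenV"
  unfolding left_module_def
proof (intro conjI ballI)
  note rf = row_emb[OF KS.row_finite_S]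
  note lc = W.lift_closed[OF W.V0_closed]
  note add = free_vs_ops(2)[of F W.X0] and sm = free_vs_ops(3)[of F W.X0]
  show "module K chenV" by (rule module_chenV)
  fix s m assume s: "s \<in> carrier KS.S" and m: "m \<in> carrier chenV"
  note mV = m[unfolded chenV_simps(1)]
  note A = chen_act_lift[OF s mV]
  show "act chenV s m \<in> carrier chenV" using A(1) by (simp add: chenV_simps(1))
  {
    fix m' assume m': "m' \<in> carrier chenV"
    note mV' = m'[unfolded chenV_simps(1)]
    note A' = chen_act_lift[OF s mV']
    note sum = W.V0.M.a_closed[OF mV mV']
    show "act chenV s (m \<oplus>\<^bsub>chenV\<^esub> m') = act chenV s m \<oplus>\<^bsub>chenV\<^esub> act chenV s m'"
      unfolding chenV_simps(3)
    proof (rule W.lift_inj)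
      show "act chenV s (m \<oplus>\<^bsub>W.V0\<^esub> m') \<in> carrier W.V0" by (rule chen_act_lift(1)[OF s sum])
      show "act chenV s m \<oplus>\<^bsub>W.V0\<^esub> act chenV s m' \<in> carrier W.V0" using A(1) A'(1) by simp
      show "W.lift (act chenV s (m \<oplus>\<^bsub>W.V0\<^esub> m')) = W.lift (act chenV s m \<oplus>\<^bsub>W.V0\<^esub> act chenV s m')"
        unfolding chen_act_lift(2)[OF s sum] unfolding add
        by (simp add: W.lift_add W.V0_closed mV mV' A(1) A'(1) A(2) A'(2) W.FS.row_conv_add_right rf[OF s] lc[OF mV] lc[OF mV'])
    qed
  }
  {
    fix t assume t: "t \<in> carrier KS.S"
    note B = chen_act_lift[OF t mV]
    have st: "s \<oplus>\<^bsub>KS.S\<^esub> t \<in> carrier KS.S" using s t by (simp add: steinberg_simps(2) KS.S_add)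
    have e: "(\<lambda>u. emb ((s \<oplus>\<^bsub>KS.S\<^esub> t) u)) = (\<lambda>u. emb (s u) \<oplus>\<^bsub>F\<^esub> emb (t u))"
      using KS.S_closed[OF s] KS.S_closed[OF t] by (simp add: steinberg_simps(2))
    show "act chenV (s \<oplus>\<^bsub>KS.S\<^esub> t) m = act chenV s m \<oplus>\<^bsub>chenV\<^esub> act chenV t m"
      unfolding chenV_simps(3)
    proof (rule W.lift_inj)
      show "act chenV (s \<oplus>\<^bsub>KS.S\<^esub> t) m \<in> carrier W.V0" by (rule chen_act_lift(1)[OF st mV])
      show "act chenV s m \<oplus>\<^bsub>W.V0\<^esub> act chenV t m \<in> carrier W.V0" using A(1) B(1) by simp
      show "W.lift (act chenV (s \<oplus>\<^bsub>KS.S\<^esub> t) m) = W.lift (act chenV s m \<oplus>\<^bsub>W.V0\<^esub> act chenV t m)"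
        unfolding chen_act_lift(2)[OF st mV] e unfolding add
        by (simp add: W.lift_add W.V0_closed A(1) B(1) A(2) B(2) W.FS.row_conv_add_left rf[OF s] rf[OF t] lc[OF mV])
    qed
    have st': "s \<otimes>\<^bsub>KS.S\<^esub> t \<in> carrier KS.S" by (rule KS.S_mult_closed[OF s t])
    have e': "(\<lambda>u. emb ((s \<otimes>\<^bsub>KS.S\<^esub> t) u)) = row_conv F (\<lambda>u. emb (s u)) (\<lambda>u. emb (t u))"
      unfolding KS.S_mult[OF s t] by (rule emb_row_conv[OF KS.row_finite_S[OF s] KS.S_closed[OF t]])
    show "act chenV (s \<otimes>\<^bsub>KS.S\<^esub> t) m = act chenV s (act chenV t m)"
    proof (rule W.lift_inj)
      show "act chenV (s \<otimes>\<^bsub>KS.S\<^esub> t) m \<in> carrier W.V0" by (rule chen_act_lift(1)[OF st' mV])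
      show "act chenV s (act chenV t m) \<in> carrier W.V0" by (rule chen_act_lift(1)[OF s B(1)])
      show "W.lift (act chenV (s \<otimes>\<^bsub>KS.S\<^esub> t) m) = W.lift (act chenV s (act chenV t m))"
        unfolding chen_act_lift(2)[OF st' mV] chen_act_lift(2)[OF s B(1)] B(2) e'
        by (rule W.FS.row_conv_assoc[OF rf[OF s] rf[OF t] lc[OF mV]])
    qed
  }
next
  note rf = row_emb[OF KS.row_finite_S]
  note lc = W.lift_closed[OF W.V0_closed]
  note sm = free_vs_ops(3)[of F W.X0]
  fix k s m assume k: "k \<in> carrier K" and s: "s \<in> carrier KS.S" and m: "m \<in> carrier chenV"
  note mV = m[unfolded chenV_simps(1)]
  note A = chen_act_lift[OF s mV]
  have ek: "emb k \<in> carrier F" using k by simp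
  have ks: "k \<odot>\<^bsub>KS.S\<^esub> s \<in> carrier KS.S" using k s by (simp add: steinberg_simps(3) KS.S_smult)
  have e: "(\<lambda>u. emb ((k \<odot>\<^bsub>KS.S\<^esub> s) u)) = (\<lambda>u. emb k \<otimes>\<^bsub>F\<^esub> emb (s u))"
    using KS.S_closed[OF s] k by (simp add: steinberg_simps(3))
  note km = W.V0.smult_closed[OF ek mV]
  have kA: "emb k \<odot>\<^bsub>W.V0\<^esub> act chenV s m \<in> carrier W.V0" by (rule W.V0.smult_closed[OF ek A(1)])
  have lk: "W.lift (emb k \<odot>\<^bsub>W.V0\<^esub> act chenV s m) = (\<lambda>u. emb k \<otimes>\<^bsub>F\<^esub> row_conv F (\<lambda>u. emb (s u)) (W.lift m) u)"
    unfolding sm by (simp add: W.lift_smult W.V0_closed[OF A(1)] ek A(2))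
  show "act chenV (k \<odot>\<^bsub>KS.S\<^esub> s) m = k \<odot>\<^bsub>chenV\<^esub> act chenV s m"
    unfolding chenV_simps(4)
  proof (rule W.lift_inj[OF chen_act_lift(1)[OF ks mV] kA])
    show "W.lift (act chenV (k \<odot>\<^bsub>KS.S\<^esub> s) m) = W.lift (emb k \<odot>\<^bsub>W.V0\<^esub> act chenV s m)"
      unfolding chen_act_lift(2)[OF ks mV] lk e
      by (rule W.FS.row_conv_smult_left[OF rf[OF s] ek lc[OF mV]])
  qed
  show "act chenV s (k \<odot>\<^bsub>chenV\<^esub> m) = k \<odot>\<^bsub>chenV\<^esub> act chenV s m"
    unfolding chenV_simps(4)
  proof (rule W.lift_inj[OF chen_act_lift(1)[OF s km] kA])
    have "W.lift (emb k \<odot>\<^bsub>W.V0\<^esub> m) = (\<lambda>u. emb k \<otimes>\<^bsub>F\<^esub> W.lift m u)"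
      unfolding sm by (rule W.lift_smult[OF W.V0_closed[OF mV] ek])
    then show "W.lift (act chenV s (emb k \<odot>\<^bsub>W.V0\<^esub> m)) = W.lift (emb k \<odot>\<^bsub>W.V0\<^esub> act chenV s m)"
      unfolding chen_act_lift(2)[OF s km] lk
      using W.FS.row_conv_smult_right[OF rf[OF s] lc[OF mV] ek] by simp
  qed
qed

end

section \<open>Simplicity of the restricted Chen module\<close>

lemma (in cring) free_vs_induct [consumes 1, case_names zero step]:
  assumes "m \<in> carrier (free_vs R A)" "P (\<lambda>_. \<zero>)"
    and step: "\<And>k a p. \<lbrakk>k \<in> carrier R; a \<in> A; p \<in> carrier (free_vs R A); P p\<rbrakk>
                  \<Longrightarrow> P (\<lambda>s. k \<otimes> basis_vec R a s \<oplus> p s)"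
  shows "P m"
proof -
  have "m \<in> fin_supp R" by (rule carrier_free_vs_fin_supp[OF assms(1)])
  then have "m \<in> carrier (free_vs R A) \<longrightarrow> P m"
  proof (induction m rule: fin_supp_induct)
    case zero
    then show ?case using assms(2) by simp
  next
    case (step k a p)
    have pc: "p s \<in> carrier R" for s by (rule fin_suppD[OF step(2)])
    show ?case
    proof
      assume m: "(\<lambda>s. k \<otimes> basis_vec R a s \<oplus> p s) \<in> carrier (free_vs R A)"
      have out: "k \<otimes> basis_vec R a s \<oplus> p s = \<zero>" if "s \<notin> A" for s
        using m that by (simp add: carrier_free_vs)
      have pA: "p s = \<zero>" if "s \<notin> A" for s
        using out[OF that] step pc[of s] by (cases "s = a") (simp_all add: basis_vec_apply)
      then have p: "p \<in> carrier (free_vs R A)"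
        using pc fin_supp_finite[OF step(2)] by (simp add: carrier_free_vs)
      show "P (\<lambda>s. k \<otimes> basis_vec R a s \<oplus> p s)"
      proof (cases "a \<in> A")
        case True
        then show ?thesis using assms(3) step p by blast
      next
        case False
        then have "k = \<zero>" using out[OF False] step by (simp add: basis_vec_apply)
        then have "(\<lambda>s. k \<otimes> basis_vec R a s \<oplus> p s) = p" using pc by (auto simp: basis_vec_apply)
        then show ?thesis using step p by simp
      qed
    qed
  qed
  then show ?thesis using assms(1) by blast
qed

context steinberg
begin

text \<open>The row of the bisection at \<open>\<mu>z\<close> has one entry, and all other rows vanish.\<close>
lemma row_conv_cylinder:
  fixes n :: "('v, 'e) arrow \<Rightarrow> 'k"
  assumes w: "awalk u p v" "awalk u' q v" and n: "\<And>a. n a \<in> carrier K"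
  shows "z \<in> boundary_paths E \<Longrightarrow> path_source E z = v \<Longrightarrow>
      row_conv K (ind (cylinder E (u, p) (u', q))) n (path_append (u, p) z, k, x) =
      n (path_append (u', q) z, k - (int (length p) - int (length q)), x)"
    and "(\<And>z. z \<in> boundary_paths E \<Longrightarrow> path_source E z = v \<Longrightarrow> y \<noteq> path_append (u, p) z) \<Longrightarrow>
      row_conv K (ind (cylinder E (u, p) (u', q))) n (y, k, x) = \<zero>"
proof -
  let ?Z = "cylinder E (u, p) (u', q)"
  {
    assume z: "z \<in> boundary_paths E" "path_source E z = v"
    have "((path_append (u, p) z, j, x') \<in> ?Z) = ((j, x') = (int (length p) - int (length q), path_append (u', q) z))" for j x'
    proof
      assume "(path_append (u, p) z, j, x') \<in> ?Z"
      then obtain z' where z': "path_source E z' = v" "path_append (u, p) z = path_append (u, p) z'"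
          "j = int (length p) - int (length q)" "x' = path_append (u', q) z'"
        unfolding cylinder_awalk[OF w] by blast
      have "z = z'" by (rule path_append_inj[OF z'(2), of E]) (simp add: z z')
      then show "(j, x') = (int (length p) - int (length q), path_append (u', q) z)" using z' by simp
    next
      assume "(j, x') = (int (length p) - int (length q), path_append (u', q) z)"
      then show "(path_append (u, p) z, j, x') \<in> ?Z" unfolding cylinder_awalk[OF w] using z by blast
    qed
    then have "row (ind ?Z) (path_append (u, p) z) = basis_vec K (int (length p) - int (length q), path_append (u', q) z)"
      by (auto simp: row_def basis_vec_def fun_eq_iff)
    then show "row_conv K (ind ?Z) n (path_append (u, p) z, k, x) =
        n (path_append (u', q) z, k - (int (length p) - int (length q)), x)"
      using lincomb_basis[of "\<lambda>(j, x'). n (x', k - j, x)"] n by (simp add: row_conv_def split_def)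
  }
  assume y: "\<And>z. z \<in> boundary_paths E \<Longrightarrow> path_source E z = v \<Longrightarrow> y \<noteq> path_append (u, p) z"
  have "(y, j, x') \<notin> ?Z" for j x' unfolding cylinder_awalk[OF w] using y by blast
  then have "row (ind ?Z) y = (\<lambda>_. \<zero>)" by (auto simp: row_def)
  then show "row_conv K (ind ?Z) n (y, k, x) = \<zero>" by (simp add: row_conv_def)
qed

end

context weighted
begin

definition delta :: "'f \<Rightarrow> ('v, 'e) epath \<Rightarrow> ('v, 'e) epath \<Rightarrow> 'f" where
  "delta z p = (\<lambda>q. if q = p then z else \<zero>)"

lemma delta_V0: "z \<in> carrier F \<Longrightarrow> p \<in> X0 \<Longrightarrow> delta z p \<in> carrier V0"
  by (rule V0_memI) (auto simp: delta_def)

lemma delta_zero: "delta \<zero> p = (\<lambda>_. \<zero>)"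
  by (auto simp: delta_def)

lemma cocycle_shift_cancel:
  assumes "(q, k, x0) \<in> groupoid_arrows E" "z \<in> carrier F" "u \<in> carrier F"
    and "inv (cocycle q k) \<otimes> z = u"
  shows "z = cocycle q k \<otimes> u"
  using assms cocycle_unit[OF assms(1)] by (auto simp: m_assoc[symmetric] Units_closed)

end

context chen_setting
begin

lemma emb_ind: "(\<lambda>u. emb (KS.ind Z u)) = W.FS.ind Z"
  by (simp add: fun_eq_iff emb.hom_one emb.hom_zero)

text \<open>Read off at arrows into the base path, where the action is convolution with a bisection. A
  path other than \<open>\<mu>y\<close> gets nothing, because \<open>\<nu>\<close> determines the remaining path.\<close>
lemma cylinder_delta:
  assumes w: "awalk u m v" "awalk u' n v" and z: "z \<in> carrier F"
    and y: "y \<in> boundary_paths E" "path_source E y = v"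
    and arr: "(path_append (u', n) y, k, x0) \<in> groupoid_arrows E"
  defines "d \<equiv> int (length m) - int (length n)"
  shows "(path_append (u, m) y, k + d, x0) \<in> groupoid_arrows E"
    and "act chenV (KS.ind (cylinder E (u, m) (u', n))) (W.delta z (path_append (u', n) y)) =
      W.delta (W.cocycle (path_append (u, m) y) (k + d) \<otimes>\<^bsub>F\<^esub> (inv\<^bsub>F\<^esub> (W.cocycle (path_append (u', n) y) k) \<otimes>\<^bsub>F\<^esub> z)) (path_append (u, m) y)"
proof -
  let ?s = "KS.ind (cylinder E (u, m) (u', n))" and ?p = "path_append (u', n) y" and ?q = "path_append (u, m) y"
  show qarr: "(?q, k + d, x0) \<in> groupoid_arrows E"
  proof -
    obtain t where t: "?p = InfPath t" "tail_lag t k" using arr unfolding arrow_x0 by blast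
    then obtain r where r: "y = InfPath r" by (cases y) auto
    have tr: "t = n @- r" using t(1) r by simp
    obtain i j where ij: "k = int i - int j" "sdrop i t = sdrop j cinf" using t(2) by (auto simp: tail_lag_def)
    have qb: "?q \<in> boundary_paths E" by (rule boundary_append[OF w(1) y(2,1)])
    have "sdrop (length n + i) t = sdrop (j + length n) cinf"
      using ij(2) by (metis sdrop_add add.commute)
    then have "sdrop i r = sdrop (j + length n) cinf" using tr by (simp add: sdrop_shift)
    then have "sdrop (length m + i) (m @- r) = sdrop (j + length n) cinf" by (simp add: sdrop_shift)
    moreover have "m @- r \<in> infinite_paths E" using qb r by (simp add: boundary_InfPath)
    ultimately have "tail_lag (m @- r) (int (length m + i) - int (j + length n))"
      unfolding tail_lag_def by blast
    moreover have "int (length m + i) - int (j + length n) = k + d" using ij(1) by (simp add: d_def)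
    ultimately show ?thesis unfolding arrow_x0 using r by (intro exI[of _ "m @- r"]) simp
  qed
  have s: "?s \<in> carrier KS.S" by (rule KS.cylinder_mem[OF w])
  have pX: "?p \<in> W.X0" and qX: "?q \<in> W.X0" using arr qarr by (auto simp: tail_class_arrow)
  have dV: "W.delta z ?p \<in> carrier W.V0" by (rule W.delta_V0[OF z pX])
  let ?c = "W.cocycle ?q (k + d) \<otimes>\<^bsub>F\<^esub> (inv\<^bsub>F\<^esub> (W.cocycle ?p k) \<otimes>\<^bsub>F\<^esub> z)"
  note A = chen_act_lift[OF s dV]
  have lc: "W.lift (W.delta z ?p) a \<in> carrier F" for a by (rule W.lift_closed[OF W.V0_closed[OF dV]])
  show "act chenV ?s (W.delta z ?p) = W.delta ?c ?q"
  proof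
    fix q'
    show "act chenV ?s (W.delta z ?p) q' = W.delta ?c ?q q'"
    proof (cases "q' \<in> W.X0")
      case False
      then show ?thesis using W.V0_supp[OF A(1), of q'] qX by (auto simp: W.delta_def)
    next
      case True
      then obtain k' where k': "(q', k', x0) \<in> groupoid_arrows E" by (auto simp: tail_class_arrow)
      show ?thesis
      proof (cases "q' = ?q")
        case eq: True
        have "inv\<^bsub>F\<^esub> (W.cocycle ?q (k + d)) \<otimes>\<^bsub>F\<^esub> act chenV ?s (W.delta z ?p) ?q = W.lift (act chenV ?s (W.delta z ?p)) (?q, k + d, x0)"
          using qarr by (simp add: W.lift_def mem_L_arrows)
        also have "\<dots> = W.lift (W.delta z ?p) (?p, k + d - d, x0)"
          unfolding A(2) emb_ind d_def by (rule W.FS.row_conv_cylinder(1)[OF w lc y])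
        also have "\<dots> = inv\<^bsub>F\<^esub> (W.cocycle ?p k) \<otimes>\<^bsub>F\<^esub> z"
          using arr by (simp add: W.lift_def mem_L_arrows W.delta_def)
        finally have "act chenV ?s (W.delta z ?p) ?q = ?c"
          by (intro W.cocycle_shift_cancel[OF qarr]) (use W.V0_closed[OF A(1)] W.cocycle_unit[OF arr] z in auto)
        then show ?thesis using eq by (simp add: W.delta_def)
      next
        case neq: False
        have "inv\<^bsub>F\<^esub> (W.cocycle q' k') \<otimes>\<^bsub>F\<^esub> act chenV ?s (W.delta z ?p) q' = W.lift (act chenV ?s (W.delta z ?p)) (q', k', x0)"
          using k' by (simp add: W.lift_def mem_L_arrows)
        also have "\<dots> = \<zero>\<^bsub>F\<^esub>"
        proof (cases "\<exists>y'. y' \<in> boundary_paths E \<and> path_source E y' = v \<and> q' = path_append (u, m) y'")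
          case True
          then obtain y' where y': "y' \<in> boundary_paths E" "path_source E y' = v" "q' = path_append (u, m) y'" by blast
          have "W.lift (act chenV ?s (W.delta z ?p)) (q', k', x0) =
              W.lift (W.delta z ?p) (path_append (u', n) y', k' - d, x0)"
            unfolding A(2) emb_ind y'(3) d_def by (rule W.FS.row_conv_cylinder(1)[OF w lc y'(1,2)])
          moreover have "path_append (u', n) y' \<noteq> ?p"
          proof
            assume e: "path_append (u', n) y' = ?p"
            have "y' = y" by (rule path_append_inj[OF e, of E]) (simp add: y' y)
            then show False using neq y'(3) by simp
          qed
          ultimately show ?thesis using W.cocycle_L by (auto simp: W.lift_def W.delta_def)
        next
          case False
          then show ?thesis unfolding A(2) emb_ind by (intro W.FS.row_conv_cylinder(2)[OF w lc]) blast
        qed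
        finally have "act chenV ?s (W.delta z ?p) q' = W.cocycle q' k' \<otimes>\<^bsub>F\<^esub> \<zero>\<^bsub>F\<^esub>"
          by (intro W.cocycle_shift_cancel[OF k']) (use W.V0_closed[OF A(1)] in auto)
        then show ?thesis using neq W.cocycle_unit[OF k'] by (simp add: W.delta_def F.Units_closed)
      qed
    qed
  qed
qed

lemma cylinder_delta_zero:
  assumes w: "awalk u m v" "awalk u' n v" and z: "z \<in> carrier F" and p: "p \<in> W.X0"
    and np: "\<And>y. y \<in> boundary_paths E \<Longrightarrow> path_source E y = v \<Longrightarrow> p \<noteq> path_append (u', n) y"
  shows "act chenV (KS.ind (cylinder E (u, m) (u', n))) (W.delta z p) = (\<lambda>_. \<zero>\<^bsub>F\<^esub>)"
proof -
  let ?s = "KS.ind (cylinder E (u, m) (u', n))"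
  have s: "?s \<in> carrier KS.S" by (rule KS.cylinder_mem[OF w])
  have dV: "W.delta z p \<in> carrier W.V0" by (rule W.delta_V0[OF z p])
  note A = chen_act_lift[OF s dV]
  have lc: "W.lift (W.delta z p) a \<in> carrier F" for a by (rule W.lift_closed[OF W.V0_closed[OF dV]])
  have zV: "(\<lambda>_. \<zero>\<^bsub>F\<^esub>) \<in> carrier W.V0" using W.V0.M.zero_closed by (simp add: free_vs_ops)
  show ?thesis
  proof (rule W.lift_inj[OF A(1) zV])
    show "W.lift (act chenV ?s (W.delta z p)) = W.lift (\<lambda>_. \<zero>\<^bsub>F\<^esub>)"
      unfolding W.lift_zero A(2) emb_ind
    proof
      fix a :: "('v, 'e) arrow"
      obtain q k x where a: "a = (q, k, x)" by (cases a) auto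
      show "row_conv F (W.FS.ind (cylinder E (u, m) (u', n))) (W.lift (W.delta z p)) a = \<zero>\<^bsub>F\<^esub>"
      proof (cases "\<exists>y'. y' \<in> boundary_paths E \<and> path_source E y' = v \<and> q = path_append (u, m) y'")
        case True
        then obtain y' where y': "y' \<in> boundary_paths E" "path_source E y' = v" "q = path_append (u, m) y'" by blast
        have "path_append (u', n) y' \<noteq> p" using np[OF y'(1,2)] by simp
        then show ?thesis
          unfolding a y'(3) W.FS.row_conv_cylinder(1)[OF w lc y'(1,2)]
          using W.cocycle_L by (auto simp: W.lift_def W.delta_def)
      next
        case False
        then show ?thesis unfolding a by (intro W.FS.row_conv_cylinder(2)[OF w lc]) blast
      qed
    qed
  qed
qed

text \<open>The bisection of an initial segment with itself consists of identities, namely those of the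
  paths that begin with the segment. The segment is nonempty so that it determines the vertex at
  which a path starts.\<close>
lemma initial_segment_act:
  assumes s: "s \<in> infinite_paths E" and g: "g \<in> carrier W.V0" and i: "0 < i"
  defines "P \<equiv> (tail E (shd s), stake i s)"
  shows "KS.ind (cylinder E P P) \<in> carrier KS.S"
    and "act chenV (KS.ind (cylinder E P P)) g = (\<lambda>q. if \<exists>t. q = InfPath t \<and> stake i t = stake i s then g q else \<zero>\<^bsub>F\<^esub>)"
proof -
  let ?u = "tail E (shd s)" and ?v = "tail E (shd (sdrop i s))"
  have w: "awalk ?u (stake i s) ?v" by (rule infinite_path_stake(1)[OF s])
  show S: "KS.ind (cylinder E P P) \<in> carrier KS.S" unfolding P_def by (rule KS.cylinder_mem[OF w w])
  note A = chen_act_lift[OF S g]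
  have lc: "W.lift g a \<in> carrier F" for a by (rule W.lift_closed[OF W.V0_closed[OF g]])
  show "act chenV (KS.ind (cylinder E P P)) g = (\<lambda>q. if \<exists>t. q = InfPath t \<and> stake i t = stake i s then g q else \<zero>\<^bsub>F\<^esub>)"
  proof
    fix q
    show "act chenV (KS.ind (cylinder E P P)) g q = (if \<exists>t. q = InfPath t \<and> stake i t = stake i s then g q else \<zero>\<^bsub>F\<^esub>)"
    proof (cases "q \<in> W.X0")
      case False
      then show ?thesis using W.V0_supp[OF A(1), of q] W.V0_supp[OF g, of q] by auto
    next
      case True
      then obtain k where k: "(q, k, x0) \<in> groupoid_arrows E" by (auto simp: tail_class_arrow)
      then obtain t where t: "q = InfPath t" "t \<in> infinite_paths E" by (auto simp: arrow_x0 tail_lag_def)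
      have e: "inv\<^bsub>F\<^esub> (W.cocycle q k) \<otimes>\<^bsub>F\<^esub> act chenV (KS.ind (cylinder E P P)) g q =
          row_conv F (W.FS.ind (cylinder E P P)) (W.lift g) (q, k, x0)"
        using fun_cong[OF A(2), of "(q, k, x0)"] k unfolding emb_ind by (simp add: W.lift_def mem_L_arrows)
      show ?thesis
      proof (cases "stake i t = stake i s")
        case True
        let ?z = "InfPath (sdrop i t) :: ('v, 'e) epath"
        have "awalk (tail E (shd t)) (stake i t) (tail E (shd (sdrop i t)))" by (rule infinite_path_stake(1)[OF t(2)])
        then have wt: "awalk (tail E (shd t)) (stake i s) (tail E (shd (sdrop i t)))" using True by simp
        have ne: "stake i s \<noteq> []" using i by simp
        have v: "tail E (shd (sdrop i t)) = ?v" using awalk_ends[OF wt ne] awalk_ends[OF w ne] by simp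
        have q: "q = path_append P ?z" unfolding P_def path_append.simps t(1) by (metis True stake_sdrop)
        have zb: "?z \<in> boundary_paths E" using infinite_path_stake(2)[OF t(2)] by (simp add: boundary_InfPath)
        have "row_conv F (W.FS.ind (cylinder E P P)) (W.lift g) (path_append P ?z, k, x0) = W.lift g (path_append P ?z, k - 0, x0)"
          using W.FS.row_conv_cylinder(1)[OF w w lc zb, where k = k and x = x0] v unfolding P_def by simp
        also have "\<dots> = inv\<^bsub>F\<^esub> (W.cocycle q k) \<otimes>\<^bsub>F\<^esub> g q" using k q by (simp add: W.lift_def mem_L_arrows)
        finally have "inv\<^bsub>F\<^esub> (W.cocycle q k) \<otimes>\<^bsub>F\<^esub> act chenV (KS.ind (cylinder E P P)) g q = inv\<^bsub>F\<^esub> (W.cocycle q k) \<otimes>\<^bsub>F\<^esub> g q"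
          using e q by simp
        then have "act chenV (KS.ind (cylinder E P P)) g q = g q"
          using W.cocycle_unit[OF k] W.V0_closed[OF A(1)] W.V0_closed[OF g] by (simp add: F.Units_l_cancel)
        then show ?thesis using True t(1) by auto
      next
        case False
        have "q \<noteq> path_append (?u, stake i s) z" for z
        proof
          assume "q = path_append (?u, stake i s) z"
          then obtain r where "t = stake i s @- r" using t(1) by (cases z) auto
          then have "stake i t = stake i s" by (simp add: stake_shift)
          then show False using \<open>stake i t \<noteq> stake i s\<close> by simp
        qed
        then have "row_conv F (W.FS.ind (cylinder E P P)) (W.lift g) (q, k, x0) = \<zero>\<^bsub>F\<^esub>"
          unfolding P_def by (intro W.FS.row_conv_cylinder(2)[OF w w lc]) blast
        then have "act chenV (KS.ind (cylinder E P P)) g q = W.cocycle q k \<otimes>\<^bsub>F\<^esub> \<zero>\<^bsub>F\<^esub>"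
          by (intro W.cocycle_shift_cancel[OF k]) (use e W.V0_closed[OF A(1)] in auto)
        then show ?thesis using False t(1) W.cocycle_unit[OF k] by (simp add: F.Units_closed)
      qed
    qed
  qed
qed

text \<open>One turn around \<open>c\<close> multiplies the value by the weight of \<open>c\<close>, which is the class of \<open>t\<close>; negative
  \<open>l\<close> follow because this class is a unit.\<close>
lemma cocycle_multiple:
  assumes "(q, k, x0) \<in> groupoid_arrows E"
  shows "(q, k + l * int len, x0) \<in> groupoid_arrows E"
    and "W.cocycle q (k + l * int len) = W.cocycle q k \<otimes>\<^bsub>F\<^esub> tau l"
proof -
  have arr: "(q, k + l * int len, x0) \<in> groupoid_arrows E" for l
    using assms tail_lag_mult by (auto simp: arrow_x0)
  show "(q, k + l * int len, x0) \<in> groupoid_arrows E" by (rule arr)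
  have lc: "W.cocycle q (k + l * int len) \<in> carrier F" for l
    using W.cocycle_unit[OF arr] by (rule F.Units_closed)
  have per: "W.cocycle q (k + (l + 1) * int len) = W.cocycle q (k + l * int len) \<otimes>\<^bsub>F\<^esub> tau 1" for l
    using W.cocycle_period[OF arr, of l] a_cycle by (simp add: laurent_tbar_def algebra_simps)
  show "W.cocycle q (k + l * int len) = W.cocycle q k \<otimes>\<^bsub>F\<^esub> tau l"
  proof (induction l rule: int_induct[where k = 0])
    case base
    then show ?case using lc[of 0] by (simp add: tau_zero)
  next
    case (step1 l)
    have "W.cocycle q (k + (l + 1) * int len) = W.cocycle q k \<otimes>\<^bsub>F\<^esub> (tau l \<otimes>\<^bsub>F\<^esub> tau 1)"
      unfolding per step1(2) using lc[of 0] by (simp add: F.m_assoc)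
    then show ?case by (simp only: tau_add)
  next
    case (step2 l)
    have "W.cocycle q (k + l * int len) \<otimes>\<^bsub>F\<^esub> tau (- 1) = W.cocycle q (k + (l - 1) * int len) \<otimes>\<^bsub>F\<^esub> (tau 1 \<otimes>\<^bsub>F\<^esub> tau (- 1))"
      using per[of "l - 1"] lc[of "l - 1"] by (simp add: F.m_assoc)
    also have "\<dots> = W.cocycle q (k + (l - 1) * int len)"
      using lc[of "l - 1"] by (simp add: tau_add[symmetric] tau_zero)
    finally have "W.cocycle q (k + (l - 1) * int len) = W.cocycle q k \<otimes>\<^bsub>F\<^esub> (tau l \<otimes>\<^bsub>F\<^esub> tau (- 1))"
      using step2(2) lc[of 0] by (simp add: F.m_assoc)
    then show ?case by (simp add: tau_add[symmetric])
  qed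
qed

lemma X0_InfPath:
  assumes "p \<in> W.X0"
  obtains s k where "p = InfPath s" "s \<in> infinite_paths E" "(p, k, x0) \<in> groupoid_arrows E"
  using assms by (auto simp: tail_class_arrow arrow_x0 tail_lag_def)

text \<open>Deleting enough edges leaves of either path a tail of \<open>c\<^sup>\<infinity>\<close>, and deleting more makes these tails
  equal.\<close>
lemma common_tail:
  assumes "(InfPath t, k1, x0) \<in> groupoid_arrows E" "(InfPath s, k2, x0) \<in> groupoid_arrows E"
  obtains i j where "sdrop i s = sdrop j t" "int i - int j = k2 - k1"
proof -
  obtain i1 j1 where 1: "k1 = int i1 - int j1" "sdrop i1 t = sdrop j1 cinf"
    using assms(1) by (auto simp: arrow_x0 tail_lag_def)
  obtain i2 j2 where 2: "k2 = int i2 - int j2" "sdrop i2 s = sdrop j2 cinf"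
    using assms(2) by (auto simp: arrow_x0 tail_lag_def)
  have "sdrop (i2 + j1) s = sdrop (j2 + j1) cinf" using 2(2) by (metis sdrop_add)
  also have "\<dots> = sdrop (i1 + j2) t" using 1(2) by (metis sdrop_add add.commute)
  finally show ?thesis using that[of "i2 + j1" "i1 + j2"] 1(1) 2(1) by simp
qed

context
  fixes N
  assumes N: "alg_submodule K KS.S chenV N"
begin

lemma sub_facts:
  shows "N \<subseteq> carrier W.V0" "(\<lambda>_. \<zero>\<^bsub>F\<^esub>) \<in> N"
    and "\<And>g h. g \<in> N \<Longrightarrow> h \<in> N \<Longrightarrow> (\<lambda>q. g q \<oplus>\<^bsub>F\<^esub> h q) \<in> N"
    and "\<And>k g. k \<in> carrier K \<Longrightarrow> g \<in> N \<Longrightarrow> (\<lambda>q. emb k \<otimes>\<^bsub>F\<^esub> g q) \<in> N"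
    and "\<And>s g. s \<in> carrier KS.S \<Longrightarrow> g \<in> N \<Longrightarrow> act chenV s g \<in> N"
proof -
  have sub: "submodule N K chenV" using N by (simp add: alg_submodule_def)
  note E = module.submoduleE[OF module_chenV sub, unfolded chenV_simps(1-4) free_vs_ops]
  show "N \<subseteq> carrier W.V0" by (rule E(1))
  show "(\<lambda>_. \<zero>\<^bsub>F\<^esub>) \<in> N"
    using subgroup.one_closed[OF submodule.axioms(1)[OF sub]] by (simp add: chenV_simps free_vs_ops)
  show "\<And>g h. g \<in> N \<Longrightarrow> h \<in> N \<Longrightarrow> (\<lambda>q. g q \<oplus>\<^bsub>F\<^esub> h q) \<in> N" by (rule E(5))
  show "\<And>k g. k \<in> carrier K \<Longrightarrow> g \<in> N \<Longrightarrow> (\<lambda>q. emb k \<otimes>\<^bsub>F\<^esub> g q) \<in> N" by (rule E(4))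
  show "\<And>s g. s \<in> carrier KS.S \<Longrightarrow> g \<in> N \<Longrightarrow> act chenV s g \<in> N"
    using N by (simp add: alg_submodule_def)
qed

text \<open>An element of minimal support is a multiple of a basis vector, because an initial segment
  separates two paths in its support.\<close>
lemma sub_single:
  assumes "N \<noteq> {\<lambda>_. \<zero>\<^bsub>F\<^esub>}"
  obtains z p where "p \<in> W.X0" "z \<in> carrier F" "z \<noteq> \<zero>\<^bsub>F\<^esub>" "W.delta z p \<in> N"
proof -
  let ?supp = "\<lambda>g. {q. g q \<noteq> \<zero>\<^bsub>F\<^esub>}"
  define P where "P = (\<lambda>g. g \<in> N \<and> g \<noteq> (\<lambda>_. \<zero>\<^bsub>F\<^esub>))"
  have "\<exists>g. P g" using assms sub_facts(2) by (auto simp: P_def)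
  then obtain g where g: "P g" and least: "\<And>h. P h \<Longrightarrow> card (?supp g) \<le> card (?supp h)"
    using ex_has_least_nat[of P _ "\<lambda>g. card (?supp g)"] by blast
  have gV: "g \<in> carrier W.V0" using g sub_facts(1) by (auto simp: P_def)
  obtain p where p: "g p \<noteq> \<zero>\<^bsub>F\<^esub>" using g by (auto simp: P_def fun_eq_iff)
  have single: "g q = \<zero>\<^bsub>F\<^esub>" if q: "q \<noteq> p" for q
  proof (rule ccontr)
    assume gq: "g q \<noteq> \<zero>\<^bsub>F\<^esub>"
    obtain s where s: "p = InfPath s" "s \<in> infinite_paths E" using W.V0_supp[OF gV p] by (rule X0_InfPath)
    obtain t where t: "q = InfPath t" "t \<in> infinite_paths E" using W.V0_supp[OF gV gq] by (rule X0_InfPath)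
    have "s \<noteq> t" using q s t by simp
    then obtain j where j: "s !! j \<noteq> t !! j" using sdrop_eq_iff[of 0 s 0 t] by auto
    let ?i = "Suc j"
    have st: "stake ?i t \<noteq> stake ?i s"
    proof
      assume "stake ?i t = stake ?i s"
      then have "stake ?i t ! j = stake ?i s ! j" by simp
      then show False using j by (simp del: stake.simps)
    qed
    let ?P = "(tail E (shd s), stake ?i s)"
    \<comment> \<open>The restriction of \<open>g\<close> to the paths with this initial segment keeps \<open>p\<close> and loses \<open>q\<close>, against minimality.\<close>
    let ?h = "act chenV (KS.ind (cylinder E ?P ?P)) g"
    note I = initial_segment_act[OF s(2) gV, of ?i]
    have h: "?h = (\<lambda>q. if \<exists>t. q = InfPath t \<and> stake ?i t = stake ?i s then g q else \<zero>\<^bsub>F\<^esub>)"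
      by (rule I(2)) simp
    have hN: "?h \<in> N" using sub_facts(5)[OF I(1)] g by (simp add: P_def)
    have "?h p \<noteq> \<zero>\<^bsub>F\<^esub>" unfolding h using p s(1) by auto
    then have "P ?h" using hN by (auto simp: P_def)
    have hq: "?h q = \<zero>\<^bsub>F\<^esub>" unfolding h using st t(1) by auto
    have hx: "?h x = \<zero>\<^bsub>F\<^esub> \<or> ?h x = g x" for x unfolding h by simp
    have "?supp ?h \<subset> ?supp g"
    proof
      show "?supp ?h \<subseteq> ?supp g"
      proof
        fix x assume "x \<in> ?supp ?h"
        then have "?h x \<noteq> \<zero>\<^bsub>F\<^esub>" by (rule CollectD)
        then have "g x \<noteq> \<zero>\<^bsub>F\<^esub>" using hx[of x] by (elim disjE) (blast, simp only: not_False_eq_True)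
        then show "x \<in> ?supp g" by (rule CollectI)
      qed
      have "q \<in> ?supp g" "q \<notin> ?supp ?h" using hq gq by (simp_all only: mem_Collect_eq not_False_eq_True simp_thms)
      then show "?supp ?h \<noteq> ?supp g" by metis
    qed
    then have "card (?supp ?h) < card (?supp g)" by (rule psubset_card_mono[OF W.V0_finite[OF gV]])
    then show False using least[OF \<open>P ?h\<close>] by simp
  qed
  have "W.delta (g p) p = g" using single by (simp add: W.delta_def fun_eq_iff)
  then show ?thesis using that[of p "g p"] W.V0_supp[OF gV p] W.V0_closed[OF gV] p g by (simp add: P_def)
qed

text \<open>The two paths share a tail, and the bisection that exchanges their initial segments moves one
  to the other.\<close>
lemma sub_move:
  assumes p: "(p, k1, x0) \<in> groupoid_arrows E" and q: "(q, k2, x0) \<in> groupoid_arrows E"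
    and z: "z \<in> carrier F" "W.delta z p \<in> N"
  shows "W.delta (W.cocycle q k2 \<otimes>\<^bsub>F\<^esub> (inv\<^bsub>F\<^esub> (W.cocycle p k1) \<otimes>\<^bsub>F\<^esub> z)) q \<in> N"
proof -
  obtain t where t: "p = InfPath t" "t \<in> infinite_paths E" using p by (auto simp: arrow_x0 tail_lag_def)
  obtain s where s: "q = InfPath s" "s \<in> infinite_paths E" using q by (auto simp: arrow_x0 tail_lag_def)
  obtain i j where ij: "sdrop i s = sdrop j t" "int i - int j = k2 - k1"
    using common_tail p q t(1) s(1) by metis
  let ?y = "InfPath (sdrop i s) :: ('v, 'e) epath" and ?v = "tail E (shd (sdrop i s))"
  have w: "awalk (tail E (shd s)) (stake i s) ?v" "awalk (tail E (shd t)) (stake j t) ?v"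
    using infinite_path_stake(1)[OF s(2), of i] infinite_path_stake(1)[OF t(2), of j] ij(1) by simp_all
  have y: "?y \<in> boundary_paths E" "path_source E ?y = ?v"
    using infinite_path_stake(2)[OF s(2)] by (simp_all add: boundary_InfPath)
  have pe: "path_append (tail E (shd t), stake j t) ?y = p"
    unfolding path_append.simps ij(1) stake_sdrop t(1) ..
  have qe: "path_append (tail E (shd s), stake i s) ?y = q"
    unfolding path_append.simps stake_sdrop s(1) ..
  have d: "int (length (stake i s)) - int (length (stake j t)) = k2 - k1" using ij(2) by simp
  note C = cylinder_delta[OF w z(1) y, of k1, unfolded pe qe d]
  have "act chenV (KS.ind (cylinder E (tail E (shd s), stake i s) (tail E (shd t), stake j t))) (W.delta z p) =
      W.delta (W.cocycle q k2 \<otimes>\<^bsub>F\<^esub> (inv\<^bsub>F\<^esub> (W.cocycle p k1) \<otimes>\<^bsub>F\<^esub> z)) q"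
    using C(2)[OF p] by simp
  then show ?thesis using sub_facts(5)[OF KS.cylinder_mem[OF w] z(2)] by simp
qed

text \<open>Arrows from \<open>p\<close> to itself that turn \<open>l\<close> times around the cycle multiply the coefficient by the
  \<open>l\<close>-th power of the class of \<open>t\<close>. The span of these multiples over \<open>K\<close> is \<open>F z0\<close>, which is \<open>F\<close> because \<open>z0\<close>
  is a unit.\<close>
lemma sub_all_multiples:
  assumes p: "p \<in> W.X0" and z0: "z0 \<in> carrier F" "z0 \<noteq> \<zero>\<^bsub>F\<^esub>" "W.delta z0 p \<in> N" and z: "z \<in> carrier F"
  shows "W.delta z p \<in> N"
proof -
  obtain k where k: "(p, k, x0) \<in> groupoid_arrows E" using p by (auto simp: tail_class_arrow)
  have u: "W.cocycle p k \<in> Units F" by (rule W.cocycle_unit[OF k])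
  have tau: "W.delta (tau l \<otimes>\<^bsub>F\<^esub> z0) p \<in> N" for l
  proof -
    have "W.cocycle p (k + l * int len) \<otimes>\<^bsub>F\<^esub> (inv\<^bsub>F\<^esub> (W.cocycle p k) \<otimes>\<^bsub>F\<^esub> z0) = (W.cocycle p k \<otimes>\<^bsub>F\<^esub> inv\<^bsub>F\<^esub> (W.cocycle p k)) \<otimes>\<^bsub>F\<^esub> (tau l \<otimes>\<^bsub>F\<^esub> z0)"
      unfolding cocycle_multiple(2)[OF k] using u z0(1) by (simp add: F.m_ac F.Units_closed)
    also have "\<dots> = tau l \<otimes>\<^bsub>F\<^esub> z0" using u z0(1) by simp
    finally show ?thesis using sub_move[OF k cocycle_multiple(1)[OF k, of l] z0(1,3)] by simp
  qed
  have "W.delta (y \<otimes>\<^bsub>F\<^esub> z0) p \<in> N" if "y \<in> carrier F" for y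
    using that
  proof (induction y rule: quotient_induct)
    case zero
    then show ?case using z0(1) sub_facts(2) by (simp add: W.delta_zero)
  next
    case (step k l y)
    have "(\<lambda>q. emb k \<otimes>\<^bsub>F\<^esub> W.delta (tau l \<otimes>\<^bsub>F\<^esub> z0) p q \<oplus>\<^bsub>F\<^esub> W.delta (y \<otimes>\<^bsub>F\<^esub> z0) p q) \<in> N"
      by (rule sub_facts(3)[OF sub_facts(4)[OF step(1) tau] step(3)])
    moreover have "(\<lambda>q. emb k \<otimes>\<^bsub>F\<^esub> W.delta (tau l \<otimes>\<^bsub>F\<^esub> z0) p q \<oplus>\<^bsub>F\<^esub> W.delta (y \<otimes>\<^bsub>F\<^esub> z0) p q) =
        W.delta ((emb k \<otimes>\<^bsub>F\<^esub> tau l \<oplus>\<^bsub>F\<^esub> y) \<otimes>\<^bsub>F\<^esub> z0) p"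
      using step(1,2) z0(1) by (simp add: W.delta_def fun_eq_iff F.l_distr F.m_assoc)
    ultimately show ?case by simp
  qed
  from this[of "z \<otimes>\<^bsub>F\<^esub> inv\<^bsub>F\<^esub> z0"] show ?thesis
    using z z0(1) F_unit[OF z0(1,2)] by (simp add: F.m_assoc)
qed

lemma sub_everything:
  assumes "N \<noteq> {\<lambda>_. \<zero>\<^bsub>F\<^esub>}"
  shows "N = carrier W.V0"
proof
  show "N \<subseteq> carrier W.V0" by (rule sub_facts(1))
  obtain z0 p where zp: "p \<in> W.X0" "z0 \<in> carrier F" "z0 \<noteq> \<zero>\<^bsub>F\<^esub>" "W.delta z0 p \<in> N"
    by (rule sub_single[OF assms])
  obtain k1 where k1: "(p, k1, x0) \<in> groupoid_arrows E" using zp(1) by (auto simp: tail_class_arrow)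
  have all: "W.delta z q \<in> N" if q: "q \<in> W.X0" and z: "z \<in> carrier F" for q z
  proof -
    obtain k2 where k2: "(q, k2, x0) \<in> groupoid_arrows E" using q by (auto simp: tail_class_arrow)
    let ?u = "W.cocycle q k2 \<otimes>\<^bsub>F\<^esub> inv\<^bsub>F\<^esub> (W.cocycle p k1)"
    have u: "?u \<in> Units F" "z0 \<in> Units F" using W.cocycle_unit[OF k1] W.cocycle_unit[OF k2] F_unit[OF zp(2,3)] by simp_all
    then have "?u \<otimes>\<^bsub>F\<^esub> z0 \<in> Units F" by simp
    moreover have "\<zero>\<^bsub>F\<^esub> \<notin> Units F" using field.field_Units[OF F_field] by simp
    ultimately have nz: "?u \<otimes>\<^bsub>F\<^esub> z0 \<noteq> \<zero>\<^bsub>F\<^esub>" by metis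
    have "W.delta (?u \<otimes>\<^bsub>F\<^esub> z0) q \<in> N"
      using sub_move[OF k1 k2 zp(2,4)] W.cocycle_unit[OF k1] W.cocycle_unit[OF k2] zp(2)
      by (simp add: F.m_assoc F.Units_closed)
    moreover have "?u \<otimes>\<^bsub>F\<^esub> z0 \<in> carrier F" using u by (simp add: F.Units_closed)
    ultimately show ?thesis using sub_all_multiples[OF q _ nz _ z] by blast
  qed
  show "carrier W.V0 \<subseteq> N"
  proof
    fix m assume "m \<in> carrier W.V0"
    then show "m \<in> N"
    proof (induction m rule: F.free_vs_induct)
      case zero
      then show ?case by (rule sub_facts(2))
    next
      case (step k a p)
      have "(\<lambda>s. k \<otimes>\<^bsub>F\<^esub> basis_vec F a s) = W.delta k a" using step(1) by (simp add: basis_vec_def W.delta_def fun_eq_iff)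
      then have "(\<lambda>s. k \<otimes>\<^bsub>F\<^esub> basis_vec F a s) \<in> N" using all[OF step(2,1)] by simp
      then show ?case using sub_facts(3) step(4) by blast
    qed
  qed
qed

end

theorem simple_chenV: "simple_left_module K KS.S chenV"
  unfolding simple_left_module_def
proof (intro conjI allI impI)
  show "left_module K KS.S chenV" by (rule left_module_chenV)
  have "(x0, 0, x0) \<in> groupoid_arrows E"
    unfolding arrow_x0 using tail_lag_zero by (auto simp: cycle_path_def)
  then have x0X: "x0 \<in> W.X0" by (auto simp: tail_class_arrow)
  have d: "W.delta \<one>\<^bsub>F\<^esub> x0 \<in> carrier W.V0" by (rule W.delta_V0[OF F.one_closed x0X])
  define s where "s = KS.ind (cylinder E (tail E (shd cinf), stake 1 cinf) (tail E (shd cinf), stake 1 cinf))"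
  note I = initial_segment_act[OF cinf_infinite d zero_less_one, folded s_def]
  have "\<exists>t. x0 = InfPath t \<and> stake 1 t = stake 1 cinf" unfolding cycle_path_def by blast
  then have "act chenV s (W.delta \<one>\<^bsub>F\<^esub> x0) x0 = \<one>\<^bsub>F\<^esub>"
    unfolding I(2) by (simp only: if_True W.delta_def refl)
  moreover have "\<one>\<^bsub>F\<^esub> \<noteq> \<zero>\<^bsub>F\<^esub>" using field.field_Units[OF F_field] F.Units_one_closed by auto
  ultimately have "act chenV s (W.delta \<one>\<^bsub>F\<^esub> x0) \<noteq> \<zero>\<^bsub>chenV\<^esub>"
    unfolding chenV_simps(2) free_vs_ops by metis
  moreover have "W.delta \<one>\<^bsub>F\<^esub> x0 \<in> carrier chenV" unfolding chenV_simps(1) by (rule d)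
  ultimately show "\<exists>a\<in>carrier KS.S. \<exists>x\<in>carrier chenV. act chenV a x \<noteq> \<zero>\<^bsub>chenV\<^esub>"
    using I(1) by blast
  show "N = {\<zero>\<^bsub>chenV\<^esub>} \<or> N = carrier chenV" if "alg_submodule K KS.S chenV N" for N
    using sub_everything[OF that] unfolding chenV_simps(1,2) free_vs_ops by blast
qed

end

section \<open>Recognizing a tensor product\<close>

lemma free_abelian_rcoset:
  "H #>\<^bsub>free_Abelian_group S\<^esub> z = (\<lambda>h. h + z) ` H"
  by (auto simp: r_coset_def)

text \<open>The hypotheses ensure that the relations of the tensor product lie in the free abelian group
  on the pairs.\<close>
locale tensor =
  fixes R :: "('r, 's) ring_scheme" and M :: "('k, 'm) module" and ra :: "'m \<Rightarrow> 'r \<Rightarrow> 'm"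
    and V :: "('k, 'r, 'x) alg_module"
  assumes M_monoid: "abelian_monoid M" and V_monoid: "abelian_monoid V"
    and ra_closed: "\<And>m r. m \<in> carrier M \<Longrightarrow> r \<in> carrier R \<Longrightarrow> ra m r \<in> carrier M"
    and act_closed: "\<And>r v. r \<in> carrier R \<Longrightarrow> v \<in> carrier V \<Longrightarrow> act V r v \<in> carrier V"
begin

sublocale M: abelian_monoid M by (rule M_monoid)
sublocale V: abelian_monoid V by (rule V_monoid)

abbreviation "FG \<equiv> free_Abelian_group (carrier M \<times> carrier V)"
abbreviation "N \<equiv> tensor_kernel R M ra V"

sublocale FG: comm_group FG by (rule abelian_free_Abelian_group)

lemma keys_diff_subset: "x \<in> carrier FG \<Longrightarrow> y \<in> carrier FG \<Longrightarrow> x - y \<in> carrier FG"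
  using keys_diff[of x y] by auto

lemma keys_add_subset: "x \<in> carrier FG \<Longrightarrow> y \<in> carrier FG \<Longrightarrow> x + y \<in> carrier FG"
  using FG.m_closed[of x y] by simp

lemma frag_mem: "m \<in> carrier M \<Longrightarrow> v \<in> carrier V \<Longrightarrow> frag_of (m, v) \<in> carrier FG"
  by simp

lemma relations_carrier: "tensor_relations R M ra V \<subseteq> carrier FG"
proof
  fix x assume "x \<in> tensor_relations R M ra V"
  then consider (left) m m' v where "x = frag_of (m \<oplus>\<^bsub>M\<^esub> m', v) - frag_of (m, v) - frag_of (m', v)"
      "m \<in> carrier M" "m' \<in> carrier M" "v \<in> carrier V"
    | (right) m v v' where "x = frag_of (m, v \<oplus>\<^bsub>V\<^esub> v') - frag_of (m, v) - frag_of (m, v')"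
      "m \<in> carrier M" "v \<in> carrier V" "v' \<in> carrier V"
    | (bal) m r v where "x = frag_of (ra m r, v) - frag_of (m, act V r v)"
      "m \<in> carrier M" "r \<in> carrier R" "v \<in> carrier V"
    unfolding tensor_relations_def by blast
  then show "x \<in> carrier FG"
  proof cases
    case left
    then show ?thesis unfolding left(1) by (intro keys_diff_subset frag_mem) auto
  next
    case right
    then show ?thesis unfolding right(1) by (intro keys_diff_subset frag_mem) auto
  next
    case bal
    then show ?thesis unfolding bal(1) by (intro keys_diff_subset frag_mem ra_closed act_closed)
  qed
qed

lemma N_subgroup: "subgroup N FG"
  unfolding tensor_kernel_def by (rule FG.generate_is_subgroup[OF relations_carrier])

lemma N_carrier: "N \<subseteq> carrier FG"
  by (rule subgroup.subset[OF N_subgroup])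

lemma N_zero: "0 \<in> N"
  using subgroup.one_closed[OF N_subgroup] by simp

lemma N_add: "x \<in> N \<Longrightarrow> y \<in> N \<Longrightarrow> x + y \<in> N"
  using subgroup.m_closed[OF N_subgroup] by simp

lemma N_uminus: "x \<in> N \<Longrightarrow> - x \<in> N"
  using subgroup.m_inv_closed[OF N_subgroup, of x] N_carrier by auto

lemma N_diff: "x \<in> N \<Longrightarrow> y \<in> N \<Longrightarrow> x - y \<in> N"
  using N_add[OF _ N_uminus] by simp

lemma N_left:
  "m \<in> carrier M \<Longrightarrow> m' \<in> carrier M \<Longrightarrow> v \<in> carrier V \<Longrightarrow>
    frag_of (m \<oplus>\<^bsub>M\<^esub> m', v) - frag_of (m, v) - frag_of (m', v) \<in> N"
  unfolding tensor_kernel_def tensor_relations_def by (intro generate.incl) blast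

lemma N_right:
  "m \<in> carrier M \<Longrightarrow> v \<in> carrier V \<Longrightarrow> v' \<in> carrier V \<Longrightarrow>
    frag_of (m, v \<oplus>\<^bsub>V\<^esub> v') - frag_of (m, v) - frag_of (m, v') \<in> N"
  unfolding tensor_kernel_def tensor_relations_def by (intro generate.incl) blast

lemma N_balanced:
  "m \<in> carrier M \<Longrightarrow> r \<in> carrier R \<Longrightarrow> v \<in> carrier V \<Longrightarrow>
    frag_of (ra m r, v) - frag_of (m, act V r v) \<in> N"
  unfolding tensor_kernel_def tensor_relations_def by (intro generate.incl) blast

lemma N_zero_left: "v \<in> carrier V \<Longrightarrow> frag_of (\<zero>\<^bsub>M\<^esub>, v) \<in> N"
  using N_uminus[OF N_left[of "\<zero>\<^bsub>M\<^esub>" "\<zero>\<^bsub>M\<^esub>" v]] by simp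

lemma N_zero_right: "m \<in> carrier M \<Longrightarrow> frag_of (m, \<zero>\<^bsub>V\<^esub>) \<in> N"
  using N_uminus[OF N_right[of m "\<zero>\<^bsub>V\<^esub>" "\<zero>\<^bsub>V\<^esub>"]] by simp

end

locale balanced_map = tensor R M ra V
  for R :: "('r, 's) ring_scheme" and M :: "('k, 'm) module" and ra :: "'m \<Rightarrow> 'r \<Rightarrow> 'm"
    and V :: "('k, 'r, 'x) alg_module" +
  fixes G :: "('g, 'z) ring_scheme" and beta :: "'m \<Rightarrow> 'x \<Rightarrow> 'g"
  assumes G_group: "abelian_group G"
    and beta_closed: "\<And>m v. m \<in> carrier M \<Longrightarrow> v \<in> carrier V \<Longrightarrow> beta m v \<in> carrier G"
    and beta_left: "\<And>m m' v. \<lbrakk>m \<in> carrier M; m' \<in> carrier M; v \<in> carrier V\<rbrakk> \<Longrightarrow>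
      beta (m \<oplus>\<^bsub>M\<^esub> m') v = beta m v \<oplus>\<^bsub>G\<^esub> beta m' v"
    and beta_right: "\<And>m v v'. \<lbrakk>m \<in> carrier M; v \<in> carrier V; v' \<in> carrier V\<rbrakk> \<Longrightarrow>
      beta m (v \<oplus>\<^bsub>V\<^esub> v') = beta m v \<oplus>\<^bsub>G\<^esub> beta m v'"
    and beta_balanced: "\<And>m r v. \<lbrakk>m \<in> carrier M; r \<in> carrier R; v \<in> carrier V\<rbrakk> \<Longrightarrow>
      beta (ra m r) v = beta m (act V r v)"
begin

sublocale G: abelian_group G by (rule G_group)

text \<open>The homomorphism on the free abelian group that \<open>beta\<close> induces.\<close>
definition theta :: "('m \<times> 'x \<Rightarrow>\<^sub>0 int) \<Rightarrow> 'g" where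
  "theta = (SOME h. h \<in> hom FG (add_monoid G) \<and> (\<forall>m\<in>carrier M. \<forall>v\<in>carrier V. h (frag_of (m, v)) = beta m v))"

lemma theta_hom: "theta \<in> hom FG (add_monoid G)"
  and theta_frag: "m \<in> carrier M \<Longrightarrow> v \<in> carrier V \<Longrightarrow> theta (frag_of (m, v)) = beta m v"
proof -
  have "(\<lambda>(m, v). beta m v) ` (carrier M \<times> carrier V) \<subseteq> carrier (add_monoid G)"
    using beta_closed by auto
  then obtain h where "h \<in> hom FG (add_monoid G)"
    "\<And>x. x \<in> carrier M \<times> carrier V \<Longrightarrow> h (frag_of x) = (\<lambda>(m, v). beta m v) x"
    using comm_group.free_Abelian_group_universal[OF G.a_comm_group] by metis
  then have h: "h \<in> hom FG (add_monoid G) \<and> (\<forall>m\<in>carrier M. \<forall>v\<in>carrier V. h (frag_of (m, v)) = beta m v)"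
    by simp
  have *: "theta \<in> hom FG (add_monoid G) \<and> (\<forall>m\<in>carrier M. \<forall>v\<in>carrier V. theta (frag_of (m, v)) = beta m v)"
    unfolding theta_def by (rule someI[where P = "\<lambda>h. h \<in> hom FG (add_monoid G) \<and>
      (\<forall>m\<in>carrier M. \<forall>v\<in>carrier V. h (frag_of (m, v)) = beta m v)", OF h])
  then show "theta \<in> hom FG (add_monoid G)" ..
  show "theta (frag_of (m, v)) = beta m v" if "m \<in> carrier M" "v \<in> carrier V" using * that by blast
qed

lemma theta_closed: "z \<in> carrier FG \<Longrightarrow> theta z \<in> carrier G"
  using hom_in_carrier[OF theta_hom] by simp

lemma theta_add: "x \<in> carrier FG \<Longrightarrow> y \<in> carrier FG \<Longrightarrow> theta (x + y) = theta x \<oplus>\<^bsub>G\<^esub> theta y"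
  using hom_mult[OF theta_hom, of x y] by simp

lemma theta_zero: "theta 0 = \<zero>\<^bsub>G\<^esub>"
  using hom_one[OF theta_hom group_free_Abelian_group G.a_group] by simp

lemma theta_diff:
  assumes "x \<in> carrier FG" "y \<in> carrier FG"
  shows "theta (x - y) = theta x \<ominus>\<^bsub>G\<^esub> theta y"
proof -
  have d: "x - y \<in> carrier FG" by (rule keys_diff_subset[OF assms])
  have "theta x = theta (x - y) \<oplus>\<^bsub>G\<^esub> theta y"
    using theta_add[OF d assms(2)] by simp
  then show ?thesis
    using theta_closed[OF d] theta_closed[OF assms(2)] by (simp add: G.minus_eq G.a_assoc G.r_neg)
qed

lemma theta_uminus: "x \<in> carrier FG \<Longrightarrow> theta (- x) = \<ominus>\<^bsub>G\<^esub> theta x"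
  using theta_diff[of 0 x] theta_closed[of x] by (simp add: theta_zero G.minus_eq)

lemma theta_relation:
  assumes "x \<in> tensor_relations R M ra V"
  shows "theta x = \<zero>\<^bsub>G\<^esub>"
proof -
  have cancel: "(p \<oplus>\<^bsub>G\<^esub> q) \<ominus>\<^bsub>G\<^esub> p \<ominus>\<^bsub>G\<^esub> q = \<zero>\<^bsub>G\<^esub>" if "p \<in> carrier G" "q \<in> carrier G" for p q
  proof -
    have "(p \<oplus>\<^bsub>G\<^esub> q) \<ominus>\<^bsub>G\<^esub> p \<ominus>\<^bsub>G\<^esub> q = (p \<oplus>\<^bsub>G\<^esub> q) \<oplus>\<^bsub>G\<^esub> \<ominus>\<^bsub>G\<^esub> (p \<oplus>\<^bsub>G\<^esub> q)"
      using that by (simp add: G.minus_eq G.a_assoc G.minus_add)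
    then show ?thesis using that by (simp add: G.r_neg)
  qed
  consider (left) m m' v where "x = frag_of (m \<oplus>\<^bsub>M\<^esub> m', v) - frag_of (m, v) - frag_of (m', v)"
      "m \<in> carrier M" "m' \<in> carrier M" "v \<in> carrier V"
    | (right) m v v' where "x = frag_of (m, v \<oplus>\<^bsub>V\<^esub> v') - frag_of (m, v) - frag_of (m, v')"
      "m \<in> carrier M" "v \<in> carrier V" "v' \<in> carrier V"
    | (bal) m r v where "x = frag_of (ra m r, v) - frag_of (m, act V r v)"
      "m \<in> carrier M" "r \<in> carrier R" "v \<in> carrier V"
    using assms unfolding tensor_relations_def by blast
  then show ?thesis
  proof cases
    case left
    have mm: "m \<oplus>\<^bsub>M\<^esub> m' \<in> carrier M" using left by simp
    note F = frag_mem[OF mm left(4)] frag_mem[OF left(2,4)] frag_mem[OF left(3,4)]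
    show ?thesis
      unfolding left(1) theta_diff[OF keys_diff_subset[OF F(1,2)] F(3)] theta_diff[OF F(1,2)]
        theta_frag[OF mm left(4)] theta_frag[OF left(2,4)] theta_frag[OF left(3,4)] beta_left[OF left(2-4)]
      by (rule cancel) (use left beta_closed in auto)
  next
    case right
    have vv: "v \<oplus>\<^bsub>V\<^esub> v' \<in> carrier V" using right by simp
    note F = frag_mem[OF right(2) vv] frag_mem[OF right(2,3)] frag_mem[OF right(2,4)]
    show ?thesis
      unfolding right(1) theta_diff[OF keys_diff_subset[OF F(1,2)] F(3)] theta_diff[OF F(1,2)]
        theta_frag[OF right(2) vv] theta_frag[OF right(2,3)] theta_frag[OF right(2,4)] beta_right[OF right(2-4)]
      by (rule cancel) (use right beta_closed in auto)
  next
    case bal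
    note c = ra_closed[OF bal(2,3)] act_closed[OF bal(3,4)]
    show ?thesis
      unfolding bal(1) theta_diff[OF frag_mem[OF c(1) bal(4)] frag_mem[OF bal(2) c(2)]]
        theta_frag[OF c(1) bal(4)] theta_frag[OF bal(2) c(2)] beta_balanced[OF bal(2-4)]
      using beta_closed[OF bal(2) c(2)] by (simp add: G.minus_eq G.r_neg)
  qed
qed

lemma theta_N: "x \<in> N \<Longrightarrow> theta x = \<zero>\<^bsub>G\<^esub>"
  unfolding tensor_kernel_def
proof (induction x rule: generate.induct)
  case one
  then show ?case by (simp add: theta_zero)
next
  case (incl h)
  then show ?case by (rule theta_relation)
next
  case (inv h)
  then have h: "h \<in> carrier FG" using relations_carrier by blast
  then show ?case using theta_uminus[OF h] theta_relation[OF inv] by simp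
next
  case (eng h1 h2)
  then have "h1 \<in> carrier FG" "h2 \<in> carrier FG"
    using FG.generate_in_carrier[OF relations_carrier] by blast+
  then show ?case using theta_add[of h1 h2] eng by simp
qed

end

text \<open>A balanced map exhibits its target as the tensor product as soon as it generates the target
  and kills nothing but consequences of the relations.\<close>
locale tensor_model = balanced_map R M ra V G beta
  for R :: "('r, 's) ring_scheme" and M :: "('k, 'm) module" and ra :: "'m \<Rightarrow> 'r \<Rightarrow> 'm"
    and V :: "('k, 'r, 'x) alg_module" and G :: "('g, 'z) ring_scheme" and beta :: "'m \<Rightarrow> 'x \<Rightarrow> 'g" +
  assumes theta_surj: "\<And>u. u \<in> carrier G \<Longrightarrow> \<exists>z\<in>carrier FG. theta z = u"
    and theta_kernel: "\<And>z. z \<in> carrier FG \<Longrightarrow> theta z = \<zero>\<^bsub>G\<^esub> \<Longrightarrow> z \<in> N"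
begin

abbreviation "T \<equiv> tensor_product R M ra V"

text \<open>The elements of the tensor product are the fibres of \<open>theta\<close>.\<close>
lemma coset_eq:
  assumes z: "z \<in> carrier FG"
  shows "N #>\<^bsub>FG\<^esub> z = {y \<in> carrier FG. theta y = theta z}"
proof (intro equalityI subsetI)
  fix y assume "y \<in> N #>\<^bsub>FG\<^esub> z"
  then obtain n where n: "n \<in> N" "y = n + z" by (auto simp: free_abelian_rcoset)
  have nc: "n \<in> carrier FG" using n N_carrier by blast
  have "theta y = theta z"
    unfolding n(2) theta_add[OF nc z] theta_N[OF n(1)] using theta_closed[OF z] by simp
  moreover have "y \<in> carrier FG" unfolding n(2) by (rule keys_add_subset[OF nc z])
  ultimately show "y \<in> {y \<in> carrier FG. theta y = theta z}" by blast
next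
  fix y assume "y \<in> {y \<in> carrier FG. theta y = theta z}"
  then have y: "y \<in> carrier FG" "theta y = theta z" by simp_all
  have "theta (y - z) = \<zero>\<^bsub>G\<^esub>"
    unfolding theta_diff[OF y(1) z] y(2) using theta_closed[OF z] by (simp add: G.minus_eq G.r_neg)
  then have "y - z \<in> N" by (rule theta_kernel[OF keys_diff_subset[OF y(1) z]])
  moreover have "y = (y - z) + z" by simp
  ultimately show "y \<in> N #>\<^bsub>FG\<^esub> z" unfolding free_abelian_rcoset by (rule rev_image_eqI)
qed

lemma T_carrier: "Y \<in> carrier T \<longleftrightarrow> (\<exists>z\<in>carrier FG. Y = N #>\<^bsub>FG\<^esub> z)"
  unfolding tensor_product_def carrier_FactGroup by blast

text \<open>\<open>theta\<close> is constant on each coset, so that the choice of a representative does not matter.\<close>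
definition model :: "('m \<times> 'x \<Rightarrow>\<^sub>0 int) set \<Rightarrow> 'g" where
  "model Y = theta (SOME z. z \<in> Y)"

lemma model_coset:
  assumes z: "z \<in> carrier FG"
  shows "model (N #>\<^bsub>FG\<^esub> z) = theta z"
proof -
  have "z \<in> N #>\<^bsub>FG\<^esub> z" unfolding coset_eq[OF z] using z by blast
  then have "(SOME y. y \<in> N #>\<^bsub>FG\<^esub> z) \<in> N #>\<^bsub>FG\<^esub> z" by (rule someI)
  then show ?thesis unfolding model_def coset_eq[OF z] by blast
qed

lemma model_bij: "bij_betw model (carrier T) (carrier G)"
  unfolding bij_betw_def
proof
  show "inj_on model (carrier T)"
  proof (rule inj_onI)
    fix Y Z assume "Y \<in> carrier T" "Z \<in> carrier T" and e: "model Y = model Z"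
    then obtain y z where yz: "y \<in> carrier FG" "z \<in> carrier FG" "Y = N #>\<^bsub>FG\<^esub> y" "Z = N #>\<^bsub>FG\<^esub> z"
      unfolding T_carrier by blast
    then have "theta y = theta z" using e by (simp only: model_coset)
    then show "Y = Z" unfolding yz(3,4) coset_eq[OF yz(1)] coset_eq[OF yz(2)] by simp
  qed
  show "model ` carrier T = carrier G"
  proof
    show "model ` carrier T \<subseteq> carrier G"
      by (auto simp only: T_carrier model_coset theta_closed)
    show "carrier G \<subseteq> model ` carrier T"
    proof
      fix u assume "u \<in> carrier G"
      then obtain z where z: "z \<in> carrier FG" "theta z = u" using theta_surj by blast
      have "N #>\<^bsub>FG\<^esub> z \<in> carrier T" unfolding T_carrier using z(1) by blast
      moreover have "u = model (N #>\<^bsub>FG\<^esub> z)" using model_coset[OF z(1)] z(2) by simp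
      ultimately show "u \<in> model ` carrier T" by (rule rev_image_eqI)
    qed
  qed
qed

lemma N_normal: "N \<lhd> FG"
  using FG.normal_iff_subgroup N_subgroup by blast

lemma model_add:
  assumes "Y \<in> carrier T" "Z \<in> carrier T"
  shows "Y \<otimes>\<^bsub>T\<^esub> Z \<in> carrier T" "model (Y \<otimes>\<^bsub>T\<^esub> Z) = model Y \<oplus>\<^bsub>G\<^esub> model Z"
proof -
  obtain y z where yz: "y \<in> carrier FG" "z \<in> carrier FG" "Y = N #>\<^bsub>FG\<^esub> y" "Z = N #>\<^bsub>FG\<^esub> z"
    using assms unfolding T_carrier by blast
  have s: "y + z \<in> carrier FG" by (rule keys_add_subset[OF yz(1,2)])
  have p: "Y \<otimes>\<^bsub>T\<^esub> Z = N #>\<^bsub>FG\<^esub> (y + z)"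
    unfolding tensor_product_def mult_FactGroup yz(3,4) normal.rcos_sum[OF N_normal yz(1,2)] by simp
  show "Y \<otimes>\<^bsub>T\<^esub> Z \<in> carrier T" unfolding p T_carrier using s by blast
  show "model (Y \<otimes>\<^bsub>T\<^esub> Z) = model Y \<oplus>\<^bsub>G\<^esub> model Z"
    unfolding p model_coset[OF s] unfolding yz(3,4) model_coset[OF yz(1)] model_coset[OF yz(2)]
    by (rule theta_add[OF yz(1,2)])
qed

lemma model_one: "\<one>\<^bsub>T\<^esub> \<in> carrier T" "model \<one>\<^bsub>T\<^esub> = \<zero>\<^bsub>G\<^esub>"
proof -
  have z: "0 \<in> carrier FG" by simp
  have o: "\<one>\<^bsub>T\<^esub> = N #>\<^bsub>FG\<^esub> 0" unfolding tensor_product_def one_FactGroup free_abelian_rcoset by simp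
  show "\<one>\<^bsub>T\<^esub> \<in> carrier T" unfolding o T_carrier using z by blast
  show "model \<one>\<^bsub>T\<^esub> = \<zero>\<^bsub>G\<^esub>" unfolding o model_coset[OF z] by (rule theta_zero)
qed

text \<open>On the free abelian group \<open>theta\<close> turns the endomorphism induced by \<open>h\<close> into \<open>g\<close>, since both agree
  on the generators. Hence this endomorphism respects the fibres of \<open>theta\<close>.\<close>
lemma model_map:
  assumes h: "\<And>m. m \<in> carrier M \<Longrightarrow> h m \<in> carrier M"
    and g: "\<And>x. x \<in> carrier G \<Longrightarrow> g x \<in> carrier G"
      "\<And>x y. x \<in> carrier G \<Longrightarrow> y \<in> carrier G \<Longrightarrow> g (x \<oplus>\<^bsub>G\<^esub> y) = g x \<oplus>\<^bsub>G\<^esub> g y"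
    and hg: "\<And>m v. m \<in> carrier M \<Longrightarrow> v \<in> carrier V \<Longrightarrow> beta (h m) v = g (beta m v)"
    and Y: "Y \<in> carrier T"
  shows "tensor_map R M ra V h Y \<in> carrier T" "model (tensor_map R M ra V h Y) = g (model Y)"
proof -
  let ?e = "frag_extend (\<lambda>(m, v). frag_of (h m, v))"
  have gz: "g \<zero>\<^bsub>G\<^esub> = \<zero>\<^bsub>G\<^esub>"
    using g(1)[OF G.zero_closed] g(2)[OF G.zero_closed G.zero_closed] by (simp add: G.add.r_cancel_one')
  have gd: "g (x \<ominus>\<^bsub>G\<^esub> y) = g x \<ominus>\<^bsub>G\<^esub> g y" if xy: "x \<in> carrier G" "y \<in> carrier G" for x y
  proof -
    have "g x = g (x \<ominus>\<^bsub>G\<^esub> y) \<oplus>\<^bsub>G\<^esub> g y"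
      using g(2)[of "x \<ominus>\<^bsub>G\<^esub> y" y] xy by (simp add: G.minus_eq G.a_assoc G.l_neg)
    then show ?thesis using g(1)[of "x \<ominus>\<^bsub>G\<^esub> y"] g(1)[OF xy(2)] xy by (simp add: G.minus_eq G.a_assoc G.r_neg)
  qed
  have e: "?e z \<in> carrier FG \<and> theta (?e z) = g (theta z)" if "z \<in> carrier FG" for z
    using that unfolding carrier_free_Abelian_group_iff
  proof (induction z rule: free_Abelian_group_induct[consumes 1, case_names zero diff frag])
    case zero
    then show ?case by (simp add: theta_zero gz)
  next
    case (diff x y)
    then have xy: "x \<in> carrier FG" "y \<in> carrier FG" "?e x \<in> carrier FG" "?e y \<in> carrier FG" by simp_all
    have d: "?e (x - y) = ?e x - ?e y" by (rule frag_extend_diff)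
    have c: "?e x - ?e y \<in> carrier FG" by (rule keys_diff_subset[OF xy(3,4)])
    have "theta (?e x - ?e y) = g (theta x) \<ominus>\<^bsub>G\<^esub> g (theta y)"
      unfolding theta_diff[OF xy(3,4)] using diff by simp
    also have "\<dots> = g (theta (x - y))"
      unfolding theta_diff[OF xy(1,2)] gd[OF theta_closed[OF xy(1)] theta_closed[OF xy(2)]] ..
    finally show ?case using c unfolding d by simp
  next
    case (frag a)
    then obtain m v where a: "a = (m, v)" "m \<in> carrier M" "v \<in> carrier V" by blast
    show ?case using frag_mem[OF h[OF a(2)] a(3)] theta_frag[OF h[OF a(2)] a(3)] theta_frag[OF a(2,3)] hg[OF a(2,3)]
      by (simp add: a(1))
  qed
  obtain z where z: "z \<in> carrier FG" "Y = N #>\<^bsub>FG\<^esub> z" using Y unfolding T_carrier by blast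
  have "N #>\<^bsub>FG\<^esub> ?e y = N #>\<^bsub>FG\<^esub> ?e z" if "y \<in> Y" for y
  proof -
    have "y \<in> carrier FG" "theta y = theta z" using that unfolding z(2) coset_eq[OF z(1)] by blast+
    then show ?thesis using e[of y] e[OF z(1)] coset_eq[of "?e y"] coset_eq[of "?e z"] by simp
  qed
  moreover have "z \<in> Y" unfolding z(2) coset_eq[OF z(1)] using z(1) by blast
  ultimately have t: "tensor_map R M ra V h Y = N #>\<^bsub>FG\<^esub> ?e z" unfolding tensor_map_def by blast
  have ez: "?e z \<in> carrier FG" using e[OF z(1)] by (rule conjunct1)
  show "tensor_map R M ra V h Y \<in> carrier T" unfolding t T_carrier using ez by blast
  show "model (tensor_map R M ra V h Y) = g (model Y)"
    unfolding t model_coset[OF ez] unfolding z(2) model_coset[OF z(1)] using e[OF z(1)] by (rule conjunct2)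
qed

end

section \<open>Transport of structure\<close>

text \<open>The axioms for \<open>W\<close> are identities, which can be checked after applying the injective map \<open>g\<close>;
  submodules of \<open>W\<close> correspond to their images.\<close>
lemma simple_left_module_transport:
  fixes V :: "('k, 'a, 'x) alg_module" and W :: "('k, 'a, 'y) alg_module"
  assumes V: "simple_left_module K A V" and bij: "bij_betw g (carrier W) (carrier V)"
    and zero: "\<zero>\<^bsub>W\<^esub> \<in> carrier W" "g \<zero>\<^bsub>W\<^esub> = \<zero>\<^bsub>V\<^esub>"
    and add: "\<And>x y. x \<in> carrier W \<Longrightarrow> y \<in> carrier W \<Longrightarrow> x \<oplus>\<^bsub>W\<^esub> y \<in> carrier W \<and> g (x \<oplus>\<^bsub>W\<^esub> y) = g x \<oplus>\<^bsub>V\<^esub> g y"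
    and smult: "\<And>k x. k \<in> carrier K \<Longrightarrow> x \<in> carrier W \<Longrightarrow> k \<odot>\<^bsub>W\<^esub> x \<in> carrier W \<and> g (k \<odot>\<^bsub>W\<^esub> x) = k \<odot>\<^bsub>V\<^esub> g x"
    and act: "\<And>a x. a \<in> carrier A \<Longrightarrow> x \<in> carrier W \<Longrightarrow> act W a x \<in> carrier W \<and> g (act W a x) = act V a (g x)"
    and A: "\<And>a b. a \<in> carrier A \<Longrightarrow> b \<in> carrier A \<Longrightarrow> a \<oplus>\<^bsub>A\<^esub> b \<in> carrier A \<and> a \<otimes>\<^bsub>A\<^esub> b \<in> carrier A"
      "\<And>k a. k \<in> carrier K \<Longrightarrow> a \<in> carrier A \<Longrightarrow> k \<odot>\<^bsub>A\<^esub> a \<in> carrier A"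
  shows "simple_left_module K A W" "left_modules_isomorphic K A V W"
proof -
  have lV: "left_module K A V" using V by (simp add: simple_left_module_def)
  then have mV: "module K V" by (simp add: left_module_def)
  interpret V: module K V by (rule mV)
  have inj: "x = y" if "g x = g y" "x \<in> carrier W" "y \<in> carrier W" for x y
    using bij that by (auto simp: bij_betw_def inj_on_def)
  have gc: "g x \<in> carrier V" if "x \<in> carrier W" for x using bij that by (auto simp: bij_betw_def)
  have surj: "\<exists>y\<in>carrier W. g y = x" if "x \<in> carrier V" for x using bij that by (force simp: bij_betw_def)
  have aW: "x \<oplus>\<^bsub>W\<^esub> y \<in> carrier W" "g (x \<oplus>\<^bsub>W\<^esub> y) = g x \<oplus>\<^bsub>V\<^esub> g y" if "x \<in> carrier W" "y \<in> carrier W" for x y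
    using add[OF that] by simp_all
  have sW: "k \<odot>\<^bsub>W\<^esub> x \<in> carrier W" "g (k \<odot>\<^bsub>W\<^esub> x) = k \<odot>\<^bsub>V\<^esub> g x" if "k \<in> carrier K" "x \<in> carrier W" for k x
    using smult[OF that] by simp_all
  have cW: "act W a x \<in> carrier W" "g (act W a x) = act V a (g x)" if "a \<in> carrier A" "x \<in> carrier W" for a x
    using act[OF that] by simp_all
  have mW: "module K W"
  proof (rule moduleI)
    show "cring K" by (rule V.R.is_cring)
    show "abelian_group W"
    proof (rule abelian_groupI)
      fix x assume x: "x \<in> carrier W"
      obtain y where y: "y \<in> carrier W" "g y = \<ominus>\<^bsub>V\<^esub> g x" using surj[OF V.M.a_inv_closed[OF gc[OF x]]] by blast
      have "y \<oplus>\<^bsub>W\<^esub> x = \<zero>\<^bsub>W\<^esub>"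
        by (rule inj) (use x y zero gc in \<open>simp_all add: aW V.M.l_neg\<close>)
      then show "\<exists>y\<in>carrier W. y \<oplus>\<^bsub>W\<^esub> x = \<zero>\<^bsub>W\<^esub>" using y(1) by blast
      show "\<zero>\<^bsub>W\<^esub> \<oplus>\<^bsub>W\<^esub> x = x" by (rule inj) (use x zero gc in \<open>simp_all add: aW\<close>)
      fix y assume y: "y \<in> carrier W"
      show "x \<oplus>\<^bsub>W\<^esub> y \<in> carrier W" by (rule aW(1)[OF x y])
      show "x \<oplus>\<^bsub>W\<^esub> y = y \<oplus>\<^bsub>W\<^esub> x" by (rule inj) (use x y gc in \<open>simp_all add: aW V.M.a_comm\<close>)
      fix z assume z: "z \<in> carrier W"
      show "x \<oplus>\<^bsub>W\<^esub> y \<oplus>\<^bsub>W\<^esub> z = x \<oplus>\<^bsub>W\<^esub> (y \<oplus>\<^bsub>W\<^esub> z)"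
        by (rule inj) (use x y z gc in \<open>simp_all add: aW V.M.a_assoc\<close>)
    qed (rule zero(1))
  next
    fix k l x assume k: "k \<in> carrier K" and x: "x \<in> carrier W"
    show "k \<odot>\<^bsub>W\<^esub> x \<in> carrier W" by (rule sW(1)[OF k x])
    {
      assume l: "l \<in> carrier K"
      show "(k \<oplus>\<^bsub>K\<^esub> l) \<odot>\<^bsub>W\<^esub> x = k \<odot>\<^bsub>W\<^esub> x \<oplus>\<^bsub>W\<^esub> l \<odot>\<^bsub>W\<^esub> x"
        by (rule inj) (use k l x gc in \<open>simp_all add: aW sW V.smult_l_distr\<close>)
      show "(k \<otimes>\<^bsub>K\<^esub> l) \<odot>\<^bsub>W\<^esub> x = k \<odot>\<^bsub>W\<^esub> (l \<odot>\<^bsub>W\<^esub> x)"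
        by (rule inj) (use k l x gc in \<open>simp_all add: sW V.smult_assoc1\<close>)
    }
    fix y assume y: "y \<in> carrier W"
    show "k \<odot>\<^bsub>W\<^esub> (x \<oplus>\<^bsub>W\<^esub> y) = k \<odot>\<^bsub>W\<^esub> x \<oplus>\<^bsub>W\<^esub> k \<odot>\<^bsub>W\<^esub> y"
      by (rule inj) (use k x y gc in \<open>simp_all add: aW sW V.smult_r_distr\<close>)
  next
    fix x assume x: "x \<in> carrier W"
    show "\<one>\<^bsub>K\<^esub> \<odot>\<^bsub>W\<^esub> x = x" by (rule inj) (use x gc in \<open>simp_all add: sW V.smult_one\<close>)
  qed
  have V1: "act V a (x \<oplus>\<^bsub>V\<^esub> y) = act V a x \<oplus>\<^bsub>V\<^esub> act V a y" if "a \<in> carrier A" "x \<in> carrier V" "y \<in> carrier V" for a x y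
    using lV that by (simp add: left_module_def)
  have V2: "act V (a \<oplus>\<^bsub>A\<^esub> b) x = act V a x \<oplus>\<^bsub>V\<^esub> act V b x" "act V (a \<otimes>\<^bsub>A\<^esub> b) x = act V a (act V b x)"
    if "a \<in> carrier A" "b \<in> carrier A" "x \<in> carrier V" for a b x
    using lV that by (simp_all add: left_module_def)
  have V3: "act V (k \<odot>\<^bsub>A\<^esub> a) x = k \<odot>\<^bsub>V\<^esub> act V a x" "act V a (k \<odot>\<^bsub>V\<^esub> x) = k \<odot>\<^bsub>V\<^esub> act V a x"
    if "k \<in> carrier K" "a \<in> carrier A" "x \<in> carrier V" for k a x
    using lV that by (simp_all add: left_module_def)
  have lW: "left_module K A W"
    unfolding left_module_def
  proof (intro conjI ballI)
    show "module K W" by (rule mW)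
    fix a x assume a: "a \<in> carrier A" and x: "x \<in> carrier W"
    show "act W a x \<in> carrier W" by (rule cW(1)[OF a x])
    {
      fix y assume y: "y \<in> carrier W"
      show "act W a (x \<oplus>\<^bsub>W\<^esub> y) = act W a x \<oplus>\<^bsub>W\<^esub> act W a y"
        by (rule inj) (use a x y gc in \<open>simp_all add: aW cW V1\<close>)
    }
    {
      fix b assume b: "b \<in> carrier A"
      have ab: "a \<oplus>\<^bsub>A\<^esub> b \<in> carrier A" "a \<otimes>\<^bsub>A\<^esub> b \<in> carrier A" using A(1)[OF a b] by simp_all
      show "act W (a \<oplus>\<^bsub>A\<^esub> b) x = act W a x \<oplus>\<^bsub>W\<^esub> act W b x"
        by (rule inj) (use a b ab x gc in \<open>simp_all add: aW cW V2\<close>)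
      show "act W (a \<otimes>\<^bsub>A\<^esub> b) x = act W a (act W b x)"
        by (rule inj) (use a b ab x gc in \<open>simp_all add: cW V2\<close>)
    }
  next
    fix k a x assume k: "k \<in> carrier K" and a: "a \<in> carrier A" and x: "x \<in> carrier W"
    show "act W (k \<odot>\<^bsub>A\<^esub> a) x = k \<odot>\<^bsub>W\<^esub> act W a x"
      by (rule inj) (use k a x gc A(2) in \<open>simp_all add: cW sW V3\<close>)
    show "act W a (k \<odot>\<^bsub>W\<^esub> x) = k \<odot>\<^bsub>W\<^esub> act W a x"
      by (rule inj) (use k a x gc in \<open>simp_all add: cW sW V3\<close>)
  qed
  have nz: "\<exists>a\<in>carrier A. \<exists>x\<in>carrier W. act W a x \<noteq> \<zero>\<^bsub>W\<^esub>"
  proof -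
    obtain a x where ax: "a \<in> carrier A" "x \<in> carrier V" "act V a x \<noteq> \<zero>\<^bsub>V\<^esub>"
      using V by (auto simp: simple_left_module_def)
    obtain y where y: "y \<in> carrier W" "g y = x" using surj[OF ax(2)] by blast
    have "act W a y \<noteq> \<zero>\<^bsub>W\<^esub>" using cW(2)[OF ax(1) y(1)] ax(3) y(2) zero(2) by auto
    then show ?thesis using ax(1) y(1) by blast
  qed
  have sub: "N = {\<zero>\<^bsub>W\<^esub>} \<or> N = carrier W" if N: "alg_submodule K A W N" for N
  proof -
    have sN: "submodule N K W" using N by (simp add: alg_submodule_def)
    note E = module.submoduleE[OF mW sN]
    have NW: "N \<subseteq> carrier W" by (rule E(1))
    have z: "\<zero>\<^bsub>W\<^esub> \<in> N" using subgroup.one_closed[OF submodule.axioms(1)[OF sN]] by simp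
    have "submodule (g ` N) K V"
    proof (rule V.submoduleI)
      show "g ` N \<subseteq> carrier V" using NW gc by blast
      show "\<zero>\<^bsub>V\<^esub> \<in> g ` N" using z zero(2) by (metis imageI)
      have sm: "k \<odot>\<^bsub>V\<^esub> y \<in> g ` N" if k: "k \<in> carrier K" and y: "y \<in> g ` N" for k y
      proof -
        obtain n where n: "n \<in> N" "y = g n" using y by blast
        have "k \<odot>\<^bsub>V\<^esub> y = g (k \<odot>\<^bsub>W\<^esub> n)" using sW(2)[OF k] n NW by auto
        then show ?thesis using E(4)[OF k n(1)] by blast
      qed
      show "k \<odot>\<^bsub>V\<^esub> y \<in> g ` N" if "k \<in> carrier K" "y \<in> g ` N" for k y using that by (rule sm)
      show "\<ominus>\<^bsub>V\<^esub> y \<in> g ` N" if y: "y \<in> g ` N" for y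
      proof -
        have yV: "y \<in> carrier V" using y NW gc by blast
        have "(\<ominus>\<^bsub>K\<^esub> \<one>\<^bsub>K\<^esub>) \<odot>\<^bsub>V\<^esub> y = \<ominus>\<^bsub>V\<^esub> y" using yV by (simp add: V.smult_l_minus V.smult_one)
        then show ?thesis using sm[of "\<ominus>\<^bsub>K\<^esub> \<one>\<^bsub>K\<^esub>" y] y by simp
      qed
      show "x \<oplus>\<^bsub>V\<^esub> y \<in> g ` N" if xy: "x \<in> g ` N" "y \<in> g ` N" for x y
      proof -
        obtain m n where mn: "m \<in> N" "n \<in> N" "x = g m" "y = g n" using xy by blast
        have "x \<oplus>\<^bsub>V\<^esub> y = g (m \<oplus>\<^bsub>W\<^esub> n)" 
          using aW(2)[OF subsetD[OF NW mn(1)] subsetD[OF NW mn(2)]] mn(3,4) by simp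
        then show ?thesis using E(5)[OF mn(1,2)] by blast
      qed
    qed
    moreover have "\<forall>a\<in>carrier A. \<forall>x\<in>g ` N. act V a x \<in> g ` N"
    proof (intro ballI)
      fix a x assume a: "a \<in> carrier A" and "x \<in> g ` N"
      then obtain n where n: "n \<in> N" "x = g n" by blast
      have "act V a x = g (act W a n)" using cW(2)[OF a] n NW by auto
      moreover have "act W a n \<in> N" using N a n(1) by (simp add: alg_submodule_def)
      ultimately show "act V a x \<in> g ` N" by blast
    qed
    ultimately have "alg_submodule K A V (g ` N)" by (simp add: alg_submodule_def)
    then have "g ` N = {\<zero>\<^bsub>V\<^esub>} \<or> g ` N = carrier V" using V by (simp add: simple_left_module_def)
    then show ?thesis
    proof
      assume "g ` N = {\<zero>\<^bsub>V\<^esub>}"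
      then have "g n = g \<zero>\<^bsub>W\<^esub>" if "n \<in> N" for n using that zero(2) by auto
      then have "n = \<zero>\<^bsub>W\<^esub>" if "n \<in> N" for n by (rule inj[OF _ subsetD[OF NW that] zero(1)]) (rule that)
      then show ?thesis using z by blast
    next
      assume e: "g ` N = carrier V"
      have "x \<in> N" if x: "x \<in> carrier W" for x
      proof -
        obtain n where n: "n \<in> N" "g x = g n" using gc[OF x] unfolding e[symmetric] by blast
        show ?thesis using inj[OF n(2) x subsetD[OF NW n(1)]] n(1) by simp
      qed
      then show ?thesis using NW by blast
    qed
  qed
  show "simple_left_module K A W"
    unfolding simple_left_module_def by (intro conjI allI impI lW nz sub)
  define h where "h = inv_into (carrier W) g"
  have h: "h x \<in> carrier W" "g (h x) = x" if "x \<in> carrier V" for x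
    using that bij unfolding h_def by (auto simp: bij_betw_def inv_into_into f_inv_into_f)
  have "left_module_iso K A V W h"
    unfolding left_module_iso_def
  proof (intro conjI ballI)
    show "bij_betw h (carrier V) (carrier W)" unfolding h_def by (rule bij_betw_inv_into[OF bij])
    fix x assume x: "x \<in> carrier V"
    {
      fix y assume y: "y \<in> carrier V"
      show "h (x \<oplus>\<^bsub>V\<^esub> y) = h x \<oplus>\<^bsub>W\<^esub> h y" by (rule inj) (use x y in \<open>simp_all add: h aW\<close>)
    }
  next
    fix k x assume k: "k \<in> carrier K" and x: "x \<in> carrier V"
    show "h (k \<odot>\<^bsub>V\<^esub> x) = k \<odot>\<^bsub>W\<^esub> h x" by (rule inj) (use k x in \<open>simp_all add: h sW\<close>)
  next
    fix a x assume a: "a \<in> carrier A" and x: "x \<in> carrier V"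
    have "act V a x \<in> carrier V" using lV a x by (simp add: left_module_def)
    then show "h (act V a x) = act W a (h x)" by (intro inj) (use a x in \<open>simp_all add: h cW\<close>)
  qed
  then show "left_modules_isomorphic K A V W" by (auto simp: left_modules_isomorphic_def)
qed

section \<open>The induced module\<close>

lemma (in tensor) N_sum: "(\<And>i. i \<in> A \<Longrightarrow> x i \<in> N) \<Longrightarrow> sum x A \<in> N"
  by (induction A rule: infinite_finite_induct) (simp_all add: N_zero N_add)

context chen_setting
begin

abbreviation "LK \<equiv> free_vs K (L_arrows E x0)"
abbreviation "IG \<equiv> isotropy_group E x0"
abbreviation "GA \<equiv> semigroup_algebra K IG"
abbreviation "ra \<equiv> L_right_act E K x0"
abbreviation "VQ \<equiv> (laurent_quotient_module K f c :: ('k, ('v, 'e) arrow \<Rightarrow> 'k, (int \<Rightarrow> 'k) set) alg_module)"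
abbreviation "loop l \<equiv> (x0, l * int len, x0)"
abbreviation "pull r \<equiv> (\<lambda>l. r (loop l))"

lemma VQ_simps:
  "carrier VQ = carrier F" "ring.zero VQ = \<zero>\<^bsub>F\<^esub>" "ring.add VQ = ring.add F"
  "act VQ r z = cls (pull r) \<otimes>\<^bsub>F\<^esub> z"
  by (simp_all add: laurent_quotient_module_def Let_def)

lemma GA_carrier: "carrier GA = carrier (free_vs K (carrier IG))"
  by (simp add: semigroup_algebra_def)

lemma LK_fin_supp: "m \<in> carrier LK \<Longrightarrow> m \<in> fin_supp K"
  by (rule carrier_free_vs_fin_supp)

lemma LK_supp: "m \<in> carrier LK \<Longrightarrow> m u \<noteq> \<zero> \<Longrightarrow> u \<in> L_arrows E x0"
  unfolding carrier_free_vs by metis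

lemma LK_memI: "m \<in> fin_supp K \<Longrightarrow> (\<And>u. u \<notin> L_arrows E x0 \<Longrightarrow> m u = \<zero>) \<Longrightarrow> m \<in> carrier LK"
  by (auto simp: carrier_free_vs fin_supp_def)

lemma basis_LK: "u \<in> L_arrows E x0 \<Longrightarrow> basis_vec K u \<in> carrier LK"
  by (rule LK_memI[OF fin_supp_basis]) (auto simp: basis_vec_apply)

lemma GA_fin_supp: "r \<in> carrier GA \<Longrightarrow> r \<in> fin_supp K"
  unfolding GA_carrier by (rule carrier_free_vs_fin_supp)

lemma GA_supp: "r \<in> carrier GA \<Longrightarrow> r t \<noteq> \<zero> \<Longrightarrow> t \<in> carrier IG"
  unfolding GA_carrier carrier_free_vs by metis

lemma inj_loop: "inj (\<lambda>l. loop l :: ('v, 'e) arrow)"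
  using c_nonempty by (auto simp: inj_def)

lemma pull_fin_supp: "r \<in> carrier GA \<Longrightarrow> pull r \<in> fin_supp K"
  by (rule fin_supp_reindex[OF GA_fin_supp inj_loop])

lemma arrow_mult_loop:
  assumes "s \<in> L_arrows E x0" "t \<in> carrier IG"
  shows "arrow_mult s t \<in> L_arrows E x0"
proof -
  obtain q k x where s: "s = (q, k, x)" by (cases s) auto
  obtain l where t: "t = loop l" using assms(2) isotropy_carrier by auto
  have "(q, k, x0) \<in> groupoid_arrows E" using assms(1) by (simp add: s mem_L_arrows)
  then have "(q, k + l * int len, x0) \<in> groupoid_arrows E" by (rule cocycle_multiple(1))
  then show ?thesis by (simp add: s t mem_L_arrows)
qed

lemma ra_convolution:
  assumes "m \<in> carrier LK" "r \<in> carrier GA"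
  shows "ra m r \<in> carrier LK"
proof (rule LK_memI)
  show "ra m r \<in> fin_supp K"
    unfolding L_right_act_def
    by (rule lincomb_convolution(1)[OF LK_fin_supp[OF assms(1)] GA_fin_supp[OF assms(2)]])
       (use assms LK_supp GA_supp in blast)
  fix u assume u: "u \<notin> L_arrows E x0"
  have e: "{(s, t) \<in> L_arrows E x0 \<times> carrier IG. m s \<noteq> \<zero> \<and> r t \<noteq> \<zero> \<and> arrow_mult s t = u} = {}"
    using u arrow_mult_loop by blast
  show "ra m r u = \<zero>" unfolding L_right_act_def convolution_def e by (rule finsum_empty)
qed

lemma emb_basis: "emb (basis_vec K s u) = basis_vec F s u"
  by (simp add: basis_vec_apply emb.hom_one emb.hom_zero)

lemma emb_fin_supp: "p \<in> fin_supp K \<Longrightarrow> (\<lambda>s. emb (p s)) \<in> fin_supp F"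
  by (rule emb.hom_lincomb(2)[of p "\<lambda>_. \<zero>"]) simp_all

lemma emb_convolution:
  assumes p: "p \<in> fin_supp K" and q: "q \<in> fin_supp K"
    and P: "\<And>s t. p s \<noteq> \<zero> \<Longrightarrow> q t \<noteq> \<zero> \<Longrightarrow> (s, t) \<in> P"
  shows "emb (convolution K P mul p q u) = convolution F P mul (\<lambda>s. emb (p s)) (\<lambda>t. emb (q t)) u"
proof -
  have bc: "basis_vec K s u \<in> carrier K" for s by (rule fin_suppD[OF fin_supp_basis])
  have P': "(s, t) \<in> P" if "emb (p s) \<noteq> \<zero>\<^bsub>F\<^esub>" "emb (q t) \<noteq> \<zero>\<^bsub>F\<^esub>" for s t
    using that P[of s t] emb.hom_zero by metis
  have "convolution K P mul p q = (\<lambda>u. lincomb K p (\<lambda>s. lincomb K q (\<lambda>t. basis_vec K (mul s t) u)))"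
    by (rule convolution_lincomb_basis[OF p q], rule P)
  moreover have "convolution F P mul (\<lambda>s. emb (p s)) (\<lambda>t. emb (q t)) =
      (\<lambda>u. lincomb F (\<lambda>s. emb (p s)) (\<lambda>s. lincomb F (\<lambda>t. emb (q t)) (\<lambda>t. basis_vec F (mul s t) u)))"
    by (rule F.convolution_lincomb_basis[OF emb_fin_supp[OF p] emb_fin_supp[OF q]], rule P')
  ultimately show ?thesis
    by (simp add: emb.hom_lincomb(1)[OF p] emb.hom_lincomb(1)[OF q] lincomb_closed[OF q] bc emb_basis)
qed

text \<open>The coefficient at the path \<open>q\<close> of the image of an arrow: an arrow contributes to its source
  only, with the value of the cocycle.\<close>
definition fiber :: "('v, 'e) epath \<Rightarrow> ('v, 'e) arrow \<Rightarrow> (int \<Rightarrow> 'k) set" where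
  "fiber q = (\<lambda>(q', k, x). if (q', k, x) \<in> L_arrows E x0 \<and> q' = q then W.cocycle q k else \<zero>\<^bsub>F\<^esub>)"

definition ev :: "(('v, 'e) arrow \<Rightarrow> 'k) \<Rightarrow> ('v, 'e) epath \<Rightarrow> (int \<Rightarrow> 'k) set" where
  "ev m q = lincomb F (\<lambda>u. emb (m u)) (fiber q)"

definition beta :: "(('v, 'e) arrow \<Rightarrow> 'k) \<Rightarrow> (int \<Rightarrow> 'k) set \<Rightarrow> ('v, 'e) epath \<Rightarrow> (int \<Rightarrow> 'k) set" where
  "beta m v q = ev m q \<otimes>\<^bsub>F\<^esub> v"

lemma fiber_arrow:
  "(q', k, x0) \<in> groupoid_arrows E \<Longrightarrow> fiber q (q', k, x0) = (if q' = q then W.cocycle q' k else \<zero>\<^bsub>F\<^esub>)"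
  by (simp add: fiber_def mem_L_arrows)

lemma fiber_closed: "fiber q u \<in> carrier F"
proof -
  obtain q' k x where u: "u = (q', k, x)" by (cases u) auto
  have "W.cocycle q' k \<in> carrier F" if "(q', k, x) \<in> L_arrows E x0"
    using that W.cocycle_unit[of q' k] by (simp add: mem_L_arrows F.Units_closed)
  then show ?thesis unfolding u fiber_def by auto
qed

lemma ev_closed: "m \<in> fin_supp K \<Longrightarrow> ev m q \<in> carrier F"
  unfolding ev_def by (intro F.lincomb_closed emb_fin_supp fiber_closed)

lemma ev_add:
  assumes "m \<in> fin_supp K" "m' \<in> fin_supp K"
  shows "ev (\<lambda>u. m u \<oplus> m' u) q = ev m q \<oplus>\<^bsub>F\<^esub> ev m' q"
proof -
  have e: "(\<lambda>u. emb (m u \<oplus> m' u)) = (\<lambda>u. emb (m u) \<oplus>\<^bsub>F\<^esub> emb (m' u))"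
    using assms by (simp add: fin_suppD)
  show ?thesis unfolding ev_def e
    by (rule F.lincomb_add_left[OF emb_fin_supp[OF assms(1)] emb_fin_supp[OF assms(2)] fiber_closed])
qed

lemma ev_smult:
  assumes "m \<in> fin_supp K" "k \<in> carrier K"
  shows "ev (\<lambda>u. k \<otimes> m u) q = emb k \<otimes>\<^bsub>F\<^esub> ev m q"
proof -
  have e: "(\<lambda>u. emb (k \<otimes> m u)) = (\<lambda>u. emb k \<otimes>\<^bsub>F\<^esub> emb (m u))"
    using assms by (simp add: fin_suppD)
  show ?thesis unfolding ev_def e
    by (rule F.lincomb_smult_left[OF emb_fin_supp[OF assms(1)] emb.hom_closed[OF assms(2)] fiber_closed])
qed

lemma ev_zero: "ev (\<lambda>_. \<zero>) q = \<zero>\<^bsub>F\<^esub>"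
  by (simp add: ev_def emb.hom_zero)

lemma ev_basis: "ev (basis_vec K u) q = fiber q u"
  unfolding ev_def emb_basis by (rule F.lincomb_basis[OF fiber_closed])

lemma beta_zero: "v \<in> carrier F \<Longrightarrow> beta (\<lambda>_. \<zero>) v = (\<lambda>_. \<zero>\<^bsub>F\<^esub>)"
  by (simp add: beta_def ev_zero fun_eq_iff)

lemma beta_add:
  assumes "m \<in> fin_supp K" "m' \<in> fin_supp K" "v \<in> carrier F"
  shows "beta (\<lambda>u. m u \<oplus> m' u) v = (\<lambda>q. beta m v q \<oplus>\<^bsub>F\<^esub> beta m' v q)"
  using assms by (simp add: beta_def ev_add ev_closed F.l_distr fun_eq_iff)

lemma beta_smult:
  assumes "m \<in> fin_supp K" "k \<in> carrier K" "v \<in> carrier F"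
  shows "beta (\<lambda>u. k \<otimes> m u) v = (\<lambda>q. emb k \<otimes>\<^bsub>F\<^esub> beta m v q)"
  using assms by (simp add: beta_def ev_smult ev_closed F.m_assoc fun_eq_iff)

lemma beta_basis:
  assumes "(q, k, x0) \<in> groupoid_arrows E" "v \<in> carrier F"
  shows "beta (basis_vec K (q, k, x0)) v = W.delta (W.cocycle q k \<otimes>\<^bsub>F\<^esub> v) q"
proof
  fix p
  show "beta (basis_vec K (q, k, x0)) v p = W.delta (W.cocycle q k \<otimes>\<^bsub>F\<^esub> v) q p"
    using assms by (simp add: beta_def ev_basis fiber_def mem_L_arrows W.delta_def)
qed

lemma beta_V0:
  assumes "m \<in> carrier LK" "v \<in> carrier F"
  shows "beta m v \<in> carrier W.V0"
  using assms(1)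
proof (induction m rule: free_vs_induct)
  case zero
  then show ?case using assms(2) W.V0.M.zero_closed by (simp add: beta_zero free_vs_ops)
next
  case (step k u p)
  obtain q j where u: "u = (q, j, x0)" and arr: "(q, j, x0) \<in> groupoid_arrows E"
    using step(2) by (cases u) (auto simp: mem_L_arrows)
  have "W.cocycle q j \<otimes>\<^bsub>F\<^esub> v \<in> carrier F" using W.cocycle_unit[OF arr] assms(2) by (simp add: F.Units_closed)
  moreover have "q \<in> W.X0" using arr by (auto simp: tail_class_arrow)
  ultimately have d: "beta (basis_vec K u) v \<in> carrier W.V0"
    unfolding u beta_basis[OF arr assms(2)] by (rule W.delta_V0)
  have "beta (\<lambda>s. k \<otimes> basis_vec K u s \<oplus> p s) v = emb k \<odot>\<^bsub>W.V0\<^esub> beta (basis_vec K u) v \<oplus>\<^bsub>W.V0\<^esub> beta p v"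
    using step(1) LK_fin_supp[OF step(3)] assms(2) by (simp add: beta_add beta_smult free_vs_ops)
  then show ?case using d step(1,4) by simp
qed

text \<open>A loop that turns \<open>l\<close> times around \<open>c\<close> shifts the lags of the arrows, which multiplies the
  cocycle by the \<open>l\<close>-th power of the class of \<open>t\<close>. This is the identification of the group algebra of
  the loops with the Laurent ring.\<close>
lemma ev_right_act:
  assumes m: "m \<in> carrier LK" and r: "r \<in> carrier GA"
  shows "ev (ra m r) q = ev m q \<otimes>\<^bsub>F\<^esub> cls (pull r)"
proof -
  let ?m = "\<lambda>s. emb (m s)" and ?r = "\<lambda>t. emb (r t)"
  have fm: "m \<in> fin_supp K" and fr: "r \<in> fin_supp K" by (rule LK_fin_supp[OF m], rule GA_fin_supp[OF r])
  have P: "(s, t) \<in> L_arrows E x0 \<times> carrier IG" if "m s \<noteq> \<zero>" "r t \<noteq> \<zero>" for s t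
    using that LK_supp[OF m] GA_supp[OF r] by blast
  have mnz: "m s \<noteq> \<zero>" if "?m s \<noteq> \<zero>\<^bsub>F\<^esub>" for s using that emb.hom_zero by metis
  have rnz: "r t \<noteq> \<zero>" if "?r t \<noteq> \<zero>\<^bsub>F\<^esub>" for t using that emb.hom_zero by metis
  have c: "cls (pull r) \<in> carrier F" using pull_fin_supp[OF r] by (auto simp: carrier_F)
  have inner: "lincomb F ?r (\<lambda>t. fiber q (arrow_mult s t)) = cls (pull r) \<otimes>\<^bsub>F\<^esub> fiber q s" if s: "s \<in> L_arrows E x0" for s
  proof -
    obtain q' k where s': "s = (q', k, x0)" and arr: "(q', k, x0) \<in> groupoid_arrows E"
      using s by (cases s) (auto simp: mem_L_arrows)
    have f: "fiber q (arrow_mult s (loop l)) = fiber q s \<otimes>\<^bsub>F\<^esub> tau l" for l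
      unfolding s' arrow_mult.simps fiber_arrow[OF arr] fiber_arrow[OF cocycle_multiple(1)[OF arr]]
        cocycle_multiple(2)[OF arr] by (cases "q' = q") (simp_all only: simp_thms if_True if_False F.l_null tau_closed)
    have "lincomb F ?r (\<lambda>t. fiber q (arrow_mult s t)) =
        lincomb F (\<lambda>l. emb (r (loop l))) (\<lambda>l. fiber q (arrow_mult s (loop l)))"
    proof (rule F.lincomb_reindex[OF emb_fin_supp[OF fr] fiber_closed inj_loop])
      fix t assume t: "emb (r t) \<noteq> \<zero>\<^bsub>F\<^esub>"
      have "t \<in> carrier IG" by (rule GA_supp[OF r rnz[OF t]])
      then show "t \<in> range (\<lambda>l. loop l)" unfolding isotropy_carrier by blast
    qed
    also have "\<dots> = fiber q s \<otimes>\<^bsub>F\<^esub> lincomb F (\<lambda>l. emb (r (loop l))) (\<lambda>l. tau l)"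
      unfolding f by (rule F.lincomb_smult_right[OF emb_fin_supp[OF pull_fin_supp[OF r]] fiber_closed tau_closed])
    also have "\<dots> = fiber q s \<otimes>\<^bsub>F\<^esub> cls (pull r)" unfolding cls_lincomb[OF pull_fin_supp[OF r]] ..
    finally show ?thesis using c fiber_closed by (simp add: F.m_comm)
  qed
  have e: "(\<lambda>u. emb (ra m r u)) = convolution F (L_arrows E x0 \<times> carrier IG) arrow_mult ?m ?r"
    unfolding L_right_act_def by (rule ext, rule emb_convolution[OF fm fr], rule P)
  have "ev (ra m r) q = lincomb F ?m (\<lambda>s. lincomb F ?r (\<lambda>t. fiber q (arrow_mult s t)))"
    unfolding ev_def e
    by (rule F.lincomb_convolution(2)[OF emb_fin_supp[OF fm] emb_fin_supp[OF fr] _ fiber_closed], rule P[OF mnz rnz])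
  also have "\<dots> = lincomb F ?m (\<lambda>s. cls (pull r) \<otimes>\<^bsub>F\<^esub> fiber q s)"
  proof (rule F.lincomb_cong[OF emb_fin_supp[OF fm]])
    fix s assume "?m s \<noteq> \<zero>\<^bsub>F\<^esub>"
    then have s: "s \<in> L_arrows E x0" using LK_supp[OF m mnz] by blast
    show "lincomb F ?r (\<lambda>t. fiber q (arrow_mult s t)) = cls (pull r) \<otimes>\<^bsub>F\<^esub> fiber q s" by (rule inner[OF s])
    show "lincomb F ?r (\<lambda>t. fiber q (arrow_mult s t)) \<in> carrier F"
      by (rule F.lincomb_closed[OF emb_fin_supp[OF fr] fiber_closed])
  qed
  also have "\<dots> = cls (pull r) \<otimes>\<^bsub>F\<^esub> ev m q"
    unfolding ev_def by (rule F.lincomb_smult_right[OF emb_fin_supp[OF fm] c fiber_closed])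
  finally show ?thesis using c ev_closed[OF fm] by (simp add: F.m_comm)
qed

lemma LK_ops: "x \<oplus>\<^bsub>LK\<^esub> y = (\<lambda>s. x s \<oplus> y s)" "k \<odot>\<^bsub>LK\<^esub> x = (\<lambda>s. k \<otimes> x s)" "\<zero>\<^bsub>LK\<^esub> = (\<lambda>_. \<zero>)"
  by (simp_all add: free_vs_ops)

sublocale LK: module K LK by (rule module_free_vs) simp_all

lemma GA_act_closed: "r \<in> carrier GA \<Longrightarrow> v \<in> carrier F \<Longrightarrow> cls (pull r) \<otimes>\<^bsub>F\<^esub> v \<in> carrier F"
  using pull_fin_supp[of r] by (intro F.m_closed) (auto simp: carrier_F)

sublocale TB: balanced_map GA LK ra VQ W.V0 beta
proof (intro balanced_map.intro tensor.intro balanced_map_axioms.intro)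
  show "abelian_monoid LK" by (rule LK.M.abelian_monoid_axioms)
  show "abelian_monoid VQ"
    by (rule abelian_monoidI) (simp_all add: VQ_simps(1-3) F.a_ac)
  show "abelian_group W.V0" by (rule W.V0.M.abelian_group_axioms)
  show "ra m r \<in> carrier LK" if "m \<in> carrier LK" "r \<in> carrier GA" for m r
    using that by (rule ra_convolution)
  show "act VQ r v \<in> carrier VQ" if "r \<in> carrier GA" "v \<in> carrier VQ" for r v
    using that unfolding VQ_simps by (rule GA_act_closed)
  show "beta m v \<in> carrier W.V0" if "m \<in> carrier LK" "v \<in> carrier VQ" for m v
    using that unfolding VQ_simps by (rule beta_V0)
  show "beta (m \<oplus>\<^bsub>LK\<^esub> m') v = beta m v \<oplus>\<^bsub>W.V0\<^esub> beta m' v"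
    if "m \<in> carrier LK" "m' \<in> carrier LK" "v \<in> carrier VQ" for m m' v
    using that unfolding VQ_simps by (simp add: free_vs_ops beta_add LK_fin_supp)
  show "beta m (v \<oplus>\<^bsub>VQ\<^esub> v') = beta m v \<oplus>\<^bsub>W.V0\<^esub> beta m v'"
    if "m \<in> carrier LK" "v \<in> carrier VQ" "v' \<in> carrier VQ" for m v v'
    using that unfolding VQ_simps by (simp add: free_vs_ops beta_def F.r_distr ev_closed LK_fin_supp fun_eq_iff)
  show "beta (ra m r) v = beta m (act VQ r v)"
    if "m \<in> carrier LK" "r \<in> carrier GA" "v \<in> carrier VQ" for m r v
  proof -
    have "cls (pull r) \<in> carrier F" using pull_fin_supp[OF that(2)] by (auto simp: carrier_F)
    then show ?thesis
      using that unfolding VQ_simps by (simp add: beta_def ev_right_act F.m_assoc ev_closed LK_fin_supp fun_eq_iff)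
  qed
qed

text \<open>A chosen lag for each path of the tail class. The arrows with the same source differ from the
  chosen one by loops at \<open>c\<^sup>\<infinity>\<close>, so that the chosen arrows form a basis of \<open>LK\<close> over the group algebra.\<close>
definition lag :: "('v, 'e) epath \<Rightarrow> int" where
  "lag q = (SOME k. (q, k, x0) \<in> groupoid_arrows E)"

text \<open>A normal form of an element of the tensor product, with one term for each path.\<close>
definition eta :: "('v, 'e) epath set \<Rightarrow> (('v, 'e) epath \<Rightarrow> (int \<Rightarrow> 'k) set)
    \<Rightarrow> (('v, 'e) arrow \<Rightarrow> 'k) \<times> (int \<Rightarrow> 'k) set \<Rightarrow>\<^sub>0 int" where
  "eta A w = (\<Sum>q\<in>A. frag_of (basis_vec K (q, lag q, x0), w q))"

definition normalizable :: "((('v, 'e) arrow \<Rightarrow> 'k) \<times> (int \<Rightarrow> 'k) set \<Rightarrow>\<^sub>0 int) \<Rightarrow> bool" where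
  "normalizable z \<longleftrightarrow> (\<exists>A w. finite A \<and> A \<subseteq> W.X0 \<and> (\<forall>q. w q \<in> carrier F) \<and>
     (\<forall>q. q \<notin> A \<longrightarrow> w q = \<zero>\<^bsub>F\<^esub>) \<and> z - eta A w \<in> TB.N)"

lemma lag: "q \<in> W.X0 \<Longrightarrow> (q, lag q, x0) \<in> groupoid_arrows E"
  unfolding lag_def by (rule someI_ex) (simp add: tail_class_arrow)

lemma gen_LK: "q \<in> W.X0 \<Longrightarrow> basis_vec K (q, lag q, x0) \<in> carrier LK"
  by (rule basis_LK) (simp add: mem_L_arrows lag)

lemma eta_superset:
  assumes "finite B" "A \<subseteq> B" "B \<subseteq> W.X0" "\<And>q. q \<notin> A \<Longrightarrow> w q = \<zero>\<^bsub>F\<^esub>"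
  shows "eta B w - eta A w \<in> TB.N"
proof -
  have "eta B w - eta A w = (\<Sum>q\<in>B - A. frag_of (basis_vec K (q, lag q, x0), w q))"
    using sum.subset_diff[OF assms(2,1), of "\<lambda>q. frag_of (basis_vec K (q, lag q, x0), w q)"] unfolding eta_def by simp
  also have "\<dots> \<in> TB.N"
  proof (rule TB.N_sum)
    fix q assume q: "q \<in> B - A"
    then have "basis_vec K (q, lag q, x0) \<in> carrier LK" using gen_LK assms(3) by blast
    from TB.N_zero_right[OF this] show "frag_of (basis_vec K (q, lag q, x0), w q) \<in> TB.N"
      using q assms(4) by (simp add: VQ_simps)
  qed
  finally show ?thesis .
qed

lemma eta_diff:
  assumes "A \<subseteq> W.X0" "\<And>q. w q \<in> carrier F" "\<And>q. w' q \<in> carrier F"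
  shows "eta A w - eta A w' - eta A (\<lambda>q. w q \<ominus>\<^bsub>F\<^esub> w' q) \<in> TB.N"
proof -
  have "eta A w - eta A w' - eta A (\<lambda>q. w q \<ominus>\<^bsub>F\<^esub> w' q) = (\<Sum>q\<in>A. frag_of (basis_vec K (q, lag q, x0), w q)
      - frag_of (basis_vec K (q, lag q, x0), w' q) - frag_of (basis_vec K (q, lag q, x0), w q \<ominus>\<^bsub>F\<^esub> w' q))"
    unfolding eta_def by (simp add: sum_subtractf)
  also have "\<dots> \<in> TB.N"
  proof (rule TB.N_sum)
    fix q assume q: "q \<in> A"
    then have g: "basis_vec K (q, lag q, x0) \<in> carrier LK" using gen_LK assms(1) by blast
    have "w' q \<oplus>\<^bsub>F\<^esub> (w q \<ominus>\<^bsub>F\<^esub> w' q) = w q"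
      using assms(2,3) by (simp add: F.minus_eq F.a_lcomm F.r_neg)
    moreover have "frag_of (basis_vec K (q, lag q, x0), w' q \<oplus>\<^bsub>VQ\<^esub> (w q \<ominus>\<^bsub>F\<^esub> w' q))
      - frag_of (basis_vec K (q, lag q, x0), w' q) - frag_of (basis_vec K (q, lag q, x0), w q \<ominus>\<^bsub>F\<^esub> w' q) \<in> TB.N"
      using assms(2,3) by (intro TB.N_right g) (simp_all add: VQ_simps)
    ultimately show "frag_of (basis_vec K (q, lag q, x0), w q) - frag_of (basis_vec K (q, lag q, x0), w' q)
      - frag_of (basis_vec K (q, lag q, x0), w q \<ominus>\<^bsub>F\<^esub> w' q) \<in> TB.N"
      by (simp add: VQ_simps)
  qed
  finally show ?thesis .
qed

lemma normalizable_N: "z \<in> TB.N \<Longrightarrow> normalizable z"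
  unfolding normalizable_def by (rule exI[of _ "{}"], rule exI[of _ "\<lambda>_. \<zero>\<^bsub>F\<^esub>"]) (simp add: eta_def)

lemma normalizable_cong:
  assumes "normalizable z'" "z - z' \<in> TB.N"
  shows "normalizable z"
proof -
  obtain A w where A: "finite A" "A \<subseteq> W.X0" "\<forall>q. w q \<in> carrier F" "\<forall>q. q \<notin> A \<longrightarrow> w q = \<zero>\<^bsub>F\<^esub>" "z' - eta A w \<in> TB.N"
    using assms(1) unfolding normalizable_def by blast
  have "z - eta A w \<in> TB.N" using TB.N_add[OF assms(2) A(5)] by simp
  then show ?thesis unfolding normalizable_def using A by blast
qed

lemma normalizable_diff:
  assumes "normalizable z" "normalizable z'"
  shows "normalizable (z - z')"
proof -
  obtain A w where A: "finite A" "A \<subseteq> W.X0" "\<forall>q. w q \<in> carrier F" "\<forall>q. q \<notin> A \<longrightarrow> w q = \<zero>\<^bsub>F\<^esub>" "z - eta A w \<in> TB.N"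
    using assms(1) unfolding normalizable_def by blast
  obtain B w' where B: "finite B" "B \<subseteq> W.X0" "\<forall>q. w' q \<in> carrier F" "\<forall>q. q \<notin> B \<longrightarrow> w' q = \<zero>\<^bsub>F\<^esub>" "z' - eta B w' \<in> TB.N"
    using assms(2) unfolding normalizable_def by blast
  let ?C = "A \<union> B" and ?d = "\<lambda>q. w q \<ominus>\<^bsub>F\<^esub> w' q"
  have C: "finite ?C" "?C \<subseteq> W.X0" using A(1,2) B(1,2) by auto
  \<comment> \<open>Both normal forms are first extended by zero to a common index set.\<close>
  have 1: "eta ?C w - eta A w \<in> TB.N" by (rule eta_superset[OF C(1) Un_upper1 C(2)]) (use A(4) in blast)
  have 2: "eta ?C w' - eta B w' \<in> TB.N" by (rule eta_superset[OF C(1) Un_upper2 C(2)]) (use B(4) in blast)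
  have 3: "eta ?C w - eta ?C w' - eta ?C ?d \<in> TB.N" by (rule eta_diff[OF C(2)]) (use A(3) B(3) in blast)+
  have "(z - eta A w) - (eta ?C w - eta A w) - ((z' - eta B w') - (eta ?C w' - eta B w')) + (eta ?C w - eta ?C w' - eta ?C ?d) \<in> TB.N"
    by (intro TB.N_add TB.N_diff A(5) B(5) 1 2 3)
  moreover have "(z - eta A w) - (eta ?C w - eta A w) - ((z' - eta B w') - (eta ?C w' - eta B w')) + (eta ?C w - eta ?C w' - eta ?C ?d)
      = (z - z') - eta ?C ?d" by (simp add: algebra_simps)
  ultimately have "(z - z') - eta ?C ?d \<in> TB.N" by simp
  moreover have "\<forall>q. ?d q \<in> carrier F" using A(3) B(3) by simp
  moreover have "\<forall>q. q \<notin> ?C \<longrightarrow> ?d q = \<zero>\<^bsub>F\<^esub>" using A(4) B(4) by (simp add: F.minus_eq)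
  ultimately show ?thesis unfolding normalizable_def by (intro exI[of _ ?C] exI[of _ ?d] conjI C)
qed

lemma normalizable_add: "normalizable z \<Longrightarrow> normalizable z' \<Longrightarrow> normalizable (z + z')"
  using normalizable_diff[OF _ normalizable_diff[OF normalizable_N[OF TB.N_zero]], of z z'] by simp

text \<open>The arrow is the chosen arrow followed by a loop, and the loop passes to the other factor of
  the tensor product.\<close>
lemma normalizable_basis:
  assumes arr: "(q, k, x0) \<in> groupoid_arrows E" and j: "j \<in> carrier K" and v: "v \<in> carrier F"
  shows "normalizable (frag_of (\<lambda>s. j \<otimes> basis_vec K (q, k, x0) s, v))"
proof -
  have q: "q \<in> W.X0" using arr by (auto simp: tail_class_arrow)
  obtain s where s: "q = InfPath s" "tail_lag s (lag q)" using lag[OF q] unfolding arrow_x0 by blast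
  have "tail_lag s k" using arr unfolding arrow_x0 s(1) by auto
  then obtain l where l: "k = lag q + l * int len" using tail_lag_diff[OF s(2)] by blast
  let ?g = "basis_vec K (q, lag q, x0)"
  define r where "r = (\<lambda>t. j \<otimes> basis_vec K (loop l) t :: 'k)"
  have rf: "r \<in> fin_supp K" unfolding r_def by (rule fin_supp_smult[OF j fin_supp_basis])
  have lIG: "loop l \<in> carrier IG" using isotropy_carrier by auto
  have rnz: "t = loop l" if "r t \<noteq> \<zero>" for t using that j by (auto simp: r_def basis_vec_apply split: if_splits)
  have r: "r \<in> carrier GA"
    unfolding GA_carrier carrier_free_vs using fin_suppD[OF rf] fin_supp_finite[OF rf] rnz lIG by blast
  have P: "(s, t) \<in> L_arrows E x0 \<times> carrier IG" if "?g s \<noteq> \<zero>" "r t \<noteq> \<zero>" for s t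
    using LK_supp[OF gen_LK[OF q] that(1)] rnz[OF that(2)] lIG by blast
  have "ra ?g r = (\<lambda>u. j \<otimes> basis_vec K (q, k, x0) u)"
  proof
    fix u
    have bc: "basis_vec K s u \<in> carrier K" for s :: "('v, 'e) arrow" by (rule fin_suppD[OF fin_supp_basis])
    have "ra ?g r u = lincomb K ?g (\<lambda>s. lincomb K r (\<lambda>t. basis_vec K (arrow_mult s t) u))"
      unfolding L_right_act_def by (rule fun_cong[OF convolution_lincomb_basis[OF fin_supp_basis rf]], rule P)
    also have "\<dots> = lincomb K r (\<lambda>t. basis_vec K (arrow_mult (q, lag q, x0) t) u)"
      by (rule lincomb_basis[OF lincomb_closed[OF rf bc]])
    also have "\<dots> = j \<otimes> lincomb K (basis_vec K (loop l)) (\<lambda>t. basis_vec K (arrow_mult (q, lag q, x0) t) u)"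
      unfolding r_def by (rule lincomb_smult_left[OF fin_supp_basis j bc])
    also have "\<dots> = j \<otimes> basis_vec K (arrow_mult (q, lag q, x0) (loop l)) u"
      by (subst lincomb_basis) (simp_all only: bc)
    also have "\<dots> = j \<otimes> basis_vec K (q, k, x0) u" unfolding arrow_mult.simps l ..
    finally show "ra ?g r u = j \<otimes> basis_vec K (q, k, x0) u" .
  qed
  then have N: "frag_of (\<lambda>s. j \<otimes> basis_vec K (q, k, x0) s, v) - frag_of (?g, act VQ r v) \<in> TB.N"
    using TB.N_balanced[OF gen_LK[OF q] r, of v] v by (simp only: VQ_simps(1))
  let ?w = "\<lambda>p. if p = q then act VQ r v else \<zero>\<^bsub>F\<^esub>"
  have a: "act VQ r v \<in> carrier F" unfolding VQ_simps by (rule GA_act_closed[OF r v])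
  have "normalizable (frag_of (?g, act VQ r v))"
    unfolding normalizable_def
  proof (intro exI conjI)
    show "finite {q}" "{q} \<subseteq> W.X0" using q by simp_all
    show "\<forall>p. ?w p \<in> carrier F" "\<forall>p. p \<notin> {q} \<longrightarrow> ?w p = \<zero>\<^bsub>F\<^esub>" using a by simp_all
    show "frag_of (?g, act VQ r v) - eta {q} ?w \<in> TB.N" using TB.N_zero by (simp add: eta_def)
  qed
  then show ?thesis using N by (rule normalizable_cong)
qed

lemma normalizable_pure:
  assumes "m \<in> carrier LK" "v \<in> carrier F"
  shows "normalizable (frag_of (m, v))"
  using assms(1)
proof (induction m rule: free_vs_induct)
  case zero
  show ?case using TB.N_zero_left[of v] assms(2) by (intro normalizable_N) (simp add: VQ_simps LK_ops)
next
  case (step k u p)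
  obtain q j where u: "u = (q, j, x0)" and arr: "(q, j, x0) \<in> groupoid_arrows E"
    using step(2) by (cases u) (auto simp: mem_L_arrows)
  let ?b = "\<lambda>s. k \<otimes> basis_vec K u s"
  have b: "?b \<in> carrier LK" using LK.smult_closed[OF step(1) basis_LK[OF step(2)]] by (simp add: LK_ops)
  have 1: "frag_of (\<lambda>s. ?b s \<oplus> p s, v) - (frag_of (?b, v) + frag_of (p, v)) \<in> TB.N"
    using TB.N_left[OF b step(3), of v] assms(2) by (simp add: VQ_simps LK_ops diff_diff_eq)
  have "normalizable (frag_of (?b, v))" unfolding u by (rule normalizable_basis[OF arr step(1) assms(2)])
  then have "normalizable (frag_of (?b, v) + frag_of (p, v))" using step(4) by (rule normalizable_add)
  then show ?case using 1 by (rule normalizable_cong)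
qed

lemma normalizable_all:
  assumes "z \<in> carrier TB.FG"
  shows "normalizable z"
  using assms unfolding carrier_free_Abelian_group_iff
proof (induction z rule: free_Abelian_group_induct[consumes 1, case_names zero diff frag])
  case zero
  show ?case by (rule normalizable_N[OF TB.N_zero])
next
  case (diff x y)
  then show ?case using normalizable_diff by blast
next
  case (frag u)
  then obtain m v where "u = (m, v)" "m \<in> carrier LK" "v \<in> carrier F" unfolding VQ_simps(1) by (rule SigmaE)
  then show ?case using normalizable_pure[of m v] by (simp only:)
qed

text \<open>Different terms of a normal form have different paths, so that each coefficient can be read
  off.\<close>
lemma theta_eta:
  assumes "finite A" "A \<subseteq> W.X0" "\<And>q. w q \<in> carrier F"
  shows "eta A w \<in> carrier TB.FG"
    and "TB.theta (eta A w) = (\<lambda>p. if p \<in> A then W.cocycle p (lag p) \<otimes>\<^bsub>F\<^esub> w p else \<zero>\<^bsub>F\<^esub>)"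
proof -
  have "eta A w \<in> carrier TB.FG \<and> TB.theta (eta A w) = (\<lambda>p. if p \<in> A then W.cocycle p (lag p) \<otimes>\<^bsub>F\<^esub> w p else \<zero>\<^bsub>F\<^esub>)"
    using assms(1,2)
  proof (induction A rule: finite_induct)
    case empty
    show ?case by (simp add: eta_def TB.theta_zero free_vs_ops)
  next
    case (insert q A)
    let ?t = "frag_of (basis_vec K (q, lag q, x0), w q)"
    have q: "q \<in> W.X0" using insert.prems by blast
    have IH: "eta A w \<in> carrier TB.FG"
      "TB.theta (eta A w) = (\<lambda>p. if p \<in> A then W.cocycle p (lag p) \<otimes>\<^bsub>F\<^esub> w p else \<zero>\<^bsub>F\<^esub>)"
      using insert by blast+
    have wq: "w q \<in> carrier VQ" using assms(3) by (simp add: VQ_simps)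
    have t: "?t \<in> carrier TB.FG" by (rule TB.frag_mem[OF gen_LK[OF q] wq])
    have e: "eta (insert q A) w = ?t + eta A w" unfolding eta_def using insert.hyps by simp
    have lc: "W.cocycle p (lag p) \<otimes>\<^bsub>F\<^esub> w p \<in> carrier F" if "p \<in> insert q A" for p
    proof -
      have p: "p \<in> W.X0" using that insert.prems by blast
      show ?thesis by (rule F.m_closed[OF F.Units_closed[OF W.cocycle_unit[OF lag[OF p]]] assms(3)])
    qed
    have "TB.theta (eta (insert q A) w) = (\<lambda>p. if p \<in> insert q A then W.cocycle p (lag p) \<otimes>\<^bsub>F\<^esub> w p else \<zero>\<^bsub>F\<^esub>)"
      unfolding e TB.theta_add[OF t IH(1)] TB.theta_frag[OF gen_LK[OF q] wq] beta_basis[OF lag[OF q] assms(3)] IH(2)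
    proof
      fix p
      show "(W.delta (W.cocycle q (lag q) \<otimes>\<^bsub>F\<^esub> w q) q \<oplus>\<^bsub>W.V0\<^esub> (\<lambda>p. if p \<in> A then W.cocycle p (lag p) \<otimes>\<^bsub>F\<^esub> w p else \<zero>\<^bsub>F\<^esub>)) p =
          (if p \<in> insert q A then W.cocycle p (lag p) \<otimes>\<^bsub>F\<^esub> w p else \<zero>\<^bsub>F\<^esub>)"
        using lc[of p] insert.hyps(2) by (cases "p = q"; cases "p \<in> A") (simp_all add: free_vs_ops W.delta_def)
    qed
    then show ?case using TB.keys_add_subset[OF t IH(1)] unfolding e by blast
  qed
  then show "eta A w \<in> carrier TB.FG"
    and "TB.theta (eta A w) = (\<lambda>p. if p \<in> A then W.cocycle p (lag p) \<otimes>\<^bsub>F\<^esub> w p else \<zero>\<^bsub>F\<^esub>)" by blast+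
qed

sublocale TM: tensor_model GA LK ra VQ W.V0 beta
proof (rule tensor_model.intro[OF TB.balanced_map_axioms], rule tensor_model_axioms.intro)
  fix u assume u: "u \<in> carrier W.V0"
  let ?A = "{q. u q \<noteq> \<zero>\<^bsub>F\<^esub>}"
  define w where "w = (\<lambda>q. if q \<in> ?A then inv\<^bsub>F\<^esub> (W.cocycle q (lag q)) \<otimes>\<^bsub>F\<^esub> u q else \<zero>\<^bsub>F\<^esub>)"
  have A: "finite ?A" "?A \<subseteq> W.X0" using W.V0_finite[OF u] W.V0_supp[OF u] by auto
  have lu: "W.cocycle q (lag q) \<in> Units F" if "q \<in> ?A" for q using W.cocycle_unit[OF lag] A(2) that by blast
  have uc: "u q \<in> carrier F" for q by (rule W.V0_closed[OF u])
  have wc: "w q \<in> carrier F" for q using lu[of q] uc by (simp add: w_def)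
  have "TB.theta (eta ?A w) = u"
  proof
    fix p
    show "TB.theta (eta ?A w) p = u p"
      unfolding theta_eta(2)[OF A wc]
    proof (cases "p \<in> ?A")
      case True
      note l = lu[OF True]
      have "W.cocycle p (lag p) \<otimes>\<^bsub>F\<^esub> w p = W.cocycle p (lag p) \<otimes>\<^bsub>F\<^esub> (inv\<^bsub>F\<^esub> (W.cocycle p (lag p)) \<otimes>\<^bsub>F\<^esub> u p)"
        using True by (simp only: w_def if_True)
      also have "\<dots> = W.cocycle p (lag p) \<otimes>\<^bsub>F\<^esub> inv\<^bsub>F\<^esub> (W.cocycle p (lag p)) \<otimes>\<^bsub>F\<^esub> u p"
        by (rule F.m_assoc[OF F.Units_closed[OF l] F.Units_inv_closed[OF l] uc, symmetric])
      also have "\<dots> = u p" using l uc by simp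
      finally show "(if p \<in> ?A then W.cocycle p (lag p) \<otimes>\<^bsub>F\<^esub> w p else \<zero>\<^bsub>F\<^esub>) = u p" using True by simp
    qed simp
  qed
  then show "\<exists>z\<in>carrier TB.FG. TB.theta z = u" by (rule bexI) (rule theta_eta(1)[OF A wc])
next
  fix z assume z: "z \<in> carrier TB.FG" and t0: "TB.theta z = \<zero>\<^bsub>W.V0\<^esub>"
  obtain A w where A: "finite A" "A \<subseteq> W.X0" "\<forall>q. w q \<in> carrier F" "\<forall>q. q \<notin> A \<longrightarrow> w q = \<zero>\<^bsub>F\<^esub>" "z - eta A w \<in> TB.N"
    using normalizable_all[OF z] unfolding normalizable_def by blast
  note TE = theta_eta[OF A(1,2), of w, OF A(3)[rule_format]]
  have "TB.theta ((z - eta A w) + eta A w) = TB.theta (eta A w)"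
    unfolding TB.theta_add[OF subsetD[OF TB.N_carrier A(5)] TE(1)] TB.theta_N[OF A(5)]
    by (rule W.V0.M.l_zero[OF TB.theta_closed[OF TE(1)]])
  then have "TB.theta (eta A w) = \<zero>\<^bsub>W.V0\<^esub>" unfolding diff_add_cancel t0 by (rule sym)
  then have e: "(if p \<in> A then W.cocycle p (lag p) \<otimes>\<^bsub>F\<^esub> w p else \<zero>\<^bsub>F\<^esub>) = \<zero>\<^bsub>F\<^esub>" for p
    unfolding TE(2) by (simp add: free_vs_ops fun_eq_iff)
  have w0: "w p = \<zero>\<^bsub>F\<^esub>" for p
  proof (cases "p \<in> A")
    case True
    have l: "W.cocycle p (lag p) \<in> Units F" using W.cocycle_unit[OF lag] A(2) True by blast
    have wp: "w p \<in> carrier F" using A(3) by blast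
    have "W.cocycle p (lag p) \<otimes>\<^bsub>F\<^esub> w p = W.cocycle p (lag p) \<otimes>\<^bsub>F\<^esub> \<zero>\<^bsub>F\<^esub>"
      using e[of p] True F.r_null[OF F.Units_closed[OF l]] by simp
    then show ?thesis using F.Units_l_cancel[OF l wp F.zero_closed] by blast
  qed (use A(4) in blast)
  have "eta A w \<in> TB.N"
    unfolding eta_def
  proof (rule TB.N_sum)
    fix q assume "q \<in> A"
    then have "basis_vec K (q, lag q, x0) \<in> carrier LK" using gen_LK A(2) by blast
    from TB.N_zero_right[OF this] show "frag_of (basis_vec K (q, lag q, x0), w q) \<in> TB.N"
      by (simp add: VQ_simps w0)
  qed
  then show "z \<in> TB.N" using TB.N_add[OF A(5)] by fastforce
qed

end

context chen_setting
begin

section \<open>The action of the Steinberg algebra on the induced module\<close>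

abbreviation "la \<equiv> L_left_act E K x0"

lemma la_eq: "la s m = (\<lambda>y. if y \<in> L_arrows E x0 then lincomb K m (\<lambda>t. s (arrow_mult y (arrow_inv t))) else \<zero>)"
  unfolding L_left_act_def lincomb_def ..

lemma la_add_right:
  assumes "\<And>u. s u \<in> carrier K" "m \<in> fin_supp K" "m' \<in> fin_supp K"
  shows "la s (\<lambda>t. m t \<oplus> m' t) = (\<lambda>y. la s m y \<oplus> la s m' y)"
  using lincomb_add_left[OF assms(2,3) assms(1)] by (simp add: la_eq fun_eq_iff)

lemma la_smult_right:
  assumes "\<And>u. s u \<in> carrier K" "m \<in> fin_supp K" "k \<in> carrier K"
  shows "la s (\<lambda>t. k \<otimes> m t) = (\<lambda>y. k \<otimes> la s m y)"
  using lincomb_smult_left[OF assms(2,3) assms(1)] assms(3) by (simp add: la_eq fun_eq_iff)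

lemma la_add_left:
  assumes "\<And>u. s u \<in> carrier K" "\<And>u. s' u \<in> carrier K" "m \<in> fin_supp K"
  shows "la (\<lambda>u. s u \<oplus> s' u) m = (\<lambda>y. la s m y \<oplus> la s' m y)"
  using lincomb_add_right[OF assms(3) assms(1,2)] by (simp add: la_eq fun_eq_iff)

lemma la_smult_left:
  assumes "\<And>u. s u \<in> carrier K" "k \<in> carrier K" "m \<in> fin_supp K"
  shows "la (\<lambda>u. k \<otimes> s u) m = (\<lambda>y. k \<otimes> la s m y)"
  using lincomb_smult_right[OF assms(3,2) assms(1)] assms(2) by (simp add: la_eq fun_eq_iff)

lemma la_basis:
  assumes "\<And>u. s u \<in> carrier K"
  shows "la s (basis_vec K t) = (\<lambda>y. if y \<in> L_arrows E x0 then s (arrow_mult y (arrow_inv t)) else \<zero>)"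
  unfolding la_eq by (subst lincomb_basis) (simp_all only: assms)

text \<open>An arrow composed with the inverse of \<open>(\<nu>y, k, c\<^sup>\<infinity>)\<close> lies in \<open>Z\<^bsub>(\<mu>,\<nu>)\<^esub>\<close> only if its source is \<open>\<mu>y\<close>,
  because \<open>\<nu>\<close> determines the remaining path.\<close>
lemma la_cylinder_basis:
  assumes w: "awalk u m v" "awalk u' n v" and y: "y \<in> boundary_paths E" "path_source E y = v"
    and arr: "(path_append (u', n) y, k, x0) \<in> groupoid_arrows E"
  shows "la (KS.ind (cylinder E (u, m) (u', n))) (basis_vec K (path_append (u', n) y, k, x0)) =
    basis_vec K (path_append (u, m) y, k + (int (length m) - int (length n)), x0)"
proof
  fix t :: "('v, 'e) arrow"
  obtain q j x where t: "t = (q, j, x)" by (cases t) auto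
  let ?d = "int (length m) - int (length n)"
  have qarr: "(path_append (u, m) y, k + ?d, x0) \<in> groupoid_arrows E"
    by (rule cylinder_delta(1)[OF w F.one_closed y arr])
  have c: "KS.ind (cylinder E (u, m) (u', n)) z \<in> carrier K" for z by simp
  have "(t \<in> L_arrows E x0 \<and> arrow_mult t (arrow_inv (path_append (u', n) y, k, x0)) \<in> cylinder E (u, m) (u', n)) =
      (t = (path_append (u, m) y, k + ?d, x0))"
  proof
    assume h: "t \<in> L_arrows E x0 \<and> arrow_mult t (arrow_inv (path_append (u', n) y, k, x0)) \<in> cylinder E (u, m) (u', n)"
    then have "(q, j - k, path_append (u', n) y) \<in> cylinder E (u, m) (u', n)" by (simp add: t)
    then obtain z where z: "path_source E z = v" "q = path_append (u, m) z" "j - k = ?d"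
        "path_append (u', n) y = path_append (u', n) z"
      unfolding KS.cylinder_awalk[OF w] by blast
    have "y = z" by (rule path_append_inj[OF z(4), of E]) (simp add: y z)
    then have "q = path_append (u, m) y" "j = k + ?d" "x = x0" using z(2,3) h by (simp_all add: t mem_L_arrows)
    then show "t = (path_append (u, m) y, k + ?d, x0)" by (simp only: t)
  next
    assume e: "t = (path_append (u, m) y, k + ?d, x0)"
    have "(path_append (u, m) y, ?d, path_append (u', n) y) \<in> cylinder E (u, m) (u', n)"
      unfolding KS.cylinder_awalk[OF w] using y by blast
    then show "t \<in> L_arrows E x0 \<and> arrow_mult t (arrow_inv (path_append (u', n) y, k, x0)) \<in> cylinder E (u, m) (u', n)"
      using qarr unfolding e mem_L_arrows by simp
  qed
  then show "la (KS.ind (cylinder E (u, m) (u', n))) (basis_vec K (path_append (u', n) y, k, x0)) t =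
      basis_vec K (path_append (u, m) y, k + ?d, x0) t"
    unfolding la_basis[OF c] basis_vec_apply by presburger
qed

lemma la_cylinder_basis_zero:
  assumes w: "awalk u m v" "awalk u' n v"
    and np: "\<And>y. y \<in> boundary_paths E \<Longrightarrow> path_source E y = v \<Longrightarrow> p \<noteq> path_append (u', n) y"
  shows "la (KS.ind (cylinder E (u, m) (u', n))) (basis_vec K (p, k, x0)) = (\<lambda>_. \<zero>)"
proof
  fix t :: "('v, 'e) arrow"
  obtain q j x where t: "t = (q, j, x)" by (cases t) auto
  have c: "KS.ind (cylinder E (u, m) (u', n)) z \<in> carrier K" for z by simp
  have "arrow_mult t (arrow_inv (p, k, x0)) \<notin> cylinder E (u, m) (u', n)"
  proof
    assume "arrow_mult t (arrow_inv (p, k, x0)) \<in> cylinder E (u, m) (u', n)"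
    then have "(q, j - k, p) \<in> cylinder E (u, m) (u', n)" by (simp add: t)
    then show False unfolding KS.cylinder_awalk[OF w] using np by blast
  qed
  then show "la (KS.ind (cylinder E (u, m) (u', n))) (basis_vec K (p, k, x0)) t = \<zero>"
    unfolding la_basis[OF c] by presburger
qed

lemma act_facts:
  assumes "s \<in> carrier KS.S" "x \<in> carrier W.V0"
  shows "act chenV s x \<in> carrier W.V0"
    and "y \<in> carrier W.V0 \<Longrightarrow> act chenV s (x \<oplus>\<^bsub>W.V0\<^esub> y) = act chenV s x \<oplus>\<^bsub>W.V0\<^esub> act chenV s y"
    and "t \<in> carrier KS.S \<Longrightarrow> act chenV (s \<oplus>\<^bsub>KS.S\<^esub> t) x = act chenV s x \<oplus>\<^bsub>W.V0\<^esub> act chenV t x"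
    and "k \<in> carrier K \<Longrightarrow> act chenV (k \<odot>\<^bsub>KS.S\<^esub> s) x = emb k \<odot>\<^bsub>W.V0\<^esub> act chenV s x"
    and "k \<in> carrier K \<Longrightarrow> act chenV s (emb k \<odot>\<^bsub>W.V0\<^esub> x) = emb k \<odot>\<^bsub>W.V0\<^esub> act chenV s x"
  using left_module_chenV assms unfolding left_module_def chenV_simps(1-4) by blast+

lemma act_zero_right:
  assumes "s \<in> carrier KS.S"
  shows "act chenV s \<zero>\<^bsub>W.V0\<^esub> = \<zero>\<^bsub>W.V0\<^esub>"
proof -
  note z = W.V0.M.zero_closed
  have "act chenV s (emb \<zero> \<odot>\<^bsub>W.V0\<^esub> \<zero>\<^bsub>W.V0\<^esub>) = emb \<zero> \<odot>\<^bsub>W.V0\<^esub> act chenV s \<zero>\<^bsub>W.V0\<^esub>"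
    by (rule act_facts(5)[OF assms z zero_closed])
  then show ?thesis unfolding emb.hom_zero W.V0.smult_l_null[OF z] W.V0.smult_l_null[OF act_facts(1)[OF assms z]] .
qed

lemma act_zero_left:
  assumes "x \<in> carrier W.V0"
  shows "act chenV (\<lambda>_. \<zero>) x = \<zero>\<^bsub>W.V0\<^esub>"
proof -
  have z: "(\<lambda>_. \<zero>) \<in> carrier KS.S" unfolding steinberg_simps(4) by (rule lin_span.zero)
  have "act chenV (\<zero> \<odot>\<^bsub>KS.S\<^esub> (\<lambda>_. \<zero>)) x = emb \<zero> \<odot>\<^bsub>W.V0\<^esub> act chenV (\<lambda>_. \<zero>) x"
    by (rule act_facts(4)[OF z assms zero_closed])
  moreover have "\<zero> \<odot>\<^bsub>KS.S\<^esub> (\<lambda>_. \<zero>) = (\<lambda>_. \<zero>)" by (simp add: steinberg_simps(3))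
  ultimately show ?thesis unfolding emb.hom_zero W.V0.smult_l_null[OF act_facts(1)[OF z assms]] by simp
qed

definition intertwined :: "(('v, 'e) arrow \<Rightarrow> 'k) \<Rightarrow> (('v, 'e) arrow \<Rightarrow> 'k) \<Rightarrow> bool" where
  "intertwined s m \<longleftrightarrow> la s m \<in> carrier LK \<and> (\<forall>v\<in>carrier F. beta (la s m) v = act chenV s (beta m v))"

lemma beta_ops:
  assumes "m \<in> carrier LK" "v \<in> carrier F"
  shows "m' \<in> carrier LK \<Longrightarrow> beta (m \<oplus>\<^bsub>LK\<^esub> m') v = beta m v \<oplus>\<^bsub>W.V0\<^esub> beta m' v"
    and "k \<in> carrier K \<Longrightarrow> beta (k \<odot>\<^bsub>LK\<^esub> m) v = emb k \<odot>\<^bsub>W.V0\<^esub> beta m v"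
    and "beta \<zero>\<^bsub>LK\<^esub> v = \<zero>\<^bsub>W.V0\<^esub>"
  using assms unfolding LK_ops free_vs_ops[of F W.X0]
  by (simp_all only: beta_add beta_smult beta_zero LK_fin_supp)

text \<open>Either the source of the arrow begins with \<open>\<nu>\<close>, and both sides replace \<open>\<nu>\<close> by \<open>\<mu>\<close>, or both sides
  vanish.\<close>
lemma intertwined_cylinder_basis:
  assumes w: "awalk u m v" "awalk u' n v" and t: "t \<in> L_arrows E x0"
  shows "intertwined (KS.ind (cylinder E (u, m) (u', n))) (basis_vec K t)"
proof -
  obtain p k where t': "t = (p, k, x0)" and arr: "(p, k, x0) \<in> groupoid_arrows E"
    using t by (cases t) (auto simp: mem_L_arrows)
  let ?s = "KS.ind (cylinder E (u, m) (u', n))"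
  have lu: "W.cocycle p k \<in> Units F" by (rule W.cocycle_unit[OF arr])
  show ?thesis
  proof (cases "\<exists>y. y \<in> boundary_paths E \<and> path_source E y = v \<and> p = path_append (u', n) y")
    case True
    then obtain y where y: "y \<in> boundary_paths E" "path_source E y = v" "p = path_append (u', n) y" by blast
    let ?q = "path_append (u, m) y" and ?j = "k + (int (length m) - int (length n))"
    have arr': "(path_append (u', n) y, k, x0) \<in> groupoid_arrows E" using arr unfolding y(3) .
    have qarr: "(?q, ?j, x0) \<in> groupoid_arrows E" by (rule cylinder_delta(1)[OF w F.one_closed y(1,2) arr'])
    have la: "la ?s (basis_vec K t) = basis_vec K (?q, ?j, x0)"
      unfolding t' y(3) by (rule la_cylinder_basis[OF w y(1,2) arr'])
    have "beta (basis_vec K (?q, ?j, x0)) z = act chenV ?s (beta (basis_vec K t) z)" if z: "z \<in> carrier F" for z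
    proof -
      have lz: "W.cocycle p k \<otimes>\<^bsub>F\<^esub> z \<in> carrier F" using lu z by (simp add: F.Units_closed)
      have "inv\<^bsub>F\<^esub> (W.cocycle p k) \<otimes>\<^bsub>F\<^esub> (W.cocycle p k \<otimes>\<^bsub>F\<^esub> z) = inv\<^bsub>F\<^esub> (W.cocycle p k) \<otimes>\<^bsub>F\<^esub> W.cocycle p k \<otimes>\<^bsub>F\<^esub> z"
        by (rule F.m_assoc[OF F.Units_inv_closed[OF lu] F.Units_closed[OF lu] z, symmetric])
      also have "\<dots> = z" using lu z by simp
      finally have c: "inv\<^bsub>F\<^esub> (W.cocycle p k) \<otimes>\<^bsub>F\<^esub> (W.cocycle p k \<otimes>\<^bsub>F\<^esub> z) = z" .
      show ?thesis
        unfolding t' beta_basis[OF qarr z] beta_basis[OF arr z]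
        using cylinder_delta(2)[OF w lz y(1,2) arr'] c unfolding y(3) by simp
    qed
    then show ?thesis unfolding intertwined_def la using qarr by (auto intro: basis_LK simp: mem_L_arrows)
  next
    case False
    then have np: "p \<noteq> path_append (u', n) y" if "y \<in> boundary_paths E" "path_source E y = v" for y using that by blast
    have la: "la ?s (basis_vec K t) = \<zero>\<^bsub>LK\<^esub>"
      unfolding t' LK_ops by (rule la_cylinder_basis_zero[OF w np])
    have "\<zero>\<^bsub>W.V0\<^esub> = act chenV ?s (beta (basis_vec K t) z)" if z: "z \<in> carrier F" for z
    proof -
      have lz: "W.cocycle p k \<otimes>\<^bsub>F\<^esub> z \<in> carrier F" using lu z by (simp add: F.Units_closed)
      have pX: "p \<in> W.X0" using arr by (auto simp: tail_class_arrow)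
      have "act chenV ?s (W.delta (W.cocycle p k \<otimes>\<^bsub>F\<^esub> z) p) = (\<lambda>_. \<zero>\<^bsub>F\<^esub>)"
        by (rule cylinder_delta_zero[OF w lz pX], rule np)
      then show ?thesis unfolding t' beta_basis[OF arr z] free_vs_ops by (rule sym)
    qed
    then show ?thesis unfolding intertwined_def la using beta_ops(3)[OF LK.M.zero_closed] LK.M.zero_closed by simp
  qed
qed

lemma intertwined_module:
  assumes s: "s \<in> carrier KS.S" and b: "\<And>t. t \<in> L_arrows E x0 \<Longrightarrow> intertwined s (basis_vec K t)"
    and m: "m \<in> carrier LK"
  shows "intertwined s m"
  using m
proof (induction m rule: free_vs_induct)
  case zero
  have "la s (\<lambda>_. \<zero>) = \<zero>\<^bsub>LK\<^esub>" unfolding la_eq LK_ops by (simp add: fun_eq_iff)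
  then show ?case
    unfolding intertwined_def
    using beta_ops(3)[OF LK.M.zero_closed] act_zero_right[OF s] LK.M.zero_closed unfolding LK_ops(3) by simp
next
  case (step k t p)
  note sc = KS.S_closed[OF s]
  let ?b = "basis_vec K t"
  have bL: "?b \<in> carrier LK" by (rule basis_LK[OF step(2)])
  have kb: "k \<odot>\<^bsub>LK\<^esub> ?b \<in> carrier LK" by (rule LK.smult_closed[OF step(1) bL])
  have L: "la s ?b \<in> carrier LK" "la s p \<in> carrier LK" using b[OF step(2)] step(4) by (simp_all add: intertwined_def)
  have kL: "k \<odot>\<^bsub>LK\<^esub> la s ?b \<in> carrier LK" by (rule LK.smult_closed[OF step(1) L(1)])
  have e: "(\<lambda>s. k \<otimes> ?b s \<oplus> p s) = k \<odot>\<^bsub>LK\<^esub> ?b \<oplus>\<^bsub>LK\<^esub> p" unfolding LK_ops ..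
  have l: "la s (k \<odot>\<^bsub>LK\<^esub> ?b \<oplus>\<^bsub>LK\<^esub> p) = k \<odot>\<^bsub>LK\<^esub> la s ?b \<oplus>\<^bsub>LK\<^esub> la s p"
    unfolding LK_ops la_add_right[OF sc fin_supp_smult[OF step(1) fin_supp_basis] LK_fin_supp[OF step(3)]]
      la_smult_right[OF sc fin_supp_basis step(1)] ..
  have "beta (k \<odot>\<^bsub>LK\<^esub> la s ?b \<oplus>\<^bsub>LK\<^esub> la s p) v = act chenV s (beta (k \<odot>\<^bsub>LK\<^esub> ?b \<oplus>\<^bsub>LK\<^esub> p) v)" if v: "v \<in> carrier F" for v
  proof -
    note bv = beta_V0[OF bL v] and pv = beta_V0[OF step(3) v]
    have I: "beta (la s ?b) v = act chenV s (beta ?b v)" "beta (la s p) v = act chenV s (beta p v)"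
      using b[OF step(2)] step(4) v by (simp_all add: intertwined_def)
    show ?thesis
      unfolding beta_ops(1)[OF kL v L(2)] beta_ops(2)[OF L(1) v step(1)] I beta_ops(1)[OF kb v step(3)] beta_ops(2)[OF bL v step(1)]
        act_facts(2)[OF s W.V0.smult_closed[OF emb.hom_closed[OF step(1)] bv] pv] act_facts(5)[OF s bv step(1)] ..
  qed
  then show ?case unfolding e intertwined_def l using LK.M.a_closed[OF kL L(2)] by blast
qed

text \<open>Both sides are additive in both arguments, which reduces the claim to a single bisection and
  a single arrow.\<close>
lemma intertwined_all:
  assumes "s \<in> carrier KS.S" "m \<in> carrier LK"
  shows "intertwined s m"
  using assms(1)
proof (induction s rule: KS.S_induct)
  case zero
  have "la (\<lambda>_. \<zero>) m = \<zero>\<^bsub>LK\<^esub>" unfolding la_eq LK_ops by (simp add: LK_fin_supp[OF assms(2)] fun_eq_iff)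
  then show ?case
    unfolding intertwined_def using beta_ops(3)[OF LK.M.zero_closed] act_zero_left[OF beta_V0[OF assms(2)]] LK.M.zero_closed by simp
next
  case (step k u p w q v s)
  let ?z = "KS.ind (cylinder E (u, p) (w, q))"
  have zS: "?z \<in> carrier KS.S" by (rule KS.cylinder_mem[OF step(2,3)])
  note zc = KS.S_closed[OF zS] and sc = KS.S_closed[OF step(4)] and fm = LK_fin_supp[OF assms(2)]
  have z: "intertwined ?z m"
    by (rule intertwined_module[OF zS intertwined_cylinder_basis[OF step(2,3)] assms(2)])
  have kz: "k \<odot>\<^bsub>KS.S\<^esub> ?z \<in> carrier KS.S" unfolding steinberg_simps(3) by (rule KS.S_smult[OF zS step(1)])
  have L: "la ?z m \<in> carrier LK" "la s m \<in> carrier LK" using z step(5) unfolding intertwined_def by blast+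
  have kL: "k \<odot>\<^bsub>LK\<^esub> la ?z m \<in> carrier LK" by (rule LK.smult_closed[OF step(1) L(1)])
  have e: "(\<lambda>u. k \<otimes> ?z u \<oplus> s u) = k \<odot>\<^bsub>KS.S\<^esub> ?z \<oplus>\<^bsub>KS.S\<^esub> s" unfolding steinberg_simps(2,3) ..
  have kzc: "k \<otimes> ?z u \<in> carrier K" for u by (rule m_closed[OF step(1) zc])
  have l: "la (\<lambda>u. k \<otimes> ?z u \<oplus> s u) m = k \<odot>\<^bsub>LK\<^esub> la ?z m \<oplus>\<^bsub>LK\<^esub> la s m"
    unfolding la_add_left[OF kzc sc fm] la_smult_left[OF zc step(1) fm] LK_ops ..
  have "beta (k \<odot>\<^bsub>LK\<^esub> la ?z m \<oplus>\<^bsub>LK\<^esub> la s m) x = act chenV (k \<odot>\<^bsub>KS.S\<^esub> ?z \<oplus>\<^bsub>KS.S\<^esub> s) (beta m x)" if x: "x \<in> carrier F" for x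
  proof -
    note mx = beta_V0[OF assms(2) x]
    have I: "beta (la ?z m) x = act chenV ?z (beta m x)" "beta (la s m) x = act chenV s (beta m x)"
      using z step(5) x unfolding intertwined_def by blast+
    show ?thesis
      unfolding beta_ops(1)[OF kL x L(2)] beta_ops(2)[OF L(1) x step(1)] I
        act_facts(3)[OF kz mx step(4)] act_facts(4)[OF zS mx step(1)] ..
  qed
  then show ?case unfolding intertwined_def l unfolding e using LK.M.a_closed[OF kL L(2)] by blast
qed

section \<open>The isomorphism\<close>

abbreviation "indW \<equiv> induced_module E K x0 VQ"

lemma indW_simps:
  "carrier indW = carrier TM.T" "ring.zero indW = \<one>\<^bsub>TM.T\<^esub>" "ring.add indW = monoid.mult TM.T"
  "module.smult indW = (\<lambda>k. tensor_map GA LK ra VQ (\<lambda>m. k \<odot>\<^bsub>LK\<^esub> m))"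
  "act indW = (\<lambda>s. tensor_map GA LK ra VQ (la s))"
  by (simp_all add: induced_module_def Let_def)

text \<open>The Chen module is a model of the tensor product on which the operations of the induced
  module become its own.\<close>
theorem chen_induced_isomorphic:
  "simple_left_module K KS.S indW" "left_modules_isomorphic K KS.S chenV indW"
proof -
  have bij: "bij_betw TM.model (carrier indW) (carrier chenV)"
    unfolding indW_simps chenV_simps by (rule TM.model_bij)
  have zero: "\<zero>\<^bsub>indW\<^esub> \<in> carrier indW" "TM.model \<zero>\<^bsub>indW\<^esub> = \<zero>\<^bsub>chenV\<^esub>"
    unfolding indW_simps chenV_simps by (rule TM.model_one)+
  have add: "x \<oplus>\<^bsub>indW\<^esub> y \<in> carrier indW \<and> TM.model (x \<oplus>\<^bsub>indW\<^esub> y) = TM.model x \<oplus>\<^bsub>chenV\<^esub> TM.model y"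
    if "x \<in> carrier indW" "y \<in> carrier indW" for x y
    using that TM.model_add unfolding indW_simps chenV_simps by blast
  have smult: "k \<odot>\<^bsub>indW\<^esub> x \<in> carrier indW \<and> TM.model (k \<odot>\<^bsub>indW\<^esub> x) = k \<odot>\<^bsub>chenV\<^esub> TM.model x"
    if k: "k \<in> carrier K" and x: "x \<in> carrier indW" for k x
  proof -
    note ek = emb.hom_closed[OF k]
    have b: "beta (k \<odot>\<^bsub>LK\<^esub> m) v = emb k \<odot>\<^bsub>W.V0\<^esub> beta m v" if "m \<in> carrier LK" "v \<in> carrier VQ" for m v
      using beta_ops(2)[OF that(1) _ k] that(2) unfolding VQ_simps(1) by blast
    show ?thesis
      using TM.model_map[OF LK.smult_closed[OF k] W.V0.smult_closed[OF ek] W.V0.smult_r_distr[OF ek] b x[unfolded indW_simps]]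
      unfolding indW_simps chenV_simps by blast
  qed
  have act: "act indW s x \<in> carrier indW \<and> TM.model (act indW s x) = act chenV s (TM.model x)"
    if s: "s \<in> carrier KS.S" and x: "x \<in> carrier indW" for s x
  proof -
    have c: "la s m \<in> carrier LK" if "m \<in> carrier LK" for m
      using intertwined_all[OF s that] unfolding intertwined_def by blast
    have b: "beta (la s m) v = act chenV s (beta m v)" if "m \<in> carrier LK" "v \<in> carrier VQ" for m v
      using intertwined_all[OF s that(1)] that(2) unfolding intertwined_def VQ_simps(1) by blast
    show ?thesis
      using TM.model_map[OF c act_facts(1)[OF s] act_facts(2)[OF s] b x[unfolded indW_simps]]
      unfolding indW_simps by blast
  qed
  have A: "s \<oplus>\<^bsub>KS.S\<^esub> t \<in> carrier KS.S \<and> s \<otimes>\<^bsub>KS.S\<^esub> t \<in> carrier KS.S" if "s \<in> carrier KS.S" "t \<in> carrier KS.S" for s t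
    using KS.S_add[OF that] KS.S_mult_closed[OF that] unfolding steinberg_simps(2) by blast
  have A': "k \<odot>\<^bsub>KS.S\<^esub> s \<in> carrier KS.S" if "k \<in> carrier K" "s \<in> carrier KS.S" for k s
    unfolding steinberg_simps(3) by (rule KS.S_smult[OF that(2,1)])
  note T = simple_left_module_transport[OF simple_chenV bij zero add smult act A A']
  show "simple_left_module K KS.S indW" by (rule T(1))
  show "left_modules_isomorphic K KS.S chenV indW" by (rule T(2))
qed

end

theorem corollary2p4:
  fixes E :: "('v, 'e) pre_digraph"
    and K :: "('k, 'r) ring_scheme"
    and c :: "'e list"
    and f :: "'k list"
    and a :: "'e \<Rightarrow> (int \<Rightarrow> 'k) set"
  assumes "wf_digraph E"
    and "field K"
    and "simple_closed_path E c"
    and "f \<in> carrier (univ_poly K (carrier K))"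
    and "ring_irreducible\<^bsub>univ_poly K (carrier K)\<^esub> f"
    and "\<not> f \<sim>\<^bsub>univ_poly K (carrier K)\<^esub> X\<^bsub>K\<^esub>"
    and "\<forall>e\<in>arcs E. a e \<in> carrier (laurent_quotient K f) - {\<zero>\<^bsub>laurent_quotient K f\<^esub>}"
    and "path_weight (laurent_quotient K f) a c = laurent_tbar K f"
  defines "A \<equiv> steinberg_algebra E K"
    and "V \<equiv> as_steinberg_module E K (restricted_chen_module E K f a c)"
    and "W \<equiv> induced_module E K (cycle_path c) (laurent_quotient_module K f c)"
  shows "simple_left_module K A V \<and> simple_left_module K A W \<and> left_modules_isomorphic K A V W"
proof -
  interpret chen_setting E K c f a
    by (intro chen_setting.intro laurent_quot.intro laurent_quot_axioms.intro closed_walk.intro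
        closed_walk_axioms.intro chen_setting_axioms.intro assms(1-6,8)) (use assms(7) in blast)
  show ?thesis
    unfolding A_def V_def W_def using simple_chenV chen_induced_isomorphic by blast
qed

end
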